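(* Let $\Omega\subset\mathbb R^N$, $N\ge2$. Let $w_1,\dots,w_h\in H^1(\Omega)$ be nonnegative subharmonic functions in a ball $B(x_0,\bar r)\subset\Omega$ (i.e. $-\Delta w_i\le0$ in the distributional sense). Assume that $w_i(x)w_j(x)=0$ a.e. if $i\ne j$ and that $x_0\in\partial(\mathrm{supp}(w_j))\cap\Omega$ for all $j=1,\dots,h$. Define $$\Phi(r)=\prod_{i=1}^h\frac1{r^{\beta(h,N)}}\int_{B(x_0,r)}|\nabla w_i(x)|^2dx .$$ Then $\Phi$ is a nondecreasing function in $(0,\bar r]$.
   Context: $\Omega\subset\mathbb R^N$ is a connected, open, bounded domain with regular boundary. $S^{N-1}$ is the boundary of the unit ball of $\mathbb R^N$. For a nonempty open $\omega\subset S^{N-1}$, $\lambda_1(\omega)$ is the first eigenvalue of the Laplace–Beltrami operator $-\Delta_{S^{N-1}}$ in $H^1_0(\omega)$, i.e. the minimum of $\int_\omega|\nabla u|^2/\int_\omega u^2$ over $u\in H^1_0(\omega)\setminus\{0\}$. $\mathcal P(k,N)$ is the set of $k$-tuples of pairwise disjoint (nonempty) open connected subsets $\omega_1,\dots,\omega_k$ of $S^{N-1}$, and $$\beta(k,N):=\inf_{(\omega_1,\dots,\omega_k)\in\mathcal P(k,N)}\frac2k\sum_{i=1}^k\sqrt{\lambda_1(\omega_i)} .$$ *)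

theory Defs
  imports "HOL-Analysis.Analysis"
begin

section \<open>Smooth functions and test functions\<close>

definition partial_deriv :: "'a::euclidean_space \<Rightarrow> ('a \<Rightarrow> real) \<Rightarrow> 'a \<Rightarrow> real" where
  "partial_deriv i f x = frechet_derivative f (at x) i"

definition grad :: "('a::euclidean_space \<Rightarrow> real) \<Rightarrow> 'a \<Rightarrow> 'a" where
  "grad f x = (\<Sum>i\<in>Basis. partial_deriv i f x *\<^sub>R i)"

definition laplacian :: "('a::euclidean_space \<Rightarrow> real) \<Rightarrow> 'a \<Rightarrow> real" where
  "laplacian f x = (\<Sum>i\<in>Basis. partial_deriv i (partial_deriv i f) x)"

text \<open>Only meant for open sets.\<close>

fun Ck_on :: "nat \<Rightarrow> 'a::euclidean_space set \<Rightarrow> ('a \<Rightarrow> real) \<Rightarrow> bool" where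
  "Ck_on 0 U f \<longleftrightarrow> continuous_on U f"
| "Ck_on (Suc k) U f \<longleftrightarrow> f differentiable_on U \<and> (\<forall>i\<in>Basis. Ck_on k U (partial_deriv i f))"

definition smooth_on :: "'a::euclidean_space set \<Rightarrow> ('a \<Rightarrow> real) \<Rightarrow> bool" where
  "smooth_on U f \<longleftrightarrow> (\<forall>k. Ck_on k U f)"

definition test_functions :: "'a::euclidean_space set \<Rightarrow> ('a \<Rightarrow> real) set" where
  "test_functions U =
     {\<phi>. smooth_on UNIV \<phi> \<and> compact (closure {x. \<phi> x \<noteq> 0}) \<and> closure {x. \<phi> x \<noteq> 0} \<subseteq> U}"

section \<open>Sobolev functions on open sets\<close>

definition square_integrable :: "'a measure \<Rightarrow> ('a \<Rightarrow> 'b::euclidean_space) \<Rightarrow> bool" where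
  "square_integrable M f \<longleftrightarrow> f \<in> borel_measurable M \<and> integrable M (\<lambda>x. (norm (f x))\<^sup>2)"

definition locally_integrable_on ::
    "'a::euclidean_space set \<Rightarrow> ('a \<Rightarrow> 'b::euclidean_space) \<Rightarrow> bool" where
  "locally_integrable_on U f \<longleftrightarrow> (\<forall>K. compact K \<and> K \<subseteq> U \<longrightarrow> f absolutely_integrable_on K)"

definition has_weak_grad :: "'a::euclidean_space set \<Rightarrow> ('a \<Rightarrow> real) \<Rightarrow> ('a \<Rightarrow> 'a) \<Rightarrow> bool" where
  "has_weak_grad U u g \<longleftrightarrow>
     locally_integrable_on U u \<and> locally_integrable_on U g \<and>
     (\<forall>\<phi>\<in>test_functions U. \<forall>i\<in>Basis.
        (LINT x:U|lebesgue. u x * partial_deriv i \<phi> x) = - (LINT x:U|lebesgue. (g x \<bullet> i) * \<phi> x))"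

definition H1 :: "'a::euclidean_space set \<Rightarrow> ('a \<Rightarrow> real) set" where
  "H1 U = {u. square_integrable (lebesgue_on U) u \<and>
              (\<exists>g. has_weak_grad U u g \<and> square_integrable (lebesgue_on U) g)}"

text \<open>Weak gradients are unique only up to null sets; a representative is chosen here.\<close>

definition weak_grad :: "'a::euclidean_space set \<Rightarrow> ('a \<Rightarrow> real) \<Rightarrow> 'a \<Rightarrow> 'a" where
  "weak_grad U u = (SOME g. has_weak_grad U u g)"

text \<open>\<open>- \<Delta> w \<le> 0\<close> in the sense of distributions.\<close>

definition weakly_subharmonic_on :: "'a::euclidean_space set \<Rightarrow> ('a \<Rightarrow> real) \<Rightarrow> bool" where
  "weakly_subharmonic_on U w \<longleftrightarrow>
     locally_integrable_on U w \<and>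
     (\<forall>\<phi>\<in>test_functions U. (\<forall>x. 0 \<le> \<phi> x) \<longrightarrow> - (LINT x:U|lebesgue. w x * laplacian \<phi> x) \<le> 0)"

text \<open>The support of a function that is only defined almost everywhere on \<open>U\<close>: the complement of
  the largest open set on which the function vanishes almost everywhere.\<close>

definition ess_supp :: "'a::euclidean_space set \<Rightarrow> ('a \<Rightarrow> real) \<Rightarrow> 'a set" where
  "ess_supp U w = - \<Union>{V. open V \<and> (AE y in lebesgue. y \<in> V \<inter> U \<longrightarrow> w y = 0)}"

text \<open>Near each boundary point the set is, in suitable orthogonal coordinates, the region
  below a Lipschitz graph: \<open>x \<bullet> \<nu>\<close> is the height and \<open>x - (x \<bullet> \<nu>) *\<^sub>R \<nu>\<close> the base point.
  Every \<open>C\<^sup>1\<close> or smoother bounded domain qualifies.\<close>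

definition regular_boundary :: "'a::euclidean_space set \<Rightarrow> bool" where
  "regular_boundary U \<longleftrightarrow>
     (\<forall>p\<in>frontier U. \<exists>V \<nu> \<gamma> L. open V \<and> p \<in> V \<and> norm \<nu> = 1 \<and> L-lipschitz_on UNIV \<gamma> \<and>
        U \<inter> V = {x\<in>V. x \<bullet> \<nu> < (\<gamma> (x - (x \<bullet> \<nu>) *\<^sub>R \<nu>) :: real)})"

section \<open>The unit sphere\<close>

text \<open>Surface measure as cone measure: the measure of \<open>A\<close> is \<open>N\<close> times the volume of
  \<open>{t x | 0 < t < 1, x \<in> A}\<close>.\<close>

definition sphere_measure :: "'a::euclidean_space measure" where
  "sphere_measure =
     scale_measure (of_nat DIM('a))
       (distr (restrict_space lborel (ball 0 1 - {0})) (restrict_space borel (sphere 0 1))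
          (\<lambda>x. x /\<^sub>R norm x))"

text \<open>The extension that is homogeneous of degree 0. A function on the sphere is smooth iff this
  extension is smooth off the origin, and on the sphere the Euclidean gradient of the extension
  is the tangential gradient.\<close>

definition radial_ext :: "('a::euclidean_space \<Rightarrow> real) \<Rightarrow> 'a \<Rightarrow> real" where
  "radial_ext u x = u (x /\<^sub>R norm x)"

definition sphere_grad :: "('a::euclidean_space \<Rightarrow> real) \<Rightarrow> 'a \<Rightarrow> 'a" where
  "sphere_grad u = grad (radial_ext u)"

definition sphere_test_functions :: "'a::euclidean_space set \<Rightarrow> ('a \<Rightarrow> real) set" where
  "sphere_test_functions \<omega> =
     {\<phi>. smooth_on (- {0}) (radial_ext \<phi>) \<and> closure {x \<in> sphere 0 1. \<phi> x \<noteq> 0} \<subseteq> \<omega>}"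

text \<open>\<open>u\<close> belongs to the closure \<open>H\<^sup>1\<^sub>0(\<omega>)\<close> of the test functions in the \<open>H\<^sup>1\<close> norm and
  \<open>g\<close> is its (a.e. unique) weak tangential gradient, i.e. the limit of the gradients.\<close>

definition H10_sphere :: "'a::euclidean_space set \<Rightarrow> ('a \<Rightarrow> real) \<Rightarrow> ('a \<Rightarrow> 'a) \<Rightarrow> bool" where
  "H10_sphere \<omega> u g \<longleftrightarrow>
     (let M = restrict_space sphere_measure \<omega> in
        square_integrable M u \<and> square_integrable M g \<and>
        (\<exists>\<phi>. (\<forall>n. \<phi> n \<in> sphere_test_functions \<omega>) \<and>
             (\<lambda>n::nat. (LINT x|M. (\<phi> n x - u x)\<^sup>2)
                       + (LINT x|M. (norm (sphere_grad (\<phi> n) x - g x))\<^sup>2)) \<longlonglongrightarrow> 0))"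

definition first_eigenvalue :: "'a::euclidean_space set \<Rightarrow> real" where
  "first_eigenvalue \<omega> =
     (let M = restrict_space sphere_measure \<omega> in
        Inf {(LINT x|M. (norm (g x))\<^sup>2) / (LINT x|M. (u x)\<^sup>2) | u g.
               H10_sphere \<omega> u g \<and> \<not> (AE x in M. u x = 0)})"

definition sphere_partitions :: "nat \<Rightarrow> (nat \<Rightarrow> 'a::euclidean_space set) set" where
  "sphere_partitions k =
     {\<omega>. (\<forall>i\<in>{1..k}. openin (top_of_set (sphere 0 1)) (\<omega> i) \<and> connected (\<omega> i) \<and> \<omega> i \<noteq> {}) \<and>
         disjoint_family_on \<omega> {1..k}}"

text \<open>The type argument stands for the ambient space, hence for the dimension \<open>N\<close>.\<close>

definition optimal_beta :: "'a::euclidean_space itself \<Rightarrow> nat \<Rightarrow> real" where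
  "optimal_beta T k =
     (INF \<omega> \<in> (sphere_partitions k :: (nat \<Rightarrow> 'a set) set).
        2 / real k * (\<Sum>i\<in>{1..k}. sqrt (first_eigenvalue (\<omega> i))))"

end

theory Submission
  imports Defs
begin

text \<open>Put $D_i(r) = \int_{B_r} |\nabla w_i|^2$ with $B_r$ the ball of radius $r$ about the given point, and let
$S_r$ be its boundary. The function $D_i$ is the integral of $D_i'(r) = \int_{S_r} |\nabla w_i|^2$. Three facts
about almost every sphere give the theorem.

(1) Multiplying $\Delta w_i \ge 0$ by $w_i \ge 0$ and integrating by parts over the ball gives
$D_i(r) \le \int_{S_r} w_i \partial_\nu w_i$ (\<open>energy_smooth\<close>, \<open>energy_slice\<close>).

(2) Let $\kappa_i^2$ be the quotient of $\int_{S_r} |\nabla_{tan} w_i|^2$ by $\int_{S_r} w_i^2$. Since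
$2 \kappa w v \le v^2 + \kappa^2 w^2$, integration yields
$2 \kappa_i \int_{S_r} w_i \partial_\nu w_i \le \int_{S_r} (\partial_\nu w_i)^2 + \int_{S_r} |\nabla_{tan} w_i|^2 = D_i'(r)$,
so $D_i' / D_i \ge 2 \kappa_i$ (\<open>slice_ratio\<close>).

(3) After scaling $S_r$ to the unit sphere, $r^2 \kappa_i^2$ is the Rayleigh quotient of a function on the
sphere, and for different $i$ these functions have product zero. Hence
$\frac{2}{h} \sum_i r \kappa_i \ge \beta$ (\<open>beta_le_quotients\<close>).

Together $\sum_i (\ln D_i)' \ge h \beta / r$, and integrating this between two radii (\<open>log_growth\<close>) is the
monotonicity of $\prod_i r^{-\beta} D_i(r)$.

The functions are only of class $H^1$, so (1) and (3) are reached by mollification. Polar coordinates turn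
convergence in $L^2$ of the mollified functions and of their gradients into convergence on almost every sphere
along one subsequence (\<open>sphere_slices\<close>); on such spheres (1) passes to the limit. For (3) there is the further
point that \<open>\<beta>\<close> is an infimum over disjoint open connected sets, whereas the sets where the
traces are positive need not be open, are disjoint only up to null sets, and may overlap for the mollified
functions $\phi_i$. The open sets
$\{\phi_i > \sum_{j \ne i} \phi_j\}$ are disjoint, and a smooth positive part of
$\phi_i - \sum_{j \ne i} \phi_j$ is admissible on the $i$-th of them. In the limit the subtraction costs
nothing, because where $w_i$ is positive all other $w_j$ vanish, and the gradient of an $H^1$ function
vanishes almost everywhere on its zero set (\<open>stampacchia\<close>). Finally some connected component of the open
set has a Rayleigh quotient at most that of the whole (\<open>exists_component\<close>).\<close>

section \<open>Calculus of smooth functions\<close>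

lemma partial_deriv_eqI:
  "(f has_derivative D) (at x) \<Longrightarrow> partial_deriv i f x = D i"
  unfolding partial_deriv_def using frechet_derivative_at by metis

lemma partial_deriv_cong_open:
  assumes "open U" "x \<in> U" "\<And>y. y \<in> U \<Longrightarrow> f y = g y"
  shows "partial_deriv i f x = partial_deriv i g x"
proof -
  have "(f has_derivative D) (at x) \<longleftrightarrow> (g has_derivative D) (at x)" for D
    using assms has_derivative_transform_within_open[of f D x UNIV U g]
      has_derivative_transform_within_open[of g D x UNIV U f] by auto
  then show ?thesis by (simp add: partial_deriv_def frechet_derivative_def)
qed

lemma differentiable_on_cong_open:
  fixes f g :: "'a::real_normed_vector \<Rightarrow> 'b::real_normed_vector"
  assumes "open U" "\<And>y. y \<in> U \<Longrightarrow> f y = g y"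
  shows "f differentiable_on U \<longleftrightarrow> g differentiable_on U"
proof -
  have *: "g' differentiable_on U" if dif: "f' differentiable_on U" and eq: "\<And>y. y \<in> U \<Longrightarrow> f' y = g' y" for f' g' :: "'a \<Rightarrow> 'b"
    unfolding differentiable_on_def differentiable_def
  proof
    fix x assume x: "x \<in> U"
    then obtain D where "(f' has_derivative D) (at x)"
      using dif x unfolding differentiable_on_eq_differentiable_at[OF assms(1)] differentiable_def by blast
    then have "(g' has_derivative D) (at x)"
      by (rule has_derivative_transform_within_open[OF _ assms(1) x]) (fact eq)
    then show "\<exists>D. (g' has_derivative D) (at x within U)"
      using has_derivative_at_withinI by blast
  qed
  show ?thesis using *[of f g] *[of g f] assms(2) by auto
qed

lemma Ck_on_cong:
  assumes "open U" "\<And>y. y \<in> U \<Longrightarrow> f y = g y"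
  shows "Ck_on k U f \<longleftrightarrow> Ck_on k U g"
  using assms(2)
proof (induction k arbitrary: f g)
  case 0
  show ?case unfolding Ck_on.simps(1) by (rule continuous_on_cong[OF refl 0])
next
  case (Suc k)
  have "Ck_on k U (partial_deriv i f) \<longleftrightarrow> Ck_on k U (partial_deriv i g)" for i
    by (rule Suc.IH) (rule partial_deriv_cong_open[OF assms(1) _ Suc.prems])
  then show ?case unfolding Ck_on.simps(2)
    by (intro conj_cong differentiable_on_cong_open assms(1) Suc.prems ball_cong refl)
qed

lemma Ck_on_Suc_D: "Ck_on (Suc k) U f \<Longrightarrow> Ck_on k U f"
  by (induction k arbitrary: f) (auto simp: differentiable_imp_continuous_on)

lemma Ck_on_subset:
  assumes "Ck_on k U f" "V \<subseteq> U" shows "Ck_on k V f"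
  using assms by (induction k arbitrary: f)
    (auto intro: continuous_on_subset differentiable_on_subset)

lemma Ck_on_union:
  assumes "open U" "open V" "Ck_on k U f" "Ck_on k V f" shows "Ck_on k (U \<union> V) f"
  using assms(3,4)
proof (induction k arbitrary: f)
  case 0
  then show ?case using assms(1,2) by (simp add: continuous_on_open_Un)
next
  case (Suc k)
  then show ?case using assms(1,2)
    by (auto simp: differentiable_on_eq_differentiable_at open_Un)
qed

lemma sum_Basis_inner:
  fixes f :: "'a::euclidean_space \<Rightarrow> real"
  assumes "i \<in> Basis" shows "(\<Sum>b\<in>Basis. (i \<bullet> b) * f b) = f i"
proof -
  have "(\<Sum>b\<in>Basis. (i \<bullet> b) * f b) = (\<Sum>b\<in>Basis. if b = i then f b else 0)"
    using assms by (intro sum.cong) (auto simp: inner_Basis)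
  then show ?thesis using assms by simp
qed

lemma Ck_on_has_derivative:
  assumes "Ck_on (Suc k) U f" "open U" "x \<in> U"
  shows "(f has_derivative (\<lambda>h. \<Sum>b\<in>Basis. (h \<bullet> b) * partial_deriv b f x)) (at x)"
proof -
  have "f differentiable (at x)"
    using assms by (auto simp: differentiable_on_eq_differentiable_at)
  then have D: "(f has_derivative frechet_derivative f (at x)) (at x)"
    by (simp add: frechet_derivative_works)
  then have L: "linear (frechet_derivative f (at x))" by (rule has_derivative_linear)
  have "frechet_derivative f (at x) h = (\<Sum>b\<in>Basis. (h \<bullet> b) * partial_deriv b f x)" for h
  proof -
    have "frechet_derivative f (at x) (\<Sum>b\<in>Basis. (h \<bullet> b) *\<^sub>R b)
        = (\<Sum>b\<in>Basis. (h \<bullet> b) * partial_deriv b f x)"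
      by (simp add: linear_sum[OF L] linear_cmul[OF L] partial_deriv_def)
    then show ?thesis by (simp add: euclidean_representation)
  qed
  then show ?thesis using D by presburger
qed

lemma Ck_on_const [simp]: "Ck_on k U (\<lambda>x. c)"
proof (induction k arbitrary: c)
  case (Suc k)
  have "partial_deriv i (\<lambda>x::'a. c) = (\<lambda>x. 0)" for i
    by (rule ext) (rule partial_deriv_eqI[OF has_derivative_const])
  then show ?case using Suc by simp
qed simp

lemma Ck_on_inner_const [simp]: "Ck_on k U (\<lambda>x. x \<bullet> b)"
proof (cases k)
  case (Suc k)
  have "partial_deriv i (\<lambda>x. x \<bullet> b) = (\<lambda>x. i \<bullet> b)" for i
    by (rule ext) (rule partial_deriv_eqI[OF has_derivative_inner_left[OF has_derivative_ident]])
  moreover have "(\<lambda>x. x \<bullet> b) differentiable_on U"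
    unfolding differentiable_on_def differentiable_def
    by (auto intro: has_derivative_inner_left[OF has_derivative_ident])
  ultimately show ?thesis using Suc by simp
qed (simp add: continuous_on_inner)

lemma Ck_on_add:
  assumes "open U" "Ck_on k U f" "Ck_on k U g"
  shows "Ck_on k U (\<lambda>x. f x + g x)"
  using assms(2,3)
proof (induction k arbitrary: f g)
  case 0
  then show ?case by (simp add: continuous_on_add)
next
  case (Suc k)
  have "partial_deriv i (\<lambda>x. f x + g x) x = partial_deriv i f x + partial_deriv i g x"
    if "i \<in> Basis" "x \<in> U" for i x
    by (rule partial_deriv_eqI[THEN trans], rule has_derivative_add,
        rule Ck_on_has_derivative[OF Suc.prems(1) assms(1)], fact,
        rule Ck_on_has_derivative[OF Suc.prems(2) assms(1)], fact)
       (use that in \<open>simp add: sum_Basis_inner\<close>)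
  note pd = this
  have ck: "Ck_on k U (\<lambda>x. partial_deriv i f x + partial_deriv i g x)" if "i \<in> Basis" for i
    by (intro Suc.IH) (use that Suc.prems in auto)
  have "Ck_on k U (partial_deriv i (\<lambda>x. f x + g x))" if "i \<in> Basis" for i
    by (rule Ck_on_cong[OF assms(1) pd[OF that], THEN iffD2, OF _ ck[OF that]])
  moreover have "(\<lambda>x. f x + g x) differentiable_on U"
    using Suc.prems by (simp add: differentiable_on_add)
  ultimately show ?case by simp
qed

lemma Ck_on_mult:
  assumes "open U" "Ck_on k U f" "Ck_on k U g"
  shows "Ck_on k U (\<lambda>x. f x * g x)"
  using assms(2,3)
proof (induction k arbitrary: f g)
  case 0
  then show ?case by (simp add: continuous_on_mult)
next
  case (Suc k)
  have "partial_deriv i (\<lambda>x. f x * g x) x = f x * partial_deriv i g x + partial_deriv i f x * g x"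
    if "i \<in> Basis" "x \<in> U" for i x
    by (rule partial_deriv_eqI[THEN trans], rule has_derivative_mult,
        rule Ck_on_has_derivative[OF Suc.prems(1) assms(1)], fact,
        rule Ck_on_has_derivative[OF Suc.prems(2) assms(1)], fact)
       (use that in \<open>simp add: sum_Basis_inner\<close>)
  note pd = this
  have ck: "Ck_on k U (\<lambda>x. f x * partial_deriv i g x + partial_deriv i f x * g x)" if "i \<in> Basis" for i
    by (intro Ck_on_add Suc.IH assms(1) Suc.prems[THEN Ck_on_Suc_D]) (use that Suc.prems in auto)
  have "Ck_on k U (partial_deriv i (\<lambda>x. f x * g x))" if "i \<in> Basis" for i
    by (rule Ck_on_cong[OF assms(1) pd[OF that], THEN iffD2, OF _ ck[OF that]])
  moreover have "(\<lambda>x. f x * g x) differentiable_on U"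
    using Suc.prems by (auto simp: differentiable_on_def intro: differentiable_mult)
  ultimately show ?case by simp
qed

lemma Ck_on_sum:
  assumes "open U" "\<And>i. i \<in> I \<Longrightarrow> Ck_on k U (f i)"
  shows "Ck_on k U (\<lambda>x. \<Sum>i\<in>I. f i x)"
  using assms(2)
proof (induction I rule: infinite_finite_induct)
  case (insert i I)
  then show ?case by (simp add: Ck_on_add[OF assms(1)])
qed auto

text \<open>Induction on the order works because, by the chain rule, every partial derivative of the composition is a
sum of products of a composition with a partial derivative of \<open>f\<close> and a partial derivative of a component of \<open>T\<close>,
so that one order of differentiability is consumed.\<close>

lemma Ck_on_compose:
  fixes T :: "'a::euclidean_space \<Rightarrow> 'b::euclidean_space"
  assumes "open U" "open V" "Ck_on k V f" "\<And>b. b \<in> Basis \<Longrightarrow> Ck_on k U (\<lambda>x. T x \<bullet> b)"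
    and "T ` U \<subseteq> V"
  shows "Ck_on k U (\<lambda>x. f (T x))"
  using assms(3,4)
proof (induction k arbitrary: f)
  case 0
  then have "continuous_on U T" by (subst continuous_on_componentwise) simp
  then show ?case using 0 assms(5) by (auto intro: continuous_on_compose2)
next
  case (Suc k)
  define D where "D x h = (\<Sum>b\<in>Basis. (\<Sum>c\<in>Basis. (h \<bullet> c) * partial_deriv c (\<lambda>x. T x \<bullet> b) x) *\<^sub>R b)" for x h
  have T: "(T has_derivative D x) (at x)" if "x \<in> U" for x
    unfolding D_def
    by (subst has_derivative_componentwise_within)
      (use Ck_on_has_derivative[OF Suc.prems(2) assms(1) that] in simp)
  have F: "((\<lambda>x. f (T x)) has_derivative (\<lambda>h. \<Sum>b\<in>Basis. (D x h \<bullet> b) * partial_deriv b f (T x))) (at x)"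
    if "x \<in> U" for x
  proof -
    have "T x \<in> V" using that assms(5) by blast
    from diff_chain_at[OF T[OF that] Ck_on_has_derivative[OF Suc.prems(1) assms(2) this]]
    show ?thesis unfolding o_def .
  qed
  have P: "partial_deriv i (\<lambda>x. f (T x)) x
      = (\<Sum>b\<in>Basis. partial_deriv i (\<lambda>x. T x \<bullet> b) x * partial_deriv b f (T x))"
    if "i \<in> Basis" "x \<in> U" for i x
  proof -
    have "D x i \<bullet> b = partial_deriv i (\<lambda>x. T x \<bullet> b) x" if "b \<in> Basis" for b
      using that \<open>i \<in> Basis\<close> by (simp add: D_def sum_Basis_inner)
    then show ?thesis unfolding partial_deriv_eqI[OF F[OF that(2)]] by (intro sum.cong) simp_all
  qed
  have "Ck_on k U (\<lambda>x. partial_deriv i (\<lambda>x. T x \<bullet> b) x * partial_deriv b f (T x))"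
    if "i \<in> Basis" "b \<in> Basis" for i b
  proof (rule Ck_on_mult[OF assms(1)])
    show "Ck_on k U (partial_deriv i (\<lambda>x. T x \<bullet> b))"
      using Suc.prems(2)[OF that(2)] that(1) by simp
    show "Ck_on k U (\<lambda>x. partial_deriv b f (T x))"
      by (rule Suc.IH[OF _ Ck_on_Suc_D[OF Suc.prems(2)]]) (use Suc.prems(1) that(2) in simp_all)
  qed
  then have ck: "Ck_on k U (\<lambda>x. \<Sum>b\<in>Basis. partial_deriv i (\<lambda>x. T x \<bullet> b) x * partial_deriv b f (T x))"
    if "i \<in> Basis" for i
    using that by (intro Ck_on_sum assms(1))
  have "Ck_on k U (partial_deriv i (\<lambda>x. f (T x)))" if "i \<in> Basis" for i
    by (rule Ck_on_cong[OF assms(1) P[OF that], THEN iffD2, OF _ ck[OF that]])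
  moreover have "(\<lambda>x. f (T x)) differentiable_on U"
    unfolding differentiable_on_eq_differentiable_at[OF assms(1)] differentiable_def
    using F by blast
  ultimately show ?case by simp
qed

lemma partial_deriv_real: "((f::real\<Rightarrow>real) has_real_derivative d) (at x) \<Longrightarrow> partial_deriv 1 f x = d"
  using partial_deriv_eqI[of f "(*) d" x 1] by (simp add: has_field_derivative_def)

text \<open>On the real line \<open>Basis\<close> is \<open>{1}\<close>, so one ordinary derivative stands for all partial derivatives.\<close>

lemma Ck_on_real_Suc:
  fixes f :: "real \<Rightarrow> real"
  assumes "open U" "\<And>x. x \<in> U \<Longrightarrow> (f has_real_derivative f' x) (at x)" "Ck_on k U f'"
  shows "Ck_on (Suc k) U f"
proof -
  have "Ck_on k U (partial_deriv 1 f)"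
    by (rule Ck_on_cong[OF assms(1), THEN iffD2, OF partial_deriv_real[OF assms(2)] assms(3)])
  moreover have "f differentiable_on U"
    unfolding differentiable_on_eq_differentiable_at[OF assms(1)]
    using assms(2) real_differentiable_def by blast
  ultimately show ?thesis by simp
qed

lemma smooth_on_compose_real:
  assumes "smooth_on UNIV (f::real\<Rightarrow>real)" "smooth_on U g" "open U"
  shows "smooth_on U (\<lambda>x. f (g x))"
  unfolding smooth_on_def
proof
  fix k show "Ck_on k U (\<lambda>x. f (g x))"
    by (rule Ck_on_compose[OF assms(3) open_UNIV])
      (use assms in \<open>simp_all add: smooth_on_def\<close>)
qed

lemma smooth_on_compose_real_on:
  assumes "smooth_on V (f::real\<Rightarrow>real)" "open V" "smooth_on U g" "open U" "g ` U \<subseteq> V"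
  shows "smooth_on U (\<lambda>x. f (g x))"
  unfolding smooth_on_def
proof
  fix k show "Ck_on k U (\<lambda>x. f (g x))"
    by (rule Ck_on_compose[OF assms(4,2) _ _ assms(5)])
      (use assms in \<open>simp_all add: smooth_on_def\<close>)
qed

lemma power_pred_eq_iff:
  fixes y :: "'a::comm_monoid_mult"
  shows "y * y ^ (m - Suc 0) = y ^ m \<longleftrightarrow> m \<noteq> 0 \<or> y = 1" "y ^ m = y * y ^ (m - Suc 0) \<longleftrightarrow> m \<noteq> 0 \<or> y = 1"
  by (cases m; auto)+

text \<open>Negative powers with a constant factor are closed under differentiation, which is what the induction on
the order needs.\<close>

lemma smooth_on_power_inverse: "smooth_on (-{0}) (\<lambda>x::real. c * inverse x ^ n)"
  unfolding smooth_on_def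
proof
  fix k show "Ck_on k (-{0}) (\<lambda>x::real. c * inverse x ^ n)"
  proof (induction k arbitrary: c n)
    case 0
    then show ?case by (auto intro!: continuous_intros)
  next
    case (Suc k)
    have "((\<lambda>x. c * inverse x ^ n) has_real_derivative - c * real n * inverse x ^ Suc n) (at x)"
      if "x \<in> -{0}" for x::real
      using that by (cases n; cases "n - 1") (auto intro!: derivative_eq_intros simp: power2_eq_square algebra_simps power_pred_eq_iff)
    then show ?case using Suc[of "-c * real n" "Suc n"] by (intro Ck_on_real_Suc) auto
  qed
qed

lemma smooth_on_sqrt: "smooth_on {0<..} sqrt"
proof -
  have *: "Ck_on k {0<..} (\<lambda>x::real. c * x powr a)" for k c a
  proof (induction k arbitrary: c a)
    case 0
    then show ?case by (auto intro!: continuous_intros)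
  next
    case (Suc k)
    have "((\<lambda>x. c * x powr a) has_real_derivative (c * a) * x powr (a - 1)) (at x)" if "x \<in> {0<..}" for x
      using that by (auto intro!: derivative_eq_intros)
    then show ?case using Suc by (intro Ck_on_real_Suc) auto
  qed
  have "Ck_on k {0<..} sqrt" for k
    using *[of k 1 "1/2"] Ck_on_cong[of "{0<..}" sqrt "\<lambda>x. 1 * x powr (1/2)" k]
    by (simp add: powr_half_sqrt)
  then show ?thesis by (simp add: smooth_on_def)
qed

lemma smooth_on_norm: "smooth_on (-{0}) (norm :: 'a::euclidean_space \<Rightarrow> real)"
proof -
  have "smooth_on (-{0}) (\<lambda>x::'a. \<Sum>b\<in>Basis. (x \<bullet> b) * (x \<bullet> b))"
    unfolding smooth_on_def by (intro allI Ck_on_sum Ck_on_mult Ck_on_inner_const) auto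
  then have "smooth_on (-{0}) (\<lambda>x::'a. sqrt (\<Sum>b\<in>Basis. (x \<bullet> b) * (x \<bullet> b)))"
    by (intro smooth_on_compose_real_on[OF smooth_on_sqrt])
      (auto simp: euclidean_inner[symmetric])
  then show ?thesis by (simp add: euclidean_inner[symmetric] norm_eq_sqrt_inner[abs_def])
qed

lemma smooth_on_normalize_inner:
  "smooth_on (-{0}) (\<lambda>x::'a::euclidean_space. (x /\<^sub>R norm x) \<bullet> b)"
proof -
  have "smooth_on (-{0}) (\<lambda>x::'a. 1 * inverse (norm x) ^ 1)"
    by (intro smooth_on_compose_real_on[OF smooth_on_power_inverse _ smooth_on_norm]) auto
  then have "smooth_on (-{0}) (\<lambda>x::'a. (1 * inverse (norm x) ^ 1) * (x \<bullet> b))"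
    unfolding smooth_on_def by (intro allI Ck_on_mult Ck_on_inner_const) auto
  then show ?thesis by (simp add: divide_inverse)
qed

section \<open>Flat functions and a smooth positive part\<close>

text \<open>This is $e^{-1/t} t^{-m}$ continued by zero. The parameter \<open>m\<close> is there to make the family closed under
differentiation, see \<open>flat_deriv\<close>.\<close>

definition flat :: "nat \<Rightarrow> real \<Rightarrow> real" where
  "flat m t = (if t > 0 then exp (- 1 / t) * inverse t ^ m else 0)"

text \<open>The term of order \<open>m + 2\<close> of the series of $e^{1/t}$ already dominates. The exponent two on the right is
what makes the derivative at zero exist and vanish.\<close>

lemma flat_bound: "\<bar>flat m t\<bar> \<le> fact (m + 2) * t\<^sup>2"
proof (cases "t > 0")
  case True
  have "(1/t) ^ (m+2) / fact (m+2) \<le> exp (1/t)"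
    using sum_le_suminf[OF summable_exp, of "{m+2}" "1/t"] True
    by (simp add: exp_def divide_inverse mult.commute)
  then have "inverse (fact (m+2) * t ^ (m+2)) \<le> exp (1/t)"
    using True by (simp add: field_simps)
  then have "inverse (exp (1/t)) \<le> fact (m+2) * t ^ (m+2)"
    using True by (metis inverse_inverse_eq le_imp_inverse_le positive_imp_inverse_positive
      mult_pos_pos fact_gt_zero zero_less_power)
  then have "exp (-1/t) * inverse t ^ m \<le> (fact (m+2) * t ^ (m+2)) * inverse t ^ m"
    using True by (intro mult_right_mono) (auto simp: exp_minus)
  also have "\<dots> = fact (m+2) * t\<^sup>2"
    using True by (simp add: field_simps power_add power2_eq_square)
  finally show ?thesis using True by (simp add: flat_def)
qed (auto simp: flat_def)

lemma flat_deriv: "(flat m has_real_derivative (flat (m+2) t - real m * flat (m+1) t)) (at t)"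
proof -
  consider "t > 0" | "t < 0" | "t = 0" by linarith
  then show ?thesis
  proof cases
    case 1
    have "((\<lambda>t. exp (- 1 / t) * inverse t ^ m) has_real_derivative
        (flat (m+2) t - real m * flat (m+1) t)) (at t)"
      using 1 by (cases m) (auto intro!: derivative_eq_intros simp: flat_def field_simps power2_eq_square power_pred_eq_iff)
    then show ?thesis
      by (rule has_field_derivative_transform_within_open[of _ _ _ "{0<..}"])
         (use 1 in \<open>auto simp: flat_def\<close>)
  next
    case 2
    have "((\<lambda>t. 0) has_real_derivative (flat (m+2) t - real m * flat (m+1) t)) (at t)"
      using 2 by (simp add: flat_def)
    then show ?thesis
      by (rule has_field_derivative_transform_within_open[of _ _ _ "{..<0}"])
         (use 2 in \<open>auto simp: flat_def\<close>)
  next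
    case 3
    have "((\<lambda>h. flat m h / h) \<longlongrightarrow> 0) (at 0)"
    proof (rule Lim_null_comparison)
      show "\<forall>\<^sub>F h in at 0. norm (flat m h / h) \<le> fact (m + 2) * \<bar>h\<bar>"
        unfolding eventually_at_filter
      proof (rule always_eventually, intro allI impI)
        fix h :: real assume "h \<noteq> 0"
        moreover have "\<bar>flat m h\<bar> \<le> (fact (m + 2) * \<bar>h\<bar>) * \<bar>h\<bar>"
          using flat_bound[of m h] by (simp only: mult.assoc power2_eq_square[symmetric] power2_abs)
        ultimately show "norm (flat m h / h) \<le> fact (m + 2) * \<bar>h\<bar>"
          by (simp add: abs_divide pos_divide_le_eq del: fact_Suc add_2_eq_Suc')
      qed
      show "((\<lambda>h::real. fact (m + 2) * \<bar>h\<bar>) \<longlongrightarrow> 0) (at 0)"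
        by (auto intro!: tendsto_eq_intros)
    qed
    then show ?thesis using 3 by (simp add: DERIV_def flat_def)
  qed
qed

lemma smooth_flat: "smooth_on UNIV (flat m)"
proof -
  have "Ck_on k UNIV (flat m)" for k
  proof (induction k arbitrary: m)
    case 0
    show ?case unfolding Ck_on.simps
      by (intro continuous_at_imp_continuous_on ballI) (rule DERIV_isCont[OF flat_deriv])
  next
    case (Suc k)
    have "Ck_on k UNIV (\<lambda>t. flat (m+2) t + (- real m) * flat (m+1) t)"
      by (intro Ck_on_add Ck_on_mult Suc Ck_on_const) auto
    then show ?case using flat_deriv by (intro Ck_on_real_Suc) auto
  qed
  then show ?thesis by (simp add: smooth_on_def)
qed

text \<open>A smooth substitute for $\max(t, 0)$. It vanishes for $t \le \epsilon$, so that a composition with a continuous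
function has its support inside the open set where that function is positive.\<close>

definition soft_pos :: "real \<Rightarrow> real \<Rightarrow> real" where
  "soft_pos \<epsilon> t = (t - \<epsilon>) * flat 0 ((t - \<epsilon>) / \<epsilon>)"

definition soft_pos' :: "real \<Rightarrow> real \<Rightarrow> real" where
  "soft_pos' \<epsilon> t = flat 0 ((t - \<epsilon>) / \<epsilon>) + flat 1 ((t - \<epsilon>) / \<epsilon>)"

lemma smooth_affine: "smooth_on U (\<lambda>x::real. (x - b) / c)"
proof -
  have "Ck_on k U (\<lambda>x::real. (x - b) / c)" for k
  proof -
    have "Ck_on k UNIV (\<lambda>x::real. (x \<bullet> 1) * (1 / c) + (- b / c))"
      by (intro Ck_on_add Ck_on_mult Ck_on_const Ck_on_inner_const) auto
    then have "Ck_on k U (\<lambda>x::real. (x \<bullet> 1) * (1 / c) + (- b / c))"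
      by (rule Ck_on_subset) auto
    then show ?thesis by (simp add: diff_divide_distrib)
  qed
  then show ?thesis by (simp add: smooth_on_def)
qed

lemma smooth_soft_pos: "smooth_on UNIV (soft_pos \<epsilon>)"
  unfolding soft_pos_def[abs_def] smooth_on_def
  using smooth_on_compose_real[OF smooth_flat smooth_affine, of UNIV 0 \<epsilon> \<epsilon>]
    smooth_affine[of UNIV \<epsilon> 1]
  by (intro allI Ck_on_mult) (auto simp: smooth_on_def)

lemma soft_pos_deriv:
  assumes "\<epsilon> > 0" shows "(soft_pos \<epsilon> has_real_derivative soft_pos' \<epsilon> t) (at t)"
proof -
  have "((\<lambda>t. flat 0 ((t - \<epsilon>) / \<epsilon>)) has_real_derivative flat 2 ((t - \<epsilon>) / \<epsilon>) * (1 / \<epsilon>)) (at t)"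
  proof (rule DERIV_chain2[where f="flat 0"])
    show "(flat 0 has_real_derivative flat 2 ((t - \<epsilon>) / \<epsilon>)) (at ((t - \<epsilon>) / \<epsilon>))"
      using flat_deriv[of 0 "(t - \<epsilon>) / \<epsilon>"] by (simp add: numeral_2_eq_2)
    show "((\<lambda>t. (t - \<epsilon>) / \<epsilon>) has_real_derivative 1 / \<epsilon>) (at t)"
      using assms by (auto intro!: derivative_eq_intros)
  qed
  then have "(soft_pos \<epsilon> has_real_derivative
      (flat 0 ((t - \<epsilon>) / \<epsilon>) + (flat 2 ((t - \<epsilon>) / \<epsilon>) * (1 / \<epsilon>)) * (t - \<epsilon>))) (at t)"
    unfolding soft_pos_def[abs_def] by (auto intro!: derivative_eq_intros)
  moreover have "flat 2 ((t - \<epsilon>) / \<epsilon>) * (1 / \<epsilon>) * (t - \<epsilon>) = flat 1 ((t - \<epsilon>) / \<epsilon>)"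
  proof -
    have "flat 2 s * s = flat 1 s" for s
      by (auto simp: flat_def power2_eq_square)
    from this[of "(t - \<epsilon>) / \<epsilon>"] show ?thesis by simp
  qed
  ultimately show ?thesis by (simp add: soft_pos'_def)
qed

text \<open>With $s = \epsilon / (t - \epsilon)$ the derivative is $e^{-s} (1 + s)$, and $1 + s \le e^s$. The bound
by one means that composing with \<open>soft_pos\<close> does not increase Dirichlet integrals.\<close>

lemma soft_pos'_bounds:
  assumes "\<epsilon> > 0" shows "0 \<le> soft_pos' \<epsilon> t" "soft_pos' \<epsilon> t \<le> 1"
proof -
  define s where "s = inverse ((t - \<epsilon>) / \<epsilon>)"
  show "0 \<le> soft_pos' \<epsilon> t" using assms
    by (auto simp: soft_pos'_def flat_def zero_less_divide_iff)
  show "soft_pos' \<epsilon> t \<le> 1"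
  proof (cases "t > \<epsilon>")
    case True
    have "exp (- s) * (1 + s) \<le> exp (- s) * exp s"
      by (intro mult_left_mono exp_ge_add_one_self) auto
    then have "exp (- s) + exp (- s) * s \<le> 1" by (simp add: exp_minus algebra_simps)
    then show ?thesis using True assms by (simp add: soft_pos'_def flat_def s_def divide_inverse)
  qed (use assms in \<open>simp add: soft_pos'_def flat_def zero_less_divide_iff\<close>)
qed

lemma soft_pos_eq_0: "\<epsilon> > 0 \<Longrightarrow> t \<le> \<epsilon> \<Longrightarrow> soft_pos \<epsilon> t = 0" "\<epsilon> > 0 \<Longrightarrow> t \<le> \<epsilon> \<Longrightarrow> soft_pos' \<epsilon> t = 0"
  by (auto simp: soft_pos_def soft_pos'_def flat_def zero_less_divide_iff)

lemma soft_pos_bounds: "\<epsilon> > 0 \<Longrightarrow> 0 \<le> soft_pos \<epsilon> t" "\<epsilon> > 0 \<Longrightarrow> soft_pos \<epsilon> t \<le> \<bar>t\<bar>"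
  by (auto simp: soft_pos_def flat_def zero_less_divide_iff mult_left_le intro!: order.trans[OF mult_left_le])

lemma continuous_soft_pos: "continuous_on UNIV (soft_pos \<epsilon>)"
  using smooth_soft_pos[of \<epsilon>] unfolding smooth_on_def by (metis Ck_on.simps(1))

lemma continuous_soft_pos': "continuous_on UNIV (soft_pos' \<epsilon>)"
proof -
  have "smooth_on UNIV (\<lambda>t. flat m ((t - \<epsilon>) / \<epsilon>))" for m
    by (rule smooth_on_compose_real[OF smooth_flat smooth_affine]) auto
  then have "continuous_on UNIV (\<lambda>t. flat m ((t - \<epsilon>) / \<epsilon>))" for m
    unfolding smooth_on_def by (metis Ck_on.simps(1))
  then show ?thesis unfolding soft_pos'_def[abs_def] by (intro continuous_on_add)
qed

lemma soft_pos_tendsto: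
  assumes "t \<ge> 0"
  shows "(\<lambda>n. soft_pos (1 / real (Suc n)) t) \<longlonglongrightarrow> t"
proof (cases "t = 0")
  case True
  then show ?thesis by (simp add: soft_pos_eq_0)
next
  case False
  then have t: "t > 0" using assms by simp
  have e: "(\<lambda>n. 1 / real (Suc n)) \<longlonglongrightarrow> 0" by (rule LIMSEQ_Suc[OF lim_1_over_n])
  have "(\<lambda>n. (t - 1 / real (Suc n)) * exp (- ((1 / real (Suc n)) / (t - 1 / real (Suc n))))) \<longlonglongrightarrow> (t - 0) * exp (- (0 / (t - 0)))"
    by (intro tendsto_intros e) (use t in auto)
  moreover have "\<forall>\<^sub>F n in sequentially. (t - 1 / real (Suc n)) * exp (- ((1 / real (Suc n)) / (t - 1 / real (Suc n))))
      = soft_pos (1 / real (Suc n)) t"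
  proof -
    have "\<forall>\<^sub>F n in sequentially. 1 / real (Suc n) < t" using e t by (rule order_tendstoD)
    then show ?thesis
      by eventually_elim (auto simp: soft_pos_def flat_def zero_less_divide_iff)
  qed
  ultimately show ?thesis by (auto intro: Lim_transform_eventually)
qed

section \<open>Test functions\<close>

definition bump :: "real \<Rightarrow> 'a::euclidean_space \<Rightarrow> real" where
  "bump d x = flat 0 (d\<^sup>2 - x \<bullet> x)"

lemma smooth_bump: "smooth_on UNIV (bump d)"
proof -
  have "smooth_on UNIV (\<lambda>x::'a. d\<^sup>2 + (-1) * (\<Sum>b\<in>Basis. (x \<bullet> b) * (x \<bullet> b)))"
    unfolding smooth_on_def by (intro allI Ck_on_sum Ck_on_mult Ck_on_add Ck_on_const Ck_on_inner_const) auto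
  from smooth_on_compose_real[OF smooth_flat this]
  show ?thesis unfolding bump_def[abs_def] by (simp add: euclidean_inner[symmetric])
qed

lemma bump_nonneg: "0 \<le> bump d x"
  by (simp add: bump_def flat_def)

lemma bump_pos_iff: "d > 0 \<Longrightarrow> bump d x \<noteq> 0 \<longleftrightarrow> norm x < d"
  by (simp add: bump_def flat_def dot_square_norm abs_square_less_1) (smt (verit) norm_ge_zero power2_less_imp_less power_strict_mono zero_less_numeral)

lemma test_functionsD:
  assumes "\<rho> \<in> test_functions U"
  shows "smooth_on UNIV \<rho>" "compact (closure {x. \<rho> x \<noteq> 0})" "closure {x. \<rho> x \<noteq> 0} \<subseteq> U"
  using assms by (auto simp: test_functions_def)

lemma test_functions_mono: "U \<subseteq> V \<Longrightarrow> \<rho> \<in> test_functions U \<Longrightarrow> \<rho> \<in> test_functions V"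
  by (auto simp: test_functions_def)

lemma smooth_on_continuous: "smooth_on U f \<Longrightarrow> continuous_on U f"
  unfolding smooth_on_def by (metis Ck_on.simps(1))

lemma smooth_on_has_derivative:
  assumes "smooth_on U f" "open U" "x \<in> U"
  shows "(f has_derivative (\<lambda>h. \<Sum>b\<in>Basis. (h \<bullet> b) * partial_deriv b f x)) (at x)"
proof (rule Ck_on_has_derivative[OF _ assms(2,3)])
  show "Ck_on (Suc 0) U f" using assms(1) unfolding smooth_on_def by blast
qed

lemma smooth_on_partial_deriv:
  assumes "smooth_on U f" "b \<in> Basis" shows "smooth_on U (partial_deriv b f)"
  unfolding smooth_on_def
proof
  fix k
  have "Ck_on (Suc k) U f" using assms(1) unfolding smooth_on_def by blast
  then show "Ck_on k U (partial_deriv b f)" using assms(2) unfolding Ck_on.simps(2) by blast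
qed

lemma partial_deriv_support:
  "{x. partial_deriv b \<rho> x \<noteq> 0} \<subseteq> closure {x. \<rho> x \<noteq> 0}"
proof
  fix x assume x: "x \<in> {x. partial_deriv b \<rho> x \<noteq> 0}"
  show "x \<in> closure {x. \<rho> x \<noteq> 0}"
  proof (rule ccontr)
    assume "x \<notin> closure {x. \<rho> x \<noteq> 0}"
    then have "partial_deriv b \<rho> x = partial_deriv b (\<lambda>x. 0) x"
      by (intro partial_deriv_cong_open[where U="- closure {x. \<rho> x \<noteq> 0}"])
         (use closure_subset[of "{x. \<rho> x \<noteq> 0}"] in auto)
    also have "\<dots> = 0" by (rule partial_deriv_eqI[OF has_derivative_const])
    finally show False using x by simp
  qed
qed

lemma test_functions_partial:
  assumes "\<rho> \<in> test_functions U" "b \<in> Basis" shows "partial_deriv b \<rho> \<in> test_functions U"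
proof -
  have sub: "closure {x. partial_deriv b \<rho> x \<noteq> 0} \<subseteq> closure {x. \<rho> x \<noteq> 0}"
    by (rule closure_minimal[OF partial_deriv_support closed_closure])
  then have "compact (closure {x. partial_deriv b \<rho> x \<noteq> 0})"
    using test_functionsD(2)[OF assms(1)] by (metis closed_closure compact_Int_closed inf.absorb_iff2)
  then show ?thesis using sub test_functionsD[OF assms(1)] smooth_on_partial_deriv[OF _ assms(2)]
    unfolding test_functions_def by blast
qed

lemma test_functions_bounded:
  assumes "\<rho> \<in> test_functions U" shows "\<exists>B. \<forall>x. \<bar>\<rho> x\<bar> \<le> B"
proof -
  have "compact (\<rho> ` closure {x. \<rho> x \<noteq> 0})"
    using test_functionsD[OF assms] smooth_on_continuous
    by (intro compact_continuous_image) (auto intro: continuous_on_subset)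
  then obtain B where B: "\<And>y. y \<in> \<rho> ` closure {x. \<rho> x \<noteq> 0} \<Longrightarrow> norm y \<le> B"
    using compact_imp_bounded bounded_iff by metis
  have "\<bar>\<rho> x\<bar> \<le> max B 0" for x
  proof (cases "\<rho> x = 0")
    case False
    then have "x \<in> closure {x. \<rho> x \<noteq> 0}" by (intro closure_subset[THEN subsetD]) simp
    then show ?thesis using B[of "\<rho> x"] by auto
  qed simp
  then show ?thesis by blast
qed

lemma test_functions_measurable: "\<rho> \<in> test_functions U \<Longrightarrow> \<rho> \<in> borel_measurable borel"
  by (intro borel_measurable_continuous_onI smooth_on_continuous test_functionsD)

lemma onorm_partials_le:
  fixes c :: "'a::euclidean_space \<Rightarrow> real"
  assumes "\<And>b. b \<in> Basis \<Longrightarrow> \<bar>c b\<bar> \<le> B"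
  shows "onorm (\<lambda>h::'a. \<Sum>b\<in>Basis. (h \<bullet> b) * c b) \<le> real DIM('a) * B"
proof (rule onorm_le)
  fix h :: 'a
  have "norm (\<Sum>b\<in>Basis. (h \<bullet> b) * c b) \<le> (\<Sum>b\<in>(Basis::'a set). norm h * B)"
  proof (rule sum_norm_le)
    fix b :: 'a assume "b \<in> Basis"
    then show "norm ((h \<bullet> b) * c b) \<le> norm h * B"
      using Basis_le_norm[of b h] assms[of b] by (auto simp: abs_mult intro!: mult_mono)
  qed
  then show "norm (\<Sum>b\<in>Basis. (h \<bullet> b) * c b) \<le> real DIM('a) * B * norm h"
    by (simp add: mult_ac)
qed

lemma test_functions_lipschitz:
  fixes \<rho> :: "'a::euclidean_space \<Rightarrow> real"
  assumes "\<rho> \<in> test_functions U" shows "\<exists>L\<ge>0. \<forall>x y. \<bar>\<rho> x - \<rho> y\<bar> \<le> L * norm (x - y)"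
proof -
  have "\<forall>b\<in>Basis. \<exists>B. \<forall>x. \<bar>partial_deriv b \<rho> x\<bar> \<le> B"
    using test_functions_bounded[OF test_functions_partial[OF assms]] by blast
  then obtain B where B: "\<And>b x. b \<in> Basis \<Longrightarrow> \<bar>partial_deriv b \<rho> x\<bar> \<le> B b" by metis
  define C where "C = (\<Sum>b\<in>(Basis::'a set). \<bar>B b\<bar>)"
  have C: "\<bar>partial_deriv b \<rho> x\<bar> \<le> C" if "b \<in> Basis" for b x
  proof -
    have "\<bar>B b\<bar> \<le> C" unfolding C_def by (intro member_le_sum) (use that in auto)
    then show ?thesis using B[OF that, of x] by linarith
  qed
  have "norm (\<rho> x - \<rho> y) \<le> (real DIM('a) * C) * norm (x - y)" for x y
  proof (rule differentiable_bound[where S=UNIV])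
    show "(\<rho> has_derivative (\<lambda>h. \<Sum>b\<in>Basis. (h \<bullet> b) * partial_deriv b \<rho> x)) (at x within UNIV)" for x
      using smooth_on_has_derivative[OF test_functionsD(1)[OF assms]] by simp
    show "onorm (\<lambda>h. \<Sum>b\<in>Basis. (h \<bullet> b) * partial_deriv b \<rho> x) \<le> real DIM('a) * C" for x
      by (rule onorm_partials_le) (rule C)
  qed auto
  moreover have "0 \<le> real DIM('a) * C" by (simp add: C_def sum_nonneg)
  ultimately show ?thesis by (metis real_norm_def)
qed

text \<open>A remainder estimate that is uniform in the base point; it allows differentiation under the integral in
\<open>conv_has_derivative\<close> and gives \<open>test_integral_partial\<close> from difference quotients.\<close>

lemma test_functions_taylor:
  fixes \<rho> :: "'a::euclidean_space \<Rightarrow> real"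
  assumes "\<rho> \<in> test_functions U"
  shows "\<exists>C\<ge>0. \<forall>z h. \<bar>\<rho> (z + h) - \<rho> z - (\<Sum>b\<in>Basis. (h \<bullet> b) * partial_deriv b \<rho> z)\<bar> \<le> C * (norm h)\<^sup>2"
proof -
  have "\<forall>b\<in>Basis. \<exists>L\<ge>0. \<forall>x y. \<bar>partial_deriv b \<rho> x - partial_deriv b \<rho> y\<bar> \<le> L * norm (x - y)"
    using test_functions_lipschitz[OF test_functions_partial[OF assms]] by blast
  then obtain L where L: "\<And>b. b \<in> Basis \<Longrightarrow> L b \<ge> 0"
    "\<And>b x y. b \<in> Basis \<Longrightarrow> \<bar>partial_deriv b \<rho> x - partial_deriv b \<rho> y\<bar> \<le> L b * norm (x - y)" by metis
  define C where "C = (\<Sum>b\<in>(Basis::'a set). L b)"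
  have C0: "C \<ge> 0" unfolding C_def using L(1) by (rule sum_nonneg)
  have C: "\<bar>partial_deriv b \<rho> x - partial_deriv b \<rho> y\<bar> \<le> C * norm (x - y)" if "b \<in> Basis" for b x y
  proof -
    have "L b \<le> C" unfolding C_def by (intro member_le_sum) (use that L in auto)
    then show ?thesis using L(2)[OF that, of x y] by (meson mult_right_mono norm_ge_zero order_trans)
  qed
  have "\<bar>\<rho> (z + h) - \<rho> z - (\<Sum>b\<in>Basis. (h \<bullet> b) * partial_deriv b \<rho> z)\<bar> \<le> (real DIM('a) * C) * (norm h)\<^sup>2" for z h
  proof -
    define \<psi> where "\<psi> t = \<rho> (z + t) - (\<Sum>b\<in>Basis. (t \<bullet> b) * partial_deriv b \<rho> z)" for t
    have d: "(\<psi> has_derivative (\<lambda>k. \<Sum>b\<in>Basis. (k \<bullet> b) * (partial_deriv b \<rho> (z + t) - partial_deriv b \<rho> z))) (at t within S)" for t S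
    proof -
      have "((\<lambda>t. \<rho> (z + t)) has_derivative (\<lambda>k. \<Sum>b\<in>Basis. (k \<bullet> b) * partial_deriv b \<rho> (z + t))) (at t within S)"
        by (rule has_derivative_compose[where g=\<rho> and f="\<lambda>t. z + t" and f'="\<lambda>k. k"])
           (auto intro!: derivative_eq_intros smooth_on_has_derivative[OF test_functionsD(1)[OF assms]])
      moreover have "((\<lambda>t. \<Sum>b\<in>Basis. (t \<bullet> b) * partial_deriv b \<rho> z) has_derivative
          (\<lambda>k. \<Sum>b\<in>Basis. (k \<bullet> b) * partial_deriv b \<rho> z)) (at t within S)"
        by (intro has_derivative_sum has_derivative_mult_left has_derivative_inner_left has_derivative_ident)
      ultimately show ?thesis unfolding \<psi>_def
        by (auto dest: has_derivative_diff simp: sum_subtractf right_diff_distrib)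
    qed
    have "norm (\<psi> h - \<psi> 0) \<le> (real DIM('a) * (C * norm h)) * norm (h - 0)"
    proof (rule differentiable_bound[where S="cball 0 (norm h)"])
      show "(\<psi> has_derivative (\<lambda>k. \<Sum>b\<in>Basis. (k \<bullet> b) * (partial_deriv b \<rho> (z + t) - partial_deriv b \<rho> z))) (at t within cball 0 (norm h))" for t
        by (rule d)
      fix t :: 'a assume t: "t \<in> cball 0 (norm h)"
      show "onorm (\<lambda>k. \<Sum>b\<in>Basis. (k \<bullet> b) * (partial_deriv b \<rho> (z + t) - partial_deriv b \<rho> z)) \<le> real DIM('a) * (C * norm h)"
      proof (rule onorm_partials_le)
        fix b :: 'a assume "b \<in> Basis"
        then have "\<bar>partial_deriv b \<rho> (z + t) - partial_deriv b \<rho> z\<bar> \<le> C * norm t"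
          using C[of b "z + t" z] by simp
        also have "\<dots> \<le> C * norm h" using t C0 by (intro mult_left_mono) auto
        finally show "\<bar>partial_deriv b \<rho> (z + t) - partial_deriv b \<rho> z\<bar> \<le> C * norm h" .
      qed
    qed auto
    then show ?thesis by (simp add: \<psi>_def power2_eq_square mult_ac algebra_simps)
  qed
  then show ?thesis using C0 by (meson mult_nonneg_nonneg of_nat_0_le_iff)
qed

section \<open>Convolution with test functions\<close>

definition conv :: "('a::euclidean_space \<Rightarrow> real) \<Rightarrow> ('a \<Rightarrow> real) \<Rightarrow> 'a \<Rightarrow> real" where
  "conv f \<rho> x = (LINT y|lborel. f y * \<rho> (x - y))"

lemma integrable_conv:
  fixes \<rho> :: "'a::euclidean_space \<Rightarrow> real"
  assumes f: "integrable lborel f" and \<rho>: "\<rho> \<in> borel_measurable borel" "\<And>x. \<bar>\<rho> x\<bar> \<le> B"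
  shows "integrable lborel (\<lambda>y. f y * \<rho> (x - y))"
proof (rule Bochner_Integration.integrable_bound[where f="\<lambda>y. B * f y"])
  have [measurable]: "f \<in> borel_measurable borel" using f by simp
  note \<rho>(1)[measurable]
  show "(\<lambda>y. f y * \<rho> (x - y)) \<in> borel_measurable lborel" by measurable
  show "AE y in lborel. norm (f y * \<rho> (x - y)) \<le> norm (B * f y)"
  proof (rule AE_I2)
    fix y
    have "\<bar>f y\<bar> * \<bar>\<rho> (x - y)\<bar> \<le> \<bar>f y\<bar> * \<bar>B\<bar>"
      using \<rho>(2)[of "x - y"] by (intro mult_left_mono) auto
    then show "norm (f y * \<rho> (x - y)) \<le> norm (B * f y)" by (simp add: abs_mult mult.commute)
  qed
qed (use f in simp)

lemma integrable_conv_test: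
  assumes "integrable lborel f" "\<rho> \<in> test_functions U"
  shows "integrable lborel (\<lambda>y. f y * \<rho> (x - y))"
  using integrable_conv[OF assms(1) test_functions_measurable[OF assms(2)]] test_functions_bounded[OF assms(2)]
  by blast

text \<open>The quadratic Taylor remainder of \<open>\<rho>\<close> is uniform, hence its integral against \<open>f\<close> is at most a multiple of
$|h|^2$.\<close>

lemma conv_has_derivative:
  fixes f :: "'a::euclidean_space \<Rightarrow> real"
  assumes f: "integrable lborel f" and \<rho>: "\<rho> \<in> test_functions U"
  shows "(conv f \<rho> has_derivative (\<lambda>h. \<Sum>b\<in>Basis. (h \<bullet> b) * conv f (partial_deriv b \<rho>) x)) (at x)"
  unfolding has_derivative_at_alt
proof (intro conjI allI impI)
  show "bounded_linear (\<lambda>h. \<Sum>b\<in>Basis. (h \<bullet> b) * conv f (partial_deriv b \<rho>) x)"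
    by (intro bounded_linear_sum bounded_linear_mult_const bounded_linear_inner_left)
  fix e :: real assume e: "e > 0"
  obtain C where C: "C \<ge> 0" "\<And>z h. \<bar>\<rho> (z + h) - \<rho> z - (\<Sum>b\<in>Basis. (h \<bullet> b) * partial_deriv b \<rho> z)\<bar> \<le> C * (norm h)\<^sup>2"
    using test_functions_taylor[OF \<rho>] by blast
  \<comment> \<open>The remainder is at most \<open>I * C * |h|\<^sup>2\<close>, where \<open>I\<close> is the $L^1$ norm of \<open>f\<close>.\<close>
  define I where "I = (LINT y|lborel. \<bar>f y\<bar>)"
  have I0: "I \<ge> 0" unfolding I_def by simp
  have fp: "integrable lborel (\<lambda>y. f y * partial_deriv b \<rho> (x - y))" if "b \<in> Basis" for b
    by (rule integrable_conv_test[OF f test_functions_partial[OF \<rho> that]])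
  have main: "norm (conv f \<rho> y - conv f \<rho> x - (\<Sum>b\<in>Basis. ((y - x) \<bullet> b) * conv f (partial_deriv b \<rho>) x))
      \<le> I * (C * (norm (y - x))\<^sup>2)" for y
  proof -
    define h where "h = y - x"
    have y: "y = x + h" by (simp add: h_def)
    have "conv f \<rho> y - conv f \<rho> x - (\<Sum>b\<in>Basis. (h \<bullet> b) * conv f (partial_deriv b \<rho>) x)
        = (LINT z|lborel. f z * \<rho> (y - z) - f z * \<rho> (x - z) - (\<Sum>b\<in>Basis. (h \<bullet> b) * (f z * partial_deriv b \<rho> (x - z))))"
      unfolding conv_def
      using fp integrable_conv_test[OF f \<rho>]
      by (simp add: Bochner_Integration.integral_diff Bochner_Integration.integral_sum)
    also have "\<dots> = (LINT z|lborel. f z * (\<rho> ((x - z) + h) - \<rho> (x - z) - (\<Sum>b\<in>Basis. (h \<bullet> b) * partial_deriv b \<rho> (x - z))))"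
      unfolding y by (simp add: right_diff_distrib sum_distrib_left mult_ac algebra_simps)
    finally have eq: "conv f \<rho> y - conv f \<rho> x - (\<Sum>b\<in>Basis. (h \<bullet> b) * conv f (partial_deriv b \<rho>) x)
        = (LINT z|lborel. f z * (\<rho> ((x - z) + h) - \<rho> (x - z) - (\<Sum>b\<in>Basis. (h \<bullet> b) * partial_deriv b \<rho> (x - z))))" .
    have "norm (LINT z|lborel. f z * (\<rho> ((x - z) + h) - \<rho> (x - z) - (\<Sum>b\<in>Basis. (h \<bullet> b) * partial_deriv b \<rho> (x - z))))
        \<le> (LINT z|lborel. \<bar>f z\<bar> * (C * (norm h)\<^sup>2))"
    proof (rule order_trans[OF integral_norm_bound], rule integral_mono)
      show "integrable lborel (\<lambda>z. \<bar>f z\<bar> * (C * (norm h)\<^sup>2))" using f by simp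
      have "integrable lborel (\<lambda>z. f z * \<rho> (y - z) - f z * \<rho> (x - z) - (\<Sum>b\<in>Basis. (h \<bullet> b) * (f z * partial_deriv b \<rho> (x - z))))"
        using fp integrable_conv_test[OF f \<rho>]
        by (intro Bochner_Integration.integrable_diff Bochner_Integration.integrable_sum) auto
      then show "integrable lborel (\<lambda>z. norm (f z * (\<rho> ((x - z) + h) - \<rho> (x - z) - (\<Sum>b\<in>Basis. (h \<bullet> b) * partial_deriv b \<rho> (x - z)))))"
        unfolding y by (intro integrable_norm) (simp add: right_diff_distrib sum_distrib_left mult.left_commute algebra_simps)
      show "norm (f z * (\<rho> ((x - z) + h) - \<rho> (x - z) - (\<Sum>b\<in>Basis. (h \<bullet> b) * partial_deriv b \<rho> (x - z))))
          \<le> \<bar>f z\<bar> * (C * (norm h)\<^sup>2)" for z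
        using C(2)[of "x - z" h] by (auto simp: abs_mult intro!: mult_left_mono)
    qed
    also have "\<dots> = I * (C * (norm h)\<^sup>2)" by (simp add: I_def)
    finally show ?thesis unfolding eq[symmetric] unfolding h_def .
  qed
  define d where "d = e / (I * C + 1)"
  have IC: "I * C \<ge> 0" using I0 C(1) by simp
  show "\<exists>d>0. \<forall>y. norm (y - x) < d \<longrightarrow>
      norm (conv f \<rho> y - conv f \<rho> x - (\<Sum>b\<in>Basis. ((y - x) \<bullet> b) * conv f (partial_deriv b \<rho>) x)) \<le> e * norm (y - x)"
  proof (intro exI conjI allI impI)
    show "d > 0" using e IC by (simp add: d_def)
    fix y assume y: "norm (y - x) < d"
    have "I * (C * (norm (y - x))\<^sup>2) = (I * C * norm (y - x)) * norm (y - x)"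
      by (simp add: power2_eq_square)
    also have "\<dots> \<le> e * norm (y - x)"
    proof (rule mult_right_mono)
      have "I * C * norm (y - x) \<le> (I * C + 1) * d" using y IC by (intro mult_mono) auto
      also have "\<dots> = e" using IC by (simp add: d_def)
      finally show "I * C * norm (y - x) \<le> e" .
    qed simp
    finally show "norm (conv f \<rho> y - conv f \<rho> x - (\<Sum>b\<in>Basis. ((y - x) \<bullet> b) * conv f (partial_deriv b \<rho>) x)) \<le> e * norm (y - x)"
      using main[of y] by linarith
  qed
qed

lemma partial_deriv_conv:
  assumes "integrable lborel f" "\<rho> \<in> test_functions U" "b \<in> Basis"
  shows "partial_deriv b (conv f \<rho>) = conv f (partial_deriv b \<rho>)"
  by (rule ext) (use assms(3) in \<open>simp add: partial_deriv_eqI[OF conv_has_derivative[OF assms(1,2)]] sum_Basis_inner\<close>)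

lemma smooth_conv:
  assumes "integrable lborel f" "\<rho> \<in> test_functions U"
  shows "smooth_on UNIV (conv f \<rho>)"
  unfolding smooth_on_def
proof
  fix k show "Ck_on k UNIV (conv f \<rho>)"
    using assms(2)
  proof (induction k arbitrary: \<rho>)
    case 0
    show ?case unfolding Ck_on.simps
      by (intro continuous_at_imp_continuous_on ballI has_derivative_continuous)
         (rule conv_has_derivative[OF assms(1) 0])
  next
    case (Suc k)
    show ?case unfolding Ck_on.simps
    proof (intro conjI ballI)
      show "conv f \<rho> differentiable_on UNIV"
        unfolding differentiable_on_def differentiable_def
        using conv_has_derivative[OF assms(1) Suc.prems] by blast
      fix b :: 'a assume b: "b \<in> Basis"
      show "Ck_on k UNIV (partial_deriv b (conv f \<rho>))"
        unfolding partial_deriv_conv[OF assms(1) Suc.prems b]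
        by (rule Suc.IH[OF test_functions_partial[OF Suc.prems b]])
    qed
  qed
qed

section \<open>Mollifiers\<close>

lemma test_functions_integrable:
  assumes "\<rho> \<in> test_functions U" shows "integrable lborel \<rho>"
proof -
  let ?K = "closure {x. \<rho> x \<noteq> 0}"
  have "integrable lborel (\<lambda>x. indicator ?K x *\<^sub>R \<rho> x)"
    using test_functionsD[OF assms]
    by (intro borel_integrable_compact) (auto intro: continuous_on_subset smooth_on_continuous)
  moreover have "(\<lambda>x. indicator ?K x *\<^sub>R \<rho> x) = \<rho>"
    using closure_subset[of "{x. \<rho> x \<noteq> 0}"] by (auto simp: indicator_def fun_eq_iff)
  ultimately show ?thesis by simp
qed

lemma bump_test: fixes U :: "'a::euclidean_space set" shows "d > 0 \<Longrightarrow> cball 0 d \<subseteq> U \<Longrightarrow> bump d \<in> test_functions U"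
proof -
  assume d: "d > 0" "cball 0 d \<subseteq> U"
  have "{x::'a. bump d x \<noteq> 0} = ball 0 d" unfolding bump_pos_iff[OF d(1)] by (auto simp: mem_ball_0)
  then have "closure {x::'a. bump d x \<noteq> 0} = cball 0 d" using closure_ball[OF d(1)] by metis
  then show ?thesis using d(2) smooth_bump compact_cball unfolding test_functions_def mem_Collect_eq by metis
qed

definition mollifier :: "real \<Rightarrow> 'a::euclidean_space \<Rightarrow> real" where
  "mollifier d x = bump d x / (LINT y|lborel. bump d (y::'a))"

lemma bump_integral_pos:
  assumes "d > 0" shows "(LINT y|lborel. bump d (y::'a::euclidean_space)) > 0"
proof -
  have i: "integrable lborel (bump d :: 'a \<Rightarrow> real)"
    by (rule test_functions_integrable[OF bump_test[OF assms subset_UNIV]])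
  have "(LINT y|lborel. bump d (y::'a)) \<noteq> 0"
  proof
    assume "(LINT y|lborel. bump d (y::'a)) = 0"
    then have "AE y in lborel. bump d (y::'a) = 0"
      using integral_nonneg_eq_0_iff_AE[OF i] bump_nonneg by auto
    then have "AE y in lborel. (y::'a) \<notin> ball 0 d"
      by eventually_elim (use bump_pos_iff[OF assms] in auto)
    then have "emeasure lborel (ball (0::'a) d) = 0"
      by (subst (asm) AE_iff_measurable[where N="ball 0 d"]) auto
    moreover have "measure lborel (ball (0::'a) d) > 0" using content_ball_pos[OF assms] by (simp add: measure_def)
    ultimately show False by (simp add: measure_def)
  qed
  moreover have "(LINT y|lborel. bump d (y::'a)) \<ge> 0" by (intro integral_nonneg_AE) (simp add: bump_nonneg)
  ultimately show ?thesis by simp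
qed

lemma mollifier_nonneg: "d > 0 \<Longrightarrow> mollifier d x \<ge> 0"
  by (simp add: mollifier_def bump_nonneg less_imp_le[OF bump_integral_pos])

lemma mollifier_eq_0_iff: "d > 0 \<Longrightarrow> mollifier d (x::'a::euclidean_space) = 0 \<longleftrightarrow> norm x \<ge> d"
  using bump_integral_pos[of d, where 'a='a] bump_pos_iff[of d x] by (auto simp: mollifier_def)

lemma mollifier_uminus: "mollifier d (- x) = mollifier d x"
  by (simp add: mollifier_def bump_def)

lemma mollifier_integral: "d > 0 \<Longrightarrow> (LINT y|lborel. mollifier d (y::'a::euclidean_space)) = 1"
  using bump_integral_pos[of d, where 'a='a] by (simp add: mollifier_def)

lemma mollifier_smooth: "smooth_on UNIV (mollifier d)"
proof -
  have "smooth_on UNIV (\<lambda>x::'a. bump d x * (1 / (LINT y|lborel. bump d (y::'a))))"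
    using smooth_bump[of d] unfolding smooth_on_def by (intro allI Ck_on_mult Ck_on_const) auto
  then show ?thesis by (simp add: mollifier_def[abs_def])
qed

lemma mollifier_test: 
  fixes U :: "'a::euclidean_space set"
  assumes "d > 0" "cball 0 d \<subseteq> U" shows "mollifier d \<in> test_functions U"
proof -
  have "{x::'a. mollifier d x \<noteq> 0} = ball 0 d" unfolding mollifier_eq_0_iff[OF assms(1)] by (auto simp: mem_ball_0)
  then have "closure {x::'a. mollifier d x \<noteq> 0} = cball 0 d" using closure_ball[OF assms(1)] by metis
  then show ?thesis using assms(2) mollifier_smooth compact_cball unfolding test_functions_def mem_Collect_eq by metis
qed

lemma lborel_reflect: "distr lborel borel (\<lambda>y. x - y) = (lborel :: 'a::euclidean_space measure)"
proof -
  have "lborel = density (distr lborel borel (\<lambda>y::'a. x + (-1) *\<^sub>R y)) (\<lambda>_. ennreal (\<bar>-1\<bar> ^ DIM('a)))"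
    by (rule lborel_affine) simp
  then show ?thesis by (simp add: density_1)
qed

lemma nn_integral_reflect:
  fixes f :: "'a::euclidean_space \<Rightarrow> ennreal"
  assumes [measurable]: "f \<in> borel_measurable borel"
  shows "(\<integral>\<^sup>+ y. f (x - y) \<partial>lborel) = (\<integral>\<^sup>+ y. f y \<partial>lborel)"
  by (subst lborel_reflect[of x, symmetric], subst nn_integral_distr) (simp_all)

lemma integral_reflect:
  fixes f :: "'a::euclidean_space \<Rightarrow> real"
  assumes [measurable]: "f \<in> borel_measurable borel"
  shows "(LINT y|lborel. f (x - y)) = (LINT y|lborel. f y)"
  by (subst lborel_reflect[of x, symmetric], subst integral_distr) (simp_all)

lemma mollifier_measurable [measurable]: "mollifier d \<in> borel_measurable borel"
  by (intro borel_measurable_continuous_onI smooth_on_continuous mollifier_smooth)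

lemma mollifier_integrable: "d > 0 \<Longrightarrow> integrable lborel (mollifier d)"
  by (rule test_functions_integrable[OF mollifier_test[OF _ subset_UNIV]])

lemma mollifier_nn_integral: "d > 0 \<Longrightarrow> (\<integral>\<^sup>+ y. ennreal (mollifier d (y::'a::euclidean_space)) \<partial>lborel) = 1"
  using nn_integral_eq_integral[OF mollifier_integrable[where 'a='a], of d] mollifier_nonneg[of d, where 'a='a]
    mollifier_integral[of d, where 'a='a]
  by simp

lemma conv_measurable:
  assumes [measurable]: "f \<in> borel_measurable borel" "\<rho> \<in> borel_measurable borel"
  shows "conv f \<rho> \<in> borel_measurable borel"
proof -
  have "(\<lambda>x. LINT y|lborel. f y * \<rho> (x - y)) \<in> borel_measurable lborel"
    by (rule lborel.borel_measurable_lebesgue_integral) measurable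
  then show ?thesis unfolding conv_def[abs_def] by simp
qed

lemma integrable_conv_mollifier:
  "integrable lborel f \<Longrightarrow> d > 0 \<Longrightarrow> integrable lborel (\<lambda>y. f y * mollifier d (x - y))"
  using integrable_conv_test[OF _ mollifier_test[OF _ subset_UNIV]] .

section \<open>Convergence of mollifications\<close>

text \<open>Mollifications are needed in $L^1$ (to pass to almost everywhere convergent subsequences) and in $L^2$. Both
cases share the proof below, which uses of the gauge its monotonicity, $\Phi(s+t) \le 2\Phi(s) + 2\Phi(t)$ and
the convexity inequality \<open>gauge_conv_le\<close>.\<close>

definition gauge_fn :: "(real \<Rightarrow> real) \<Rightarrow> bool" where
  "gauge_fn \<Phi> \<longleftrightarrow> \<Phi> = abs \<or> \<Phi> = (\<lambda>t. t\<^sup>2)"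

lemma gauge_fn_props:
  assumes "gauge_fn \<Phi>"
  shows "\<Phi> t \<ge> 0" "\<Phi> 0 = 0" "\<bar>s\<bar> \<le> \<bar>t\<bar> \<Longrightarrow> \<Phi> s \<le> \<Phi> t" "\<Phi> (s + t) \<le> 2 * \<Phi> s + 2 * \<Phi> t"
    "continuous_on UNIV \<Phi>" "\<Phi> (- t) = \<Phi> t" "\<Phi> \<in> borel_measurable borel"
proof -
  have "\<Phi> (s + t) \<le> 2 * \<Phi> s + 2 * \<Phi> t"
  proof (cases "\<Phi> = abs")
    case False
    then have P: "\<Phi> = (\<lambda>t. t\<^sup>2)" using assms by (auto simp: gauge_fn_def)
    have "0 \<le> (s - t)\<^sup>2" by simp
    then show ?thesis unfolding P by (simp add: power2_eq_square algebra_simps)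
  qed auto
  then show "\<Phi> (s + t) \<le> 2 * \<Phi> s + 2 * \<Phi> t" .
  show c: "continuous_on UNIV \<Phi>" using assms unfolding gauge_fn_def
    by (auto intro!: continuous_intros)
  then show "\<Phi> \<in> borel_measurable borel" by (rule borel_measurable_continuous_onI)
  show "\<bar>s\<bar> \<le> \<bar>t\<bar> \<Longrightarrow> \<Phi> s \<le> \<Phi> t" using assms unfolding gauge_fn_def
    by (auto simp: abs_le_square_iff[symmetric])
qed (use assms in \<open>auto simp: gauge_fn_def\<close>)

text \<open>This is Jensen's inequality for the probability density $y \mapsto$ \<open>mollifier d (x - y)\<close>. For the square it is
the fact that a variance is nonnegative.\<close>

lemma gauge_conv_le:
  fixes f :: "'a::euclidean_space \<Rightarrow> real"
  assumes g: "gauge_fn \<Phi>" and f: "integrable lborel f" "integrable lborel (\<lambda>x. \<Phi> (f x))" and d: "d > 0"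
  shows "\<Phi> (conv f (mollifier d) x) \<le> (LINT y|lborel. \<Phi> (f y) * mollifier d (x - y))"
proof (cases "\<Phi> = abs")
  case True
  have "\<bar>LINT y|lborel. f y * mollifier d (x - y)\<bar> \<le> (LINT y|lborel. \<bar>f y * mollifier d (x - y)\<bar>)"
    using integral_norm_bound[of lborel "\<lambda>y. f y * mollifier d (x - y)"] by simp
  then show ?thesis by (simp add: True conv_def abs_mult abs_of_nonneg[OF mollifier_nonneg[OF d]])
next
  case False
  then have P: "\<Phi> = (\<lambda>t. t\<^sup>2)" using g by (auto simp: gauge_fn_def)
  define m where "m = conv f (mollifier d) x"
  have i1: "integrable lborel (\<lambda>y. f y * mollifier d (x - y))" by (rule integrable_conv_mollifier[OF f(1) d])
  have i2: "integrable lborel (\<lambda>y. (f y)\<^sup>2 * mollifier d (x - y))" 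
    using integrable_conv_mollifier[OF f(2) d] by (simp add: P)
  have m1: "(LINT y|lborel. mollifier d (x - y)) = 1"
    using integral_reflect[of "mollifier d" x] mollifier_integral[OF d, where 'a='a] by simp
  have i3: "integrable lborel (\<lambda>y. mollifier d (x - y))"
    using m1 not_integrable_integral_eq by fastforce
  have "0 \<le> (LINT y|lborel. (f y - m)\<^sup>2 * mollifier d (x - y))"
    by (intro integral_nonneg_AE AE_I2) (simp add: mollifier_nonneg[OF d])
  also have "(LINT y|lborel. (f y - m)\<^sup>2 * mollifier d (x - y))
      = (LINT y|lborel. (f y)\<^sup>2 * mollifier d (x - y) - (2 * m) * (f y * mollifier d (x - y)) + m\<^sup>2 * mollifier d (x - y))"
    by (intro Bochner_Integration.integral_cong) (auto simp: power2_eq_square algebra_simps)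
  also have "\<dots> = (LINT y|lborel. (f y)\<^sup>2 * mollifier d (x - y)) - (2 * m) * m + m\<^sup>2"
    using i1 i2 i3 m1 by (simp add: m_def conv_def)
  finally show ?thesis by (simp add: P m_def power2_eq_square)
qed

text \<open>Integrate \<open>gauge_conv_le\<close> in \<open>x\<close> and exchange the integrals by Tonelli's theorem; the mollifier has mass one.\<close>

lemma young_mollifier:
  fixes f :: "'a::euclidean_space \<Rightarrow> real"
  assumes g: "gauge_fn \<Phi>" and f: "integrable lborel f" "integrable lborel (\<lambda>x. \<Phi> (f x))" and d: "d > 0"
  shows "integrable lborel (\<lambda>x. \<Phi> (conv f (mollifier d) x))"
    "(LINT x|lborel. \<Phi> (conv f (mollifier d) x)) \<le> (LINT x|lborel. \<Phi> (f x))"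
proof -
  note [measurable] = gauge_fn_props(7)[OF g]
  have [measurable]: "f \<in> borel_measurable borel" using f(1) by simp
  have [measurable]: "conv f (mollifier d) \<in> borel_measurable borel" by (rule conv_measurable) auto
  have "(\<integral>\<^sup>+ x. ennreal (\<Phi> (conv f (mollifier d) x)) \<partial>lborel)
      \<le> (\<integral>\<^sup>+ x. \<integral>\<^sup>+ y. ennreal (\<Phi> (f y)) * ennreal (mollifier d (x - y)) \<partial>lborel \<partial>lborel)"
  proof (rule nn_integral_mono)
    fix x
    have "ennreal (\<Phi> (conv f (mollifier d) x)) \<le> ennreal (LINT y|lborel. \<Phi> (f y) * mollifier d (x - y))"
      by (rule ennreal_leI[OF gauge_conv_le[OF g f d]])
    also have "\<dots> = (\<integral>\<^sup>+ y. ennreal (\<Phi> (f y) * mollifier d (x - y)) \<partial>lborel)"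
      by (rule nn_integral_eq_integral[symmetric, OF integrable_conv_mollifier[OF f(2) d]])
         (simp add: gauge_fn_props(1)[OF g] mollifier_nonneg[OF d])
    finally show "ennreal (\<Phi> (conv f (mollifier d) x)) \<le> (\<integral>\<^sup>+ y. ennreal (\<Phi> (f y)) * ennreal (mollifier d (x - y)) \<partial>lborel)"
      by (simp add: ennreal_mult gauge_fn_props(1)[OF g] mollifier_nonneg[OF d])
  qed
  also have "\<dots> = (\<integral>\<^sup>+ y. \<integral>\<^sup>+ x. ennreal (\<Phi> (f y)) * ennreal (mollifier d (x - y)) \<partial>lborel \<partial>lborel)"
    by (rule lborel_pair.Fubini') measurable
  also have "\<dots> = (\<integral>\<^sup>+ y. ennreal (\<Phi> (f y)) \<partial>lborel)"
  proof (rule nn_integral_cong)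
    fix y :: 'a
    have "(\<integral>\<^sup>+ x. ennreal (\<Phi> (f y)) * ennreal (mollifier d (x - y)) \<partial>lborel)
        = ennreal (\<Phi> (f y)) * (\<integral>\<^sup>+ x. ennreal (mollifier d (y - x)) \<partial>lborel)"
      using mollifier_uminus[of d "x - y" for x] by (simp add: nn_integral_cmult)
    also have "(\<integral>\<^sup>+ x. ennreal (mollifier d (y - x)) \<partial>lborel) = 1"
      using nn_integral_reflect[of "\<lambda>x. ennreal (mollifier d x)" y] mollifier_nn_integral[OF d, where 'a='a] by simp
    finally show "(\<integral>\<^sup>+ x. ennreal (\<Phi> (f y)) * ennreal (mollifier d (x - y)) \<partial>lborel) = ennreal (\<Phi> (f y))" by simp
  qed
  also have "\<dots> = ennreal (LINT x|lborel. \<Phi> (f x))"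
    by (rule nn_integral_eq_integral[OF f(2)]) (simp add: gauge_fn_props(1)[OF g])
  finally have le: "(\<integral>\<^sup>+ x. ennreal (\<Phi> (conv f (mollifier d) x)) \<partial>lborel) \<le> ennreal (LINT x|lborel. \<Phi> (f x))" .
  show i: "integrable lborel (\<lambda>x. \<Phi> (conv f (mollifier d) x))"
  proof (rule integrableI_bounded)
    show "(\<integral>\<^sup>+ x. ennreal (norm (\<Phi> (conv f (mollifier d) x))) \<partial>lborel) < \<infinity>"
      using le_less_trans[OF le ennreal_less_top] gauge_fn_props(1)[OF g] by simp
  qed measurable
  show "(LINT x|lborel. \<Phi> (conv f (mollifier d) x)) \<le> (LINT x|lborel. \<Phi> (f x))"
    using le nn_integral_eq_integral[OF i] gauge_fn_props(1)[OF g]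
    by (simp add: ennreal_le_iff integral_nonneg_AE)
qed

lemma integrable_ball_const: "integrable lborel (\<lambda>x::'a::euclidean_space. K * indicator (ball a r) x :: real)"
proof -
  have "emeasure lborel (ball a r) < \<infinity>" by (rule emeasure_bounded_finite[OF bounded_ball])
  then have "integrable lborel (indicator (ball a r) :: 'a \<Rightarrow> real)"
    by (intro integrable_real_indicator) simp_all
  then show ?thesis by simp
qed

text \<open>The function is truncated in size and in space, which is a small change by dominated convergence. The
truncated function is an almost everywhere limit of continuous functions, and these can be cut to the same bound
and the same ball, so that dominated convergence applies once more.\<close>

lemma approx_continuous_gauge:
  fixes f :: "'a::euclidean_space \<Rightarrow> real"
  assumes g: "gauge_fn \<Phi>" and f: "f \<in> borel_measurable borel" "integrable lborel (\<lambda>x. \<Phi> (f x))" and e: "e > 0"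
  shows "\<exists>c k. continuous_on UNIV c \<and> (\<forall>x. \<bar>c x\<bar> \<le> k) \<and> (\<forall>x. norm x \<ge> k \<longrightarrow> c x = 0)
    \<and> integrable lborel (\<lambda>x. \<Phi> (f x - c x)) \<and> (LINT x|lborel. \<Phi> (f x - c x)) < e"
proof -
  note [measurable] = gauge_fn_props(7)[OF g] f(1)
  note gp = gauge_fn_props[OF g]
  define t where "t k x = (if norm x \<le> real k \<and> \<bar>f x\<bar> \<le> real k then f x else 0)" for k x
  have [measurable]: "t k \<in> borel_measurable borel" for k unfolding t_def[abs_def] by measurable
  have "(\<lambda>k. LINT x|lborel. \<Phi> (f x - t k x)) \<longlonglongrightarrow> (LINT x|(lborel::'a measure). 0)"
  proof (rule integral_dominated_convergence[where w="\<lambda>x. \<Phi> (f x)"])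
    show "AE x in lborel. (\<lambda>k. \<Phi> (f x - t k x)) \<longlonglongrightarrow> 0"
    proof (rule AE_I2)
      fix x
      obtain K where K: "max (norm x) \<bar>f x\<bar> \<le> real K" using real_arch_simple by blast
      have "\<forall>\<^sub>F k in sequentially. \<Phi> (f x - t k x) = 0"
        using eventually_ge_at_top[of K]
        by eventually_elim (use K gp(2) in \<open>auto simp: t_def\<close>)
      then show "(\<lambda>k. \<Phi> (f x - t k x)) \<longlonglongrightarrow> 0" by (rule tendsto_eventually)
    qed
    show "AE x in lborel. norm (\<Phi> (f x - t k x)) \<le> \<Phi> (f x)" for k
      by (rule AE_I2) (use gp(1,2) in \<open>auto simp: t_def\<close>)
  qed (use f(2) in auto)
  then have "\<forall>\<^sub>F k in sequentially. (LINT x|lborel. \<Phi> (f x - t k x)) < e / 4"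
    by (rule order_tendstoD(2)) (simp add: e)
  then obtain k where k: "(LINT x|lborel. \<Phi> (f x - t k x)) < e / 4"
    using eventually_happens'[OF sequentially_bot] by blast
  have ik: "integrable lborel (\<lambda>x. \<Phi> (f x - t k x))"
    by (rule Bochner_Integration.integrable_bound[OF f(2)])
       (use gp(1,2) in \<open>auto simp: t_def\<close>)
  have "t k \<in> borel_measurable lebesgue" by (simp add: borel_measurable_if_I measurable_completion)
  then have "t k measurable_on UNIV"
    by (intro lebesgue_measurable_imp_measurable_on_real) auto
  then obtain N h where N: "negligible N" and hc: "\<And>n. continuous_on UNIV (h n)"
    and hl: "\<And>x. x \<notin> N \<Longrightarrow> (\<lambda>n. h n x) \<longlonglongrightarrow> t k x"
    unfolding measurable_on_def by auto
  \<comment> \<open>Truncation of the approximants at height \<open>k\<close>, and a linear cut-off between radius \<open>k\<close> and \<open>k + 1\<close>.\<close>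
  define c where "c n x = max (- real k) (min (real k) (h n x)) * max 0 (min 1 (real k + 1 - norm x))" for n x
  have cc: "continuous_on UNIV (c n)" for n unfolding c_def[abs_def]
    by (intro continuous_intros hc)
  have [measurable]: "c n \<in> borel_measurable borel" for n by (rule borel_measurable_continuous_onI[OF cc])
  have cb: "\<bar>c n x\<bar> \<le> real k" for n x
  proof -
    have "\<bar>max (- real k) (min (real k) (h n x))\<bar> * \<bar>max 0 (min 1 (real k + 1 - norm x))\<bar> \<le> real k * 1"
      by (intro mult_mono) auto
    then show ?thesis by (simp add: c_def abs_mult)
  qed
  have c0: "c n x = 0" if "norm x \<ge> real k + 1" for n x using that by (simp add: c_def)
  have tb: "\<bar>t k x\<bar> \<le> real k" for x by (simp add: t_def)
  let ?w = "\<lambda>x::'a. \<Phi> (2 * real k) * indicator (ball 0 (real k + 1)) x"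
  have wi: "integrable lborel ?w"
    by (rule integrable_ball_const)
  have wb: "norm (\<Phi> (t k x - c n x)) \<le> ?w x" for n x
  proof (cases "x \<in> ball 0 (real k + 1)")
    case True
    then show ?thesis using gp(1) gp(3)[of "t k x - c n x" "2 * real k"] tb[of x] cb[of n x] by simp
  next
    case False
    then have "t k x = 0" "c n x = 0" using c0 by (auto simp: t_def)
    then show ?thesis using gp(2) gp(1)[of "2 * real k"] by simp
  qed
  have ic: "integrable lborel (\<lambda>x. \<Phi> (t k x - c n x))" for n
  proof (rule Bochner_Integration.integrable_bound[OF wi])
    show "AE x in lborel. norm (\<Phi> (t k x - c n x)) \<le> norm (?w x)"
      by (rule AE_I2, rule order_trans[OF wb]) simp
  qed measurable
  have "(\<lambda>n. LINT x|lborel. \<Phi> (t k x - c n x)) \<longlonglongrightarrow> (LINT x|(lborel::'a measure). 0)"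
  proof (rule integral_dominated_convergence[where w="?w"])
    have "AE x in lborel. x \<notin> N"
      using N by (metis AE_not_in negligible_iff_null_sets null_sets_completion_iff2 AE_completion_iff)
    then show "AE x in lborel. (\<lambda>n. \<Phi> (t k x - c n x)) \<longlonglongrightarrow> 0"
    proof eventually_elim
      fix x assume "x \<notin> N"
      then have l: "(\<lambda>n. h n x) \<longlonglongrightarrow> t k x" by (rule hl)
      have "(\<lambda>n. c n x) \<longlonglongrightarrow> max (- real k) (min (real k) (t k x)) * max 0 (min 1 (real k + 1 - norm x))"
        unfolding c_def by (intro tendsto_intros l)
      also have "max (- real k) (min (real k) (t k x)) * max 0 (min 1 (real k + 1 - norm x)) = t k x"
        using tb[of x] by (auto simp: t_def)
      finally have "(\<lambda>n. t k x - c n x) \<longlonglongrightarrow> t k x - t k x" by (intro tendsto_intros)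
      then have "(\<lambda>n. \<Phi> (t k x - c n x)) \<longlonglongrightarrow> \<Phi> (t k x - t k x)"
        by (rule continuous_on_tendsto_compose[OF gp(5)]) auto
      then show "(\<lambda>n. \<Phi> (t k x - c n x)) \<longlonglongrightarrow> 0" using gp(2) by simp
    qed
    show "AE x in lborel. norm (\<Phi> (t k x - c n x)) \<le> ?w x" for n using wb by (intro AE_I2)
  qed (use wi in auto)
  then have "\<forall>\<^sub>F n in sequentially. (LINT x|lborel. \<Phi> (t k x - c n x)) < e / 4"
    by (rule order_tendstoD(2)) (simp add: e)
  then obtain n where n: "(LINT x|lborel. \<Phi> (t k x - c n x)) < e / 4"
    using eventually_happens'[OF sequentially_bot] by blast
  have le: "\<Phi> (f x - c n x) \<le> 2 * \<Phi> (f x - t k x) + 2 * \<Phi> (t k x - c n x)" for x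
    using gp(4)[of "f x - t k x" "t k x - c n x"] by simp
  have ifin: "integrable lborel (\<lambda>x. \<Phi> (f x - c n x))"
  proof (rule Bochner_Integration.integrable_bound)
    show "integrable lborel (\<lambda>x. 2 * \<Phi> (f x - t k x) + 2 * \<Phi> (t k x - c n x))" using ik ic by simp
    show "AE x in lborel. norm (\<Phi> (f x - c n x)) \<le> norm (2 * \<Phi> (f x - t k x) + 2 * \<Phi> (t k x - c n x))"
      using le gp(1) by (intro AE_I2) (simp add: abs_of_nonneg)
  qed measurable
  have "(LINT x|lborel. \<Phi> (f x - c n x)) \<le> (LINT x|lborel. 2 * \<Phi> (f x - t k x) + 2 * \<Phi> (t k x - c n x))"
    by (rule integral_mono[OF ifin _ le]) (use ik ic in auto)
  also have "\<dots> = 2 * (LINT x|lborel. \<Phi> (f x - t k x)) + 2 * (LINT x|lborel. \<Phi> (t k x - c n x))"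
    using ik ic by simp
  also have "\<dots> < e" using k n by simp
  finally have fin: "(LINT x|lborel. \<Phi> (f x - c n x)) < e" .
  show ?thesis
    using cc[of n] cb[of n] c0[of _ n] ifin fin
    by (intro exI[of _ "c n"] exI[of _ "real k + 1"]) (auto intro: order_trans[OF cb[of n]])
qed

text \<open>Convergence is pointwise by continuity, and the differences are bounded and vanish outside one ball.\<close>

lemma mollify_tendsto_continuous:
  fixes c :: "'a::euclidean_space \<Rightarrow> real"
  assumes g: "gauge_fn \<Phi>" and c: "continuous_on UNIV c" "\<And>x. \<bar>c x\<bar> \<le> k" "\<And>x. norm x \<ge> k \<Longrightarrow> c x = 0"
  shows "integrable lborel c" "integrable lborel (\<lambda>x. \<Phi> (c x))"
    "(\<lambda>n. LINT x|lborel. \<Phi> (conv c (mollifier (1 / real (Suc n))) x - c x)) \<longlonglongrightarrow> 0"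
proof -
  note gp = gauge_fn_props[OF g] and [measurable] = gauge_fn_props(7)[OF g]
  have [measurable]: "c \<in> borel_measurable borel" by (rule borel_measurable_continuous_onI[OF c(1)])
  have k: "k \<ge> 0" using c(2)[of 0] by linarith
  have cb: "norm (c x) \<le> norm (k * indicator (ball 0 k) x)" for x
    using c(2,3)[of x] k by (cases "x \<in> ball 0 k") auto
  show ci: "integrable lborel c"
    by (rule Bochner_Integration.integrable_bound[OF integrable_ball_const]) (use cb in \<open>auto intro!: AE_I2\<close>)
  have cb2: "norm (\<Phi> (c x)) \<le> norm (\<Phi> k * indicator (ball 0 k) x)" for x
    using c(2,3)[of x] k gp(1) gp(2) gp(3)[of "c x" k] by (cases "x \<in> ball 0 k") auto
  show "integrable lborel (\<lambda>x. \<Phi> (c x))"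
    by (rule Bochner_Integration.integrable_bound[OF integrable_ball_const]) (use cb2 in \<open>auto intro!: AE_I2\<close>)
  have eq: "conv c (mollifier d) x = (LINT z|lborel. c (x - z) * mollifier d z)" for d x
    unfolding conv_def using integral_reflect[of "\<lambda>y. c y * mollifier d (x - y)" x] by simp
  have mi: "integrable lborel (\<lambda>z. c (x - z) * mollifier d z)" if "d > 0" for d x
  proof (rule Bochner_Integration.integrable_bound[where f="\<lambda>z. k * mollifier d z"])
    show "AE z in lborel. norm (c (x - z) * mollifier d z) \<le> norm (k * mollifier d z)"
      using c(2) k mollifier_nonneg[OF that] by (intro AE_I2) (auto simp: abs_mult intro!: mult_right_mono)
  qed (use mollifier_integrable[OF that] in auto)
  have close: "\<bar>conv c (mollifier d) x - c x\<bar> \<le> e" if d: "d > 0" and e: "\<And>z. norm z < d \<Longrightarrow> \<bar>c (x - z) - c x\<bar> \<le> e" for d x e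
  proof -
    have "conv c (mollifier d) x - c x = (LINT z|lborel. c (x - z) * mollifier d z - c x * mollifier d z)"
      using mi[OF d] mollifier_integrable[OF d, where 'a='a] mollifier_integral[OF d, where 'a='a] by (simp add: eq)
    also have "\<bar>\<dots>\<bar> \<le> (LINT z|lborel. norm (c (x - z) * mollifier d z - c x * mollifier d z))"
      using integral_norm_bound[of lborel "\<lambda>z. c (x - z) * mollifier d z - c x * mollifier d z"] by simp
    also have "\<dots> \<le> (LINT z|lborel. e * mollifier d (z::'a))"
    proof (rule integral_mono)
      show "integrable lborel (\<lambda>z. norm (c (x - z) * mollifier d z - c x * mollifier d z))"
        using mi[OF d] mollifier_integrable[OF d, where 'a='a] by simp
      show "integrable lborel (\<lambda>z::'a. e * mollifier d z)" using mollifier_integrable[OF d, where 'a='a] by simp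
      fix z
      show "norm (c (x - z) * mollifier d z - c x * mollifier d z) \<le> e * mollifier d z"
      proof (cases "norm z < d")
        case True
        have "norm (c (x - z) * mollifier d z - c x * mollifier d z) = \<bar>c (x - z) - c x\<bar> * mollifier d z"
          using mollifier_nonneg[OF d, of z] by (simp add: left_diff_distrib[symmetric] abs_mult)
        then show ?thesis using e[OF True] mollifier_nonneg[OF d, of z] by (simp add: mult_right_mono)
      next
        case False
        then show ?thesis using mollifier_eq_0_iff[OF d, of z] by simp
      qed
    qed
    also have "\<dots> = e" using mollifier_integral[OF d, where 'a='a] by simp
    finally show ?thesis .
  qed
  define \<delta> where "\<delta> n = 1 / real (Suc n)" for n
  have \<delta>: "\<delta> n > 0" "\<delta> n \<le> 1" for n by (auto simp: \<delta>_def)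
  have \<delta>0: "\<delta> \<longlonglongrightarrow> 0" unfolding \<delta>_def by (rule LIMSEQ_Suc[OF lim_1_over_n])
  have [measurable]: "conv c (mollifier d) \<in> borel_measurable borel" for d by (rule conv_measurable) auto
  have "(\<lambda>n. LINT x|lborel. \<Phi> (conv c (mollifier (\<delta> n)) x - c x)) \<longlonglongrightarrow> (LINT x|(lborel::'a measure). 0)"
  proof (rule integral_dominated_convergence[where w="\<lambda>x. \<Phi> (2 * k) * indicator (ball 0 (k + 1)) x"])
    show "integrable lborel (\<lambda>x::'a. \<Phi> (2 * k) * indicator (ball 0 (k + 1)) x)" by (rule integrable_ball_const)
    show "AE x in lborel. (\<lambda>n. \<Phi> (conv c (mollifier (\<delta> n)) x - c x)) \<longlonglongrightarrow> 0"
    proof (rule AE_I2)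
      fix x
      have "(\<lambda>n. conv c (mollifier (\<delta> n)) x - c x) \<longlonglongrightarrow> 0"
      proof (rule LIMSEQ_I)
        fix e :: real assume e: "e > 0"
        have "isCont c x" using c(1) continuous_on_eq_continuous_at open_UNIV by blast
        then obtain d where d: "d > 0" "\<And>y. dist y x < d \<Longrightarrow> dist (c y) (c x) < e / 2"
          unfolding continuous_at_eps_delta using e half_gt_zero by metis
        have "\<forall>\<^sub>F n in sequentially. \<delta> n < d" using \<delta>0 d(1) by (rule order_tendstoD)
        then obtain n0 where n0: "\<And>n. n \<ge> n0 \<Longrightarrow> \<delta> n < d" unfolding eventually_sequentially by blast
        have "\<bar>conv c (mollifier (\<delta> n)) x - c x\<bar> \<le> e / 2" if "n \<ge> n0" for n
        proof (rule close[OF \<delta>(1)])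
          fix z :: 'a assume "norm z < \<delta> n"
          then have "dist (x - z) x < d" using n0[OF that] by (simp add: dist_norm)
          then show "\<bar>c (x - z) - c x\<bar> \<le> e / 2" using d(2)[of "x - z"] by (simp add: dist_real_def)
        qed
        then show "\<exists>no. \<forall>n\<ge>no. norm (conv c (mollifier (\<delta> n)) x - c x - 0) < e"
          using e by (intro exI[of _ n0]) (force)
      qed
      then have "(\<lambda>n. \<Phi> (conv c (mollifier (\<delta> n)) x - c x)) \<longlonglongrightarrow> \<Phi> 0"
        by (rule continuous_on_tendsto_compose[OF gp(5)]) auto
      then show "(\<lambda>n. \<Phi> (conv c (mollifier (\<delta> n)) x - c x)) \<longlonglongrightarrow> 0" using gp(2) by simp
    qed
    fix n
    show "AE x in lborel. norm (\<Phi> (conv c (mollifier (\<delta> n)) x - c x)) \<le> \<Phi> (2 * k) * indicator (ball 0 (k + 1)) x"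
    proof (rule AE_I2)
      fix x
      show "norm (\<Phi> (conv c (mollifier (\<delta> n)) x - c x)) \<le> \<Phi> (2 * k) * indicator (ball 0 (k + 1)) x"
      proof (cases "x \<in> ball 0 (k + 1)")
        case True
        have "\<bar>conv c (mollifier (\<delta> n)) x - c x\<bar> \<le> 2 * k"
          by (rule close[OF \<delta>(1)]) (use c(2)[of x] c(2)[of "x - z" for z] in \<open>smt (verit)\<close>)
        then show ?thesis using True gp(1) gp(3)[of "conv c (mollifier (\<delta> n)) x - c x" "2 * k"] k by simp
      next
        case False
        then have x: "norm x \<ge> k + 1" by simp
        have "\<bar>conv c (mollifier (\<delta> n)) x - c x\<bar> \<le> 0"
        proof (rule close[OF \<delta>(1)])
          fix z :: 'a assume "norm z < \<delta> n"
          then have "norm (x - z) \<ge> k" using x \<delta>(2)[of n] norm_triangle_ineq2[of x z] by linarith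
          then show "\<bar>c (x - z) - c x\<bar> \<le> 0" using c(3)[of "x - z"] c(3)[of x] x by simp
        qed
        then show ?thesis using gp(2) False by simp
      qed
    qed
  qed measurable
  then show "(\<lambda>n. LINT x|lborel. \<Phi> (conv c (mollifier (1 / real (Suc n))) x - c x)) \<longlonglongrightarrow> 0"
    by (simp add: \<delta>_def)
qed

lemma conv_diff:
  assumes "integrable lborel f" "integrable lborel g" "d > 0"
  shows "conv (\<lambda>x. f x - g x) (mollifier d) x = conv f (mollifier d) x - conv g (mollifier d) x"
  unfolding conv_def left_diff_distrib
  by (rule Bochner_Integration.integral_diff[OF integrable_conv_mollifier[OF assms(1,3)] integrable_conv_mollifier[OF assms(2,3)]])

lemma gauge_integrable_diff:
  assumes g: "gauge_fn \<Phi>" and m: "u \<in> borel_measurable M" "v \<in> borel_measurable M"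
    and i: "integrable M (\<lambda>x. \<Phi> (u x))" "integrable M (\<lambda>x. \<Phi> (v x))"
  shows "integrable M (\<lambda>x. \<Phi> (u x - v x))"
    "(LINT x|M. \<Phi> (u x - v x)) \<le> 2 * (LINT x|M. \<Phi> (u x)) + 2 * (LINT x|M. \<Phi> (v x))"
proof -
  note [measurable] = m gauge_fn_props(7)[OF g]
  have le: "\<Phi> (u x - v x) \<le> 2 * \<Phi> (u x) + 2 * \<Phi> (v x)" for x
    using gauge_fn_props(4)[OF g, of "u x" "- v x"] gauge_fn_props(6)[OF g] by simp
  show *: "integrable M (\<lambda>x. \<Phi> (u x - v x))"
  proof (rule Bochner_Integration.integrable_bound[where f="\<lambda>x. 2 * \<Phi> (u x) + 2 * \<Phi> (v x)"])
    show "AE x in M. norm (\<Phi> (u x - v x)) \<le> norm (2 * \<Phi> (u x) + 2 * \<Phi> (v x))"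
      using le gauge_fn_props(1)[OF g] by (intro AE_I2) (simp add: abs_of_nonneg)
  qed (use i in auto)
  have "(LINT x|M. \<Phi> (u x - v x)) \<le> (LINT x|M. 2 * \<Phi> (u x) + 2 * \<Phi> (v x))"
    by (rule integral_mono[OF * _ le]) (use i in simp)
  then show "(LINT x|M. \<Phi> (u x - v x)) \<le> 2 * (LINT x|M. \<Phi> (u x)) + 2 * (LINT x|M. \<Phi> (v x))"
    using i by simp
qed

text \<open>Choose a continuous \<open>c\<close> with compact support near \<open>f\<close>. By \<open>young_mollifier\<close> the mollifications of \<open>f\<close> and \<open>c\<close>
are as close to each other as \<open>f\<close> and \<open>c\<close> are, so the continuous case suffices.\<close>

theorem mollify_tendsto:
  fixes f :: "'a::euclidean_space \<Rightarrow> real"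
  assumes g: "gauge_fn \<Phi>" and f: "integrable lborel f" "integrable lborel (\<lambda>x. \<Phi> (f x))"
  shows "d > 0 \<Longrightarrow> integrable lborel (\<lambda>x. \<Phi> (conv f (mollifier d) x - f x))"
    "(\<lambda>n. LINT x|lborel. \<Phi> (conv f (mollifier (1 / real (Suc n))) x - f x)) \<longlonglongrightarrow> 0"
proof -
  note gp = gauge_fn_props[OF g] and [measurable] = gauge_fn_props(7)[OF g]
  have fm [measurable]: "f \<in> borel_measurable borel" using f(1) by simp
  have cm: "u \<in> borel_measurable borel \<Longrightarrow> conv u (mollifier d) \<in> borel_measurable lborel" for u :: "'a \<Rightarrow> real" and d
    using conv_measurable[of u "mollifier d"] by simp
  show *: "integrable lborel (\<lambda>x. \<Phi> (conv f (mollifier d) x - f x))" if "d > 0" for d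
    by (rule gauge_integrable_diff(1)[OF g cm _ young_mollifier(1)[OF g f that] f(2)]) auto
  show "(\<lambda>n. LINT x|lborel. \<Phi> (conv f (mollifier (1 / real (Suc n))) x - f x)) \<longlonglongrightarrow> 0"
  proof (rule LIMSEQ_I)
    fix e :: real assume e: "e > 0"
    obtain c k where c: "continuous_on UNIV c" "\<And>x. \<bar>c x\<bar> \<le> k" "\<And>x. norm x \<ge> k \<Longrightarrow> c x = 0"
      and ci: "integrable lborel (\<lambda>x. \<Phi> (f x - c x))" and ce: "(LINT x|lborel. \<Phi> (f x - c x)) < e / 16"
      using approx_continuous_gauge[OF g fm f(2), of "e/16"] e by auto
    have cc: "integrable lborel c" "integrable lborel (\<lambda>x. \<Phi> (c x))"
        "(\<lambda>n. LINT x|lborel. \<Phi> (conv c (mollifier (1 / real (Suc n))) x - c x)) \<longlonglongrightarrow> 0"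
      by (rule mollify_tendsto_continuous[OF g c(1) c(2) c(3)], assumption)+
    have cmb [measurable]: "c \<in> borel_measurable borel" by (rule borel_measurable_continuous_onI[OF c(1)])
    have "\<forall>\<^sub>F n in sequentially. (LINT x|lborel. \<Phi> (conv c (mollifier (1 / real (Suc n))) x - c x)) < e / 16"
      by (rule order_tendstoD(2)[OF cc(3)]) (rule divide_pos_pos[OF e], simp)
    then obtain n0 where n0: "\<And>n. n \<ge> n0 \<Longrightarrow> (LINT x|lborel. \<Phi> (conv c (mollifier (1 / real (Suc n))) x - c x)) < e / 16"
      unfolding eventually_sequentially by blast
    have "norm ((LINT x|lborel. \<Phi> (conv f (mollifier (1 / real (Suc n))) x - f x)) - 0) < e" if n: "n \<ge> n0" for n
    proof -
      define d where "d = 1 / real (Suc n)"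
      have d: "d > 0" by (simp add: d_def)
      let ?u = "\<lambda>x. f x - c x"
      have ui: "integrable lborel ?u" using f(1) cc(1) by simp
      have y: "integrable lborel (\<lambda>x. \<Phi> (conv ?u (mollifier d) x))"
        "(LINT x|lborel. \<Phi> (conv ?u (mollifier d) x)) \<le> (LINT x|lborel. \<Phi> (?u x))"
        using young_mollifier[OF g ui ci d] .
      have z: "integrable lborel (\<lambda>x. \<Phi> (conv c (mollifier d) x - c x))"
        by (rule gauge_integrable_diff(1)[OF g cm _ young_mollifier(1)[OF g cc(1,2) d] cc(2)]) auto
      have [measurable]: "conv ?u (mollifier d) \<in> borel_measurable borel" "conv c (mollifier d) \<in> borel_measurable borel"
        by (auto intro!: conv_measurable)
      have z1: "integrable lborel (\<lambda>x. \<Phi> (?u x - (conv c (mollifier d) x - c x)))"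
          "(LINT x|lborel. \<Phi> (?u x - (conv c (mollifier d) x - c x))) \<le> 2 * (LINT x|lborel. \<Phi> (?u x)) + 2 * (LINT x|lborel. \<Phi> (conv c (mollifier d) x - c x))"
        by (rule gauge_integrable_diff[OF g _ _ ci z]; measurable)+
      have z2: "(LINT x|lborel. \<Phi> (conv ?u (mollifier d) x - (?u x - (conv c (mollifier d) x - c x))))
          \<le> 2 * (LINT x|lborel. \<Phi> (conv ?u (mollifier d) x)) + 2 * (LINT x|lborel. \<Phi> (?u x - (conv c (mollifier d) x - c x)))"
        by (rule gauge_integrable_diff(2)[OF g _ _ y(1) z1(1)]; measurable)
      have "(\<lambda>x. \<Phi> (conv ?u (mollifier d) x - (?u x - (conv c (mollifier d) x - c x)))) = (\<lambda>x. \<Phi> (conv f (mollifier d) x - f x))"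
        by (simp add: conv_diff[OF f(1) cc(1) d])
      then have "(LINT x|lborel. \<Phi> (conv f (mollifier d) x - f x)) < e"
        using z2 z1(2) y(2) ce n0[OF n] e by (simp add: d_def)
      moreover have "(LINT x|lborel. \<Phi> (conv f (mollifier d) x - f x)) \<ge> 0"
        by (intro integral_nonneg_AE) (simp add: gp(1))
      ultimately show ?thesis by (simp add: d_def)
    qed
    then show "\<exists>no. \<forall>n\<ge>no. norm ((LINT x|lborel. \<Phi> (conv f (mollifier (1 / real (Suc n))) x - f x)) - 0) < e" by blast
  qed
qed

section \<open>The fundamental lemma of the calculus of variations\<close>

lemma smooth_affine_map:
  fixes \<rho> :: "'a::euclidean_space \<Rightarrow> real"
  assumes "smooth_on UNIV \<rho>" shows "smooth_on UNIV (\<lambda>y. \<rho> (x + c *\<^sub>R y))"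
  unfolding smooth_on_def
proof
  fix k show "Ck_on k UNIV (\<lambda>y. \<rho> (x + c *\<^sub>R y))"
  proof (rule Ck_on_compose[where V=UNIV and f=\<rho> and T="\<lambda>y. x + c *\<^sub>R y"])
    show "Ck_on k UNIV \<rho>" using assms by (simp add: smooth_on_def)
    fix b :: 'a
    have "Ck_on k UNIV (\<lambda>y. (x \<bullet> b) + c * (y \<bullet> b))"
      by (intro Ck_on_add Ck_on_mult Ck_on_const Ck_on_inner_const) auto
    then show "Ck_on k UNIV (\<lambda>y. (x + c *\<^sub>R y) \<bullet> b)" by (simp add: inner_add_left)
  qed auto
qed

lemma partial_deriv_affine_map:
  fixes \<rho> :: "'a::euclidean_space \<Rightarrow> real"
  assumes "smooth_on UNIV \<rho>" "b \<in> Basis"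
  shows "partial_deriv b (\<lambda>y. \<rho> (x + c *\<^sub>R y)) = (\<lambda>y. c * partial_deriv b \<rho> (x + c *\<^sub>R y))"
proof
  fix y
  have "((\<lambda>y. \<rho> (x + c *\<^sub>R y)) has_derivative (\<lambda>h. \<Sum>b\<in>Basis. ((c *\<^sub>R h) \<bullet> b) * partial_deriv b \<rho> (x + c *\<^sub>R y))) (at y)"
    by (rule has_derivative_compose[OF _ smooth_on_has_derivative[OF assms(1)]])
       (auto intro!: derivative_eq_intros)
  then have "partial_deriv b (\<lambda>y. \<rho> (x + c *\<^sub>R y)) y = (\<Sum>i\<in>Basis. ((c *\<^sub>R b) \<bullet> i) * partial_deriv i \<rho> (x + c *\<^sub>R y))"
    by (rule partial_deriv_eqI)
  also have "\<dots> = c * (\<Sum>i\<in>Basis. (b \<bullet> i) * partial_deriv i \<rho> (x + c *\<^sub>R y))"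
    by (simp add: sum_distrib_left mult.assoc)
  finally show "partial_deriv b (\<lambda>y. \<rho> (x + c *\<^sub>R y)) y = c * partial_deriv b \<rho> (x + c *\<^sub>R y)"
    using sum_Basis_inner[OF assms(2)] by metis
qed

lemma test_affine_map:
  fixes \<rho> :: "'a::euclidean_space \<Rightarrow> real"
  assumes "\<rho> \<in> test_functions U" "c = 1 \<or> c = -1" "\<And>u. u \<in> U \<Longrightarrow> c *\<^sub>R (u - x) \<in> V"
  shows "(\<lambda>y. \<rho> (x + c *\<^sub>R y)) \<in> test_functions V"
proof -
  let ?K = "closure {x. \<rho> x \<noteq> 0}"
  have cc: "c * c = 1" using assms(2) by auto
  have K: "compact ((\<lambda>u. c *\<^sub>R (u - x)) ` ?K)"
    by (intro compact_continuous_image test_functionsD(2)[OF assms(1)] continuous_intros)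
  have "{y. \<rho> (x + c *\<^sub>R y) \<noteq> 0} \<subseteq> (\<lambda>u. c *\<^sub>R (u - x)) ` ?K"
  proof
    fix y assume "y \<in> {y. \<rho> (x + c *\<^sub>R y) \<noteq> 0}"
    then have "x + c *\<^sub>R y \<in> ?K" using closure_subset[of "{x. \<rho> x \<noteq> 0}"] by auto
    moreover have "y = c *\<^sub>R ((x + c *\<^sub>R y) - x)" using cc by simp
    ultimately show "y \<in> (\<lambda>u. c *\<^sub>R (u - x)) ` ?K" by (metis image_eqI)
  qed
  then have sub: "closure {y. \<rho> (x + c *\<^sub>R y) \<noteq> 0} \<subseteq> (\<lambda>u. c *\<^sub>R (u - x)) ` ?K"
    using K by (intro closure_minimal compact_imp_closed)
  moreover have "compact (closure {y. \<rho> (x + c *\<^sub>R y) \<noteq> 0})"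
    using K sub by (metis closed_closure compact_Int_closed inf.absorb_iff2)
  moreover have "(\<lambda>u. c *\<^sub>R (u - x)) ` ?K \<subseteq> V" using test_functionsD(3)[OF assms(1)] assms(3) by blast
  ultimately show ?thesis
    using smooth_affine_map[OF test_functionsD(1)[OF assms(1)]] unfolding test_functions_def by blast
qed

text \<open>In a convolution the mollifier appears as a function of the integration variable with a minus sign; this form is
what weak identities on \<open>V\<close> are tested with.\<close>

lemma mollifier_reflect_test:
  fixes x :: "'a::euclidean_space"
  assumes "d > 0" "cball x d \<subseteq> V"
  shows "(\<lambda>y. mollifier d (x - y)) \<in> test_functions V"
proof -
  have "(\<lambda>y. mollifier d (x + (-1) *\<^sub>R y)) \<in> test_functions V"
    by (rule test_affine_map[OF mollifier_test[OF assms(1) order_refl]])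
       (use assms(2) in \<open>auto simp: subset_iff dist_norm\<close>)
  then show ?thesis by simp
qed

text \<open>Reflected mollifiers are test functions, so the mollifications of \<open>F\<close> vanish on each smaller ball, as soon as the
radius of the mollifier is less than the distance to the boundary. They also converge to \<open>F\<close> in $L^1$.\<close>

theorem fundamental_lemma_ball:
  fixes F :: "'a::euclidean_space \<Rightarrow> real"
  assumes F: "F \<in> borel_measurable borel" "\<And>s. s < R \<Longrightarrow> integrable lborel (\<lambda>x. indicator (cball x0 s) x * F x)"
    and 0: "\<And>\<phi>. \<phi> \<in> test_functions (ball x0 R) \<Longrightarrow> (LINT x|lborel. F x * \<phi> x) = 0"
  shows "AE x in lborel. x \<in> ball x0 R \<longrightarrow> F x = 0"
proof -
  have gauge: "gauge_fn abs" by (simp add: gauge_fn_def)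
  have step: "AE x in lborel. x \<in> ball x0 s \<longrightarrow> F x = 0" if s: "s < R" for s
  proof -
    define s' where "s' = (s + R) / 2"
    have s': "s < s'" "s' < R" using s by (auto simp: s'_def)
    define f where "f x = indicator (cball x0 s') x * F x" for x
    have fi: "integrable lborel f" using F(2)[OF s'(2)] unfolding f_def .
    have fi': "integrable lborel (\<lambda>x. indicator (ball x0 s) x * \<bar>f x\<bar>)"
      using integrable_mult_indicator[of "ball x0 s" lborel "\<lambda>x. \<bar>f x\<bar>"] fi by simp
    have lim: "(\<lambda>n. LINT x|lborel. \<bar>conv f (mollifier (1 / real (Suc n))) x - f x\<bar>) \<longlonglongrightarrow> 0"
      by (rule mollify_tendsto(2)[OF gauge fi]) (use fi in simp)
    have "\<forall>\<^sub>F n in sequentially. (LINT x|lborel. indicator (ball x0 s) x * \<bar>f x\<bar>) \<le> (LINT x|lborel. \<bar>conv f (mollifier (1 / real (Suc n))) x - f x\<bar>)"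
    proof -
      have "\<forall>\<^sub>F n in sequentially. 1 / real (Suc n) < s' - s"
        by (rule order_tendstoD(2)[OF LIMSEQ_Suc[OF lim_1_over_n]]) (use s' in simp)
      then show ?thesis
      proof eventually_elim
        fix n assume n: "1 / real (Suc n) < s' - s"
        define d where "d = 1 / real (Suc n)"
        have d: "d > 0" "d < s' - s" using n by (auto simp: d_def)
        have z: "conv f (mollifier d) x = 0" if x: "x \<in> ball x0 s" for x
        proof -
          have sub: "cball x d \<subseteq> cball x0 s'"
          proof
            fix y assume "y \<in> cball x d"
            then show "y \<in> cball x0 s'" using x d dist_triangle[of x0 y x] by simp
          qed
          have "conv f (mollifier d) x = (LINT y|lborel. F y * mollifier d (x - y))"
            unfolding conv_def
          proof (rule Bochner_Integration.integral_cong[OF refl])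
            fix y
            show "f y * mollifier d (x - y) = F y * mollifier d (x - y)"
            proof (cases "y \<in> cball x0 s'")
              case False
              then have "y \<notin> cball x d" using sub by blast
              then have "mollifier d (x - y) = 0" using mollifier_eq_0_iff[OF d(1), of "x - y"] by (simp add: dist_norm)
              then show ?thesis by simp
            qed (simp add: f_def)
          qed
          also have "\<dots> = 0"
          proof (rule 0, rule mollifier_reflect_test[OF d(1)])
            show "cball x d \<subseteq> ball x0 R" using sub s'(2) by (force)
          qed
          finally show ?thesis .
        qed
        have "(LINT x|lborel. indicator (ball x0 s) x * \<bar>f x\<bar>) \<le> (LINT x|lborel. \<bar>conv f (mollifier d) x - f x\<bar>)"
        proof (rule integral_mono[OF fi'])
          show "integrable lborel (\<lambda>x. \<bar>conv f (mollifier d) x - f x\<bar>)"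
            by (rule mollify_tendsto(1)[OF gauge fi _ d(1)]) (use fi in simp)
          show "indicator (ball x0 s) x * \<bar>f x\<bar> \<le> \<bar>conv f (mollifier d) x - f x\<bar>" for x
            using z[of x] by (auto simp: indicator_def)
        qed
        then show "(LINT x|lborel. indicator (ball x0 s) x * \<bar>f x\<bar>) \<le> (LINT x|lborel. \<bar>conv f (mollifier (1 / real (Suc n))) x - f x\<bar>)"
          by (simp add: d_def)
      qed
    qed
    then have "(LINT x|lborel. indicator (ball x0 s) x * \<bar>f x\<bar>) \<le> 0"
      by (rule tendsto_lowerbound[OF lim _ sequentially_bot])
    moreover have "(LINT x|lborel. indicator (ball x0 s) x * \<bar>f x\<bar>) \<ge> 0"
      by (intro integral_nonneg_AE) simp
    ultimately have "(LINT x|lborel. indicator (ball x0 s) x * \<bar>f x\<bar>) = 0" by simp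
    then have "AE x in lborel. indicator (ball x0 s) x * \<bar>f x\<bar> = 0"
      using integral_nonneg_eq_0_iff_AE[OF fi'] by simp
    then show ?thesis
    proof eventually_elim
      fix x assume x: "indicator (ball x0 s) x * \<bar>f x\<bar> = 0"
      show "x \<in> ball x0 s \<longrightarrow> F x = 0"
      proof
        assume xs: "x \<in> ball x0 s"
        then have "x \<in> cball x0 s'" using s' by simp
        then show "F x = 0" using x xs by (simp add: f_def)
      qed
    qed
  qed
  have "AE x in lborel. \<forall>n. x \<in> ball x0 (R - 1 / real (Suc n)) \<longrightarrow> F x = 0"
    unfolding AE_all_countable using step by simp
  then show ?thesis
  proof eventually_elim
    fix x assume x: "\<forall>n. x \<in> ball x0 (R - 1 / real (Suc n)) \<longrightarrow> F x = 0"
    show "x \<in> ball x0 R \<longrightarrow> F x = 0"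
    proof
      assume "x \<in> ball x0 R"
      then obtain n where "inverse (real (Suc n)) < R - dist x0 x"
        using reals_Archimedean[of "R - dist x0 x"] by auto
      then have "x \<in> ball x0 (R - 1 / real (Suc n))" by (simp add: inverse_eq_divide algebra_simps)
      then show "F x = 0" using x by blast
    qed
  qed
qed

section \<open>Polar coordinates\<close>

abbreviation sphere_borel :: "'a::euclidean_space measure" where
  "sphere_borel \<equiv> restrict_space borel (sphere 0 1)"

lemma space_sphere_measure: "space (sphere_measure :: 'a::euclidean_space measure) = sphere 0 1"
  by (simp add: sphere_measure_def space_scale_measure space_restrict_space)

lemma sets_sphere_measure [measurable_cong]:
  "sets (sphere_measure :: 'a::euclidean_space measure) = sets sphere_borel"
  by (simp add: sphere_measure_def)

lemma normalize_measurable: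
  "(\<lambda>x::'a::euclidean_space. x /\<^sub>R norm x) \<in> measurable (restrict_space lborel (ball 0 1 - {0})) sphere_borel"
  by (intro measurable_restrict_space2 measurable_restrict_space1) (auto simp: space_restrict_space)

lemma emeasure_sphere_measure:
  assumes "B \<in> sets (sphere_borel :: 'a::euclidean_space measure)"
  shows "emeasure sphere_measure B = of_nat DIM('a) * emeasure lborel {x::'a. x \<noteq> 0 \<and> norm x < 1 \<and> x /\<^sub>R norm x \<in> B}"
proof -
  have "(\<lambda>x. x /\<^sub>R norm x) -` B \<inter> space (restrict_space lborel (ball (0::'a) 1 - {0}))
      = {x::'a. x \<noteq> 0 \<and> norm x < 1 \<and> x /\<^sub>R norm x \<in> B}"
    by (auto simp: space_restrict_space)
  then show ?thesis using assms
    by (simp add: sphere_measure_def emeasure_distr[OF normalize_measurable] emeasure_restrict_space subset_iff)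
qed

lemma emeasure_sphere_measure_space:
  "emeasure sphere_measure (space (sphere_measure :: 'a::euclidean_space measure)) < \<infinity>"
proof -
  have "emeasure lborel {x::'a. x \<noteq> 0 \<and> norm x < 1 \<and> x /\<^sub>R norm x \<in> sphere 0 1} \<le> emeasure lborel (ball (0::'a) 1)"
    by (rule emeasure_mono) auto
  also have "\<dots> < \<infinity>" by (rule emeasure_bounded_finite[OF bounded_ball])
  finally have "emeasure lborel {x::'a. x \<noteq> 0 \<and> norm x < 1 \<and> x /\<^sub>R norm x \<in> sphere 0 1} < \<infinity>" .
  moreover have "sphere 0 1 \<in> sets (sphere_borel :: 'a measure)"
    by (metis sets.top space_restrict_space2 space_restrict_space inf_top_right space_borel)
  ultimately show ?thesis
    unfolding space_sphere_measure by (subst emeasure_sphere_measure) (auto simp: ennreal_mult_less_top of_nat_less_top)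
qed

lemma finite_sphere_measure: "finite_measure (sphere_measure :: 'a::euclidean_space measure)"
  using emeasure_sphere_measure_space[where 'a='a] by (intro finite_measureI) simp

lemma sigma_finite_sphere_measure: "sigma_finite_measure (sphere_measure :: 'a::euclidean_space measure)"
  using finite_sphere_measure by (rule finite_measure.axioms(1))

text \<open>The measure $r^n dr$ on the positive half-line: the radial factor of Lebesgue measure in dimension \<open>n + 1\<close>.\<close>

definition radial_measure :: "nat \<Rightarrow> real measure" where
  "radial_measure n = density lborel (\<lambda>r. ennreal (r ^ n * indicator {0<..} r))"

lemma sets_radial_measure [measurable_cong, simp]: "sets (radial_measure n) = sets borel"
  by (simp add: radial_measure_def)

lemma space_radial_measure [simp]: "space (radial_measure n) = UNIV"
  by (simp add: radial_measure_def)

lemma sigma_finite_radial: "sigma_finite_measure (radial_measure n)"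
  unfolding radial_measure_def by (subst sigma_finite_measure.sigma_finite_iff_density_finite[OF lborel.sigma_finite_measure_axioms]) auto

lemma emeasure_radial_lessThan:
  assumes "n > 0"
  shows "emeasure (radial_measure (n - 1)) {..<r} = ennreal (max 0 r ^ n / real n)"
proof (cases "r > 0")
  case True
  have "emeasure (radial_measure (n - 1)) {..<r}
      = (\<integral>\<^sup>+ s. ennreal (s ^ (n - 1) * indicator {0<..} s) * indicator {..<r} s \<partial>lborel)"
    unfolding radial_measure_def by (rule emeasure_density) auto
  also have "\<dots> = (\<integral>\<^sup>+ s. ennreal (s ^ (n - 1)) * indicator {0..r} s \<partial>lborel)"
  proof (rule nn_integral_cong_AE)
    have "AE s in lborel. s \<noteq> 0 \<and> s \<noteq> r"
      using AE_lborel_singleton[of 0] AE_lborel_singleton[of r] by eventually_elim simp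
    then show "AE s in lborel. ennreal (s ^ (n - 1) * indicator {0<..} s) * indicator {..<r} s = ennreal (s ^ (n - 1)) * indicator {0..r} s"
      by eventually_elim (auto simp: indicator_def)
  qed
  also have "\<dots> = ennreal (r ^ n / real n - 0 ^ n / real n)"
  proof (rule nn_integral_FTC_Icc)
    fix s :: real assume "s \<in> {0..r}"
    then show "DERIV (\<lambda>s. s ^ n / real n) s :> s ^ (n - 1)" "0 \<le> s ^ (n - 1)"
      using assms by (auto intro!: derivative_eq_intros)
  qed (use True in auto)
  finally show ?thesis using True assms by (simp add: zero_power)
next
  case False
  have "emeasure (radial_measure (n - 1)) {..<r}
      = (\<integral>\<^sup>+ s. ennreal (s ^ (n - 1) * indicator {0<..} s) * indicator {..<r} s \<partial>lborel)"
    unfolding radial_measure_def by (rule emeasure_density) auto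
  also have "\<dots> = (\<integral>\<^sup>+ (s::real). 0 \<partial>lborel)"
    by (rule nn_integral_cong) (use False in \<open>auto simp: indicator_def\<close>)
  finally show ?thesis using False assms by (simp add: max_def)
qed

lemma emeasure_lborel_scale:
  fixes C :: "'a::euclidean_space set"
  assumes [measurable]: "C \<in> sets borel" and r: "r > 0"
  shows "emeasure lborel C = ennreal (r ^ DIM('a)) * emeasure lborel {x. r *\<^sub>R x \<in> C}"
proof -
  have "emeasure lborel C = emeasure (density (distr lborel borel (\<lambda>x::'a. 0 + r *\<^sub>R x)) (\<lambda>_. ennreal (\<bar>r\<bar> ^ DIM('a)))) C"
    using lborel_affine[of r "0::'a"] r by simp
  also have "\<dots> = ennreal (r ^ DIM('a)) * emeasure (distr lborel borel (\<lambda>x::'a. 0 + r *\<^sub>R x)) C"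
    using r by (subst emeasure_density) (auto simp: nn_integral_cmult)
  also have "emeasure (distr lborel borel (\<lambda>x::'a. 0 + r *\<^sub>R x)) C = emeasure lborel {x. r *\<^sub>R x \<in> C}"
    by (subst emeasure_distr) (auto intro!: arg_cong2[where f=emeasure])
  finally show ?thesis .
qed

abbreviation polar_map :: "'a::euclidean_space \<Rightarrow> real \<times> 'a" where
  "polar_map x \<equiv> (norm x, x /\<^sub>R norm x)"

lemma normalize_measurable':
  "(\<lambda>x::'a::euclidean_space. x /\<^sub>R norm x) \<in> measurable (restrict_space lborel (- {0})) sphere_borel"
  by (intro measurable_restrict_space2 measurable_restrict_space1) (auto simp: space_restrict_space)

lemma cone_measurable:
  assumes "B \<in> sets (sphere_borel :: 'a::euclidean_space measure)"
  shows "{x::'a. x \<noteq> 0 \<and> x /\<^sub>R norm x \<in> B} \<in> sets borel"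
proof -
  have "(\<lambda>x. x /\<^sub>R norm x) -` B \<inter> space (restrict_space lborel (- {0::'a})) \<in> sets (restrict_space lborel (- {0}))"
    by (rule measurable_sets[OF normalize_measurable' assms])
  then have "(\<lambda>x. x /\<^sub>R norm x) -` B \<inter> (- {0::'a}) \<in> sets (restrict_space lborel (- {0}))"
    by (simp add: space_restrict_space)
  then have "(\<lambda>x. x /\<^sub>R norm x) -` B \<inter> (- {0::'a}) \<in> sets borel"
    by (subst (asm) sets_restrict_space_iff) auto
  also have "(\<lambda>x. x /\<^sub>R norm x) -` B \<inter> (- {0::'a}) = {x::'a. x \<noteq> 0 \<and> x /\<^sub>R norm x \<in> B}" by auto
  finally show ?thesis .
qed

text \<open>The case $A = (-\infty, r)$ is the scaling of Lebesgue measure together with the definition of the surface measure as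
a cone measure. As functions of \<open>A\<close> both sides are measures, and the half-lines generate the Borel sets.\<close>

lemma emeasure_cone:
  assumes B: "B \<in> sets (sphere_borel :: 'a::euclidean_space measure)" and A: "A \<in> sets borel"
  shows "emeasure lborel {x::'a. x \<noteq> 0 \<and> x /\<^sub>R norm x \<in> B \<and> norm x \<in> A}
    = emeasure (radial_measure (DIM('a) - 1)) A * emeasure sphere_measure B"
proof -
  let ?C = "{x::'a. x \<noteq> 0 \<and> x /\<^sub>R norm x \<in> B}"
  note [measurable] = cone_measurable[OF B]
  \<comment> \<open>\<open>M\<close> and \<open>N\<close> are the two sides as measures in \<open>A\<close>.\<close>
  define M where "M = distr (restrict_space lborel ?C) borel norm"
  define N where "N = scale_measure (emeasure sphere_measure B) (radial_measure (DIM('a) - 1))"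
  have sfin: "emeasure (sphere_measure :: 'a measure) B < \<infinity>"
    using finite_measure.emeasure_finite[OF finite_sphere_measure, of B] by (simp add: top.not_eq_extremum)
  have M: "emeasure M X = emeasure lborel {x::'a. x \<noteq> 0 \<and> x /\<^sub>R norm x \<in> B \<and> norm x \<in> X}"
    if "X \<in> sets borel" for X
    unfolding M_def using that
    by (subst emeasure_distr; (subst emeasure_restrict_space)?)
       (auto simp: space_restrict_space intro!: measurable_restrict_space1 arg_cong2[where f=emeasure])
  have "M = N"
  proof (rule measure_eqI_generator_eq[where E="range lessThan" and \<Omega>=UNIV and A="\<lambda>n. {..<real n}"])
    show "Int_stable (range lessThan :: real set set)"
    proof (rule Int_stableI)
      fix X Y :: "real set" assume "X \<in> range lessThan" "Y \<in> range lessThan"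
      then obtain a b where "X = {..<a}" "Y = {..<b}" by auto
      then have "X \<inter> Y = {..<min a b}" by auto
      then show "X \<inter> Y \<in> range lessThan" by blast
    qed
    show "sets M = sigma_sets UNIV (range lessThan)" "sets N = sigma_sets UNIV (range lessThan)"
      by (simp_all add: M_def N_def borel_Iio)
    show "(\<Union>i. {..<real i}) = UNIV" using reals_Archimedean2 by auto
    fix X :: "real set" assume "X \<in> range lessThan"
    then obtain r where X: "X = {..<r}" by auto
    show "emeasure M X = emeasure N X"
    proof (cases "r > 0")
      case True
      have "emeasure M X = emeasure lborel {x::'a. x \<noteq> 0 \<and> x /\<^sub>R norm x \<in> B \<and> norm x < r}"
        by (subst M) (auto simp: X)
      also have "\<dots> = ennreal (r ^ DIM('a)) * emeasure lborel {x::'a. r *\<^sub>R x \<in> {x. x \<noteq> 0 \<and> x /\<^sub>R norm x \<in> B \<and> norm x < r}}"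
      proof (rule emeasure_lborel_scale[OF _ True])
        have "?C \<inter> {x. norm x < r} \<in> sets borel" by measurable
        also have "?C \<inter> {x. norm x < r} = {x::'a. x \<noteq> 0 \<and> x /\<^sub>R norm x \<in> B \<and> norm x < r}" by auto
        finally show "{x::'a. x \<noteq> 0 \<and> x /\<^sub>R norm x \<in> B \<and> norm x < r} \<in> sets borel" .
      qed
      also have "{x::'a. r *\<^sub>R x \<in> {x. x \<noteq> 0 \<and> x /\<^sub>R norm x \<in> B \<and> norm x < r}}
          = {x::'a. x \<noteq> 0 \<and> norm x < 1 \<and> x /\<^sub>R norm x \<in> B}"
      proof -
        have e: "(r *\<^sub>R x) /\<^sub>R norm (r *\<^sub>R x) = x /\<^sub>R norm x" for x :: 'a
          using True by (simp add: field_simps)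
        have n: "norm (r *\<^sub>R x) < r \<longleftrightarrow> norm x < 1" for x :: 'a using True by simp
        have z: "r *\<^sub>R x \<noteq> 0 \<longleftrightarrow> x \<noteq> 0" for x :: 'a using True by simp
        show ?thesis unfolding mem_Collect_eq e n z by blast
      qed
      finally have "emeasure M X = ennreal (r ^ DIM('a)) * emeasure lborel {x::'a. x \<noteq> 0 \<and> norm x < 1 \<and> x /\<^sub>R norm x \<in> B}" .
      moreover have "emeasure N X = ennreal (r ^ DIM('a) / real DIM('a)) * (of_nat DIM('a) * emeasure lborel {x::'a. x \<noteq> 0 \<and> norm x < 1 \<and> x /\<^sub>R norm x \<in> B})"
        using True by (simp add: N_def X emeasure_radial_lessThan[OF DIM_positive[where 'a='a], simplified] emeasure_sphere_measure[OF B] mult.commute)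
      moreover have "ennreal (r ^ DIM('a) / real DIM('a)) * of_nat DIM('a) = ennreal (r ^ DIM('a))"
        using True by (simp add: ennreal_of_nat_eq_real_of_nat ennreal_mult[symmetric])
      ultimately show ?thesis by (simp add: mult.assoc[symmetric])
    next
      case False
      then have "emeasure M X = 0"
        by (subst M) (auto simp: X intro!: emeasure_empty arg_cong[where f="emeasure lborel" and y="{}", THEN trans] dest: order_le_less_trans[OF norm_ge_zero])
      moreover have "emeasure N X = 0"
        using False by (simp add: N_def X emeasure_radial_lessThan[OF DIM_positive[where 'a='a], simplified] max_def)
      ultimately show ?thesis by simp
    qed
  next
    fix i
    have "{x::'a. x \<noteq> 0 \<and> x /\<^sub>R norm x \<in> B \<and> norm x \<in> {..<real i}} \<subseteq> ball 0 (real i)" by auto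
    then have "emeasure lborel {x::'a. x \<noteq> 0 \<and> x /\<^sub>R norm x \<in> B \<and> norm x \<in> {..<real i}} \<le> emeasure lborel (ball (0::'a) (real i))"
      by (rule emeasure_mono) simp
    also have "\<dots> < \<infinity>" by (rule emeasure_bounded_finite[OF bounded_ball])
    finally show "emeasure M {..<real i} \<noteq> \<infinity>" by (subst M) auto
  qed auto
  then have "emeasure M A = emeasure N A" by simp
  then show ?thesis using M[OF A] by (simp add: N_def mult.commute)
qed

lemma polar_map_measurable:
  "(polar_map :: 'a::euclidean_space \<Rightarrow> _) \<in> measurable (restrict_space lborel (- {0})) (radial_measure n \<Otimes>\<^sub>M sphere_measure)"
proof (rule measurable_Pair)
  show "norm \<in> measurable (restrict_space lborel (- {0::'a})) (radial_measure n)"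
    using measurable_restrict_space1[of norm lborel "radial_measure n" "- {0::'a}"] by simp
  show "(\<lambda>x::'a. x /\<^sub>R norm x) \<in> measurable (restrict_space lborel (- {0})) sphere_measure"
    using normalize_measurable' measurable_cong_sets[OF refl sets_sphere_measure] by blast
qed

text \<open>A product measure is determined by its values on rectangles, and those are computed in \<open>emeasure_cone\<close>.\<close>

theorem polar_distr:
  "radial_measure (DIM('a) - 1) \<Otimes>\<^sub>M sphere_measure
    = distr (restrict_space lborel (- {0::'a::euclidean_space})) (radial_measure (DIM('a) - 1) \<Otimes>\<^sub>M sphere_measure) polar_map"
proof (rule pair_measure_eqI[OF sigma_finite_radial sigma_finite_sphere_measure])
  fix A B assume A: "A \<in> sets (radial_measure (DIM('a) - 1))" and B: "B \<in> sets (sphere_measure :: 'a measure)"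
  have AB: "A \<times> B \<in> sets (radial_measure (DIM('a) - 1) \<Otimes>\<^sub>M sphere_measure)"
    using A B by (rule pair_measureI)
  have "emeasure (distr (restrict_space lborel (- {0::'a})) (radial_measure (DIM('a) - 1) \<Otimes>\<^sub>M sphere_measure) polar_map) (A \<times> B)
      = emeasure (restrict_space lborel (- {0::'a})) (polar_map -` (A \<times> B) \<inter> space (restrict_space lborel (- {0})))"
    by (rule emeasure_distr[OF polar_map_measurable AB])
  also have "polar_map -` (A \<times> B) \<inter> space (restrict_space lborel (- {0})) = {x::'a. x \<noteq> 0 \<and> x /\<^sub>R norm x \<in> B \<and> norm x \<in> A}"
    by (auto simp: space_restrict_space)
  also have "emeasure (restrict_space lborel (- {0::'a})) \<dots> = emeasure lborel \<dots>"
    by (rule emeasure_restrict_space) auto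
  also have "\<dots> = emeasure (radial_measure (DIM('a) - 1)) A * emeasure sphere_measure B"
    using A B by (intro emeasure_cone) (auto simp: sets_sphere_measure)
  finally show "emeasure (radial_measure (DIM('a) - 1)) A * emeasure sphere_measure B
    = emeasure (distr (restrict_space lborel (- {0::'a})) (radial_measure (DIM('a) - 1) \<Otimes>\<^sub>M sphere_measure) polar_map) (A \<times> B)" ..
qed simp

lemma polar_comp_measurable:
  assumes [measurable]: "f \<in> borel_measurable (borel :: 'a::euclidean_space measure)"
  shows "(\<lambda>(r, \<theta>). f (r *\<^sub>R \<theta>)) \<in> borel_measurable (radial_measure n \<Otimes>\<^sub>M (sphere_measure :: 'a measure))"
proof -
  have "(\<lambda>\<theta>::'a. \<theta>) \<in> measurable sphere_borel borel" by (rule measurable_restrict_space1) simp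
  then have [measurable]: "(\<lambda>\<theta>::'a. \<theta>) \<in> measurable sphere_measure borel"
    using measurable_cong_sets[OF sets_sphere_measure refl] by blast
  have "(\<lambda>z. fst z *\<^sub>R (snd z :: 'a)) \<in> measurable (radial_measure n \<Otimes>\<^sub>M sphere_measure) borel"
    by (intro borel_measurable_scaleR measurable_fst'' measurable_snd'') (auto intro: measurable_compose[OF measurable_snd])
  from measurable_compose[OF this assms] show ?thesis by (simp add: case_prod_beta')
qed

lemma sphere_comp_measurable [measurable (raw)]:
  assumes "f \<in> borel_measurable (borel :: 'a::euclidean_space measure)"
  shows "(\<lambda>\<theta>. f (r *\<^sub>R \<theta>)) \<in> borel_measurable (sphere_measure :: 'a measure)"
proof -
  have "(\<lambda>\<theta>::'a. f (r *\<^sub>R \<theta>)) \<in> measurable sphere_borel borel"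
    using assms by (intro measurable_restrict_space1) simp
  then show ?thesis using measurable_cong_sets[OF sets_sphere_measure refl] by blast
qed

theorem polar_nn_integral:
  fixes f :: "'a::euclidean_space \<Rightarrow> ennreal"
  assumes f [measurable]: "f \<in> borel_measurable borel"
  shows "(\<integral>\<^sup>+ x. f x \<partial>lborel)
    = (\<integral>\<^sup>+ r. ennreal (r ^ (DIM('a) - 1) * indicator {0<..} r) * (\<integral>\<^sup>+ \<theta>. f (r *\<^sub>R \<theta>) \<partial>sphere_measure) \<partial>lborel)"
proof -
  interpret s: sigma_finite_measure "sphere_measure :: 'a measure" by (rule sigma_finite_sphere_measure)
  have "(\<integral>\<^sup>+ x. f x \<partial>lborel) = (\<integral>\<^sup>+ x. f x * indicator (- {0}) x \<partial>lborel)"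
    by (rule nn_integral_cong_AE) (use AE_lborel_singleton[of "0::'a"] in eventually_elim, simp)
  also have "\<dots> = (\<integral>\<^sup>+ x. f x \<partial>restrict_space lborel (- {0}))"
    by (rule nn_integral_restrict_space[symmetric]) simp
  also have "\<dots> = (\<integral>\<^sup>+ x. (\<lambda>(r, \<theta>). f (r *\<^sub>R \<theta>)) (polar_map x) \<partial>restrict_space lborel (- {0}))"
    by (rule nn_integral_cong) (auto simp: space_restrict_space)
  also have "\<dots> = (\<integral>\<^sup>+ z. (\<lambda>(r, \<theta>). f (r *\<^sub>R \<theta>)) z \<partial>(radial_measure (DIM('a) - 1) \<Otimes>\<^sub>M sphere_measure))"
    by (subst polar_distr, rule nn_integral_distr[symmetric, OF polar_map_measurable])
       (simp add: polar_comp_measurable[OF f])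
  also have "\<dots> = (\<integral>\<^sup>+ r. \<integral>\<^sup>+ \<theta>. f (r *\<^sub>R \<theta>) \<partial>sphere_measure \<partial>radial_measure (DIM('a) - 1))"
    using s.nn_integral_fst[OF polar_comp_measurable[OF f]] by simp
  also have "\<dots> = (\<integral>\<^sup>+ r. ennreal (r ^ (DIM('a) - 1) * indicator {0<..} r) * (\<integral>\<^sup>+ \<theta>. f (r *\<^sub>R \<theta>) \<partial>sphere_measure) \<partial>lborel)"
    unfolding radial_measure_def
  proof (rule nn_integral_density)
    have "(\<lambda>r. \<integral>\<^sup>+ \<theta>. f (r *\<^sub>R \<theta>) \<partial>sphere_measure) \<in> borel_measurable (radial_measure 0)"
      using s.borel_measurable_nn_integral_fst[OF polar_comp_measurable[OF f]] by simp
    then show "(\<lambda>r. \<integral>\<^sup>+ \<theta>. f (r *\<^sub>R \<theta>) \<partial>sphere_measure) \<in> borel_measurable lborel"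
      using measurable_cong_sets[OF sets_radial_measure refl] by auto
  qed measurable
  finally show ?thesis .
qed

lemma sphere_integral_measurable:
  fixes f :: "'a::euclidean_space \<Rightarrow> real"
  assumes f: "f \<in> borel_measurable borel"
  shows "(\<lambda>r. LINT \<theta>|sphere_measure. f (r *\<^sub>R \<theta>)) \<in> borel_measurable borel"
proof -
  interpret s: sigma_finite_measure "sphere_measure :: 'a measure" by (rule sigma_finite_sphere_measure)
  have "(\<lambda>r. LINT \<theta>|sphere_measure. f (r *\<^sub>R \<theta>)) \<in> borel_measurable (radial_measure 0)"
    by (rule s.borel_measurable_lebesgue_integral) (rule polar_comp_measurable[OF f])
  then show ?thesis using measurable_cong_sets[OF sets_radial_measure refl] by auto
qed

theorem polar_integral:
  fixes f :: "'a::euclidean_space \<Rightarrow> real"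
  assumes f: "integrable lborel f"
  shows "integrable lborel (\<lambda>r. r ^ (DIM('a) - 1) * indicator {0<..} r * (LINT \<theta>|sphere_measure. f (r *\<^sub>R \<theta>)))"
    "(LINT x|lborel. f x) = (LINT r|lborel. r ^ (DIM('a) - 1) * indicator {0<..} r * (LINT \<theta>|sphere_measure. f (r *\<^sub>R \<theta>)))"
    "AE r in lborel. r > 0 \<longrightarrow> integrable sphere_measure (\<lambda>\<theta>. f (r *\<^sub>R \<theta>))"
proof -
  have fm [measurable]: "f \<in> borel_measurable borel" using f by simp
  note pm = polar_comp_measurable[OF fm, of "DIM('a) - 1"]
  interpret p: pair_sigma_finite "radial_measure (DIM('a) - 1)" "sphere_measure :: 'a measure"
    by (rule pair_sigma_finite.intro[OF sigma_finite_radial sigma_finite_sphere_measure])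
  let ?R = "restrict_space lborel (- {0::'a})"
  let ?P = "radial_measure (DIM('a) - 1) \<Otimes>\<^sub>M (sphere_measure :: 'a measure)"
  let ?g = "\<lambda>(r, \<theta>). f (r *\<^sub>R \<theta>)"
  let ?d = "\<lambda>r::real. r ^ (DIM('a) - 1) * indicator {0<..} r"
  have iR: "integrable ?R f" using f
    by (subst integrable_restrict_space) (auto intro: integrable_mult_indicator[where 'b=real, simplified])
  have iR': "integrable ?R (\<lambda>x. ?g (polar_map x))"
    by (rule Bochner_Integration.integrable_cong[THEN iffD1, OF refl _ iR]) (auto simp: space_restrict_space)
  have iP: "integrable ?P ?g"
    by (subst polar_distr, subst integrable_distr_eq[OF polar_map_measurable pm]) (rule iR')
  have eq: "(LINT x|lborel. f x) = integral\<^sup>L ?P ?g"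
  proof -
    have "(LINT x|lborel. f x) = (LINT x|lborel. indicator (- {0}) x *\<^sub>R f x)"
    proof (rule integral_cong_AE)
      show "AE x in lborel. f x = indicator (- {0}) x *\<^sub>R f x"
        using AE_lborel_singleton[of "0::'a"] by eventually_elim simp
    qed measurable
    also have "\<dots> = (LINT x|?R. f x)" by (rule integral_restrict_space[symmetric]) simp
    also have "\<dots> = (LINT x|?R. ?g (polar_map x))"
      by (rule Bochner_Integration.integral_cong) (auto simp: space_restrict_space)
    also have "\<dots> = integral\<^sup>L (distr ?R ?P polar_map) ?g"
      by (rule integral_distr[symmetric, OF polar_map_measurable pm])
    finally show ?thesis by (simp only: polar_distr[symmetric])
  qed
  have fst: "integrable (radial_measure (DIM('a) - 1)) (\<lambda>r. LINT \<theta>|sphere_measure. f (r *\<^sub>R \<theta>))"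
    using p.integrable_fst'[OF iP] by simp
  then show "integrable lborel (\<lambda>r. ?d r * (LINT \<theta>|sphere_measure. f (r *\<^sub>R \<theta>)))"
    unfolding radial_measure_def using sphere_integral_measurable[OF fm]
    by (subst (asm) integrable_density) (auto simp: indicator_def)
  have "integral\<^sup>L ?P ?g = (LINT r|radial_measure (DIM('a) - 1). LINT \<theta>|sphere_measure. f (r *\<^sub>R \<theta>))"
    using p.integral_fst'[OF iP] by simp
  also have "\<dots> = (LINT r|lborel. ?d r * (LINT \<theta>|sphere_measure. f (r *\<^sub>R \<theta>)))"
    unfolding radial_measure_def using sphere_integral_measurable[OF fm]
    by (subst integral_density) (auto simp: indicator_def)
  finally show "(LINT x|lborel. f x) = (LINT r|lborel. ?d r * (LINT \<theta>|sphere_measure. f (r *\<^sub>R \<theta>)))"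
    using eq by simp
  have "AE r in radial_measure (DIM('a) - 1). integrable sphere_measure (\<lambda>\<theta>. f (r *\<^sub>R \<theta>))"
    using p.AE_integrable_fst'[OF iP] by simp
  then show "AE r in lborel. r > 0 \<longrightarrow> integrable sphere_measure (\<lambda>\<theta>. f (r *\<^sub>R \<theta>))"
    unfolding radial_measure_def
    by (subst (asm) AE_density) (auto elim!: eventually_mono simp: indicator_def)
qed

text \<open>Polar integration of the indicator of a null set.\<close>

theorem polar_AE:
  fixes P :: "'a::euclidean_space \<Rightarrow> bool"
  assumes "AE x in lborel. P x"
  shows "AE r in lborel. r > 0 \<longrightarrow> (AE \<theta> in sphere_measure. P (r *\<^sub>R \<theta>))"
proof -
  interpret s: sigma_finite_measure "sphere_measure :: 'a measure" by (rule sigma_finite_sphere_measure)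
  obtain N where N: "{x. \<not> P x} \<subseteq> N" "N \<in> sets borel" "emeasure lborel N = 0"
    using AE_E[OF assms] by auto
  have [measurable]: "(indicator N :: 'a \<Rightarrow> ennreal) \<in> borel_measurable borel" using N(2) by simp
  have m: "(\<lambda>r. \<integral>\<^sup>+ \<theta>. indicator N (r *\<^sub>R \<theta> :: 'a) \<partial>sphere_measure) \<in> borel_measurable (lborel::real measure)"
    using s.borel_measurable_nn_integral_fst[OF polar_comp_measurable[of "indicator N :: 'a \<Rightarrow> ennreal" 0]]
      measurable_cong_sets[OF sets_radial_measure refl] N(2) by auto
  have "(\<integral>\<^sup>+ r. ennreal (r ^ (DIM('a) - 1) * indicator {0<..} r) * (\<integral>\<^sup>+ \<theta>. indicator N (r *\<^sub>R \<theta>) \<partial>(sphere_measure :: 'a measure)) \<partial>lborel) = 0"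
    using polar_nn_integral[of "indicator N :: 'a \<Rightarrow> ennreal"] N(2,3) by (simp add: nn_integral_indicator)
  then have "AE r in lborel. ennreal (r ^ (DIM('a) - 1) * indicator {0<..} r) * (\<integral>\<^sup>+ \<theta>. indicator N (r *\<^sub>R \<theta>) \<partial>(sphere_measure :: 'a measure)) = 0"
    using m by (subst (asm) nn_integral_0_iff_AE) auto
  then show ?thesis
  proof eventually_elim
    fix r :: real assume r: "ennreal (r ^ (DIM('a) - 1) * indicator {0<..} r) * (\<integral>\<^sup>+ \<theta>. indicator N (r *\<^sub>R \<theta>) \<partial>(sphere_measure :: 'a measure)) = 0"
    show "r > 0 \<longrightarrow> (AE \<theta> in sphere_measure. P (r *\<^sub>R \<theta>))"
    proof
      assume "r > 0"
      then have "(\<integral>\<^sup>+ \<theta>. indicator N (r *\<^sub>R \<theta>) \<partial>(sphere_measure :: 'a measure)) = 0" using r by auto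
      moreover have "(\<lambda>\<theta>. indicator N (r *\<^sub>R \<theta>) :: ennreal) \<in> borel_measurable (sphere_measure :: 'a measure)"
        by (rule sphere_comp_measurable) simp
      ultimately have "AE \<theta> in sphere_measure. (indicator N (r *\<^sub>R \<theta> :: 'a) :: ennreal) = 0"
        using nn_integral_0_iff_AE by blast
      then show "AE \<theta> in sphere_measure. P (r *\<^sub>R \<theta>)"
        by eventually_elim (use N(1) in \<open>auto simp: indicator_def split: if_splits\<close>)
    qed
  qed
qed

section \<open>Integration by parts\<close>

lemma compact_closure_subset:
  fixes K :: "'a::euclidean_space set"
  shows "compact K \<Longrightarrow> closure A \<subseteq> K \<Longrightarrow> compact (closure A)"
  unfolding compact_eq_bounded_closed using bounded_subset closed_closure by blast

lemma smooth_on_mult: "smooth_on U f \<Longrightarrow> smooth_on U g \<Longrightarrow> open U \<Longrightarrow> smooth_on U (\<lambda>x. f x * g x)"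
  unfolding smooth_on_def using Ck_on_mult by blast

lemma smooth_on_add: "smooth_on U f \<Longrightarrow> smooth_on U g \<Longrightarrow> open U \<Longrightarrow> smooth_on U (\<lambda>x. f x + g x)"
  unfolding smooth_on_def using Ck_on_add by blast

lemma smooth_on_const: "smooth_on U (\<lambda>x. c)"
  unfolding smooth_on_def using Ck_on_const by blast

lemma partial_deriv_mult:
  assumes "smooth_on U f" "smooth_on U g" "open U" "x \<in> U" "b \<in> Basis"
  shows "partial_deriv b (\<lambda>x. f x * g x) x = f x * partial_deriv b g x + partial_deriv b f x * g x"
  by (rule partial_deriv_eqI[THEN trans], rule has_derivative_mult,
      rule smooth_on_has_derivative[OF assms(1,3,4)], rule smooth_on_has_derivative[OF assms(2,3,4)])
     (use assms(5) in \<open>simp add: sum_Basis_inner\<close>)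

lemma test_functions_mult:
  assumes "\<kappa> \<in> test_functions U" "smooth_on UNIV \<phi>"
  shows "(\<lambda>x. \<kappa> x * \<phi> x) \<in> test_functions U"
proof -
  have sub: "closure {x. \<kappa> x * \<phi> x \<noteq> 0} \<subseteq> closure {x. \<kappa> x \<noteq> 0}" by (rule closure_mono) auto
  then have "compact (closure {x. \<kappa> x * \<phi> x \<noteq> 0})"
    by (rule compact_closure_subset[OF test_functionsD(2)[OF assms(1)]])
  moreover have "smooth_on UNIV (\<lambda>x. \<kappa> x * \<phi> x)"
    by (rule smooth_on_mult[OF test_functionsD(1)[OF assms(1)] assms(2) open_UNIV])
  ultimately show ?thesis using sub test_functionsD(3)[OF assms(1)] unfolding test_functions_def by blast
qed

lemma integral_translate:
  fixes f :: "'a::euclidean_space \<Rightarrow> real"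
  assumes [measurable]: "f \<in> borel_measurable borel"
  shows "(LINT y|lborel. f (c + y)) = (LINT y|lborel. f y)"
  by (subst (2) lborel_distr_plus[of c, symmetric], subst integral_distr) simp_all

lemma integrable_translate:
  fixes f :: "'a::euclidean_space \<Rightarrow> 'b::euclidean_space"
  assumes "integrable lborel f"
  shows "integrable lborel (\<lambda>y. f (c + y))"
proof -
  have [measurable]: "f \<in> borel_measurable borel" using assms by simp
  have "integrable (distr lborel borel ((+) c)) f" by (subst lborel_distr_plus) (rule assms)
  then show ?thesis by (subst (asm) integrable_distr_eq) simp_all
qed

text \<open>The integral of \<open>\<psi>\<close> is translation invariant, hence the integral of each difference quotient is zero; by
\<open>test_functions_taylor\<close> the quotients converge uniformly to the partial derivative.\<close>

lemma test_integral_partial: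
  fixes \<psi> :: "'a::euclidean_space \<Rightarrow> real"
  assumes \<psi>: "\<psi> \<in> test_functions U" and b: "b \<in> Basis"
  shows "(LINT x|lborel. partial_deriv b \<psi> x) = 0"
proof -
  obtain C where C: "C \<ge> 0" "\<And>z h. \<bar>\<psi> (z + h) - \<psi> z - (\<Sum>b\<in>Basis. (h \<bullet> b) * partial_deriv b \<psi> z)\<bar> \<le> C * (norm h)\<^sup>2"
    using test_functions_taylor[OF \<psi>] by blast
  obtain R where R: "R > 0" "closure {x. \<psi> x \<noteq> 0} \<subseteq> ball 0 R"
    using bounded_subset_ballD[OF compact_imp_bounded[OF test_functionsD(2)[OF \<psi>]]] by blast
  have zero: "\<psi> x = 0" "partial_deriv b \<psi> x = 0" if "x \<notin> ball 0 R" for x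
    using R(2) that closure_subset[of "{x. \<psi> x \<noteq> 0}"] partial_deriv_support[of b \<psi>] by blast+
  define V where "V = measure lborel (ball (0::'a) (R + 1))"
  have i1: "integrable lborel \<psi>" by (rule test_functions_integrable[OF \<psi>])
  have i2: "integrable lborel (\<lambda>x. \<psi> (x + h))" for h
    using integrable_translate[OF i1, of h] by (simp add: add.commute)
  have i3: "integrable lborel (partial_deriv b \<psi>)"
    by (rule test_functions_integrable[OF test_functions_partial[OF \<psi> b]])
  have eq: "(LINT x|lborel. \<psi> (x + h)) = (LINT x|lborel. \<psi> x)" for h
    using integral_translate[of \<psi> h] i1 by (simp add: add.commute)
  have main: "\<bar>LINT x|lborel. partial_deriv b \<psi> x\<bar> \<le> C * V * t" if t: "t > 0" "t < 1" for t
  proof -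
    have "(LINT x|lborel. \<psi> (x + t *\<^sub>R b) - \<psi> x - t * partial_deriv b \<psi> x) = - t * (LINT x|lborel. partial_deriv b \<psi> x)"
      using i1 i2 i3 eq by simp
    moreover have "norm (LINT x|lborel. \<psi> (x + t *\<^sub>R b) - \<psi> x - t * partial_deriv b \<psi> x)
        \<le> (LINT x|lborel. (C * t\<^sup>2) * indicator (ball (0::'a) (R + 1)) x)"
    proof (rule order_trans[OF integral_norm_bound], rule integral_mono)
      show "integrable lborel (\<lambda>x. norm (\<psi> (x + t *\<^sub>R b) - \<psi> x - t * partial_deriv b \<psi> x))"
        using i1 i2 i3 by simp
      show "integrable lborel (\<lambda>x::'a. (C * t\<^sup>2) * indicator (ball 0 (R + 1)) x)" by (rule integrable_ball_const)
      fix x :: 'a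
      show "norm (\<psi> (x + t *\<^sub>R b) - \<psi> x - t * partial_deriv b \<psi> x) \<le> (C * t\<^sup>2) * indicator (ball 0 (R + 1)) x"
      proof (cases "x \<in> ball 0 (R + 1)")
        case True
        have "(\<Sum>i\<in>Basis. ((t *\<^sub>R b) \<bullet> i) * partial_deriv i \<psi> x) = t * (\<Sum>i\<in>Basis. (b \<bullet> i) * partial_deriv i \<psi> x)"
          by (simp add: sum_distrib_left mult.assoc)
        then have "(\<Sum>i\<in>Basis. ((t *\<^sub>R b) \<bullet> i) * partial_deriv i \<psi> x) = t * partial_deriv b \<psi> x"
          using sum_Basis_inner[OF b] by metis
        then show ?thesis using C(2)[of x "t *\<^sub>R b"] True b t by simp
      next
        case False
        then have "norm x \<ge> R + 1" by simp
        moreover have "norm (x + t *\<^sub>R b) \<ge> norm x - norm (t *\<^sub>R b)"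
          using norm_diff_ineq by blast
        ultimately have "x + t *\<^sub>R b \<notin> ball 0 R" "x \<notin> ball 0 R" using b t by auto
        then have "norm (\<psi> (x + t *\<^sub>R b) - \<psi> x - t * partial_deriv b \<psi> x) = 0" using zero by simp
        then show ?thesis using C(1) by simp
      qed
    qed
    ultimately have "t * \<bar>LINT x|lborel. partial_deriv b \<psi> x\<bar> \<le> t * (C * V * t)"
      using t by (simp add: V_def abs_mult power2_eq_square mult_ac)
    then show ?thesis using t by (simp only: mult_le_cancel_left_pos)
  qed
  have "\<bar>LINT x|lborel. partial_deriv b \<psi> x\<bar> \<le> 0"
  proof (rule tendsto_lowerbound[where F="at_right 0" and f="\<lambda>t. C * V * t"])
    show "((\<lambda>t. C * V * t) \<longlongrightarrow> 0) (at_right 0)" by (auto intro!: tendsto_eq_intros)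
    show "\<forall>\<^sub>F t in at_right 0. \<bar>LINT x|lborel. partial_deriv b \<psi> x\<bar> \<le> C * V * t"
      unfolding eventually_at_right_field using main by (intro exI[of _ 1]) auto
  qed simp
  then show ?thesis by simp
qed

lemma integral_by_parts_test:
  fixes \<kappa> :: "'a::euclidean_space \<Rightarrow> real"
  assumes "\<kappa> \<in> test_functions U" "smooth_on UNIV \<phi>" "b \<in> Basis"
  shows "(LINT x|lborel. \<kappa> x * partial_deriv b \<phi> x) = - (LINT x|lborel. partial_deriv b \<kappa> x * \<phi> x)"
proof -
  have i: "integrable lborel (\<lambda>x. \<kappa> x * partial_deriv b \<phi> x)" "integrable lborel (\<lambda>x. partial_deriv b \<kappa> x * \<phi> x)"
    by (rule test_functions_integrable[OF test_functions_mult[OF assms(1) smooth_on_partial_deriv[OF assms(2,3)]]])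
       (rule test_functions_integrable[OF test_functions_mult[OF test_functions_partial[OF assms(1,3)] assms(2)]])
  have "0 = (LINT x|lborel. partial_deriv b (\<lambda>x. \<kappa> x * \<phi> x) x)"
    using test_integral_partial[OF test_functions_mult[OF assms(1,2)] assms(3)] by simp
  also have "\<dots> = (LINT x|lborel. \<kappa> x * partial_deriv b \<phi> x + partial_deriv b \<kappa> x * \<phi> x)"
    by (simp add: partial_deriv_mult[OF test_functionsD(1)[OF assms(1)] assms(2) open_UNIV _ assms(3)])
  also have "\<dots> = (LINT x|lborel. \<kappa> x * partial_deriv b \<phi> x) + (LINT x|lborel. partial_deriv b \<kappa> x * \<phi> x)"
    using i by simp
  finally show ?thesis by simp
qed

section \<open>Sphere integrals of continuous functions and gradients\<close>

lemma sphere_measurable_continuous: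
  fixes f :: "'a::euclidean_space \<Rightarrow> 'b::euclidean_space"
  assumes "continuous_on (sphere 0 1) f" shows "f \<in> borel_measurable sphere_measure"
  using borel_measurable_continuous_on_restrict[OF assms] measurable_cong_sets[OF sets_sphere_measure refl] by blast

lemma sphere_integrable_continuous:
  fixes f :: "'a::euclidean_space \<Rightarrow> 'b::euclidean_space"
  assumes "continuous_on (sphere 0 1) f" shows "integrable sphere_measure f"
proof -
  have "bounded (f ` sphere 0 1)"
    by (rule compact_imp_bounded[OF compact_continuous_image[OF assms compact_sphere]])
  then obtain B where "\<And>x. x \<in> sphere 0 1 \<Longrightarrow> norm (f x) \<le> B" unfolding bounded_iff by blast
  then show ?thesis
    by (intro finite_measure.integrable_const_bound[OF finite_sphere_measure, where B=B]
        sphere_measurable_continuous[OF assms] AE_I2) (simp add: space_sphere_measure)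
qed

lemma continuous_sphere_integral:
  fixes F :: "real \<Rightarrow> 'a::euclidean_space \<Rightarrow> real"
  assumes F: "continuous_on UNIV (\<lambda>z. F (fst z) (snd z))"
  shows "continuous_on UNIV (\<lambda>s. LINT \<theta>|sphere_measure. F s \<theta>)"
  unfolding continuous_on_sequentially
proof (intro allI ballI impI, elim conjE)
  fix s :: "nat \<Rightarrow> real" and a assume s: "s \<longlonglongrightarrow> a"
  have "bounded (range s)" using s by (rule convergent_imp_bounded)
  then obtain K where "\<forall>y\<in>range s. norm y \<le> K" unfolding bounded_iff by blast
  then have K: "\<bar>s n\<bar> \<le> K" for n by (metis rangeI real_norm_def)
  have "compact ({-K..K} \<times> sphere (0::'a) 1)" by (intro compact_Times) auto
  then have "compact ((\<lambda>z. F (fst z) (snd z)) ` ({-K..K} \<times> sphere (0::'a) 1))"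
    by (intro compact_continuous_image continuous_on_subset[OF F]) auto
  then have "bounded ((\<lambda>z. F (fst z) (snd z)) ` ({-K..K} \<times> sphere (0::'a) 1))" by (rule compact_imp_bounded)
  then obtain B where "\<forall>y\<in>(\<lambda>z. F (fst z) (snd z)) ` ({-K..K} \<times> sphere (0::'a) 1). norm y \<le> B"
    unfolding bounded_iff by blast
  then have B: "norm (F (fst z) (snd z)) \<le> B" if "z \<in> {-K..K} \<times> sphere (0::'a) 1" for z
    using that by blast
  have c1: "continuous_on A (F t)" for t A
    using continuous_on_compose2[OF F continuous_on_Pair[OF continuous_on_const continuous_on_id] subset_UNIV, of A t] by simp
  show "((\<lambda>s. LINT \<theta>|sphere_measure. F s \<theta>) \<circ> s) \<longlonglongrightarrow> (LINT \<theta>|sphere_measure. F a \<theta>)"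
    unfolding o_def
  proof (rule integral_dominated_convergence[where w="\<lambda>_. B"])
    show "integrable (sphere_measure :: 'a measure) (\<lambda>_. B)"
      using finite_measure.integrable_const[OF finite_sphere_measure] by blast
    show "AE \<theta> in sphere_measure. (\<lambda>n. F (s n) \<theta>) \<longlonglongrightarrow> F a \<theta>"
    proof (rule AE_I2)
      fix \<theta> :: 'a
      have "(\<lambda>n. (s n, \<theta>)) \<longlonglongrightarrow> (a, \<theta>)" using s by (intro tendsto_intros)
      from continuous_on_tendsto_compose[OF F this] show "(\<lambda>n. F (s n) \<theta>) \<longlonglongrightarrow> F a \<theta>" by simp
    qed
    show "AE \<theta> in sphere_measure. norm (F (s n) \<theta>) \<le> B" for n
    proof (rule AE_I2)
      fix \<theta> :: 'a assume "\<theta> \<in> space sphere_measure"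
      then have "(s n, \<theta>) \<in> {-K..K} \<times> sphere 0 1" using K[of n] by (auto simp: space_sphere_measure)
      from B[OF this] show "norm (F (s n) \<theta>) \<le> B" by simp
    qed
  qed (auto intro!: sphere_measurable_continuous c1)
qed

lemma inner_grad: "grad f x \<bullet> y = (\<Sum>b\<in>Basis. (y \<bullet> b) * partial_deriv b f x)"
  unfolding grad_def inner_sum_left by (intro sum.cong) (auto simp: inner_commute)

lemma norm_grad_sq: "(norm (grad f x))\<^sup>2 = (\<Sum>b\<in>Basis. (partial_deriv b f x)\<^sup>2)"
proof -
  have "grad f x \<bullet> b = partial_deriv b f x" if "b \<in> Basis" for b
    unfolding inner_grad by (rule sum_Basis_inner[OF that])
  then show ?thesis
    unfolding power2_norm_eq_inner by (subst euclidean_inner) (simp add: power2_eq_square)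
qed

lemma continuous_grad:
  assumes "smooth_on U f" shows "continuous_on U (grad f)"
  unfolding grad_def[abs_def]
  by (intro continuous_on_sum continuous_on_scaleR continuous_on_const smooth_on_continuous smooth_on_partial_deriv[OF assms])

section \<open>The energy inequality for smooth subharmonic functions\<close>

text \<open>A smooth function of $|x|^2$ that is supported in the ball of radius \<open>r\<close> and increases to its indicator as
$\epsilon \to 0$. As it is radial, its gradient is a multiple of \<open>x\<close> and produces the normal derivative in
\<open>energy_smooth\<close>.\<close>

definition radial_cutoff :: "real \<Rightarrow> real \<Rightarrow> 'a::euclidean_space \<Rightarrow> real" where
  "radial_cutoff \<epsilon> r x = flat 0 ((r\<^sup>2 - x \<bullet> x) / \<epsilon>)"

lemma smooth_inner_self: "smooth_on UNIV (\<lambda>x::'a::euclidean_space. c + d * (x \<bullet> x))"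
proof -
  have "smooth_on UNIV (\<lambda>x::'a. c + d * (\<Sum>b\<in>Basis. (x \<bullet> b) * (x \<bullet> b)))"
    unfolding smooth_on_def by (intro allI Ck_on_sum Ck_on_mult Ck_on_add Ck_on_const Ck_on_inner_const) auto
  then show ?thesis by (simp add: euclidean_inner[symmetric])
qed

lemma smooth_radial_cutoff: "smooth_on UNIV (radial_cutoff \<epsilon> r)"
  using smooth_on_compose_real[OF smooth_flat smooth_inner_self open_UNIV, of 0 "r\<^sup>2 / \<epsilon>" "- 1 / \<epsilon>"]
  unfolding radial_cutoff_def[abs_def] by (simp add: diff_divide_distrib)

lemma inner_less_square_iff: "r > 0 \<Longrightarrow> 0 < r\<^sup>2 - x \<bullet> x \<longleftrightarrow> norm x < r"
  by (smt (verit) norm_ge_zero power2_norm_eq_inner power2_less_imp_less power_strict_mono zero_less_numeral)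

lemma radial_cutoff_zero: "\<epsilon> > 0 \<Longrightarrow> r > 0 \<Longrightarrow> norm x \<ge> r \<Longrightarrow> radial_cutoff \<epsilon> r x = 0"
  using inner_less_square_iff[of r x] by (auto simp: radial_cutoff_def flat_def zero_less_divide_iff)

lemma radial_cutoff_test:
  fixes U :: "'a::euclidean_space set"
  assumes "\<epsilon> > 0" "r > 0" shows "(radial_cutoff \<epsilon> r :: 'a \<Rightarrow> real) \<in> test_functions UNIV"
proof -
  have "{x::'a. radial_cutoff \<epsilon> r x \<noteq> 0} \<subseteq> cball 0 r"
    using radial_cutoff_zero[OF assms] by (force simp: mem_cball_0)
  then have "closure {x::'a. radial_cutoff \<epsilon> r x \<noteq> 0} \<subseteq> cball 0 r" by (rule closure_minimal) simp
  then have "compact (closure {x::'a. radial_cutoff \<epsilon> r x \<noteq> 0})"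
    by (rule compact_closure_subset[OF compact_cball])
  then show ?thesis using smooth_radial_cutoff unfolding test_functions_def by blast
qed

lemma radial_cutoff_partial:
  assumes "\<epsilon> > 0"
  shows "partial_deriv b (radial_cutoff \<epsilon> r) x = - (2 / \<epsilon>) * (x \<bullet> b) * flat 2 ((r\<^sup>2 - x \<bullet> x) / \<epsilon>)"
proof -
  have f: "(flat 0 has_derivative (\<lambda>h. flat 2 t * h)) (at t)" for t
    using flat_deriv[of 0 t] by (simp add: has_field_derivative_def numeral_2_eq_2)
  have "((\<lambda>x. (r\<^sup>2 - x \<bullet> x) / \<epsilon>) has_derivative (\<lambda>h. - 2 * (x \<bullet> h) / \<epsilon>)) (at x)"
    using assms by (auto intro!: derivative_eq_intros simp: inner_commute field_simps)
  from has_derivative_compose[OF this f]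
  have "(radial_cutoff \<epsilon> r has_derivative (\<lambda>h. flat 2 ((r\<^sup>2 - x \<bullet> x) / \<epsilon>) * (- 2 * (x \<bullet> h) / \<epsilon>))) (at x)"
    unfolding radial_cutoff_def[abs_def] .
  from partial_deriv_eqI[OF this, of b] show ?thesis by simp
qed

lemma flat0_bounds: "0 \<le> flat 0 t" "flat 0 t \<le> 1"
  by (auto simp: flat_def)

lemma radial_cutoff_bounds: "0 \<le> radial_cutoff \<epsilon> r x" "radial_cutoff \<epsilon> r x \<le> 1"
  by (simp_all add: radial_cutoff_def flat0_bounds)

lemma flat0_tendsto: "t > 0 \<Longrightarrow> (\<lambda>n. flat 0 (t / (1 / real (Suc n)))) \<longlonglongrightarrow> 1"
proof -
  assume t: "t > 0"
  have "(\<lambda>n. exp (- ((1 / real (Suc n)) / t))) \<longlonglongrightarrow> exp (- (0 / t))"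
    by (intro tendsto_intros LIMSEQ_Suc[OF lim_1_over_n]) (use t in auto)
  then show ?thesis using t by (simp add: flat_def mult.commute)
qed

text \<open>The kernel is minus the derivative of the cut-off along a ray; \<open>flat_deriv\<close> with \<open>m = 0\<close> gives \<open>flat 2\<close>.\<close>

lemma kernel_mass:
  fixes r :: real
  assumes "\<epsilon> > 0" "0 \<le> a" "a \<le> c"
  shows "has_bochner_integral lborel (\<lambda>s. (2 / \<epsilon>) * s * flat 2 ((r\<^sup>2 - s\<^sup>2) / \<epsilon>) * indicator {a..c} s)
     (flat 0 ((r\<^sup>2 - a\<^sup>2) / \<epsilon>) - flat 0 ((r\<^sup>2 - c\<^sup>2) / \<epsilon>))"
proof -
  have f2: "continuous_on UNIV (flat 2)" by (rule smooth_on_continuous[OF smooth_flat])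
  have "has_bochner_integral lborel (\<lambda>s. (2 / \<epsilon>) * s * flat 2 ((r\<^sup>2 - s\<^sup>2) / \<epsilon>) * indicator {a..c} s)
     ((\<lambda>s. - flat 0 ((r\<^sup>2 - s\<^sup>2) / \<epsilon>)) c - (\<lambda>s. - flat 0 ((r\<^sup>2 - s\<^sup>2) / \<epsilon>)) a)"
  proof (rule has_bochner_integral_FTC_Icc_nonneg)
    show "(\<lambda>s. (2 / \<epsilon>) * s * flat 2 ((r\<^sup>2 - s\<^sup>2) / \<epsilon>)) \<in> borel_measurable borel"
      by (intro borel_measurable_continuous_onI continuous_intros continuous_on_compose2[OF f2]) (use assms in auto)
    fix s assume "s \<in> {a..c}"
    then have s: "a \<le> s" "s \<le> c" by auto
    show "0 \<le> (2 / \<epsilon>) * s * flat 2 ((r\<^sup>2 - s\<^sup>2) / \<epsilon>)" using s assms by (simp add: flat_def)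
    show "((\<lambda>s. - flat 0 ((r\<^sup>2 - s\<^sup>2) / \<epsilon>)) has_real_derivative (2 / \<epsilon>) * s * flat 2 ((r\<^sup>2 - s\<^sup>2) / \<epsilon>)) (at s)"
    proof -
      have "((\<lambda>s. (r\<^sup>2 - s\<^sup>2) / \<epsilon>) has_real_derivative (- 2 * s / \<epsilon>)) (at s)"
        using assms by (auto intro!: derivative_eq_intros)
      from DERIV_chain2[OF flat_deriv[of 0] this]
      show ?thesis by (auto intro!: derivative_eq_intros simp: numeral_2_eq_2)
    qed
  qed (use assms in auto)
  then show ?thesis by simp
qed

text \<open>By \<open>kernel_mass\<close> the kernels have total mass at most one, and the mass tends to one and concentrates at \<open>r\<close> from
below, where \<open>b\<close> is close to \<open>b r\<close> by continuity.\<close>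

lemma kernel_limsup:
  fixes b :: "real \<Rightarrow> real"
  assumes b: "continuous_on UNIV b" and r: "r > 0" and e: "e > 0"
  shows "\<forall>\<^sub>F n in sequentially.
    (LINT s|lborel. (2 * real (Suc n)) * s * flat 2 ((r\<^sup>2 - s\<^sup>2) / (1 / real (Suc n))) * indicator {0..r} s * b s) \<le> b r + e"
proof -
  have "bounded (b ` {0..r})"
    by (rule compact_imp_bounded[OF compact_continuous_image[OF continuous_on_subset[OF b subset_UNIV] compact_Icc]])
  then obtain M where "\<forall>y\<in>b ` {0..r}. norm y \<le> M" unfolding bounded_iff by blast
  then have M: "\<bar>b s\<bar> \<le> M" if "s \<in> {0..r}" for s
    using that by (metis imageI real_norm_def)
  have M0: "M \<ge> 0" using M[of 0] r by simp
  have "isCont b r" using b continuous_on_eq_continuous_at open_UNIV by blast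
  then obtain d where d: "d > 0" "\<And>s. dist s r < d \<Longrightarrow> dist (b s) (b r) < e / 2"
    unfolding continuous_at_eps_delta using e half_gt_zero by metis
  \<comment> \<open>On \<open>{a..r}\<close> the function \<open>b\<close> is below \<open>b r + e / 2\<close>; on \<open>{0..a}\<close> the mass of the kernel, \<open>m1 - m2\<close>, tends to zero.\<close>
  define a where "a = max 0 (r - d / 2)"
  have a: "0 \<le> a" "a < r" using d r by (auto simp: a_def)
  have ba: "b s \<le> b r + e / 2" if "s \<in> {a..r}" for s
  proof -
    have "dist s r < d" using that d(1) by (auto simp: a_def dist_real_def split: if_splits)
    from d(2)[OF this] show ?thesis unfolding dist_real_def by argo
  qed
  have ra: "r\<^sup>2 - a\<^sup>2 > 0" using a by (simp add: power_strict_mono)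
  define m1 where "m1 n = flat 0 (r\<^sup>2 / (1 / real (Suc n)))" for n
  define m2 where "m2 n = flat 0 ((r\<^sup>2 - a\<^sup>2) / (1 / real (Suc n)))" for n
  have m1: "m1 \<longlonglongrightarrow> 1" unfolding m1_def by (rule flat0_tendsto) (use r in simp)
  have m2: "m2 \<longlonglongrightarrow> 1" unfolding m2_def by (rule flat0_tendsto[OF ra])
  have "(\<lambda>n. M * (m1 n - m2 n) + (b r + e / 2) * m2 n) \<longlonglongrightarrow> M * (1 - 1) + (b r + e / 2) * 1"
    by (intro tendsto_intros m1 m2)
  then have "\<forall>\<^sub>F n in sequentially. M * (m1 n - m2 n) + (b r + e / 2) * m2 n < b r + e"
    by (rule order_tendstoD) (use e in simp)
  then show ?thesis
  proof eventually_elim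
    fix n assume n: "M * (m1 n - m2 n) + (b r + e / 2) * m2 n < b r + e"
    define \<epsilon> where "\<epsilon> = 1 / real (Suc n)"
    have \<epsilon>: "\<epsilon> > 0" by (simp add: \<epsilon>_def)
    let ?k = "\<lambda>s. (2 / \<epsilon>) * s * flat 2 ((r\<^sup>2 - s\<^sup>2) / \<epsilon>)"
    have k0: "s \<ge> 0 \<Longrightarrow> ?k s \<ge> 0" for s using \<epsilon> by (simp add: flat_def)
    have h1: "has_bochner_integral lborel (\<lambda>s. ?k s * indicator {0..a} s) (m1 n - m2 n)"
      using kernel_mass[OF \<epsilon> order_refl a(1), of r] by (simp add: m1_def m2_def \<epsilon>_def)
    have h2: "has_bochner_integral lborel (\<lambda>s. ?k s * indicator {a..r} s) (m2 n)"
      using kernel_mass[OF \<epsilon> a(1) less_imp_le[OF a(2)], of r] by (simp add: m2_def \<epsilon>_def flat_def)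
    have h3: "has_bochner_integral lborel (\<lambda>s. ?k s * indicator {0..r} s) (m1 n)"
      using kernel_mass[OF \<epsilon> order_refl less_imp_le[OF r], of r] by (simp add: m1_def \<epsilon>_def flat_def)
    have [measurable]: "b \<in> borel_measurable borel" by (rule borel_measurable_continuous_onI[OF b])
    have "(LINT s|lborel. ?k s * indicator {0..r} s * b s)
        \<le> (LINT s|lborel. M * (?k s * indicator {0..a} s) + (b r + e / 2) * (?k s * indicator {a..r} s))"
    proof (rule integral_mono_AE)
      show "integrable lborel (\<lambda>s. ?k s * indicator {0..r} s * b s)"
      proof (rule Bochner_Integration.integrable_bound)
        show "integrable lborel (\<lambda>s. M * (?k s * indicator {0..r} s))"
          using h3 by (intro integrable_mult_right) (simp add: has_bochner_integral_iff)
        have [measurable]: "(\<lambda>s. ?k s * indicator {0..r} s) \<in> borel_measurable lborel"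
          by (rule borel_measurable_integrable, use h3 in \<open>unfold has_bochner_integral_iff, blast\<close>)
        show "(\<lambda>s. ?k s * indicator {0..r} s * b s) \<in> borel_measurable lborel" by measurable
        show "AE s in lborel. norm (?k s * indicator {0..r} s * b s) \<le> norm (M * (?k s * indicator {0..r} s))"
        proof (rule AE_I2)
          fix s show "norm (?k s * indicator {0..r} s * b s) \<le> norm (M * (?k s * indicator {0..r} s))"
          proof (cases "s \<in> {0..r}")
            case True
            have "\<bar>?k s\<bar> * \<bar>b s\<bar> \<le> \<bar>?k s\<bar> * \<bar>M\<bar>" using M[OF True] by (intro mult_left_mono) auto
            then show ?thesis using True by (simp add: abs_mult mult_ac)
          qed simp
        qed
      qed
      show "integrable lborel (\<lambda>s. M * (?k s * indicator {0..a} s) + (b r + e / 2) * (?k s * indicator {a..r} s))"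
        using h1 h2 by (intro Bochner_Integration.integrable_add integrable_mult_right) (simp_all add: has_bochner_integral_iff)
      have "AE s in lborel. s \<noteq> a" by (rule AE_lborel_singleton)
      then show "AE s in lborel. ?k s * indicator {0..r} s * b s \<le> M * (?k s * indicator {0..a} s) + (b r + e / 2) * (?k s * indicator {a..r} s)"
      proof eventually_elim
        fix s assume sa: "s \<noteq> a"
        consider "s \<notin> {0..r}" | "s \<in> {0..r}" "s < a" | "s \<in> {0..r}" "s > a" using sa by linarith
        then show "?k s * indicator {0..r} s * b s \<le> M * (?k s * indicator {0..a} s) + (b r + e / 2) * (?k s * indicator {a..r} s)"
        proof cases
          case 1 then show ?thesis using a by (auto simp: indicator_def)
        next
          case 2
          have "?k s * b s \<le> ?k s * M" using k0[of s] M[of s] 2 by (intro mult_left_mono) auto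
          then show ?thesis using 2 by (simp add: mult_ac)
        next
          case 3
          have "?k s * b s \<le> ?k s * (b r + e / 2)" using k0[of s] ba[of s] 3 by (intro mult_left_mono) auto
          then show ?thesis using 3 by (simp add: mult_ac)
        qed
      qed
    qed
    also have "\<dots> = M * (m1 n - m2 n) + (b r + e / 2) * m2 n"
      by (rule has_bochner_integral_integral_eq[OF has_bochner_integral_add[OF has_bochner_integral_mult_right[OF h1] has_bochner_integral_mult_right[OF h2]]])
    finally show "(LINT s|lborel. (2 * real (Suc n)) * s * flat 2 ((r\<^sup>2 - s\<^sup>2) / (1 / real (Suc n))) * indicator {0..r} s * b s) \<le> b r + e"
      using n by (simp add: \<epsilon>_def)
  qed
qed

text \<open>Integrate $\kappa \phi \Delta\phi \ge 0$ by parts with the cut-off $\kappa$. In polar coordinates the boundary term is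
the average of the continuous function \<open>B\<close> against a kernel that concentrates at \<open>r\<close>. Working with a cut-off avoids the
divergence theorem on the ball.\<close>

theorem energy_smooth:
  fixes \<phi> :: "'a::euclidean_space \<Rightarrow> real"
  assumes \<phi>: "smooth_on UNIV \<phi>" and r: "r > 0"
    and pos: "\<And>x. norm x < r \<Longrightarrow> \<phi> x \<ge> 0" and sub: "\<And>x. norm x < r \<Longrightarrow> laplacian \<phi> x \<ge> 0"
  shows "(LINT x|lborel. indicator (ball 0 r) x * (norm (grad \<phi> x))\<^sup>2)
    \<le> r ^ (DIM('a) - 1) * (LINT \<theta>|sphere_measure. \<phi> (r *\<^sub>R \<theta>) * (grad \<phi> (r *\<^sub>R \<theta>) \<bullet> \<theta>))"
proof -
  define \<epsilon> where "\<epsilon> n = 1 / real (Suc n)" for n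
  have \<epsilon>: "\<epsilon> n > 0" for n by (simp add: \<epsilon>_def)
  \<comment> \<open>The boundary term as a function of the radius; the claim is that the energy is at most \<open>B r\<close>.\<close>
  define B where "B s = s ^ (DIM('a) - 1) * (LINT \<theta>|sphere_measure. \<phi> (s *\<^sub>R \<theta>) * (grad \<phi> (s *\<^sub>R \<theta>) \<bullet> (\<theta>::'a)))" for s
  have \<phi>c: "continuous_on UNIV \<phi>" and gc: "continuous_on UNIV (grad \<phi>)"
    using smooth_on_continuous[OF \<phi>] continuous_grad[OF \<phi>] .
  have Bc: "continuous_on UNIV B" unfolding B_def[abs_def]
    by (intro continuous_intros continuous_sphere_integral continuous_on_compose2[OF \<phi>c] continuous_on_compose2[OF gc]) auto
  have [measurable]: "\<phi> \<in> borel_measurable borel" "grad \<phi> \<in> borel_measurable borel"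
    by (auto intro: borel_measurable_continuous_onI \<phi>c gc)
  have pd: "smooth_on UNIV (partial_deriv b \<phi>)" if "b \<in> Basis" for b
    by (rule smooth_on_partial_deriv[OF \<phi> that])
  \<comment> \<open>$\int \kappa |\nabla\phi|^2 + \int \kappa \phi \Delta\phi = - \int \phi \nabla\kappa \cdot \nabla\phi$, and the second integral
is nonnegative.\<close>
  have parts: "(LINT x|lborel. radial_cutoff (\<epsilon> n) r x * (norm (grad \<phi> x))\<^sup>2)
     \<le> (LINT x|lborel. (2 / \<epsilon> n) * flat 2 ((r\<^sup>2 - x \<bullet> x) / \<epsilon> n) * (\<phi> x * (grad \<phi> x \<bullet> x)))" for n
  proof -
    let ?\<kappa> = "radial_cutoff (\<epsilon> n) r :: 'a \<Rightarrow> real"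
    note \<kappa> = radial_cutoff_test[OF \<epsilon>[of n] r, where 'a='a]
    have i1: "integrable lborel (\<lambda>x. ?\<kappa> x * (partial_deriv b \<phi> x * partial_deriv b \<phi> x))" if "b \<in> Basis" for b
      by (intro test_functions_integrable[OF test_functions_mult[OF \<kappa>]] smooth_on_mult pd that open_UNIV)
    have i2: "integrable lborel (\<lambda>x. ?\<kappa> x * (\<phi> x * partial_deriv b (partial_deriv b \<phi>) x))" if "b \<in> Basis" for b
      by (intro test_functions_integrable[OF test_functions_mult[OF \<kappa>]] smooth_on_mult \<phi> smooth_on_partial_deriv pd that open_UNIV)
    have i3: "integrable lborel (\<lambda>x. partial_deriv b ?\<kappa> x * (\<phi> x * partial_deriv b \<phi> x))" if "b \<in> Basis" for b
      by (intro test_functions_integrable[OF test_functions_mult[OF test_functions_partial[OF \<kappa>]]] smooth_on_mult \<phi> pd that open_UNIV)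
    have p: "(LINT x|lborel. ?\<kappa> x * (partial_deriv b \<phi> x * partial_deriv b \<phi> x)) + (LINT x|lborel. ?\<kappa> x * (\<phi> x * partial_deriv b (partial_deriv b \<phi>) x))
        = - (LINT x|lborel. partial_deriv b ?\<kappa> x * (\<phi> x * partial_deriv b \<phi> x))" if b: "b \<in> Basis" for b
    proof -
      have "- (LINT x|lborel. partial_deriv b ?\<kappa> x * (\<phi> x * partial_deriv b \<phi> x))
        = (LINT x|lborel. ?\<kappa> x * partial_deriv b (\<lambda>x. \<phi> x * partial_deriv b \<phi> x) x)"
        using integral_by_parts_test[OF \<kappa> smooth_on_mult[OF \<phi> pd[OF b] open_UNIV] b] by simp
      also have "\<dots> = (LINT x|lborel. ?\<kappa> x * (partial_deriv b \<phi> x * partial_deriv b \<phi> x) + ?\<kappa> x * (\<phi> x * partial_deriv b (partial_deriv b \<phi>) x))"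
        by (intro Bochner_Integration.integral_cong refl)
           (simp add: partial_deriv_mult[OF \<phi> pd[OF b] open_UNIV _ b] algebra_simps)
      also have "\<dots> = (LINT x|lborel. ?\<kappa> x * (partial_deriv b \<phi> x * partial_deriv b \<phi> x)) + (LINT x|lborel. ?\<kappa> x * (\<phi> x * partial_deriv b (partial_deriv b \<phi>) x))"
        by (rule Bochner_Integration.integral_add[OF i1[OF b] i2[OF b]])
      finally show ?thesis by simp
    qed
    have "(LINT x|lborel. ?\<kappa> x * (norm (grad \<phi> x))\<^sup>2) = (\<Sum>b\<in>Basis. LINT x|lborel. ?\<kappa> x * (partial_deriv b \<phi> x * partial_deriv b \<phi> x))"
      unfolding norm_grad_sq sum_distrib_left unfolding power2_eq_square
      by (rule Bochner_Integration.integral_sum) (rule i1)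
    moreover have "0 \<le> (\<Sum>b\<in>Basis. LINT x|lborel. ?\<kappa> x * (\<phi> x * partial_deriv b (partial_deriv b \<phi>) x))"
    proof -
      have "(\<Sum>b\<in>Basis. LINT x|lborel. ?\<kappa> x * (\<phi> x * partial_deriv b (partial_deriv b \<phi>) x))
          = (LINT x|lborel. ?\<kappa> x * (\<phi> x * laplacian \<phi> x))"
        by (subst Bochner_Integration.integral_sum[symmetric]) (auto simp: i2 laplacian_def sum_distrib_left)
      also have "\<dots> \<ge> 0"
      proof (intro integral_nonneg_AE AE_I2)
        fix x :: 'a
        show "0 \<le> ?\<kappa> x * (\<phi> x * laplacian \<phi> x)"
          using pos[of x] sub[of x] radial_cutoff_bounds(1)[of "\<epsilon> n" r x] radial_cutoff_zero[OF \<epsilon>[of n] r, of x]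
          by (cases "norm x < r") auto
      qed
      finally show ?thesis .
    qed
    moreover have "(\<Sum>b\<in>Basis. - (LINT x|lborel. partial_deriv b ?\<kappa> x * (\<phi> x * partial_deriv b \<phi> x)))
        = (LINT x|lborel. (2 / \<epsilon> n) * flat 2 ((r\<^sup>2 - x \<bullet> x) / \<epsilon> n) * (\<phi> x * (grad \<phi> x \<bullet> x)))"
    proof -
      have "(\<Sum>b\<in>Basis. - (LINT x|lborel. partial_deriv b ?\<kappa> x * (\<phi> x * partial_deriv b \<phi> x)))
          = (LINT x|lborel. (\<Sum>b\<in>Basis. - (partial_deriv b ?\<kappa> x * (\<phi> x * partial_deriv b \<phi> x))))"
        by (subst Bochner_Integration.integral_sum) (auto simp: i3)
      also have "\<dots> = (LINT x|lborel. (2 / \<epsilon> n) * flat 2 ((r\<^sup>2 - x \<bullet> x) / \<epsilon> n) * (\<phi> x * (grad \<phi> x \<bullet> x)))"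
      proof (rule Bochner_Integration.integral_cong[OF refl])
        fix x :: 'a
        have "(\<Sum>b\<in>Basis. - (partial_deriv b ?\<kappa> x * (\<phi> x * partial_deriv b \<phi> x)))
            = (\<Sum>b\<in>Basis. ((2 / \<epsilon> n) * flat 2 ((r\<^sup>2 - x \<bullet> x) / \<epsilon> n) * \<phi> x) * ((x \<bullet> b) * partial_deriv b \<phi> x))"
          by (intro sum.cong) (simp_all add: radial_cutoff_partial[OF \<epsilon>] mult_ac)
        then show "(\<Sum>b\<in>Basis. - (partial_deriv b ?\<kappa> x * (\<phi> x * partial_deriv b \<phi> x)))
            = (2 / \<epsilon> n) * flat 2 ((r\<^sup>2 - x \<bullet> x) / \<epsilon> n) * (\<phi> x * (grad \<phi> x \<bullet> x))"
          unfolding sum_distrib_left[symmetric] inner_grad by (simp only: mult.assoc)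
      qed
      finally show ?thesis .
    qed
    moreover have "(\<Sum>b\<in>Basis. LINT x|lborel. ?\<kappa> x * (partial_deriv b \<phi> x * partial_deriv b \<phi> x))
        + (\<Sum>b\<in>Basis. LINT x|lborel. ?\<kappa> x * (\<phi> x * partial_deriv b (partial_deriv b \<phi>) x))
        = (\<Sum>b\<in>Basis. - (LINT x|lborel. partial_deriv b ?\<kappa> x * (\<phi> x * partial_deriv b \<phi> x)))"
      unfolding sum.distrib[symmetric] by (rule sum.cong[OF refl p])
    ultimately show ?thesis by linarith
  qed
  \<comment> \<open>On the sphere of radius \<open>s\<close> the factor \<open>x \<bullet> \<nabla>\<phi>\<close> is \<open>s\<close> times the normal derivative.\<close>
  have polar: "(LINT x|lborel. (2 / \<epsilon> n) * flat 2 ((r\<^sup>2 - x \<bullet> x) / \<epsilon> n) * (\<phi> x * (grad \<phi> x \<bullet> x)))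
     = (LINT s|lborel. (2 * real (Suc n)) * s * flat 2 ((r\<^sup>2 - s\<^sup>2) / (1 / real (Suc n))) * indicator {0..r} s * B s)" for n
  proof -
    let ?h = "\<lambda>x::'a. (2 / \<epsilon> n) * flat 2 ((r\<^sup>2 - x \<bullet> x) / \<epsilon> n) * (\<phi> x * (grad \<phi> x \<bullet> x))"
    have hz: "?h x = 0" if "norm x > r" for x
      using inner_less_square_iff[OF r, of x] that \<epsilon>[of n] by (auto simp: flat_def zero_less_divide_iff)
    have hc: "continuous_on UNIV ?h"
      by (intro continuous_intros continuous_on_compose2[OF smooth_on_continuous[OF smooth_flat]] \<phi>c gc) (use \<epsilon>[of n] in auto)
    have "integrable lborel (\<lambda>x. indicator (cball 0 r) x *\<^sub>R ?h x)"
      by (rule borel_integrable_compact[OF compact_cball continuous_on_subset[OF hc subset_UNIV]])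
    moreover have "(\<lambda>x. indicator (cball 0 r) x *\<^sub>R ?h x) = ?h"
    proof
      fix x show "indicator (cball 0 r) x *\<^sub>R ?h x = ?h x" using hz[of x] by (cases "norm x > r") auto
    qed
    ultimately have hi: "integrable lborel ?h" by simp
    have "(LINT x|lborel. ?h x) = (LINT s|lborel. s ^ (DIM('a) - 1) * indicator {0<..} s * (LINT \<theta>|sphere_measure. ?h (s *\<^sub>R \<theta>)))"
      by (rule polar_integral(2)[OF hi])
    also have "\<dots> = (LINT s|lborel. (2 * real (Suc n)) * s * flat 2 ((r\<^sup>2 - s\<^sup>2) / (1 / real (Suc n))) * indicator {0..r} s * B s)"
    proof (rule Bochner_Integration.integral_cong[OF refl])
      fix s :: real
      have sph: "(LINT \<theta>|sphere_measure. ?h (s *\<^sub>R \<theta>)) = (LINT \<theta>|sphere_measure. ((2 / \<epsilon> n) * s * flat 2 ((r\<^sup>2 - s\<^sup>2) / \<epsilon> n)) * (\<phi> (s *\<^sub>R \<theta>) * (grad \<phi> (s *\<^sub>R \<theta>) \<bullet> \<theta>)))"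
      proof (rule Bochner_Integration.integral_cong[OF refl])
        fix \<theta> :: 'a assume "\<theta> \<in> space sphere_measure"
        then have "\<theta> \<bullet> \<theta> = 1" by (simp add: space_sphere_measure dot_square_norm)
        then show "?h (s *\<^sub>R \<theta>) = ((2 / \<epsilon> n) * s * flat 2 ((r\<^sup>2 - s\<^sup>2) / \<epsilon> n)) * (\<phi> (s *\<^sub>R \<theta>) * (grad \<phi> (s *\<^sub>R \<theta>) \<bullet> \<theta>))"
          by (simp add: power2_eq_square)
      qed
      show "s ^ (DIM('a) - 1) * indicator {0<..} s * (LINT \<theta>|sphere_measure. ?h (s *\<^sub>R \<theta>))
          = (2 * real (Suc n)) * s * flat 2 ((r\<^sup>2 - s\<^sup>2) / (1 / real (Suc n))) * indicator {0..r} s * B s"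
      proof (cases "0 < s \<and> s \<le> r")
        case True
        then show ?thesis unfolding sph integral_mult_right_zero by (simp add: B_def \<epsilon>_def mult_ac)
      next
        case False
        then consider "s < 0" | "s = 0" | "s > r" by linarith
        then show ?thesis
        proof cases
          case 3
          then have "r\<^sup>2 - s\<^sup>2 < 0" using r by (simp add: power_strict_mono)
          then have "flat 2 ((r\<^sup>2 - s\<^sup>2) / \<epsilon> n) = 0" using \<epsilon>[of n] by (simp add: flat_def zero_less_divide_iff)
          then show ?thesis unfolding sph using 3 by (simp add: \<epsilon>_def)
        qed auto
      qed
    qed
    finally show ?thesis .
  qed
  have lhs: "(\<lambda>n. LINT x|lborel. radial_cutoff (\<epsilon> n) r x * (norm (grad \<phi> x))\<^sup>2) \<longlonglongrightarrow> (LINT x|lborel. indicator (ball 0 r) x * (norm (grad \<phi> x))\<^sup>2)"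
  proof (rule integral_dominated_convergence[where w="\<lambda>x. indicator (cball 0 r) x *\<^sub>R (norm (grad \<phi> x))\<^sup>2"])
    show "integrable lborel (\<lambda>x. indicator (cball 0 r) x *\<^sub>R (norm (grad \<phi> x))\<^sup>2)"
      by (rule borel_integrable_compact) (auto intro!: continuous_intros continuous_on_subset[OF gc])
    have [measurable]: "(radial_cutoff e r :: 'a \<Rightarrow> real) \<in> borel_measurable borel" for e
      by (intro borel_measurable_continuous_onI smooth_on_continuous smooth_radial_cutoff)
    show "(\<lambda>x. radial_cutoff (\<epsilon> n) r x * (norm (grad \<phi> x))\<^sup>2) \<in> borel_measurable lborel" for n by measurable
    show "AE x in lborel. (\<lambda>n. radial_cutoff (\<epsilon> n) r x * (norm (grad \<phi> x))\<^sup>2) \<longlonglongrightarrow> indicator (ball 0 r) x * (norm (grad \<phi> x))\<^sup>2"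
    proof (rule AE_I2)
      fix x :: 'a
      have "(\<lambda>n. radial_cutoff (\<epsilon> n) r x) \<longlonglongrightarrow> indicator (ball 0 r) x"
      proof (cases "norm x < r")
        case True
        then show ?thesis using flat0_tendsto[of "r\<^sup>2 - x \<bullet> x"] inner_less_square_iff[OF r, of x]
          by (simp add: radial_cutoff_def \<epsilon>_def)
      next
        case False
        then show ?thesis using radial_cutoff_zero[OF \<epsilon> r, of x] by simp
      qed
      then show "(\<lambda>n. radial_cutoff (\<epsilon> n) r x * (norm (grad \<phi> x))\<^sup>2) \<longlonglongrightarrow> indicator (ball 0 r) x * (norm (grad \<phi> x))\<^sup>2"
        by (rule tendsto_mult_right)
    qed
    show "AE x in lborel. norm (radial_cutoff (\<epsilon> n) r x * (norm (grad \<phi> x))\<^sup>2) \<le> indicator (cball 0 r) x *\<^sub>R (norm (grad \<phi> x))\<^sup>2" for n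
    proof (rule AE_I2)
      fix x :: 'a
      have "\<bar>radial_cutoff (\<epsilon> n) r x\<bar> \<le> indicator (cball 0 r) x"
        using radial_cutoff_bounds[of "\<epsilon> n" r x] radial_cutoff_zero[OF \<epsilon>[of n] r, of x] by (auto simp: indicator_def)
      then show "norm (radial_cutoff (\<epsilon> n) r x * (norm (grad \<phi> x))\<^sup>2) \<le> indicator (cball 0 r) x *\<^sub>R (norm (grad \<phi> x))\<^sup>2"
        by (simp add: abs_mult mult_right_mono)
    qed
    have "(\<lambda>x. (norm (grad \<phi> x))\<^sup>2) \<in> borel_measurable borel"
      by (intro borel_measurable_continuous_onI continuous_on_power continuous_on_norm gc)
    then show "(\<lambda>x. indicator (ball 0 r) x * (norm (grad \<phi> x))\<^sup>2) \<in> borel_measurable lborel"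
      by (intro borel_measurable_times borel_measurable_indicator) auto
  qed
  have "(LINT x|lborel. indicator (ball 0 r) x * (norm (grad \<phi> x))\<^sup>2) \<le> B r + e" if e: "e > 0" for e
  proof (rule tendsto_upperbound[OF lhs _ sequentially_bot])
    show "\<forall>\<^sub>F n in sequentially. (LINT x|lborel. radial_cutoff (\<epsilon> n) r x * (norm (grad \<phi> x))\<^sup>2) \<le> B r + e"
      using kernel_limsup[OF Bc r e]
    proof eventually_elim
      case (elim n)
      then show ?case using parts[of n] polar[of n] by linarith
    qed
  qed
  then have "(LINT x|lborel. indicator (ball 0 r) x * (norm (grad \<phi> x))\<^sup>2) \<le> B r" by (rule field_le_epsilon)
  then show ?thesis by (simp add: B_def)
qed

section \<open>Sobolev functions on a ball and their mollifications\<close>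

text \<open>From $| |q|^2 - |p|^2 | \le |q-p|^2 + 2 |p| |q-p|$ and Young's inequality with a small parameter.\<close>

lemma L2_norm_tendsto:
  fixes q :: "nat \<Rightarrow> 'a \<Rightarrow> 'b::euclidean_space"
  assumes [measurable]: "\<And>n. q n \<in> borel_measurable M" "p \<in> borel_measurable M"
    and ip: "integrable M (\<lambda>x. (norm (p x))\<^sup>2)" and id: "\<And>n. integrable M (\<lambda>x. (norm (q n x - p x))\<^sup>2)"
    and lim: "(\<lambda>n. LINT x|M. (norm (q n x - p x))\<^sup>2) \<longlonglongrightarrow> 0"
  shows "(\<lambda>n. LINT x|M. (norm (q n x))\<^sup>2) \<longlonglongrightarrow> (LINT x|M. (norm (p x))\<^sup>2)"
    "integrable M (\<lambda>x. (norm (q n x))\<^sup>2)"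
proof -
  have bd: "(norm (q n x))\<^sup>2 \<le> 2 * (norm (q n x - p x))\<^sup>2 + 2 * (norm (p x))\<^sup>2" for n x
  proof -
    have "norm (q n x) \<le> norm (q n x - p x) + norm (p x)" using norm_triangle_ineq[of "q n x - p x" "p x"] by simp
    then have "(norm (q n x))\<^sup>2 \<le> (norm (q n x - p x) + norm (p x))\<^sup>2" by (intro power_mono) auto
    also have "\<dots> \<le> 2 * (norm (q n x - p x))\<^sup>2 + 2 * (norm (p x))\<^sup>2"
      using zero_le_power2[of "norm (q n x - p x) - norm (p x)"] by (simp add: power2_eq_square algebra_simps)
    finally show ?thesis .
  qed
  have iq: "integrable M (\<lambda>x. (norm (q n x))\<^sup>2)" for n
  proof (rule Bochner_Integration.integrable_bound)
    show "integrable M (\<lambda>x. 2 * (norm (q n x - p x))\<^sup>2 + 2 * (norm (p x))\<^sup>2)" using ip id by simp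
    show "AE x in M. norm ((norm (q n x))\<^sup>2) \<le> norm (2 * (norm (q n x - p x))\<^sup>2 + 2 * (norm (p x))\<^sup>2)"
      using bd[of n] by (intro AE_I2) (simp add: abs_of_nonneg)
  qed measurable
  then show "integrable M (\<lambda>x. (norm (q n x))\<^sup>2)" .
  define I where "I = (LINT x|M. (norm (p x))\<^sup>2)"
  have I0: "I \<ge> 0" unfolding I_def by simp
  have key: "\<bar>(norm (q n x))\<^sup>2 - (norm (p x))\<^sup>2\<bar> \<le> (1 + 1/e) * (norm (q n x - p x))\<^sup>2 + e * (norm (p x))\<^sup>2" if e: "e > 0" for e n x
  proof -
    define a b d where "a = norm (q n x)" and "b = norm (p x)" and "d = norm (q n x - p x)"
    have d: "\<bar>a - b\<bar> \<le> d" unfolding a_def b_def d_def by (rule norm_triangle_ineq3)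
    have nn: "a \<ge> 0" "b \<ge> 0" "d \<ge> 0" by (auto simp: a_def b_def d_def)
    have "\<bar>a\<^sup>2 - b\<^sup>2\<bar> = \<bar>a - b\<bar> * (a + b)" using nn by (simp add: power2_eq_square square_diff_square_factored abs_mult)
    also have "\<dots> \<le> d * (d + 2 * b)" using d nn by (intro mult_mono) auto
    also have "\<dots> \<le> (1 + 1/e) * d\<^sup>2 + e * b\<^sup>2"
    proof -
      have "0 \<le> (d - e * b)\<^sup>2 / e" using e by simp
      also have "\<dots> = d\<^sup>2 / e - 2 * d * b + e * b\<^sup>2" using e by (simp add: power2_eq_square field_simps)
      finally show ?thesis by (simp add: power2_eq_square algebra_simps)
    qed
    finally show ?thesis unfolding a_def b_def d_def .
  qed
  show "(\<lambda>n. LINT x|M. (norm (q n x))\<^sup>2) \<longlonglongrightarrow> (LINT x|M. (norm (p x))\<^sup>2)"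
  proof (rule LIMSEQ_I)
    fix \<eta> :: real assume \<eta>: "\<eta> > 0"
    define e where "e = \<eta> / (2 * (I + 1))"
    have e: "e > 0" using \<eta> I0 by (simp add: e_def)
    have eI: "e * I \<le> \<eta> / 2" using I0 \<eta> by (simp add: e_def field_simps)
    have "(\<lambda>n. (1 + 1/e) * (LINT x|M. (norm (q n x - p x))\<^sup>2)) \<longlonglongrightarrow> (1 + 1/e) * 0"
      by (intro tendsto_intros lim)
    then have "\<forall>\<^sub>F n in sequentially. (1 + 1/e) * (LINT x|M. (norm (q n x - p x))\<^sup>2) < \<eta> / 2"
      by (rule order_tendstoD) (use \<eta> in simp)
    then obtain n0 where n0: "\<And>n. n \<ge> n0 \<Longrightarrow> (1 + 1/e) * (LINT x|M. (norm (q n x - p x))\<^sup>2) < \<eta> / 2"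
      unfolding eventually_sequentially by blast
    have "norm ((LINT x|M. (norm (q n x))\<^sup>2) - (LINT x|M. (norm (p x))\<^sup>2)) < \<eta>" if "n \<ge> n0" for n
    proof -
      have "norm ((LINT x|M. (norm (q n x))\<^sup>2) - (LINT x|M. (norm (p x))\<^sup>2))
          = norm (LINT x|M. (norm (q n x))\<^sup>2 - (norm (p x))\<^sup>2)" using iq ip by simp
      also have "\<dots> \<le> (LINT x|M. (1 + 1/e) * (norm (q n x - p x))\<^sup>2 + e * (norm (p x))\<^sup>2)"
      proof (rule order_trans[OF integral_norm_bound], rule integral_mono)
        show "integrable M (\<lambda>x. norm ((norm (q n x))\<^sup>2 - (norm (p x))\<^sup>2))" using iq ip by simp
        show "integrable M (\<lambda>x. (1 + 1/e) * (norm (q n x - p x))\<^sup>2 + e * (norm (p x))\<^sup>2)" using id ip by simp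
      qed (use key[OF e] in simp)
      also have "\<dots> = (1 + 1/e) * (LINT x|M. (norm (q n x - p x))\<^sup>2) + e * I"
        using id ip by (simp add: I_def)
      also have "\<dots> < \<eta>" using add_less_le_mono[OF n0[OF that] eI] by simp
      finally show ?thesis .
    qed
    then show "\<exists>no. \<forall>n\<ge>no. norm ((LINT x|M. (norm (q n x))\<^sup>2) - (LINT x|M. (norm (p x))\<^sup>2)) < \<eta>" by blast
  qed
qed

text \<open>An $H^1$ function on the ball of radius \<open>R\<close> about the origin together with its weak gradient, both extended by zero as
Borel functions on the whole space. The extension need not be weakly differentiable across the boundary, so the weak identity
is required only for test functions of the ball.\<close>

definition sobolev_ball :: "real \<Rightarrow> ('a::euclidean_space \<Rightarrow> real) \<Rightarrow> ('a \<Rightarrow> 'a) \<Rightarrow> bool" where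
  "sobolev_ball R W G \<longleftrightarrow> W \<in> borel_measurable borel \<and> G \<in> borel_measurable borel
    \<and> integrable lborel (\<lambda>x. (W x)\<^sup>2) \<and> integrable lborel (\<lambda>x. (norm (G x))\<^sup>2)
    \<and> (\<forall>x. norm x \<ge> R \<longrightarrow> W x = 0 \<and> G x = 0)
    \<and> (\<forall>\<phi>\<in>test_functions (ball 0 R). \<forall>b\<in>Basis.
        (LINT x|lborel. W x * partial_deriv b \<phi> x) = - (LINT x|lborel. (G x \<bullet> b) * \<phi> x))"

lemma integrable_of_square_ball:
  fixes f :: "'a::euclidean_space \<Rightarrow> real"
  assumes [measurable]: "f \<in> borel_measurable borel" and sq: "integrable lborel (\<lambda>x. (f x)\<^sup>2)" and z: "\<And>x. norm x \<ge> R \<Longrightarrow> f x = 0"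
  shows "integrable lborel f"
proof (rule Bochner_Integration.integrable_bound)
  show "integrable lborel (\<lambda>x::'a. (f x)\<^sup>2 + 1 * indicator (ball 0 R) x)"
    by (intro Bochner_Integration.integrable_add sq integrable_ball_const)
  have "norm (f x) \<le> norm ((f x)\<^sup>2 + 1 * indicator (ball 0 R) x)" for x
  proof (cases "norm x < R")
    case True
    have "0 \<le> (\<bar>f x\<bar> - 1)\<^sup>2 + \<bar>f x\<bar>" by simp
    then have "\<bar>f x\<bar> \<le> (f x)\<^sup>2 + 1" by (simp add: power2_eq_square algebra_simps abs_mult_self_eq)
    then show ?thesis using True by simp
  next
    case False
    then show ?thesis using z[of x] by simp
  qed
  then show "AE x in lborel. norm (f x) \<le> norm ((f x)\<^sup>2 + 1 * indicator (ball 0 R) x)" by simp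
qed measurable

context
  fixes R :: real and W :: "'a::euclidean_space \<Rightarrow> real" and G
  assumes SB: "sobolev_ball R W G"
begin

lemma sobolev_measurable: "W \<in> borel_measurable borel" "G \<in> borel_measurable borel"
  using SB by (auto simp: sobolev_ball_def)

lemma sobolev_square_integrable: "integrable lborel (\<lambda>x. (W x)\<^sup>2)" "integrable lborel (\<lambda>x. (norm (G x))\<^sup>2)"
  using SB by (auto simp: sobolev_ball_def)

lemma sobolev_zero_outside: "norm x \<ge> R \<Longrightarrow> W x = 0" "norm x \<ge> R \<Longrightarrow> G x = 0"
  using SB by (auto simp: sobolev_ball_def)

lemma sobolev_weak_grad: "\<phi> \<in> test_functions (ball 0 R) \<Longrightarrow> b \<in> Basis \<Longrightarrow>
    (LINT x|lborel. W x * partial_deriv b \<phi> x) = - (LINT x|lborel. (G x \<bullet> b) * \<phi> x)"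
  using SB by (auto simp: sobolev_ball_def)

lemma sobolev_integrable: "integrable lborel W"
  by (rule integrable_of_square_ball[OF sobolev_measurable(1) sobolev_square_integrable(1) sobolev_zero_outside(1)])

lemma sobolev_grad_square_integrable: assumes "b \<in> Basis" shows "integrable lborel (\<lambda>x. (G x \<bullet> b)\<^sup>2)"
proof (rule Bochner_Integration.integrable_bound[OF sobolev_square_integrable(2)])
  have "norm ((G x \<bullet> b)\<^sup>2) \<le> norm ((norm (G x))\<^sup>2)" for x
    using Basis_le_norm[OF assms, of "G x"] by (simp add: abs_le_square_iff[symmetric])
  then show "AE x in lborel. norm ((G x \<bullet> b)\<^sup>2) \<le> norm ((norm (G x))\<^sup>2)" by simp
qed (use sobolev_measurable in measurable)

lemma sobolev_grad_integrable: assumes "b \<in> Basis" shows "integrable lborel (\<lambda>x. G x \<bullet> b)"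
  by (rule integrable_of_square_ball[OF _ sobolev_grad_square_integrable[OF assms], of R])
    (use sobolev_zero_outside(2) sobolev_measurable(2) in auto)

text \<open>At points whose distance to the boundary exceeds \<open>d\<close> the reflected mollifier is a test function of the ball, so the
weak identity moves the derivative from the mollifier to \<open>W\<close>.\<close>

lemma partial_deriv_conv_sobolev:
  assumes "b \<in> Basis" "d > 0" "norm x + d < R"
  shows "partial_deriv b (conv W (mollifier d)) x = conv (\<lambda>y. G y \<bullet> b) (mollifier d) x"
proof -
  have sub: "cball x d \<subseteq> ball 0 R"
  proof
    fix y assume "y \<in> cball x d"
    then have "norm (x - y) \<le> d" by (simp add: dist_norm)
    then have "norm y < R" using assms(3) norm_triangle_ineq2[of y x] by (simp add: norm_minus_commute)
    then show "y \<in> ball 0 R" by simp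
  qed
  have "partial_deriv b (conv W (mollifier d)) x = (LINT y|lborel. W y * partial_deriv b (mollifier d) (x - y))"
    by (simp add: partial_deriv_conv[OF sobolev_integrable mollifier_test[OF assms(2) subset_UNIV] assms(1)] conv_def)
  also have "\<dots> = - (LINT y|lborel. W y * partial_deriv b (\<lambda>y. mollifier d (x + (-1) *\<^sub>R y)) y)"
    unfolding partial_deriv_affine_map[OF mollifier_smooth assms(1)] by simp
  also have "\<dots> = (LINT y|lborel. (G y \<bullet> b) * mollifier d (x - y))"
    using sobolev_weak_grad[OF mollifier_reflect_test[OF assms(2) sub] assms(1)] by simp
  finally show ?thesis by (simp add: conv_def)
qed

text \<open>The same argument with two derivatives: the reflected mollifier is nonnegative, and reflection does not change the
Laplacian.\<close>

lemma laplacian_conv_nonneg: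
  assumes sub: "\<And>\<phi>. \<phi> \<in> test_functions (ball 0 R) \<Longrightarrow> (\<And>x. \<phi> x \<ge> 0) \<Longrightarrow> (LINT x|lborel. W x * laplacian \<phi> x) \<ge> 0"
    and "d > 0" "norm x + d < R"
  shows "laplacian (conv W (mollifier d)) x \<ge> 0"
proof -
  have sb: "cball x d \<subseteq> ball 0 R"
  proof
    fix y assume "y \<in> cball x d"
    then have "norm (x - y) \<le> d" by (simp add: dist_norm)
    then have "norm y < R" using assms(3) norm_triangle_ineq2[of y x] by (simp add: norm_minus_commute)
    then show "y \<in> ball 0 R" by simp
  qed
  note mt = mollifier_test[OF assms(2) subset_UNIV, where 'a='a]
  have pp: "partial_deriv b (partial_deriv b (conv W (mollifier d))) x = (LINT y|lborel. W y * partial_deriv b (partial_deriv b (mollifier d)) (x - y))"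
    if "b \<in> Basis" for b
    by (simp add: partial_deriv_conv[OF sobolev_integrable mt that] partial_deriv_conv[OF sobolev_integrable test_functions_partial[OF mt that] that] conv_def)
  have lap: "laplacian (\<lambda>y. mollifier d (x + (-1) *\<^sub>R y)) y = (\<Sum>b\<in>Basis. partial_deriv b (partial_deriv b (mollifier d)) (x - y))" for y
    unfolding laplacian_def
  proof (rule sum.cong[OF refl])
    fix b :: 'a assume b: "b \<in> Basis"
    have e1: "partial_deriv b (\<lambda>y. mollifier d (x + (-1) *\<^sub>R y)) = (\<lambda>y. (-1) * partial_deriv b (mollifier d) (x + (-1) *\<^sub>R y))"
      by (rule partial_deriv_affine_map[OF mollifier_smooth b])
    have e2: "partial_deriv b (\<lambda>y. partial_deriv b (mollifier d) (x + (-1) *\<^sub>R y)) = (\<lambda>y. (-1) * partial_deriv b (partial_deriv b (mollifier d)) (x + (-1) *\<^sub>R y))"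
      by (rule partial_deriv_affine_map[OF smooth_on_partial_deriv[OF mollifier_smooth b] b])
    have "partial_deriv b (\<lambda>y. (-1) * partial_deriv b (mollifier d) (x + (-1) *\<^sub>R y)) y
        = (-1) * partial_deriv b (\<lambda>y. partial_deriv b (mollifier d) (x + (-1) *\<^sub>R y)) y + partial_deriv b (\<lambda>y. (-1)) y * partial_deriv b (mollifier d) (x + (-1) *\<^sub>R y)"
      by (rule partial_deriv_mult[OF smooth_on_const smooth_affine_map[OF smooth_on_partial_deriv[OF mollifier_smooth b]] open_UNIV UNIV_I b])
    moreover have "partial_deriv b (\<lambda>y::'a. - (1::real)) y = 0" by (rule partial_deriv_eqI[OF has_derivative_const])
    ultimately show "partial_deriv b (partial_deriv b (\<lambda>y. mollifier d (x + (-1) *\<^sub>R y))) y = partial_deriv b (partial_deriv b (mollifier d)) (x - y)"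
      unfolding e1 e2 by simp
  qed
  have "laplacian (conv W (mollifier d)) x = (\<Sum>b\<in>Basis. LINT y|lborel. W y * partial_deriv b (partial_deriv b (mollifier d)) (x - y))"
    unfolding laplacian_def by (intro sum.cong refl pp)
  also have "\<dots> = (LINT y|lborel. (\<Sum>b\<in>Basis. W y * partial_deriv b (partial_deriv b (mollifier d)) (x - y)))"
    by (rule Bochner_Integration.integral_sum[symmetric])
       (rule integrable_conv_test[OF sobolev_integrable test_functions_partial[OF test_functions_partial[OF mt]]])
  also have "\<dots> = (LINT y|lborel. W y * laplacian (\<lambda>y. mollifier d (x + (-1) *\<^sub>R y)) y)"
    unfolding lap by (simp add: sum_distrib_left)
  also have "\<dots> = (LINT y|lborel. W y * laplacian (\<lambda>y. mollifier d (x - y)) y)" by simp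
  also have "\<dots> \<ge> 0"
    by (rule sub[OF mollifier_reflect_test[OF assms(2) sb]]) (rule mollifier_nonneg[OF assms(2)])
  finally show ?thesis .
qed

lemma conv_nonneg:
  assumes "AE x in lborel. W x \<ge> 0" "d > 0" shows "conv W (mollifier d) x \<ge> 0"
  unfolding conv_def by (rule integral_nonneg_AE) (use assms(1) in \<open>eventually_elim, simp add: mollifier_nonneg[OF assms(2)]\<close>)

text \<open>The mollification of \<open>W\<close> at scale \<open>1 / Suc n\<close>, with \<open>W\<close> as first argument outside this context.\<close>

definition mollified :: "nat \<Rightarrow> 'a \<Rightarrow> real" where "mollified n = conv W (mollifier (1 / real (Suc n)))"

lemma mollified_smooth: "smooth_on UNIV (mollified n)"
  unfolding mollified_def by (rule smooth_conv[OF sobolev_integrable mollifier_test[OF _ subset_UNIV]]) simp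

lemma mollified_partial:
  assumes "b \<in> Basis" "norm x + 1 / real (Suc n) < R"
  shows "partial_deriv b (mollified n) x = conv (\<lambda>y. G y \<bullet> b) (mollifier (1 / real (Suc n))) x"
  unfolding mollified_def by (rule partial_deriv_conv_sobolev[OF assms(1) _ assms(2)]) simp

lemma mollified_tendsto_L1: "(\<lambda>n. LINT x|lborel. \<bar>mollified n x - W x\<bar>) \<longlonglongrightarrow> 0" "integrable lborel (\<lambda>x. \<bar>mollified n x - W x\<bar>)"
proof -
  have g: "gauge_fn abs" by (simp add: gauge_fn_def)
  have i: "integrable lborel (\<lambda>x. \<bar>W x\<bar>)" using sobolev_integrable by simp
  show "(\<lambda>n. LINT x|lborel. \<bar>mollified n x - W x\<bar>) \<longlonglongrightarrow> 0" unfolding mollified_def by (rule mollify_tendsto(2)[OF g sobolev_integrable i])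
  show "integrable lborel (\<lambda>x. \<bar>mollified n x - W x\<bar>)" unfolding mollified_def by (rule mollify_tendsto(1)[OF g sobolev_integrable i]) simp
qed

lemma mollified_tendsto_L2: "(\<lambda>n. LINT x|lborel. (mollified n x - W x)\<^sup>2) \<longlonglongrightarrow> 0" "integrable lborel (\<lambda>x. (mollified n x - W x)\<^sup>2)"
proof -
  have g: "gauge_fn (\<lambda>t. t\<^sup>2)" by (simp add: gauge_fn_def)
  show "(\<lambda>n. LINT x|lborel. (mollified n x - W x)\<^sup>2) \<longlonglongrightarrow> 0" unfolding mollified_def by (rule mollify_tendsto(2)[OF g sobolev_integrable sobolev_square_integrable(1)])
  show "integrable lborel (\<lambda>x. (mollified n x - W x)\<^sup>2)" unfolding mollified_def by (rule mollify_tendsto(1)[OF g sobolev_integrable sobolev_square_integrable(1)]) simp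
qed

lemma conv_grad_tendsto:
  assumes "b \<in> Basis" "gauge_fn \<Phi>"
  shows "(\<lambda>n. LINT x|lborel. \<Phi> (conv (\<lambda>y. G y \<bullet> b) (mollifier (1 / real (Suc n))) x - G x \<bullet> b)) \<longlonglongrightarrow> 0"
    "integrable lborel (\<lambda>x. \<Phi> (conv (\<lambda>y. G y \<bullet> b) (mollifier (1 / real (Suc n))) x - G x \<bullet> b))"
proof -
  have i: "integrable lborel (\<lambda>x. \<Phi> (G x \<bullet> b))"
    using assms(2) sobolev_grad_square_integrable[OF assms(1)] sobolev_grad_integrable[OF assms(1)] by (auto simp: gauge_fn_def)
  show "(\<lambda>n. LINT x|lborel. \<Phi> (conv (\<lambda>y. G y \<bullet> b) (mollifier (1 / real (Suc n))) x - G x \<bullet> b)) \<longlonglongrightarrow> 0"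
    by (rule mollify_tendsto(2)[OF assms(2) sobolev_grad_integrable[OF assms(1)] i])
  show "integrable lborel (\<lambda>x. \<Phi> (conv (\<lambda>y. G y \<bullet> b) (mollifier (1 / real (Suc n))) x - G x \<bullet> b))"
    by (rule mollify_tendsto(1)[OF assms(2) sobolev_grad_integrable[OF assms(1)] i]) simp
qed

lemma mollified_measurable: "mollified n \<in> borel_measurable borel" "grad (mollified n) \<in> borel_measurable borel"
  by (rule borel_measurable_continuous_onI, rule smooth_on_continuous[OF mollified_smooth])
     (rule borel_measurable_continuous_onI, rule continuous_grad[OF mollified_smooth])

text \<open>Near the boundary the gradient of the mollified extension has nothing to do with \<open>G\<close>, hence the smaller ball.\<close>

lemma grad_mollified_tendsto:
  assumes s: "s < R"
  shows "(\<lambda>n. LINT x|lborel. indicator (ball 0 s) x * (norm (grad (mollified n) x - G x))\<^sup>2) \<longlonglongrightarrow> 0"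
    "integrable lborel (\<lambda>x. indicator (ball 0 s) x * (norm (grad (mollified n) x - G x))\<^sup>2)"
proof -
  note [measurable] = sobolev_measurable mollified_measurable
  have [measurable]: "ball (0::'a) s \<in> sets borel" by simp
  have gs: "gauge_fn (\<lambda>t. t\<^sup>2)" by (simp add: gauge_fn_def)
  have norm_eq: "(norm (grad (mollified n) x - G x))\<^sup>2 = (\<Sum>b\<in>Basis. (partial_deriv b (mollified n) x - G x \<bullet> b)\<^sup>2)" for n x
  proof -
    have "grad (mollified n) x \<bullet> b = partial_deriv b (mollified n) x" if "b \<in> Basis" for b
      unfolding inner_grad by (rule sum_Basis_inner[OF that])
    then show ?thesis
      unfolding power2_norm_eq_inner by (subst euclidean_inner) (simp add: power2_eq_square inner_diff_left)
  qed
  let ?D = "\<lambda>n x. (\<Sum>b\<in>Basis. (conv (\<lambda>y. G y \<bullet> b) (mollifier (1 / real (Suc n))) x - G x \<bullet> b)\<^sup>2)"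
  have iD: "integrable lborel (?D n)" for n by (intro Bochner_Integration.integrable_sum conv_grad_tendsto(2)[OF _ gs])
  have "(\<lambda>n. \<Sum>b\<in>Basis. LINT x|lborel. (conv (\<lambda>y. G y \<bullet> b) (mollifier (1 / real (Suc n))) x - G x \<bullet> b)\<^sup>2) \<longlonglongrightarrow> (\<Sum>b\<in>(Basis::'a set). 0)"
    by (intro tendsto_sum conv_grad_tendsto(1)[OF _ gs])
  moreover have "(LINT x|lborel. ?D n x) = (\<Sum>b\<in>Basis. LINT x|lborel. (conv (\<lambda>y. G y \<bullet> b) (mollifier (1 / real (Suc n))) x - G x \<bullet> b)\<^sup>2)" for n
    by (rule Bochner_Integration.integral_sum) (rule conv_grad_tendsto(2)[OF _ gs])
  ultimately have lD: "(\<lambda>n. LINT x|lborel. ?D n x) \<longlonglongrightarrow> 0" by (simp only: sum.neutral_const)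
  show ii: "integrable lborel (\<lambda>x. indicator (ball 0 s) x * (norm (grad (mollified n) x - G x))\<^sup>2)" for n
  proof -
    have "integrable lborel (\<lambda>x. indicator (cball 0 s) x *\<^sub>R (norm (grad (mollified n) x))\<^sup>2)"
      by (rule borel_integrable_compact[OF compact_cball]) (intro continuous_on_power continuous_on_norm continuous_on_subset[OF continuous_grad[OF mollified_smooth] subset_UNIV])
    then have "integrable lborel (\<lambda>x. 2 * (indicator (cball 0 s) x *\<^sub>R (norm (grad (mollified n) x))\<^sup>2) + 2 * (norm (G x))\<^sup>2)"
      using sobolev_square_integrable(2) by simp
    then show ?thesis
    proof (rule Bochner_Integration.integrable_bound)
      have "norm (indicator (ball 0 s) x * (norm (grad (mollified n) x - G x))\<^sup>2) \<le> norm (2 * (indicator (cball 0 s) x *\<^sub>R (norm (grad (mollified n) x))\<^sup>2) + 2 * (norm (G x))\<^sup>2)" for x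
      proof (cases "x \<in> ball 0 s")
        case True
        have "norm (grad (mollified n) x - G x) \<le> norm (grad (mollified n) x) + norm (G x)" by (rule norm_triangle_ineq4)
        then have "(norm (grad (mollified n) x - G x))\<^sup>2 \<le> (norm (grad (mollified n) x) + norm (G x))\<^sup>2" by (intro power_mono) auto
        also have "\<dots> \<le> 2 * (norm (grad (mollified n) x))\<^sup>2 + 2 * (norm (G x))\<^sup>2"
          using zero_le_power2[of "norm (grad (mollified n) x) - norm (G x)"] by (simp add: power2_eq_square algebra_simps)
        finally show ?thesis using True by simp
      qed simp
      then show "AE x in lborel. norm (indicator (ball 0 s) x * (norm (grad (mollified n) x - G x))\<^sup>2) \<le> norm (2 * (indicator (cball 0 s) x *\<^sub>R (norm (grad (mollified n) x))\<^sup>2) + 2 * (norm (G x))\<^sup>2)" by simp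
    qed measurable
  qed
  show "(\<lambda>n. LINT x|lborel. indicator (ball 0 s) x * (norm (grad (mollified n) x - G x))\<^sup>2) \<longlonglongrightarrow> 0"
  proof (rule tendsto_sandwich[OF _ _ tendsto_const lD])
    show "\<forall>\<^sub>F n in sequentially. 0 \<le> (LINT x|lborel. indicator (ball 0 s) x * (norm (grad (mollified n) x - G x))\<^sup>2)"
      by (intro always_eventually allI integral_nonneg_AE AE_I2) simp
    have "\<forall>\<^sub>F n in sequentially. 1 / real (Suc n) < R - s"
      by (rule order_tendstoD(2)[OF LIMSEQ_Suc[OF lim_1_over_n]]) (use s in simp)
    then show "\<forall>\<^sub>F n in sequentially. (LINT x|lborel. indicator (ball 0 s) x * (norm (grad (mollified n) x - G x))\<^sup>2) \<le> (LINT x|lborel. ?D n x)"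
    proof eventually_elim
      fix n assume n: "1 / real (Suc n) < R - s"
      show "(LINT x|lborel. indicator (ball 0 s) x * (norm (grad (mollified n) x - G x))\<^sup>2) \<le> (LINT x|lborel. ?D n x)"
      proof (rule integral_mono[OF ii iD])
        fix x
        show "indicator (ball 0 s) x * (norm (grad (mollified n) x - G x))\<^sup>2 \<le> ?D n x"
        proof (cases "x \<in> ball 0 s")
          case True
          then have "norm x + 1 / real (Suc n) < R" using n by simp
          then have "?D n x = (\<Sum>b\<in>Basis. (partial_deriv b (mollified n) x - G x \<bullet> b)\<^sup>2)"
            by (intro sum.cong refl) (simp add: mollified_partial)
          then show ?thesis using True norm_eq[of n x] by simp
        next
          case False
          then show ?thesis by (simp add: sum_nonneg)
        qed
      qed
    qed
  qed
qed

end

section \<open>Vanishing of the gradient on the zero set\<close>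

text \<open>The function $t / (1 + k^2 t^2)$: its derivative lies between -1 and 1 and tends to the indicator of zero as
$k \to \infty$, while the function itself is at most $1/k$.\<close>

definition damped_id :: "real \<Rightarrow> real \<Rightarrow> real" where "damped_id k t = t * inverse (1 + (k * t)\<^sup>2)"
definition damped_id' :: "real \<Rightarrow> real \<Rightarrow> real" where "damped_id' k t = (1 - (k * t)\<^sup>2) * (inverse (1 + (k * t)\<^sup>2))\<^sup>2"

lemma one_plus_square_pos: "0 < 1 + (x::real)\<^sup>2"
  by (simp add: add_pos_nonneg)

lemma smooth_damped_id: "smooth_on UNIV (damped_id k)"
proof -
  have id: "smooth_on UNIV (\<lambda>t::real. t)"
    unfolding smooth_on_def using Ck_on_inner_const[of _ UNIV "1::real"] by simp
  have sq: "smooth_on UNIV (\<lambda>t::real. 1 + (k * t) * (k * t))"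
    by (intro smooth_on_add smooth_on_mult smooth_on_const id open_UNIV)
  have "smooth_on UNIV (\<lambda>t. 1 * inverse (1 + (k * t) * (k * t)) ^ 1)"
    by (rule smooth_on_compose_real_on[OF smooth_on_power_inverse _ sq])
       (use one_plus_square_pos in \<open>auto simp: power2_eq_square[symmetric] image_iff less_le\<close>)
  from smooth_on_mult[OF id this open_UNIV] show ?thesis
    unfolding damped_id_def[abs_def] by (simp add: power2_eq_square)
qed

lemma damped_id_deriv: "(damped_id k has_real_derivative damped_id' k t) (at t)"
proof -
  define c where "c = 1 + (k * t)\<^sup>2"
  have c: "c > 0" unfolding c_def by (rule one_plus_square_pos)
  have "((\<lambda>t. 1 + (k * t)\<^sup>2) has_real_derivative 2 * k * (k * t)) (at t)"
    by (auto intro!: derivative_eq_intros)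
  then have "(damped_id k has_real_derivative 1 * inverse c + (- (inverse c * (2 * k * (k * t)) * inverse c)) * t) (at t)"
    unfolding damped_id_def[abs_def] c_def
    by (intro DERIV_mult DERIV_ident DERIV_inverse') (use one_plus_square_pos[of "k * t"] in auto)
  also have "1 * inverse c + (- (inverse c * (2 * k * (k * t)) * inverse c)) * t = (c - 2 * (k * t)\<^sup>2) * (inverse c)\<^sup>2"
    using c by (simp add: field_simps power2_eq_square)
  finally show ?thesis unfolding damped_id'_def by (simp add: c_def)
qed

lemma damped_id'_bound: "\<bar>damped_id' k t\<bar> \<le> 1"
proof -
  define q where "q = (k * t)\<^sup>2"
  have q: "q \<ge> 0" by (simp add: q_def)
  have "\<bar>1 - q\<bar> \<le> (1 + q)\<^sup>2" using q by (simp add: power2_eq_square algebra_simps abs_if)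
  then have "\<bar>1 - q\<bar> * (inverse (1 + q))\<^sup>2 \<le> (1 + q)\<^sup>2 * (inverse (1 + q))\<^sup>2" by (intro mult_right_mono) auto
  also have "\<dots> = 1" using q by (simp add: power_mult_distrib[symmetric])
  finally show ?thesis unfolding damped_id'_def q_def[symmetric] by (simp add: abs_mult)
qed

lemma damped_id_bound: "k > 0 \<Longrightarrow> \<bar>damped_id k t\<bar> \<le> 1 / k"
proof -
  assume k: "k > 0"
  have "0 \<le> (k * \<bar>t\<bar> - 1)\<^sup>2 + k * \<bar>t\<bar>" using k by simp
  then have "k * \<bar>t\<bar> \<le> 1 + (k * t)\<^sup>2" by (simp add: power2_eq_square algebra_simps abs_mult_self_eq)
  then have "k * \<bar>t\<bar> * inverse (1 + (k * t)\<^sup>2) \<le> (1 + (k * t)\<^sup>2) * inverse (1 + (k * t)\<^sup>2)"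
    using one_plus_square_pos[of "k * t"] by (intro mult_right_mono) auto
  also have "\<dots> = 1" using one_plus_square_pos[of "k * t"] by simp
  finally have "k * \<bar>damped_id k t\<bar> \<le> 1" using one_plus_square_pos[of "k * t"] by (simp add: damped_id_def abs_mult)
  then show ?thesis using k by (simp add: field_simps)
qed

lemma continuous_damped_id: "continuous_on UNIV (damped_id k)" "continuous_on UNIV (damped_id' k)"
proof -
  show "continuous_on UNIV (damped_id k)" by (rule smooth_on_continuous[OF smooth_damped_id])
  have "1 + (k * t)\<^sup>2 \<noteq> 0" for t using one_plus_square_pos[of "k * t"] by simp
  then show "continuous_on UNIV (damped_id' k)" unfolding damped_id'_def[abs_def] by (intro continuous_intros) auto
qed

lemma damped_id'_tendsto: "(\<lambda>k. damped_id' (real (Suc k)) t) \<longlonglongrightarrow> (if t = 0 then 1 else 0)"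
proof (cases "t = 0")
  case False
  have b: "\<bar>damped_id' (real (Suc k)) t\<bar> \<le> (1 / real (Suc k)) * (1 / \<bar>t\<bar>)" for k
  proof -
    define q where "q = (real (Suc k) * t)\<^sup>2"
    have q: "q > 0" using False by (simp add: q_def)
    have "\<bar>damped_id' (real (Suc k)) t\<bar> = \<bar>1 - q\<bar> * (inverse (1 + q))\<^sup>2" by (simp add: damped_id'_def q_def abs_mult)
    also have "\<dots> \<le> (1 + q) * (inverse (1 + q))\<^sup>2" using q by (intro mult_right_mono) auto
    also have "\<dots> = inverse (1 + q)" using q by (simp add: power2_eq_square)
    also have "\<dots> \<le> inverse (real (Suc k) * \<bar>t\<bar>)"
    proof (rule le_imp_inverse_le)
      have "0 \<le> (real (Suc k) * \<bar>t\<bar> - 1)\<^sup>2 + real (Suc k) * \<bar>t\<bar>" by simp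
      moreover have "(real (Suc k) * \<bar>t\<bar>)\<^sup>2 = q" by (simp add: q_def power_mult_distrib)
      ultimately show "real (Suc k) * \<bar>t\<bar> \<le> 1 + q" by (simp add: power2_diff mult.commute)
      show "0 < real (Suc k) * \<bar>t\<bar>" using False by simp
    qed
    finally show ?thesis by (simp add: inverse_eq_divide)
  qed
  have "(\<lambda>k. (1 / real (Suc k)) * (1 / \<bar>t\<bar>)) \<longlonglongrightarrow> 0 * (1 / \<bar>t\<bar>)"
    by (intro tendsto_intros LIMSEQ_Suc[OF lim_1_over_n])
  then have lim0: "(\<lambda>k. (1 / real (Suc k)) * (1 / \<bar>t\<bar>)) \<longlonglongrightarrow> 0" by (simp only: mult_zero_left)
  have "(\<lambda>k. damped_id' (real (Suc k)) t) \<longlonglongrightarrow> 0"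
    by (rule Lim_null_comparison[OF always_eventually lim0], rule allI) (simp only: real_norm_def b)
  then show ?thesis using False by simp
qed (simp add: damped_id'_def)

lemma compact_in_ball_shrink:
  fixes K :: "'a::euclidean_space set"
  assumes "compact K" "K \<subseteq> ball 0 R" shows "\<exists>s<R. K \<subseteq> ball 0 s"
proof (cases "K = {}")
  case True then show ?thesis by (intro exI[of _ "R - 1"]) simp
next
  case False
  obtain x where x: "x \<in> K" "\<And>y. y \<in> K \<Longrightarrow> norm y \<le> norm x"
    using continuous_attains_sup[OF assms(1) False continuous_on_norm[OF continuous_on_id]] by blast
  have xR: "norm x < R" using x(1) assms(2) by auto
  have "K \<subseteq> ball 0 ((norm x + R) / 2)"
  proof
    fix y assume "y \<in> K"
    then have "norm y \<le> norm x" by (rule x(2))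
    then show "y \<in> ball 0 ((norm x + R) / 2)" using xR by simp
  qed
  moreover have "(norm x + R) / 2 < R" using xR by simp
  ultimately show ?thesis by blast
qed

lemma AE_subseq_of_L1:
  fixes u :: "nat \<Rightarrow> 'a \<Rightarrow> real"
  assumes "\<And>n. integrable M (u n)" "(\<lambda>n. LINT x|M. \<bar>u n x\<bar>) \<longlonglongrightarrow> 0"
  shows "\<exists>r::nat\<Rightarrow>nat. strict_mono r \<and> (AE x in M. (\<lambda>n. u (r n) x) \<longlonglongrightarrow> 0)"
  using tendsto_L1_AE_subseq[of M u] assms by simp

text \<open>The chain rule for Sobolev functions in the one case that is needed. It holds for the mollifications and passes to
the limit by dominated convergence along a subsequence that converges almost everywhere.\<close>

lemma damped_id_weak_identity:
  fixes W :: "'a::euclidean_space \<Rightarrow> real"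
  assumes SB: "sobolev_ball R W G" and b: "b \<in> Basis" and \<phi>: "\<phi> \<in> test_functions (ball 0 R)" and k: "k > 0"
  shows "(LINT x|lborel. \<phi> x * (damped_id' k (W x) * (G x \<bullet> b))) = - (LINT x|lborel. partial_deriv b \<phi> x * damped_id k (W x))"
proof -
  note [measurable] = sobolev_measurable[OF SB] mollified_measurable[OF SB] test_functions_measurable[OF \<phi>]
    test_functions_measurable[OF test_functions_partial[OF \<phi> b]]
    borel_measurable_continuous_onI[OF continuous_damped_id(1)] borel_measurable_continuous_onI[OF continuous_damped_id(2)]
  obtain B where B: "\<And>x. \<bar>\<phi> x\<bar> \<le> B" using test_functions_bounded[OF \<phi>] by blast
  have B0: "B \<ge> 0" using B[of 0] by linarith
  obtain s where s: "s < R" "closure {x. \<phi> x \<noteq> 0} \<subseteq> ball 0 s"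
    using compact_in_ball_shrink[OF test_functionsD(2,3)[OF \<phi>]] by blast
  have \<phi>0: "\<phi> x = 0" if "norm x \<ge> s" for x
    using s(2) closure_subset[of "{x. \<phi> x \<noteq> 0}"] that by force
  have iW: "integrable lborel (\<lambda>x. mollified W n x - W x)" for n
    using mollified_tendsto_L1(2)[OF SB, of n] integrable_abs_cancel by (subst (asm) integrable_abs_iff) auto
  obtain r where r: "strict_mono (r::nat \<Rightarrow> nat)" "AE x in lborel. (\<lambda>n. mollified W (r n) x - W x) \<longlonglongrightarrow> 0"
    using AE_subseq_of_L1[OF iW mollified_tendsto_L1(1)[OF SB]] by blast
  have ae: "AE x in lborel. (\<lambda>n. mollified W (r n) x) \<longlonglongrightarrow> W x"
    using r(2) by eventually_elim (simp add: LIM_zero_iff)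
  let ?C = "\<lambda>n. conv (\<lambda>y. G y \<bullet> b) (mollifier (1 / real (Suc n)))"
  have gabs: "gauge_fn abs" by (simp add: gauge_fn_def)
  have [measurable]: "?C n \<in> borel_measurable borel" for n by (rule conv_measurable) auto
  have iG: "integrable lborel (\<lambda>x. G x \<bullet> b)" by (rule sobolev_grad_integrable[OF SB b])
  \<comment> \<open>The two sides for the mollified functions converge to those for \<open>W\<close>, with \<open>G \<bullet> b\<close> already in the place of its mollification.\<close>
  have L1: "(\<lambda>n. LINT x|lborel. partial_deriv b \<phi> x * damped_id k (mollified W (r n) x)) \<longlonglongrightarrow> (LINT x|lborel. partial_deriv b \<phi> x * damped_id k (W x))"
  proof (rule integral_dominated_convergence[where w="\<lambda>x. \<bar>partial_deriv b \<phi> x\<bar> * (1 / k)"])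
    show "integrable lborel (\<lambda>x. \<bar>partial_deriv b \<phi> x\<bar> * (1 / k))"
      using test_functions_integrable[OF test_functions_partial[OF \<phi> b]] by simp
    show "AE x in lborel. (\<lambda>n. partial_deriv b \<phi> x * damped_id k (mollified W (r n) x)) \<longlonglongrightarrow> partial_deriv b \<phi> x * damped_id k (W x)"
      using ae by eventually_elim (intro tendsto_intros continuous_on_tendsto_compose[OF continuous_damped_id(1)], auto)
    show "AE x in lborel. norm (partial_deriv b \<phi> x * damped_id k (mollified W (r n) x)) \<le> \<bar>partial_deriv b \<phi> x\<bar> * (1 / k)" for n
      using damped_id_bound[OF k] by (intro AE_I2) (simp add: abs_mult mult_left_mono del: mult_1_right times_divide_eq_right)
  qed measurable
  have L2: "(\<lambda>n. LINT x|lborel. \<phi> x * (damped_id' k (mollified W (r n) x) * (G x \<bullet> b))) \<longlonglongrightarrow> (LINT x|lborel. \<phi> x * (damped_id' k (W x) * (G x \<bullet> b)))"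
  proof (rule integral_dominated_convergence[where w="\<lambda>x. B * \<bar>G x \<bullet> b\<bar>"])
    show "integrable lborel (\<lambda>x. B * \<bar>G x \<bullet> b\<bar>)" using iG by simp
    show "AE x in lborel. (\<lambda>n. \<phi> x * (damped_id' k (mollified W (r n) x) * (G x \<bullet> b))) \<longlonglongrightarrow> \<phi> x * (damped_id' k (W x) * (G x \<bullet> b))"
      using ae by eventually_elim (intro tendsto_intros continuous_on_tendsto_compose[OF continuous_damped_id(2)], auto)
    show "AE x in lborel. norm (\<phi> x * (damped_id' k (mollified W (r n) x) * (G x \<bullet> b))) \<le> B * \<bar>G x \<bullet> b\<bar>" for n
    proof (rule AE_I2)
      fix x
      have "\<bar>\<phi> x\<bar> * (\<bar>damped_id' k (mollified W (r n) x)\<bar> * \<bar>G x \<bullet> b\<bar>) \<le> B * (1 * \<bar>G x \<bullet> b\<bar>)"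
        using B[of x] B0 damped_id'_bound by (intro mult_mono) auto
      then show "norm (\<phi> x * (damped_id' k (mollified W (r n) x) * (G x \<bullet> b))) \<le> B * \<bar>G x \<bullet> b\<bar>" by (simp add: abs_mult)
    qed
  qed measurable
  have "(\<lambda>n. B * (LINT x|lborel. \<bar>?C (r n) x - G x \<bullet> b\<bar>)) \<longlonglongrightarrow> B * 0"
    by (intro tendsto_intros LIMSEQ_subseq_LIMSEQ[OF conv_grad_tendsto(1)[OF SB b gabs] r(1), unfolded o_def])
  then have lim0: "(\<lambda>n. B * (LINT x|lborel. \<bar>?C (r n) x - G x \<bullet> b\<bar>)) \<longlonglongrightarrow> 0" by simp
  have "(\<lambda>n. (LINT x|lborel. \<phi> x * (damped_id' k (mollified W (r n) x) * (?C (r n) x - G x \<bullet> b)))) \<longlonglongrightarrow> 0"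
  proof (rule Lim_null_comparison[OF always_eventually lim0], rule allI)
    fix n
    show "norm (LINT x|lborel. \<phi> x * (damped_id' k (mollified W (r n) x) * (?C (r n) x - G x \<bullet> b))) \<le> B * (LINT x|lborel. \<bar>?C (r n) x - G x \<bullet> b\<bar>)"
    proof -
      have bd: "norm (\<phi> x * (damped_id' k (mollified W (r n) x) * (?C (r n) x - G x \<bullet> b))) \<le> B * \<bar>?C (r n) x - G x \<bullet> b\<bar>" for x
      proof -
        have "\<bar>\<phi> x\<bar> * (\<bar>damped_id' k (mollified W (r n) x)\<bar> * \<bar>?C (r n) x - G x \<bullet> b\<bar>) \<le> B * (1 * \<bar>?C (r n) x - G x \<bullet> b\<bar>)"
          using B[of x] B0 damped_id'_bound by (intro mult_mono) auto
        then show ?thesis by (simp add: abs_mult)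
      qed
      have ib: "integrable lborel (\<lambda>x. B * \<bar>?C (r n) x - G x \<bullet> b\<bar>)"
        by (rule integrable_mult_right, rule conv_grad_tendsto(2)[OF SB b gabs])
      have "norm (LINT x|lborel. \<phi> x * (damped_id' k (mollified W (r n) x) * (?C (r n) x - G x \<bullet> b))) \<le> (LINT x|lborel. B * \<bar>?C (r n) x - G x \<bullet> b\<bar>)"
      proof (rule order_trans[OF integral_norm_bound], rule integral_mono[OF _ ib bd])
        show "integrable lborel (\<lambda>x. norm (\<phi> x * (damped_id' k (mollified W (r n) x) * (?C (r n) x - G x \<bullet> b))))"
          by (rule Bochner_Integration.integrable_bound[OF ib]) (measurable, use bd B0 in \<open>auto intro!: AE_I2 intro: order_trans simp: abs_mult\<close>)
      qed
      then show ?thesis by simp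
    qed
  qed
  from tendsto_add[OF this L2]
  have L3: "(\<lambda>n. (LINT x|lborel. \<phi> x * (damped_id' k (mollified W (r n) x) * (?C (r n) x - G x \<bullet> b))) + (LINT x|lborel. \<phi> x * (damped_id' k (mollified W (r n) x) * (G x \<bullet> b))))
      \<longlonglongrightarrow> (LINT x|lborel. \<phi> x * (damped_id' k (W x) * (G x \<bullet> b)))" by simp
  have "\<forall>\<^sub>F n in sequentially. 1 / real (Suc n) < R - s"
    by (rule order_tendstoD(2)[OF LIMSEQ_Suc[OF lim_1_over_n]]) (use s in simp)
  then have "\<forall>\<^sub>F n in sequentially. 1 / real (Suc (r n)) < R - s"
    using eventually_subseq[OF r(1)] by blast
  then have "\<forall>\<^sub>F n in sequentially. (LINT x|lborel. \<phi> x * (damped_id' k (mollified W (r n) x) * (?C (r n) x - G x \<bullet> b))) + (LINT x|lborel. \<phi> x * (damped_id' k (mollified W (r n) x) * (G x \<bullet> b)))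
      = - (LINT x|lborel. partial_deriv b \<phi> x * damped_id k (mollified W (r n) x))"
  proof eventually_elim
    fix n assume n: "1 / real (Suc (r n)) < R - s"
    have i1: "integrable lborel (\<lambda>x. \<phi> x * (damped_id' k (mollified W (r n) x) * (?C (r n) x - G x \<bullet> b)))"
    proof (rule Bochner_Integration.integrable_bound)
      show "integrable lborel (\<lambda>x. B * \<bar>?C (r n) x - G x \<bullet> b\<bar>)"
        by (rule integrable_mult_right, rule conv_grad_tendsto(2)[OF SB b gabs])
      show "AE x in lborel. norm (\<phi> x * (damped_id' k (mollified W (r n) x) * (?C (r n) x - G x \<bullet> b))) \<le> norm (B * \<bar>?C (r n) x - G x \<bullet> b\<bar>)"
      proof (rule AE_I2)
        fix x
        have "\<bar>\<phi> x\<bar> * (\<bar>damped_id' k (mollified W (r n) x)\<bar> * \<bar>?C (r n) x - G x \<bullet> b\<bar>) \<le> B * (1 * \<bar>?C (r n) x - G x \<bullet> b\<bar>)"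
          using B[of x] B0 damped_id'_bound by (intro mult_mono) auto
        then show "norm (\<phi> x * (damped_id' k (mollified W (r n) x) * (?C (r n) x - G x \<bullet> b))) \<le> norm (B * \<bar>?C (r n) x - G x \<bullet> b\<bar>)"
          using B0 by (simp add: abs_mult)
      qed
    qed measurable
    have i2: "integrable lborel (\<lambda>x. \<phi> x * (damped_id' k (mollified W (r n) x) * (G x \<bullet> b)))"
    proof (rule Bochner_Integration.integrable_bound)
      show "integrable lborel (\<lambda>x. B * \<bar>G x \<bullet> b\<bar>)" using iG by simp
      show "AE x in lborel. norm (\<phi> x * (damped_id' k (mollified W (r n) x) * (G x \<bullet> b))) \<le> norm (B * \<bar>G x \<bullet> b\<bar>)"
      proof (rule AE_I2)
        fix x
        have "\<bar>\<phi> x\<bar> * (\<bar>damped_id' k (mollified W (r n) x)\<bar> * \<bar>G x \<bullet> b\<bar>) \<le> B * (1 * \<bar>G x \<bullet> b\<bar>)"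
          using B[of x] B0 damped_id'_bound by (intro mult_mono) auto
        then show "norm (\<phi> x * (damped_id' k (mollified W (r n) x) * (G x \<bullet> b))) \<le> norm (B * \<bar>G x \<bullet> b\<bar>)"
          using B0 by (simp add: abs_mult)
      qed
    qed measurable
    have sm: "smooth_on UNIV (\<lambda>x. damped_id k (mollified W (r n) x))"
      by (rule smooth_on_compose_real[OF smooth_damped_id mollified_smooth[OF SB] open_UNIV])
    have pd: "partial_deriv b (\<lambda>x. damped_id k (mollified W (r n) x)) x = damped_id' k (mollified W (r n) x) * partial_deriv b (mollified W (r n)) x" for x
    proof -
      have f: "(damped_id k has_derivative (\<lambda>h. damped_id' k t * h)) (at t)" for t
        using damped_id_deriv[of k t] by (simp add: has_field_derivative_def)
      have "((\<lambda>x. damped_id k (mollified W (r n) x)) has_derivative (\<lambda>h. damped_id' k (mollified W (r n) x) * (\<Sum>b\<in>Basis. (h \<bullet> b) * partial_deriv b (mollified W (r n)) x))) (at x)"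
        by (rule has_derivative_compose[OF smooth_on_has_derivative[OF mollified_smooth[OF SB] open_UNIV UNIV_I] f])
      from partial_deriv_eqI[OF this, of b] show ?thesis by (simp add: sum_Basis_inner[OF b])
    qed
    have "(LINT x|lborel. \<phi> x * (damped_id' k (mollified W (r n) x) * (?C (r n) x - G x \<bullet> b))) + (LINT x|lborel. \<phi> x * (damped_id' k (mollified W (r n) x) * (G x \<bullet> b)))
        = (LINT x|lborel. \<phi> x * (damped_id' k (mollified W (r n) x) * (?C (r n) x - G x \<bullet> b)) + \<phi> x * (damped_id' k (mollified W (r n) x) * (G x \<bullet> b)))"
      by (rule Bochner_Integration.integral_add[symmetric, OF i1 i2])
    also have "\<dots> = (LINT x|lborel. \<phi> x * partial_deriv b (\<lambda>x. damped_id k (mollified W (r n) x)) x)"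
    proof (rule Bochner_Integration.integral_cong[OF refl])
      fix x
      show "\<phi> x * (damped_id' k (mollified W (r n) x) * (?C (r n) x - G x \<bullet> b)) + \<phi> x * (damped_id' k (mollified W (r n) x) * (G x \<bullet> b))
          = \<phi> x * partial_deriv b (\<lambda>x. damped_id k (mollified W (r n) x)) x"
      proof (cases "norm x < s")
        case True
        then have "norm x + 1 / real (Suc (r n)) < R" using n by simp
        from mollified_partial[OF SB b this] show ?thesis by (simp add: pd algebra_simps)
      next
        case False
        then show ?thesis using \<phi>0[of x] by simp
      qed
    qed
    also have "\<dots> = - (LINT x|lborel. partial_deriv b \<phi> x * damped_id k (mollified W (r n) x))"
      by (rule integral_by_parts_test[OF \<phi> sm b])
    finally show "(LINT x|lborel. \<phi> x * (damped_id' k (mollified W (r n) x) * (?C (r n) x - G x \<bullet> b))) + (LINT x|lborel. \<phi> x * (damped_id' k (mollified W (r n) x) * (G x \<bullet> b)))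
      = - (LINT x|lborel. partial_deriv b \<phi> x * damped_id k (mollified W (r n) x))" .
  qed
  from Lim_transform_eventually[OF L3 this] have "(\<lambda>n. - (LINT x|lborel. partial_deriv b \<phi> x * damped_id k (mollified W (r n) x)))
      \<longlonglongrightarrow> (LINT x|lborel. \<phi> x * (damped_id' k (W x) * (G x \<bullet> b)))" .
  moreover have "(\<lambda>n. - (LINT x|lborel. partial_deriv b \<phi> x * damped_id k (mollified W (r n) x))) \<longlonglongrightarrow> - (LINT x|lborel. partial_deriv b \<phi> x * damped_id k (W x))"
    by (rule tendsto_minus[OF L1])
  ultimately show ?thesis by (rule LIMSEQ_unique)
qed

text \<open>In \<open>damped_id_weak_identity\<close> let $k \to \infty$: the right-hand side is at most a multiple of $1/k$, and the left-hand
side tends to the integral of $\phi \partial_b W$ over $\{W = 0\}$. So this part of the gradient is orthogonal to every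
test function.\<close>

theorem stampacchia:
  fixes W :: "'a::euclidean_space \<Rightarrow> real"
  assumes SB: "sobolev_ball R W G"
  shows "AE x in lborel. W x = 0 \<longrightarrow> G x = 0"
proof -
  note [measurable] = sobolev_measurable[OF SB]
  have one: "AE x in lborel. W x = 0 \<longrightarrow> G x \<bullet> b = 0" if b: "b \<in> Basis" for b
  proof -
    have iG: "integrable lborel (\<lambda>x. G x \<bullet> b)" by (rule sobolev_grad_integrable[OF SB b])
    define F where "F x = (if W x = 0 then 1 else 0) * (G x \<bullet> b)" for x
    have Fm [measurable]: "F \<in> borel_measurable borel" unfolding F_def[abs_def] by measurable
    have Fi: "integrable lborel F"
      by (rule Bochner_Integration.integrable_bound[OF iG]) (auto simp: F_def)
    have "AE x in lborel. x \<in> ball 0 R \<longrightarrow> F x = 0"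
    proof (rule fundamental_lemma_ball[OF Fm])
      show "integrable lborel (\<lambda>x. indicator (cball 0 s) x * F x)" for s
        using integrable_mult_indicator[of "cball 0 s" lborel F] Fi by simp
      fix \<phi> assume \<phi>: "\<phi> \<in> test_functions (ball (0::'a) R)"
      note [measurable] = test_functions_measurable[OF \<phi>] test_functions_measurable[OF test_functions_partial[OF \<phi> b]]
        borel_measurable_continuous_onI[OF continuous_damped_id(1)] borel_measurable_continuous_onI[OF continuous_damped_id(2)]
      obtain B where B: "\<And>x. \<bar>\<phi> x\<bar> \<le> B" using test_functions_bounded[OF \<phi>] by blast
      have B0: "B \<ge> 0" using B[of 0] by linarith
      have L1: "(\<lambda>k. LINT x|lborel. \<phi> x * (damped_id' (real (Suc k)) (W x) * (G x \<bullet> b))) \<longlonglongrightarrow> (LINT x|lborel. F x * \<phi> x)"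
      proof (rule integral_dominated_convergence[where w="\<lambda>x. B * \<bar>G x \<bullet> b\<bar>"])
        show "integrable lborel (\<lambda>x. B * \<bar>G x \<bullet> b\<bar>)" using iG by simp
        show "AE x in lborel. (\<lambda>k. \<phi> x * (damped_id' (real (Suc k)) (W x) * (G x \<bullet> b))) \<longlonglongrightarrow> F x * \<phi> x"
        proof (rule AE_I2)
          fix x
          have "(\<lambda>k. \<phi> x * (damped_id' (real (Suc k)) (W x) * (G x \<bullet> b))) \<longlonglongrightarrow> \<phi> x * ((if W x = 0 then 1 else 0) * (G x \<bullet> b))"
            by (intro tendsto_mult tendsto_const damped_id'_tendsto)
          then show "(\<lambda>k. \<phi> x * (damped_id' (real (Suc k)) (W x) * (G x \<bullet> b))) \<longlonglongrightarrow> F x * \<phi> x"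
            by (simp only: F_def mult.commute)
        qed
        show "AE x in lborel. norm (\<phi> x * (damped_id' (real (Suc k)) (W x) * (G x \<bullet> b))) \<le> B * \<bar>G x \<bullet> b\<bar>" for k
        proof (rule AE_I2)
          fix x
          have "\<bar>\<phi> x\<bar> * (\<bar>damped_id' (real (Suc k)) (W x)\<bar> * \<bar>G x \<bullet> b\<bar>) \<le> B * (1 * \<bar>G x \<bullet> b\<bar>)"
            using B[of x] B0 damped_id'_bound by (intro mult_mono) auto
          then show "norm (\<phi> x * (damped_id' (real (Suc k)) (W x) * (G x \<bullet> b))) \<le> B * \<bar>G x \<bullet> b\<bar>" by (simp add: abs_mult)
        qed
      qed measurable
      have i: "integrable lborel (\<lambda>x. \<bar>partial_deriv b \<phi> x\<bar>)"
        using test_functions_integrable[OF test_functions_partial[OF \<phi> b]] by simp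
      have "(\<lambda>k. LINT x|lborel. \<phi> x * (damped_id' (real (Suc k)) (W x) * (G x \<bullet> b))) \<longlonglongrightarrow> 0"
      proof (rule Lim_null_comparison)
        show "(\<lambda>k. (1 / real (Suc k)) * (LINT x|lborel. \<bar>partial_deriv b \<phi> x\<bar>)) \<longlonglongrightarrow> 0"
          using tendsto_mult_right[OF LIMSEQ_Suc[OF lim_1_over_n], of "LINT x|lborel. \<bar>partial_deriv b \<phi> x\<bar>"] by simp
        show "\<forall>\<^sub>F k in sequentially. norm (LINT x|lborel. \<phi> x * (damped_id' (real (Suc k)) (W x) * (G x \<bullet> b))) \<le> (1 / real (Suc k)) * (LINT x|lborel. \<bar>partial_deriv b \<phi> x\<bar>)"
        proof (rule always_eventually, rule allI)
          fix k
          have bd: "norm (partial_deriv b \<phi> x * damped_id (real (Suc k)) (W x)) \<le> (1 / real (Suc k)) * \<bar>partial_deriv b \<phi> x\<bar>" for x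
          proof -
            have "\<bar>damped_id (real (Suc k)) (W x)\<bar> * \<bar>partial_deriv b \<phi> x\<bar> \<le> (1 / real (Suc k)) * \<bar>partial_deriv b \<phi> x\<bar>"
              by (intro mult_right_mono damped_id_bound) auto
            then show ?thesis by (simp only: real_norm_def abs_mult mult.commute)
          qed
          have "norm (LINT x|lborel. partial_deriv b \<phi> x * damped_id (real (Suc k)) (W x)) \<le> (LINT x|lborel. (1 / real (Suc k)) * \<bar>partial_deriv b \<phi> x\<bar>)"
          proof (rule order_trans[OF integral_norm_bound], rule integral_mono[OF _ _ bd])
            show i2: "integrable lborel (\<lambda>x. (1 / real (Suc k)) * \<bar>partial_deriv b \<phi> x\<bar>)" by (rule integrable_mult_right[OF i])
            show "integrable lborel (\<lambda>x. norm (partial_deriv b \<phi> x * damped_id (real (Suc k)) (W x)))"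
            proof (rule Bochner_Integration.integrable_bound[OF i2])
              show "AE x in lborel. norm (norm (partial_deriv b \<phi> x * damped_id (real (Suc k)) (W x))) \<le> norm ((1 / real (Suc k)) * \<bar>partial_deriv b \<phi> x\<bar>)"
                by (rule AE_I2) (use order_trans[OF bd abs_ge_self] in simp)
            qed measurable
          qed
          then show "norm (LINT x|lborel. \<phi> x * (damped_id' (real (Suc k)) (W x) * (G x \<bullet> b))) \<le> (1 / real (Suc k)) * (LINT x|lborel. \<bar>partial_deriv b \<phi> x\<bar>)"
            unfolding integral_mult_right_zero by (subst damped_id_weak_identity[OF SB b \<phi>]) simp_all
        qed
      qed
      from LIMSEQ_unique[OF L1 this] show "(LINT x|lborel. F x * \<phi> x) = 0" .
    qed
    then show ?thesis
    proof eventually_elim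
      fix x assume x: "x \<in> ball 0 R \<longrightarrow> F x = 0"
      show "W x = 0 \<longrightarrow> G x \<bullet> b = 0"
        using x sobolev_zero_outside(2)[OF SB, of x] by (cases "norm x < R") (auto simp: F_def)
    qed
  qed
  have "AE x in lborel. \<forall>b\<in>Basis. W x = 0 \<longrightarrow> G x \<bullet> b = 0"
    using one by (intro AE_finite_allI) auto
  then show ?thesis
    by eventually_elim (metis euclidean_all_zero_iff)
qed

section \<open>Restriction to almost every sphere\<close>

text \<open>By polar coordinates, convergence to zero of the integral over the ball of all squared errors is convergence in $L^1(dt)$
of the integrals over the spheres. A subsequence converges for almost every radius. In particular the Borel
representative restricted to such a sphere is the $L^2$ limit of smooth functions, so that it plays the part of a trace.\<close>

theorem sphere_slices:
  fixes W :: "'i \<Rightarrow> 'a::euclidean_space \<Rightarrow> real"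
  assumes I: "finite I" and SB: "\<And>i. i \<in> I \<Longrightarrow> sobolev_ball R (W i) (G i)" and s: "s < R"
  shows "\<exists>\<rho>::nat\<Rightarrow>nat. strict_mono \<rho> \<and> (AE t in lborel. 0 < t \<and> t < s \<longrightarrow> (\<forall>i\<in>I.
     (\<forall>n. integrable sphere_measure (\<lambda>\<theta>. (mollified (W i) n (t *\<^sub>R \<theta>) - W i (t *\<^sub>R \<theta>))\<^sup>2)) \<and>
     (\<forall>n. integrable sphere_measure (\<lambda>\<theta>. (norm (grad (mollified (W i) n) (t *\<^sub>R \<theta>) - G i (t *\<^sub>R \<theta>)))\<^sup>2)) \<and>
     (\<lambda>n. LINT \<theta>|sphere_measure. (mollified (W i) (\<rho> n) (t *\<^sub>R \<theta>) - W i (t *\<^sub>R \<theta>))\<^sup>2) \<longlonglongrightarrow> 0 \<and>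
     (\<lambda>n. LINT \<theta>|sphere_measure. (norm (grad (mollified (W i) (\<rho> n)) (t *\<^sub>R \<theta>) - G i (t *\<^sub>R \<theta>)))\<^sup>2) \<longlonglongrightarrow> 0))"
proof -
  \<comment> \<open>One function for all errors, so that a single subsequence serves all indices.\<close>
  define E where "E n x = (\<Sum>i\<in>I. (mollified (W i) n x - W i x)\<^sup>2 + indicator (ball 0 s) x * (norm (grad (mollified (W i) n) x - G i x))\<^sup>2)" for n x
  have Ei: "integrable lborel (E n)" for n unfolding E_def[abs_def]
    by (intro Bochner_Integration.integrable_sum Bochner_Integration.integrable_add mollified_tendsto_L2(2) grad_mollified_tendsto(2)) (use SB s in auto)
  have E0: "E n x \<ge> 0" for n x unfolding E_def by (intro sum_nonneg) simp
  have "(\<lambda>n. \<Sum>i\<in>I. (LINT x|lborel. (mollified (W i) n x - W i x)\<^sup>2) + (LINT x|lborel. indicator (ball 0 s) x * (norm (grad (mollified (W i) n) x - G i x))\<^sup>2)) \<longlonglongrightarrow> (\<Sum>i\<in>I. 0 + 0)"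
    by (intro tendsto_sum tendsto_add mollified_tendsto_L2(1) grad_mollified_tendsto(1)) (use SB s in auto)
  moreover have "(LINT x|lborel. E n x) = (\<Sum>i\<in>I. (LINT x|lborel. (mollified (W i) n x - W i x)\<^sup>2) + (LINT x|lborel. indicator (ball 0 s) x * (norm (grad (mollified (W i) n) x - G i x))\<^sup>2))" for n
  proof -
    have "(LINT x|lborel. E n x) = (\<Sum>i\<in>I. LINT x|lborel. ((mollified (W i) n x - W i x)\<^sup>2 + indicator (ball 0 s) x * (norm (grad (mollified (W i) n) x - G i x))\<^sup>2))"
      unfolding E_def
      by (intro Bochner_Integration.integral_sum Bochner_Integration.integrable_add mollified_tendsto_L2(2) grad_mollified_tendsto(2)) (use SB s in auto)
    also have "\<dots> = (\<Sum>i\<in>I. (LINT x|lborel. (mollified (W i) n x - W i x)\<^sup>2) + (LINT x|lborel. indicator (ball 0 s) x * (norm (grad (mollified (W i) n) x - G i x))\<^sup>2))"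
      by (intro sum.cong refl Bochner_Integration.integral_add mollified_tendsto_L2(2) grad_mollified_tendsto(2)) (use SB s in auto)
    finally show ?thesis .
  qed
  ultimately have El: "(\<lambda>n. LINT x|lborel. E n x) \<longlonglongrightarrow> 0" by simp
  define e where "e n t = t ^ (DIM('a) - 1) * indicator {0<..} t * (LINT \<theta>|sphere_measure. E n (t *\<^sub>R \<theta>))" for n and t :: real
  have ei: "integrable lborel (e n)" for n unfolding e_def[abs_def] by (rule polar_integral(1)[OF Ei])
  have e0: "e n t \<ge> 0" for n t unfolding e_def
    by (cases "t > 0") (auto intro!: mult_nonneg_nonneg integral_nonneg_AE AE_I2 E0)
  have "(LINT t|lborel. \<bar>e n t\<bar>) = (LINT x|lborel. E n x)" for n
    unfolding polar_integral(2)[OF Ei] e_def[symmetric] using e0 by simp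
  then have el: "(\<lambda>n. LINT t|lborel. \<bar>e n t\<bar>) \<longlonglongrightarrow> 0" using El by simp
  obtain \<rho> where \<rho>: "strict_mono (\<rho>::nat\<Rightarrow>nat)" "AE t in lborel. (\<lambda>n. e (\<rho> n) t) \<longlonglongrightarrow> 0"
    using AE_subseq_of_L1[OF ei el] by blast
  have "AE t in lborel. \<forall>n. t > 0 \<longrightarrow> integrable sphere_measure (\<lambda>\<theta>. E n (t *\<^sub>R \<theta>))"
    unfolding AE_all_countable using polar_integral(3)[OF Ei] by blast
  with \<rho>(2) have "AE t in lborel. 0 < t \<and> t < s \<longrightarrow> (\<forall>i\<in>I.
     (\<forall>n. integrable sphere_measure (\<lambda>\<theta>. (mollified (W i) n (t *\<^sub>R \<theta>) - W i (t *\<^sub>R \<theta>))\<^sup>2)) \<and>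
     (\<forall>n. integrable sphere_measure (\<lambda>\<theta>. (norm (grad (mollified (W i) n) (t *\<^sub>R \<theta>) - G i (t *\<^sub>R \<theta>)))\<^sup>2)) \<and>
     (\<lambda>n. LINT \<theta>|sphere_measure. (mollified (W i) (\<rho> n) (t *\<^sub>R \<theta>) - W i (t *\<^sub>R \<theta>))\<^sup>2) \<longlonglongrightarrow> 0 \<and>
     (\<lambda>n. LINT \<theta>|sphere_measure. (norm (grad (mollified (W i) (\<rho> n)) (t *\<^sub>R \<theta>) - G i (t *\<^sub>R \<theta>)))\<^sup>2) \<longlonglongrightarrow> 0)"
  proof eventually_elim
    fix t assume l: "(\<lambda>n. e (\<rho> n) t) \<longlonglongrightarrow> 0" and it: "\<forall>n. t > 0 \<longrightarrow> integrable sphere_measure (\<lambda>\<theta>. E n (t *\<^sub>R \<theta>))"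
    show "0 < t \<and> t < s \<longrightarrow> (\<forall>i\<in>I.
     (\<forall>n. integrable sphere_measure (\<lambda>\<theta>. (mollified (W i) n (t *\<^sub>R \<theta>) - W i (t *\<^sub>R \<theta>))\<^sup>2)) \<and>
     (\<forall>n. integrable sphere_measure (\<lambda>\<theta>. (norm (grad (mollified (W i) n) (t *\<^sub>R \<theta>) - G i (t *\<^sub>R \<theta>)))\<^sup>2)) \<and>
     (\<lambda>n. LINT \<theta>|sphere_measure. (mollified (W i) (\<rho> n) (t *\<^sub>R \<theta>) - W i (t *\<^sub>R \<theta>))\<^sup>2) \<longlonglongrightarrow> 0 \<and>
     (\<lambda>n. LINT \<theta>|sphere_measure. (norm (grad (mollified (W i) (\<rho> n)) (t *\<^sub>R \<theta>) - G i (t *\<^sub>R \<theta>)))\<^sup>2) \<longlonglongrightarrow> 0)"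
    proof (intro impI ballI)
      assume t: "0 < t \<and> t < s" fix i assume i: "i \<in> I"
      note sb = SB[OF i]
      note [measurable] = sobolev_measurable[OF sb] mollified_measurable[OF sb]
      have iE: "integrable sphere_measure (\<lambda>\<theta>. E n (t *\<^sub>R \<theta>))" for n using it t by blast
      have "(\<lambda>n. e (\<rho> n) t / t ^ (DIM('a) - 1)) \<longlonglongrightarrow> 0 / t ^ (DIM('a) - 1)"
        by (intro tendsto_divide l tendsto_const) (use t in simp)
      then have lE: "(\<lambda>n. LINT \<theta>|sphere_measure. E (\<rho> n) (t *\<^sub>R \<theta>)) \<longlonglongrightarrow> 0"
        using t by (simp add: e_def)
      let ?w = "\<lambda>n \<theta>. (mollified (W i) n (t *\<^sub>R \<theta>) - W i (t *\<^sub>R \<theta>))\<^sup>2"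
      let ?g = "\<lambda>n \<theta>. (norm (grad (mollified (W i) n) (t *\<^sub>R \<theta>) - G i (t *\<^sub>R \<theta>)))\<^sup>2"
      have le: "?w n \<theta> \<le> E n (t *\<^sub>R \<theta>)" "?g n \<theta> \<le> E n (t *\<^sub>R \<theta>)" if "\<theta> \<in> space sphere_measure" for n \<theta>
      proof -
        have b: "t *\<^sub>R \<theta> \<in> ball 0 s" using that t by (simp add: space_sphere_measure)
        have "(mollified (W i) n (t *\<^sub>R \<theta>) - W i (t *\<^sub>R \<theta>))\<^sup>2 + indicator (ball 0 s) (t *\<^sub>R \<theta>) * (norm (grad (mollified (W i) n) (t *\<^sub>R \<theta>) - G i (t *\<^sub>R \<theta>)))\<^sup>2 \<le> E n (t *\<^sub>R \<theta>)"
          unfolding E_def by (rule member_le_sum[OF i _ I]) simp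
        then have s2: "?w n \<theta> + ?g n \<theta> \<le> E n (t *\<^sub>R \<theta>)" using b by simp
        show "?w n \<theta> \<le> E n (t *\<^sub>R \<theta>)" using s2 zero_le_power2[of "norm (grad (mollified (W i) n) (t *\<^sub>R \<theta>) - G i (t *\<^sub>R \<theta>))"] by linarith
        show "?g n \<theta> \<le> E n (t *\<^sub>R \<theta>)" using s2 zero_le_power2[of "mollified (W i) n (t *\<^sub>R \<theta>) - W i (t *\<^sub>R \<theta>)"] by linarith
      qed
      have iw: "integrable sphere_measure (?w n)" for n
      proof (rule Bochner_Integration.integrable_bound[OF iE])
        show "?w n \<in> borel_measurable sphere_measure"
          by (rule sphere_comp_measurable[of "\<lambda>x. (mollified (W i) n x - W i x)\<^sup>2"]) measurable
        show "AE \<theta> in sphere_measure. norm (?w n \<theta>) \<le> norm (E n (t *\<^sub>R \<theta>))"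
          using le(1)[of _ n] E0 by (intro AE_I2) simp
      qed
      have ig: "integrable sphere_measure (?g n)" for n
      proof (rule Bochner_Integration.integrable_bound[OF iE])
        show "?g n \<in> borel_measurable sphere_measure"
          by (rule sphere_comp_measurable[of "\<lambda>x. (norm (grad (mollified (W i) n) x - G i x))\<^sup>2"]) measurable
        show "AE \<theta> in sphere_measure. norm (?g n \<theta>) \<le> norm (E n (t *\<^sub>R \<theta>))"
          using le(2)[of _ n] E0 by (intro AE_I2) simp
      qed
      have "(\<lambda>n. LINT \<theta>|sphere_measure. ?w (\<rho> n) \<theta>) \<longlonglongrightarrow> 0"
        by (rule tendsto_sandwich[OF _ _ tendsto_const lE])
           (auto intro!: always_eventually integral_nonneg_AE integral_mono[OF iw iE] le(1))
      moreover have "(\<lambda>n. LINT \<theta>|sphere_measure. ?g (\<rho> n) \<theta>) \<longlonglongrightarrow> 0"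
        by (rule tendsto_sandwich[OF _ _ tendsto_const lE])
           (auto intro!: always_eventually integral_nonneg_AE integral_mono[OF ig iE] le(2))
      ultimately show "(\<forall>n. integrable sphere_measure (?w n)) \<and> (\<forall>n. integrable sphere_measure (?g n)) \<and>
        (\<lambda>n. LINT \<theta>|sphere_measure. ?w (\<rho> n) \<theta>) \<longlonglongrightarrow> 0 \<and> (\<lambda>n. LINT \<theta>|sphere_measure. ?g (\<rho> n) \<theta>) \<longlonglongrightarrow> 0"
        using iw ig by blast
    qed
  qed
  then show ?thesis using \<rho>(1) by blast
qed

section \<open>Tangential gradients and eigenvalues of spherical domains\<close>

definition tangential :: "'a::euclidean_space \<Rightarrow> 'a \<Rightarrow> 'a" where "tangential \<theta> p = p - (p \<bullet> \<theta>) *\<^sub>R \<theta>"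

lemma norm_tangential_sq: "norm \<theta> = 1 \<Longrightarrow> (norm (tangential \<theta> p))\<^sup>2 = (norm p)\<^sup>2 - (p \<bullet> \<theta>)\<^sup>2"
proof -
  assume "norm \<theta> = 1"
  then have "\<theta> \<bullet> \<theta> = 1" by (simp add: dot_square_norm)
  then show ?thesis
    unfolding power2_norm_eq_inner tangential_def
    by (simp add: inner_diff_left inner_diff_right inner_commute power2_eq_square)
qed

lemma norm_tangential_le: "norm \<theta> = 1 \<Longrightarrow> norm (tangential \<theta> p) \<le> norm p"
  by (rule power2_le_imp_le) (simp_all add: norm_tangential_sq)

lemma tangential_diff: "tangential \<theta> p - tangential \<theta> q = tangential \<theta> (p - q)"
  by (simp add: tangential_def inner_diff_left algebra_simps)

lemma tangential_scaleR: "tangential \<theta> (c *\<^sub>R p) = c *\<^sub>R tangential \<theta> p"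
  by (simp add: tangential_def algebra_simps)

lemma smooth_radial:
  fixes V :: "'a::euclidean_space \<Rightarrow> real"
  assumes V: "smooth_on UNIV V"
  shows "smooth_on (-{0}) (radial_ext (\<lambda>x. V (r *\<^sub>R x)))"
  unfolding radial_ext_def[abs_def] smooth_on_def
proof
  fix k show "Ck_on k (-{0}) (\<lambda>x::'a. V (r *\<^sub>R (x /\<^sub>R norm x)))"
  proof (rule Ck_on_compose[where V=UNIV and f=V and T="\<lambda>x. r *\<^sub>R (x /\<^sub>R norm x)"])
    show "Ck_on k UNIV V" using V by (simp add: smooth_on_def)
    fix b :: 'a
    have "Ck_on k (-{0}) (\<lambda>x::'a. r * ((x /\<^sub>R norm x) \<bullet> b))"
      by (intro Ck_on_mult Ck_on_const) (use smooth_on_normalize_inner[of b] in \<open>auto simp: smooth_on_def\<close>)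
    then show "Ck_on k (-{0}) (\<lambda>x::'a. (r *\<^sub>R (x /\<^sub>R norm x)) \<bullet> b)" by (simp add: mult.assoc)
  qed auto
qed

text \<open>The extension of degree zero is \<open>V\<close> composed with the radial projection, whose derivative at a unit vector is the
projection onto the tangent space.\<close>

lemma sphere_grad_radial:
  fixes V :: "'a::euclidean_space \<Rightarrow> real"
  assumes V: "smooth_on UNIV V" and \<theta>: "norm \<theta> = 1"
  shows "sphere_grad (\<lambda>x. V (r *\<^sub>R x)) \<theta> = r *\<^sub>R tangential \<theta> (grad V (r *\<^sub>R \<theta>))"
proof -
  have \<theta>0: "\<theta> \<noteq> 0" and sg: "sgn \<theta> = \<theta>" using \<theta> by (auto simp: sgn_div_norm)
  have dn: "(norm has_derivative (\<lambda>h. h \<bullet> \<theta>)) (at \<theta>)"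
    using has_derivative_norm[OF \<theta>0] sg by simp
  have di: "((\<lambda>x. inverse (norm x)) has_derivative (\<lambda>h. - (h \<bullet> \<theta>))) (at \<theta>)"
    using Deriv.has_derivative_inverse[OF _ dn] \<theta> by simp
  have d: "((\<lambda>x. r *\<^sub>R (x /\<^sub>R norm x)) has_derivative (\<lambda>h. r *\<^sub>R (h - (h \<bullet> \<theta>) *\<^sub>R \<theta>))) (at \<theta>)"
    using has_derivative_scaleR_right[OF has_derivative_scaleR[OF di has_derivative_ident], of r] \<theta>
    by (simp add: algebra_simps)
  have e: "r *\<^sub>R (\<theta> /\<^sub>R norm \<theta>) = r *\<^sub>R \<theta>" using \<theta> by simp
  have f: "(V has_derivative (\<lambda>h. grad V (r *\<^sub>R \<theta>) \<bullet> h)) (at (r *\<^sub>R (\<theta> /\<^sub>R norm \<theta>)))"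
    unfolding e inner_grad by (rule smooth_on_has_derivative[OF V open_UNIV UNIV_I])
  have D: "(radial_ext (\<lambda>x. V (r *\<^sub>R x)) has_derivative (\<lambda>h. grad V (r *\<^sub>R \<theta>) \<bullet> (r *\<^sub>R (h - (h \<bullet> \<theta>) *\<^sub>R \<theta>)))) (at \<theta>)"
    unfolding radial_ext_def[abs_def] by (rule has_derivative_compose[OF d f])
  have "grad (radial_ext (\<lambda>x. V (r *\<^sub>R x))) \<theta> = (\<Sum>b\<in>Basis. ((r *\<^sub>R tangential \<theta> (grad V (r *\<^sub>R \<theta>))) \<bullet> b) *\<^sub>R b)"
    unfolding grad_def
  proof (rule sum.cong[OF refl])
    fix b :: 'a
    show "partial_deriv b (radial_ext (\<lambda>x. V (r *\<^sub>R x))) \<theta> *\<^sub>R b = ((r *\<^sub>R tangential \<theta> (\<Sum>b\<in>Basis. partial_deriv b V (r *\<^sub>R \<theta>) *\<^sub>R b)) \<bullet> b) *\<^sub>R b"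
      unfolding partial_deriv_eqI[OF D] grad_def[symmetric] tangential_def
      by (simp add: inner_diff_right inner_diff_left inner_commute mult.commute right_diff_distrib)
  qed
  also have "\<dots> = r *\<^sub>R tangential \<theta> (grad V (r *\<^sub>R \<theta>))" by (rule euclidean_representation)
  finally show ?thesis by (simp add: sphere_grad_def)
qed

lemma openin_sphere_sets:
  assumes "openin (top_of_set (sphere (0::'a::euclidean_space) 1)) C" shows "C \<in> sets sphere_measure"
proof -
  obtain T where "open T" "C = sphere 0 1 \<inter> T" using assms unfolding openin_open by blast
  then show ?thesis unfolding sets_sphere_measure sets_restrict_space by auto
qed

lemma cone_open:
  assumes "openin (top_of_set (sphere (0::'a::euclidean_space) 1)) C"
  shows "open {x::'a. x \<noteq> 0 \<and> x /\<^sub>R norm x \<in> C}"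
proof -
  obtain T where T: "open T" "C = sphere 0 1 \<inter> T" using assms unfolding openin_open by blast
  have "open ((-{0}) \<inter> (\<lambda>x::'a. x /\<^sub>R norm x) -` T)"
    by (rule continuous_open_preimage) (auto intro!: continuous_intros T)
  also have "(-{0}) \<inter> (\<lambda>x::'a. x /\<^sub>R norm x) -` T = {x::'a. x \<noteq> 0 \<and> x /\<^sub>R norm x \<in> C}"
    using T(2) by auto
  finally show ?thesis .
qed

text \<open>The components of the open set are open and disjoint, and finitely many cover the compact set \<open>K\<close>. If each of them had a
Rayleigh quotient at least \<open>\<kappa>\<close>, summation would contradict the strict inequality for the whole sphere. On a good
component the restriction of the function is again a test function, since \<open>K\<close> meets it in a closed set.\<close>

lemma exists_component:
  fixes V :: "'a::euclidean_space \<Rightarrow> real"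
  assumes V: "smooth_on UNIV V" and O: "openin (top_of_set (sphere 0 1)) \<O>"
    and K: "compact K" "K \<subseteq> \<O>" and supp: "\<And>\<theta>. norm \<theta> = 1 \<Longrightarrow> V (r *\<^sub>R \<theta>) \<noteq> 0 \<Longrightarrow> \<theta> \<in> K"
    and less: "(LINT \<theta>|sphere_measure. (norm (r *\<^sub>R tangential \<theta> (grad V (r *\<^sub>R \<theta>))))\<^sup>2)
        < \<kappa> * (LINT \<theta>|sphere_measure. (V (r *\<^sub>R \<theta>))\<^sup>2)"
  shows "\<exists>C\<in>components \<O>. openin (top_of_set (sphere 0 1)) C \<and> first_eigenvalue C \<le> \<kappa>"
proof -
  let ?S = "sphere (0::'a) 1"
  define v where "v x = V (r *\<^sub>R x)" for x
  define G where "G \<theta> = r *\<^sub>R tangential \<theta> (grad V (r *\<^sub>R \<theta>))" for \<theta>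
  have Vc: "continuous_on UNIV V" and gc: "continuous_on UNIV (grad V)"
    using smooth_on_continuous[OF V] continuous_grad[OF V] .
  have vc: "continuous_on A v" for A unfolding v_def[abs_def]
    by (intro continuous_on_compose2[OF Vc] continuous_intros) auto
  have Gc: "continuous_on A G" for A unfolding G_def[abs_def] tangential_def
    by (intro continuous_intros continuous_on_compose2[OF gc]) auto
  have OS: "\<O> \<subseteq> ?S" using O by (rule openin_imp_subset)
  have comp_open: "openin (top_of_set ?S) C" if "C \<in> components \<O>" for C
    using openin_components_locally_connected[OF locally_open_subset[OF locally_connected_sphere O] that]
      O openin_trans by blast
  \<comment> \<open>Open sets \<open>T C\<close> of the ambient space that cut out the components, to which compactness of \<open>K\<close> is applied.\<close>
  have "\<exists>T. open T \<and> C = ?S \<inter> T" if "C \<in> components \<O>" for C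
    using comp_open[OF that] unfolding openin_open by blast
  then obtain T where T: "\<And>C. C \<in> components \<O> \<Longrightarrow> open (T C) \<and> C = ?S \<inter> T C" by metis
  have "K \<subseteq> (\<Union>C\<in>components \<O>. T C)"
  proof
    fix x assume "x \<in> K"
    then have "x \<in> \<Union>(components \<O>)" using K(2) by auto
    then show "x \<in> (\<Union>C\<in>components \<O>. T C)" using T by blast
  qed
  then obtain \<C> where \<C>: "\<C> \<subseteq> components \<O>" "finite \<C>" "K \<subseteq> (\<Union>C\<in>\<C>. T C)"
    using compactE_image[OF K(1), of "components \<O>" T] T by metis
  have cover: "K \<subseteq> \<Union>\<C>"
  proof
    fix x assume x: "x \<in> K"
    then obtain C where "C \<in> \<C>" "x \<in> T C" using \<C>(3) by blast
    moreover have "x \<in> ?S" using x K(2) OS by blast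
    ultimately show "x \<in> \<Union>\<C>" using T \<C>(1) by blast
  qed
  have disj: "C \<inter> D = {}" if "C \<in> \<C>" "D \<in> \<C>" "C \<noteq> D" for C D
    using pairwise_disjoint_components[of \<O>] that \<C>(1) unfolding pairwise_def by blast
  have Cm: "C \<in> sets sphere_measure" if "C \<in> \<C>" for C
    using comp_open \<C>(1) that openin_sphere_sets by blast
  have iv: "integrable sphere_measure (\<lambda>\<theta>. (v \<theta>)\<^sup>2)"
    by (intro sphere_integrable_continuous continuous_intros vc)
  have iG: "integrable sphere_measure (\<lambda>\<theta>. (norm (G \<theta>))\<^sup>2)"
    by (intro sphere_integrable_continuous continuous_intros Gc)
  have ivC: "integrable sphere_measure (\<lambda>\<theta>. indicator C \<theta> *\<^sub>R (v \<theta>)\<^sup>2)" if "C \<in> \<C>" for C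
    by (rule integrable_mult_indicator[OF Cm[OF that] iv])
  have iGC: "integrable sphere_measure (\<lambda>\<theta>. indicator C \<theta> *\<^sub>R (norm (G \<theta>))\<^sup>2)" if "C \<in> \<C>" for C
    by (rule integrable_mult_indicator[OF Cm[OF that] iG])
  have v0: "v \<theta> = 0" if "\<theta> \<in> ?S" "\<theta> \<notin> K" for \<theta>
    using supp[of \<theta>] that by (auto simp: v_def)
  have indsum: "(\<Sum>C\<in>\<C>. indicator C \<theta> :: real) = indicator (\<Union>\<C>) \<theta>" for \<theta>
  proof (cases "\<theta> \<in> \<Union>\<C>")
    case True
    then obtain C0 where C0: "C0 \<in> \<C>" "\<theta> \<in> C0" by blast
    have "(\<Sum>C\<in>\<C>. indicator C \<theta> :: real) = (\<Sum>C\<in>\<C>. if C = C0 then 1 else 0)"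
      using disj C0 by (intro sum.cong refl) (auto simp: indicator_def)
    then show ?thesis using C0 \<C>(2) True by simp
  qed (auto simp: indicator_def intro!: sum.neutral)
  have sumv: "(\<Sum>C\<in>\<C>. LINT \<theta>|sphere_measure. indicator C \<theta> *\<^sub>R (v \<theta>)\<^sup>2) = (LINT \<theta>|sphere_measure. (v \<theta>)\<^sup>2)"
  proof -
    have "(\<Sum>C\<in>\<C>. LINT \<theta>|sphere_measure. indicator C \<theta> *\<^sub>R (v \<theta>)\<^sup>2) = (LINT \<theta>|sphere_measure. (\<Sum>C\<in>\<C>. indicator C \<theta> *\<^sub>R (v \<theta>)\<^sup>2))"
      by (rule Bochner_Integration.integral_sum[symmetric, OF ivC])
    also have "\<dots> = (LINT \<theta>|sphere_measure. (v \<theta>)\<^sup>2)"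
    proof (rule Bochner_Integration.integral_cong[OF refl])
      fix \<theta> :: 'a assume "\<theta> \<in> space sphere_measure"
      then have "\<theta> \<in> ?S" by (simp add: space_sphere_measure)
      then show "(\<Sum>C\<in>\<C>. indicator C \<theta> *\<^sub>R (v \<theta>)\<^sup>2) = (v \<theta>)\<^sup>2"
        using v0[of \<theta>] subsetD[OF cover, of \<theta>] unfolding scaleR_sum_left[symmetric] indsum
        by (cases "\<theta> \<in> K") (simp_all del: Union_iff)
    qed
    finally show ?thesis .
  qed
  have sumG: "(\<Sum>C\<in>\<C>. LINT \<theta>|sphere_measure. indicator C \<theta> *\<^sub>R (norm (G \<theta>))\<^sup>2) \<le> (LINT \<theta>|sphere_measure. (norm (G \<theta>))\<^sup>2)"
  proof -
    have "(\<Sum>C\<in>\<C>. LINT \<theta>|sphere_measure. indicator C \<theta> *\<^sub>R (norm (G \<theta>))\<^sup>2) = (LINT \<theta>|sphere_measure. (\<Sum>C\<in>\<C>. indicator C \<theta> *\<^sub>R (norm (G \<theta>))\<^sup>2))"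
      by (rule Bochner_Integration.integral_sum[symmetric, OF iGC])
    also have "\<dots> \<le> (LINT \<theta>|sphere_measure. (norm (G \<theta>))\<^sup>2)"
    proof (rule integral_mono[OF _ iG])
      show "integrable sphere_measure (\<lambda>\<theta>. \<Sum>C\<in>\<C>. indicator C \<theta> *\<^sub>R (norm (G \<theta>))\<^sup>2)"
        by (rule Bochner_Integration.integrable_sum[OF iGC])
      show "(\<Sum>C\<in>\<C>. indicator C \<theta> *\<^sub>R (norm (G \<theta>))\<^sup>2) \<le> (norm (G \<theta>))\<^sup>2" for \<theta>
        unfolding scaleR_sum_left[symmetric] indsum by (simp add: indicator_def)
    qed
    finally show ?thesis .
  qed
  have "\<exists>C\<in>\<C>. (LINT \<theta>|sphere_measure. indicator C \<theta> *\<^sub>R (norm (G \<theta>))\<^sup>2) < \<kappa> * (LINT \<theta>|sphere_measure. indicator C \<theta> *\<^sub>R (v \<theta>)\<^sup>2)"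
  proof (rule ccontr)
    assume "\<not> ?thesis"
    then have "(\<Sum>C\<in>\<C>. \<kappa> * (LINT \<theta>|sphere_measure. indicator C \<theta> *\<^sub>R (v \<theta>)\<^sup>2)) \<le> (\<Sum>C\<in>\<C>. LINT \<theta>|sphere_measure. indicator C \<theta> *\<^sub>R (norm (G \<theta>))\<^sup>2)"
      by (intro sum_mono) (simp add: not_less)
    then show False using less sumv sumG unfolding sum_distrib_left[symmetric] by (simp add: v_def G_def)
  qed
  then obtain C where C: "C \<in> \<C>" and lt: "(LINT \<theta>|sphere_measure. indicator C \<theta> *\<^sub>R (norm (G \<theta>))\<^sup>2) < \<kappa> * (LINT \<theta>|sphere_measure. indicator C \<theta> *\<^sub>R (v \<theta>)\<^sup>2)" by blast
  have CO: "C \<in> components \<O>" using C \<C>(1) by blast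
  note Cop = comp_open[OF CO]
  have CS: "C \<subseteq> ?S" using Cop by (rule openin_imp_subset)
  \<comment> \<open>The other components together form an open set, so removing them from \<open>K\<close> leaves a closed set.\<close>
  have KC: "closed (K \<inter> C)"
  proof -
    have "openin (top_of_set ?S) (\<Union>(components \<O> - {C}))" using comp_open by (intro openin_Union) auto
    then have "openin (top_of_set ?S) (\<O> - C)" using in_components_unions_complement[OF CO] by simp
    then obtain T' where T': "open T'" "\<O> - C = ?S \<inter> T'" unfolding openin_open by blast
    have "K \<inter> C = K - T'"
    proof
      show "K \<inter> C \<subseteq> K - T'" using T'(2) CS by blast
      show "K - T' \<subseteq> K \<inter> C"
      proof
        fix x assume "x \<in> K - T'"
        moreover then have "x \<in> \<O>" "x \<in> ?S" using K(2) OS by auto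
        ultimately show "x \<in> K \<inter> C" using T'(2) by blast
      qed
    qed
    then show ?thesis using T'(1) compact_imp_closed[OF K(1)] by (simp add: closed_Diff)
  qed
  define vC where "vC x = (if x \<in> C then v x else 0)" for x
  \<comment> \<open>Two open cones cover the complement of the origin: on \<open>U1\<close> the extension of \<open>vC\<close> is that of \<open>v\<close>, on \<open>U2\<close> it is zero.\<close>
  define U1 where "U1 = {x::'a. x \<noteq> 0 \<and> x /\<^sub>R norm x \<in> C}"
  define U2 where "U2 = {x::'a. x \<noteq> 0 \<and> x /\<^sub>R norm x \<in> ?S - (K \<inter> C)}"
  have U1: "open U1" unfolding U1_def by (rule cone_open[OF Cop])
  have U2: "open U2" unfolding U2_def
    by (rule cone_open) (metis KC openin_diff closed_subset openin_subtopology_self Diff_Int_distrib closedin_closed_Int Int_commute openin_open_Int open_Compl Diff_eq)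
  have nS: "x /\<^sub>R norm x \<in> ?S" if "x \<noteq> 0" for x :: 'a using that by simp
  have UU: "- {0} = U1 \<union> U2" using nS by (auto simp: U1_def U2_def)
  have e1: "radial_ext vC x = radial_ext v x" if "x \<in> U1" for x
    using that by (simp add: radial_ext_def vC_def U1_def)
  have e2: "radial_ext vC x = 0" if "x \<in> U2" for x
    using that v0[of "x /\<^sub>R norm x"] by (auto simp: radial_ext_def vC_def U2_def)
  have rs: "smooth_on (-{0}) (radial_ext v)" unfolding v_def by (rule smooth_radial[OF V])
  have "smooth_on (-{0}) (radial_ext vC)"
    unfolding smooth_on_def UU
  proof (rule allI, rule Ck_on_union[OF U1 U2])
    fix k
    have "Ck_on k (-{0}) (radial_ext v)" using rs by (simp add: smooth_on_def)
    then have "Ck_on k U1 (radial_ext v)" by (rule Ck_on_subset) (use UU in blast)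
    then show "Ck_on k U1 (radial_ext vC)" by (rule Ck_on_cong[OF U1 e1, THEN iffD2, rotated])
    show "Ck_on k U2 (radial_ext vC)" by (rule Ck_on_cong[OF U2 e2, THEN iffD2, OF _ Ck_on_const])
  qed
  moreover have "closure {x \<in> ?S. vC x \<noteq> 0} \<subseteq> C"
  proof -
    have "{x \<in> ?S. vC x \<noteq> 0} \<subseteq> K \<inter> C" using v0 by (auto simp: vC_def split: if_splits)
    then have "closure {x \<in> ?S. vC x \<noteq> 0} \<subseteq> K \<inter> C" using KC by (rule closure_minimal)
    then show ?thesis by blast
  qed
  ultimately have test: "vC \<in> sphere_test_functions C" by (simp add: sphere_test_functions_def)
  have gC: "sphere_grad vC \<theta> = G \<theta>" if "\<theta> \<in> C" for \<theta>
  proof -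
    have n: "norm \<theta> = 1" using that CS by auto
    then have "\<theta> \<in> U1" using that by (auto simp: U1_def)
    then have "sphere_grad vC \<theta> = sphere_grad v \<theta>"
      unfolding sphere_grad_def grad_def by (intro sum.cong refl arg_cong2[where f=scaleR] partial_deriv_cong_open[OF U1 _ e1])
    then show ?thesis using sphere_grad_radial[OF V n, of r] by (simp add: v_def[abs_def] G_def)
  qed
  let ?M = "restrict_space sphere_measure C"
  have CM: "C \<inter> space sphere_measure \<in> sets sphere_measure" using Cm[OF C] by (simp add: sets.Int)
  have spM: "space ?M = C" using CS by (auto simp: space_restrict_space space_sphere_measure)
  have vm: "vC \<in> borel_measurable ?M"
  proof -
    have "v \<in> borel_measurable ?M"
      by (rule measurable_restrict_space1[OF sphere_measurable_continuous[OF vc]])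
    then show ?thesis by (rule measurable_cong[THEN iffD1, rotated]) (simp add: spM vC_def)
  qed
  have gm: "sphere_grad vC \<in> borel_measurable ?M"
  proof -
    have "G \<in> borel_measurable ?M"
      by (rule measurable_restrict_space1[OF sphere_measurable_continuous[OF Gc]])
    then show ?thesis by (rule measurable_cong[THEN iffD1, rotated]) (simp add: spM gC)
  qed
  have int_v: "(LINT x|?M. (vC x)\<^sup>2) = (LINT \<theta>|sphere_measure. indicator C \<theta> *\<^sub>R (v \<theta>)\<^sup>2)"
    unfolding integral_restrict_space[OF CM]
    by (intro Bochner_Integration.integral_cong refl) (simp add: vC_def indicator_def)
  have int_g: "(LINT x|?M. (norm (sphere_grad vC x))\<^sup>2) = (LINT \<theta>|sphere_measure. indicator C \<theta> *\<^sub>R (norm (G \<theta>))\<^sup>2)"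
    unfolding integral_restrict_space[OF CM]
    by (intro Bochner_Integration.integral_cong refl) (simp add: gC indicator_def)
  have siv: "square_integrable ?M vC"
    unfolding square_integrable_def
  proof (intro conjI vm)
    show "integrable ?M (\<lambda>x. (norm (vC x))\<^sup>2)"
      unfolding integrable_restrict_space[OF CM]
      by (rule Bochner_Integration.integrable_cong[THEN iffD1, OF refl _ ivC[OF C]]) (simp add: vC_def indicator_def)
  qed
  have sig: "square_integrable ?M (sphere_grad vC)"
    unfolding square_integrable_def
  proof (intro conjI gm)
    show "integrable ?M (\<lambda>x. (norm (sphere_grad vC x))\<^sup>2)"
      unfolding integrable_restrict_space[OF CM]
      by (rule Bochner_Integration.integrable_cong[THEN iffD1, OF refl _ iGC[OF C]]) (simp add: gC indicator_def)
  qed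
  \<comment> \<open>The constant sequence is an approximating sequence.\<close>
  have H: "H10_sphere C vC (sphere_grad vC)"
    unfolding H10_sphere_def Let_def
    using siv sig test by (intro conjI exI[of _ "\<lambda>_. vC"]) simp_all
  define Q where "Q = (LINT x|?M. (vC x)\<^sup>2)"
  define A where "A = (LINT x|?M. (norm (sphere_grad vC x))\<^sup>2)"
  have AQ: "A < \<kappa> * Q" using lt by (simp add: A_def Q_def int_v int_g)
  have A0: "A \<ge> 0" and Q0: "Q \<ge> 0" by (auto simp: A_def Q_def)
  have Q: "Q > 0" using AQ A0 Q0 by (cases "Q = 0") auto
  have nz: "\<not> (AE x in ?M. vC x = 0)"
  proof
    assume "AE x in ?M. vC x = 0"
    then have "AE x in ?M. (vC x)\<^sup>2 = 0" by eventually_elim simp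
    then have "Q = 0" unfolding Q_def by (rule integral_eq_zero_AE)
    then show False using Q by simp
  qed
  have "first_eigenvalue C \<le> A / Q"
    unfolding first_eigenvalue_def Let_def
  proof (rule cInf_lower)
    show "A / Q \<in> {(LINT x|?M. (norm (g x))\<^sup>2) / (LINT x|?M. (u x)\<^sup>2) |u g. H10_sphere C u g \<and> \<not> (AE x in ?M. u x = 0)}"
      using H nz unfolding A_def Q_def by blast
    show "bdd_below {(LINT x|?M. (norm (g x))\<^sup>2) / (LINT x|?M. (u x)\<^sup>2) |u g. H10_sphere C u g \<and> \<not> (AE x in ?M. u x = 0)}"
      by (rule bdd_belowI[of _ 0]) auto
  qed
  also have "\<dots> \<le> \<kappa>" using AQ Q by (simp add: field_simps)
  finally show ?thesis using CO Cop by blast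
qed

text \<open>A set of real quotients may be empty as far as the definition is concerned, and then its infimum is the unspecified number
\<open>Inf {}\<close>. A lower bound common to all domains is enough for the infimum in \<open>optimal_beta\<close> to be one.\<close>

lemma first_eigenvalue_lower: "first_eigenvalue \<omega> \<ge> min 0 (Inf {})"
proof -
  let ?M = "restrict_space sphere_measure \<omega>"
  let ?X = "{(LINT x|?M. (norm (g x))\<^sup>2) / (LINT x|?M. (u x)\<^sup>2) |u g. H10_sphere \<omega> u g \<and> \<not> (AE x in ?M. u x = 0)}"
  have "min 0 (Inf {}) \<le> Inf ?X"
  proof (cases "?X = {}")
    case False
    then have "0 \<le> Inf ?X" by (rule cInf_greatest) auto
    then show ?thesis by simp
  next
    case True
    show ?thesis unfolding True by simp
  qed
  then show ?thesis by (simp add: first_eigenvalue_def Let_def)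
qed

lemma optimal_beta_le:
  fixes \<omega> :: "nat \<Rightarrow> 'a::euclidean_space set"
  assumes "\<omega> \<in> sphere_partitions h" "h \<ge> 1"
  shows "optimal_beta TYPE('a) h \<le> 2 / real h * (\<Sum>i\<in>{1..h}. sqrt (first_eigenvalue (\<omega> i)))"
  unfolding optimal_beta_def
proof (rule cINF_lower[OF _ assms(1)])
  show "bdd_below ((\<lambda>\<omega>::nat \<Rightarrow> 'a set. 2 / real h * (\<Sum>i\<in>{1..h}. sqrt (first_eigenvalue (\<omega> i)))) ` sphere_partitions h)"
  proof (rule bdd_belowI2)
    fix \<omega> :: "nat \<Rightarrow> 'a set"
    have "(\<Sum>i\<in>{1..h}. sqrt (min 0 (Inf {}))) \<le> (\<Sum>i\<in>{1..h}. sqrt (first_eigenvalue (\<omega> i)))"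
      by (intro sum_mono real_sqrt_le_mono first_eigenvalue_lower)
    then show "2 / real h * (\<Sum>i\<in>{1..h}. sqrt (min 0 (Inf {}))) \<le> 2 / real h * (\<Sum>i\<in>{1..h}. sqrt (first_eigenvalue (\<omega> i)))"
      by (intro mult_left_mono) auto
  qed
qed

section \<open>Rayleigh quotients of disjointly supported traces\<close>

text \<open>Convergence in $L^2$ without requiring the functions themselves to be square integrable.\<close>

definition L2_lim :: "'a measure \<Rightarrow> (nat \<Rightarrow> 'a \<Rightarrow> 'b::euclidean_space) \<Rightarrow> ('a \<Rightarrow> 'b) \<Rightarrow> bool" where
  "L2_lim M q p \<longleftrightarrow> (\<forall>n. q n \<in> borel_measurable M) \<and> p \<in> borel_measurable M
    \<and> (\<forall>n. integrable M (\<lambda>x. (norm (q n x - p x))\<^sup>2)) \<and> (\<lambda>n. LINT x|M. (norm (q n x - p x))\<^sup>2) \<longlonglongrightarrow> 0"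

lemma L2_limI:
  assumes "\<And>n. q n \<in> borel_measurable M" "p \<in> borel_measurable M"
    "\<And>n. integrable M (w n)" "\<And>n x. x \<in> space M \<Longrightarrow> (norm (q n x - p x))\<^sup>2 \<le> w n x" "(\<lambda>n. LINT x|M. w n x) \<longlonglongrightarrow> 0"
  shows "L2_lim M q p"
proof -
  note [measurable] = assms(1,2)
  have i: "integrable M (\<lambda>x. (norm (q n x - p x))\<^sup>2)" for n
  proof (rule Bochner_Integration.integrable_bound[OF assms(3)[of n]])
    show "AE x in M. norm ((norm (q n x - p x))\<^sup>2) \<le> norm (w n x)"
      using assms(4)[of _ n] by (intro AE_I2) (smt (verit) real_norm_def zero_le_power2)
  qed measurable
  have "(\<lambda>n. LINT x|M. (norm (q n x - p x))\<^sup>2) \<longlonglongrightarrow> 0"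
    by (rule tendsto_sandwich[OF _ _ tendsto_const assms(5)])
       (auto intro!: always_eventually integral_mono[OF i assms(3)] assms(4))
  then show ?thesis unfolding L2_lim_def using assms(1,2) i by blast
qed

lemma L2_limD:
  assumes "L2_lim M q p"
  shows "q n \<in> borel_measurable M" "p \<in> borel_measurable M" "integrable M (\<lambda>x. (norm (q n x - p x))\<^sup>2)"
    "(\<lambda>n. LINT x|M. (norm (q n x - p x))\<^sup>2) \<longlonglongrightarrow> 0"
  using assms by (auto simp: L2_lim_def)

lemma norm_add_sq_le: "(norm (a + b))\<^sup>2 \<le> 2 * (norm a)\<^sup>2 + 2 * (norm (b::'a::real_normed_vector))\<^sup>2"
proof -
  have "(norm (a + b))\<^sup>2 \<le> (norm a + norm b)\<^sup>2" by (intro power_mono norm_triangle_ineq) simp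
  also have "\<dots> \<le> 2 * (norm a)\<^sup>2 + 2 * (norm b)\<^sup>2"
    using zero_le_power2[of "norm a - norm b"] by (simp add: power2_eq_square algebra_simps)
  finally show ?thesis .
qed

lemma L2_lim_add:
  assumes "L2_lim M q p" "L2_lim M q' p'"
  shows "L2_lim M (\<lambda>n x. q n x + q' n x) (\<lambda>x. p x + p' x)"
proof (rule L2_limI[where w="\<lambda>n x. 2 * (norm (q n x - p x))\<^sup>2 + 2 * (norm (q' n x - p' x))\<^sup>2"])
  note [measurable] = L2_limD(1,2)[OF assms(1)] L2_limD(1,2)[OF assms(2)]
  note i = L2_limD(3)[OF assms(1)] L2_limD(3)[OF assms(2)]
  show "(\<lambda>x. q n x + q' n x) \<in> borel_measurable M" for n by measurable
  show "(\<lambda>x. p x + p' x) \<in> borel_measurable M" by measurable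
  show "integrable M (\<lambda>x. 2 * (norm (q n x - p x))\<^sup>2 + 2 * (norm (q' n x - p' x))\<^sup>2)" for n using i by simp
  show "(norm (q n x + q' n x - (p x + p' x)))\<^sup>2 \<le> 2 * (norm (q n x - p x))\<^sup>2 + 2 * (norm (q' n x - p' x))\<^sup>2" for n x
    using norm_add_sq_le[of "q n x - p x" "q' n x - p' x"] by (simp add: algebra_simps)
  have "(\<lambda>n. 2 * (LINT x|M. (norm (q n x - p x))\<^sup>2) + 2 * (LINT x|M. (norm (q' n x - p' x))\<^sup>2)) \<longlonglongrightarrow> 2 * 0 + 2 * 0"
    by (intro tendsto_intros L2_limD(4)[OF assms(1)] L2_limD(4)[OF assms(2)])
  then show "(\<lambda>n. LINT x|M. 2 * (norm (q n x - p x))\<^sup>2 + 2 * (norm (q' n x - p' x))\<^sup>2) \<longlonglongrightarrow> 0"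
    using i by simp
qed

lemma L2_lim_lipschitz:
  assumes "L2_lim M q p" "\<And>n. q' n \<in> borel_measurable M" "p' \<in> borel_measurable M"
    "\<And>n x. x \<in> space M \<Longrightarrow> norm (q' n x - p' x) \<le> norm (q n x - p x)"
  shows "L2_lim M q' p'"
  by (rule L2_limI[OF assms(2,3) L2_limD(3)[OF assms(1)] _ L2_limD(4)[OF assms(1)]])
     (intro power_mono assms(4), auto)

lemma L2_lim_zero: "L2_lim M (\<lambda>n x. 0) (\<lambda>x. 0)"
  by (simp add: L2_lim_def)

lemma L2_lim_sum:
  assumes "finite J" "\<And>j. j \<in> J \<Longrightarrow> L2_lim M (q j) (p j)"
  shows "L2_lim M (\<lambda>n x. \<Sum>j\<in>J. q j n x) (\<lambda>x. \<Sum>j\<in>J. p j x)"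
  using assms
proof (induction J rule: finite_induct)
  case empty show ?case by (simp add: L2_lim_zero)
next
  case (insert j J)
  have "L2_lim M (\<lambda>n x. q j n x + (\<Sum>j\<in>J. q j n x)) (\<lambda>x. p j x + (\<Sum>j\<in>J. p j x))"
    by (rule L2_lim_add) (use insert in auto)
  then show ?case using insert.hyps by simp
qed

lemma L2_lim_norm:
  assumes "L2_lim M q p" "integrable M (\<lambda>x. (norm (p x))\<^sup>2)"
  shows "(\<lambda>n. LINT x|M. (norm (q n x))\<^sup>2) \<longlonglongrightarrow> (LINT x|M. (norm (p x))\<^sup>2)"
  by (rule L2_norm_tendsto(1)[OF L2_limD(1,2)[OF assms(1)] assms(2) L2_limD(3,4)[OF assms(1)]])

lemma L2_lim_subseq:
  assumes "L2_lim M q p" "strict_mono (\<rho>::nat\<Rightarrow>nat)" shows "L2_lim M (\<lambda>n. q (\<rho> n)) p"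
  using assms LIMSEQ_subseq_LIMSEQ[OF L2_limD(4)[OF assms(1)] assms(2)] by (simp add: L2_lim_def o_def)

text \<open>Write $K(f_n) q_n - K(U) p = K(f_n) (q_n - p) + (K(f_n) - K(U)) p$; the second term is handled by dominated
convergence.\<close>

lemma L2_lim_scale:
  assumes H: "L2_lim M q p" "integrable M (\<lambda>x. (norm (p x))\<^sup>2)"
    and f: "\<And>n. f n \<in> borel_measurable M" "U \<in> borel_measurable M" "AE x in M. (\<lambda>n. f n x) \<longlonglongrightarrow> U x"
    and K: "continuous_on UNIV K" "\<And>t. 0 \<le> K t" "\<And>t. K t \<le> (1::real)"
  shows "L2_lim M (\<lambda>n x. K (f n x) *\<^sub>R q n x) (\<lambda>x. K (U x) *\<^sub>R p x)"
proof -
  note [measurable] = L2_limD(1,2)[OF H(1)] f(1,2) borel_measurable_continuous_onI[OF K(1)]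
  have one: "L2_lim M (\<lambda>n x. K (f n x) *\<^sub>R (q n x - p x)) (\<lambda>x. 0)"
  proof (rule L2_lim_lipschitz[OF H(1)])
    show "norm (K (f n x) *\<^sub>R (q n x - p x) - 0) \<le> norm (q n x - p x)" for n x
      using mult_right_mono[OF K(3), of "norm (q n x - p x)" "f n x"] K(2)[of "f n x"] by simp
  qed measurable
  have two: "L2_lim M (\<lambda>n x. K (f n x) *\<^sub>R p x) (\<lambda>x. K (U x) *\<^sub>R p x)"
    unfolding L2_lim_def
  proof (intro conjI allI)
    have bd: "norm ((norm (K (f n x) *\<^sub>R p x - K (U x) *\<^sub>R p x))\<^sup>2) \<le> (norm (p x))\<^sup>2" for n x
    proof -
      have "norm (K (f n x) *\<^sub>R p x - K (U x) *\<^sub>R p x) = \<bar>K (f n x) - K (U x)\<bar> * norm (p x)"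
        by (simp add: scaleR_left_diff_distrib[symmetric])
      also have "\<dots> \<le> 1 * norm (p x)"
        using K(2)[of "f n x"] K(3)[of "f n x"] K(2)[of "U x"] K(3)[of "U x"] by (intro mult_right_mono) auto
      finally show ?thesis by (simp add: power_mono)
    qed
    show "(\<lambda>x. K (f n x) *\<^sub>R p x) \<in> borel_measurable M" for n by measurable
    show "(\<lambda>x. K (U x) *\<^sub>R p x) \<in> borel_measurable M" by measurable
    show "integrable M (\<lambda>x. (norm (K (f n x) *\<^sub>R p x - K (U x) *\<^sub>R p x))\<^sup>2)" for n
    proof (rule Bochner_Integration.integrable_bound[OF H(2)])
      show "AE x in M. norm ((norm (K (f n x) *\<^sub>R p x - K (U x) *\<^sub>R p x))\<^sup>2) \<le> norm ((norm (p x))\<^sup>2)"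
        by (rule AE_I2) (use bd in simp)
    qed measurable
    have "(\<lambda>n. LINT x|M. (norm (K (f n x) *\<^sub>R p x - K (U x) *\<^sub>R p x))\<^sup>2) \<longlonglongrightarrow> (LINT x|M. 0)"
    proof (rule integral_dominated_convergence[OF _ _ H(2)])
      show "AE x in M. (\<lambda>n. (norm (K (f n x) *\<^sub>R p x - K (U x) *\<^sub>R p x))\<^sup>2) \<longlonglongrightarrow> 0"
        using f(3)
      proof eventually_elim
        fix x assume "(\<lambda>n. f n x) \<longlonglongrightarrow> U x"
        then have k: "(\<lambda>n. K (f n x)) \<longlonglongrightarrow> K (U x)" by (rule continuous_on_tendsto_compose[OF K(1)]) auto
        have "(\<lambda>n. (norm (K (f n x) *\<^sub>R p x - K (U x) *\<^sub>R p x))\<^sup>2) \<longlonglongrightarrow> (norm (K (U x) *\<^sub>R p x - K (U x) *\<^sub>R p x))\<^sup>2"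
          by (intro tendsto_intros k)
        then show "(\<lambda>n. (norm (K (f n x) *\<^sub>R p x - K (U x) *\<^sub>R p x))\<^sup>2) \<longlonglongrightarrow> 0" by simp
      qed
      show "AE x in M. norm ((norm (K (f n x) *\<^sub>R p x - K (U x) *\<^sub>R p x))\<^sup>2) \<le> (norm (p x))\<^sup>2" for n
        by (rule AE_I2) (rule bd)
    qed measurable
    then show "(\<lambda>n. LINT x|M. (norm (K (f n x) *\<^sub>R p x - K (U x) *\<^sub>R p x))\<^sup>2) \<longlonglongrightarrow> 0" by simp
  qed
  have "L2_lim M (\<lambda>n x. K (f n x) *\<^sub>R (q n x - p x) + K (f n x) *\<^sub>R p x) (\<lambda>x. 0 + K (U x) *\<^sub>R p x)"
    by (rule L2_lim_add[OF one two])
  then show ?thesis by (simp add: scaleR_add_right[symmetric])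
qed

lemma grad_sum:
  assumes "finite J" "\<And>j. j \<in> J \<Longrightarrow> smooth_on UNIV (f j)"
  shows "grad (\<lambda>x. \<Sum>j\<in>J. c j * f j x) x = (\<Sum>j\<in>J. c j *\<^sub>R grad (f j) x)"
proof -
  have D: "((\<lambda>x. \<Sum>j\<in>J. c j * f j x) has_derivative (\<lambda>h. \<Sum>j\<in>J. c j * (\<Sum>b\<in>Basis. (h \<bullet> b) * partial_deriv b (f j) x))) (at x)"
    by (intro has_derivative_sum has_derivative_mult_right smooth_on_has_derivative[OF assms(2)]) auto
  have "partial_deriv b (\<lambda>x. \<Sum>j\<in>J. c j * f j x) x = (\<Sum>j\<in>J. c j * partial_deriv b (f j) x)" if "b \<in> Basis" for b
    using partial_deriv_eqI[OF D, of b] by (simp add: sum_Basis_inner[OF that])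
  then have "grad (\<lambda>x. \<Sum>j\<in>J. c j * f j x) x = (\<Sum>b\<in>Basis. (\<Sum>j\<in>J. c j * partial_deriv b (f j) x) *\<^sub>R b)"
    unfolding grad_def by (intro sum.cong) simp_all
  also have "\<dots> = (\<Sum>j\<in>J. c j *\<^sub>R grad (f j) x)"
    unfolding grad_def by (simp add: scaleR_sum_left scaleR_sum_right sum.swap[of _ Basis J])
  finally show ?thesis .
qed

lemma grad_compose_real:
  assumes "smooth_on UNIV f" "\<And>t. (k has_real_derivative k' t) (at t)"
  shows "grad (\<lambda>x. k (f x)) x = k' (f x) *\<^sub>R grad f x"
proof -
  have f: "(k has_derivative (\<lambda>h. k' t * h)) (at t)" for t
    using assms(2)[of t] by (simp add: has_field_derivative_def)
  have D: "((\<lambda>x. k (f x)) has_derivative (\<lambda>h. k' (f x) * (\<Sum>b\<in>Basis. (h \<bullet> b) * partial_deriv b f x))) (at x)"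
    by (rule has_derivative_compose[OF smooth_on_has_derivative[OF assms(1) open_UNIV UNIV_I] f])
  have "partial_deriv b (\<lambda>x. k (f x)) x = k' (f x) * partial_deriv b f x" if "b \<in> Basis" for b
    using partial_deriv_eqI[OF D, of b] by (simp add: sum_Basis_inner[OF that])
  then show ?thesis unfolding grad_def scaleR_sum_right by (intro sum.cong) simp_all
qed

lemma soft_pos_lipschitz: "\<epsilon> > 0 \<Longrightarrow> \<bar>soft_pos \<epsilon> s - soft_pos \<epsilon> t\<bar> \<le> \<bar>s - t\<bar>"
proof -
  assume e: "\<epsilon> > 0"
  have "norm (soft_pos \<epsilon> s - soft_pos \<epsilon> t) \<le> 1 * norm (s - t)"
    by (rule field_differentiable_bound[where S=UNIV and f'="soft_pos' \<epsilon>"])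
       (auto intro: DERIV_subset[OF soft_pos_deriv[OF e]] simp: soft_pos'_bounds[OF e] abs_of_nonneg)
  then show ?thesis by simp
qed

text \<open>The admissible competitors are built as explained at the top of this theory. The functions \<open>F i n\<close>, equal to \<open>\<phi> i n\<close> minus
all other \<open>\<phi> j n\<close>, tend to \<open>U i\<close>, which equals \<open>u i\<close> where \<open>u i\<close> is positive and is nonpositive elsewhere. The smooth
positive part of \<open>F i n\<close> thus has in the limit at most the tangential energy of \<open>u i\<close>, and nearly its mass. It is
supported in \<open>{F i n > 0}\<close>, and these sets are disjoint because the \<open>\<phi> i n\<close> are nonnegative.\<close>

theorem beta_le_quotients:
  fixes \<phi> :: "nat \<Rightarrow> nat \<Rightarrow> 'a::euclidean_space \<Rightarrow> real"
  assumes h: "h \<ge> 1" and r: "r > 0"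
    and smooth: "\<And>i n. i \<in> {1..h} \<Longrightarrow> smooth_on UNIV (\<phi> i n)"
    and pos: "\<And>i n x. i \<in> {1..h} \<Longrightarrow> \<phi> i n x \<ge> 0"
    and lu: "\<And>i. i \<in> {1..h} \<Longrightarrow> L2_lim sphere_measure (\<lambda>n \<theta>. \<phi> i n (r *\<^sub>R \<theta>)) (u i)"
    and lg: "\<And>i. i \<in> {1..h} \<Longrightarrow> L2_lim sphere_measure (\<lambda>n \<theta>. grad (\<phi> i n) (r *\<^sub>R \<theta>)) (g i)"
    and iu: "\<And>i. i \<in> {1..h} \<Longrightarrow> integrable sphere_measure (\<lambda>\<theta>. (u i \<theta>)\<^sup>2)"
    and ig: "\<And>i. i \<in> {1..h} \<Longrightarrow> integrable sphere_measure (\<lambda>\<theta>. (norm (g i \<theta>))\<^sup>2)"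
    and upos: "\<And>i. i \<in> {1..h} \<Longrightarrow> AE \<theta> in sphere_measure. u i \<theta> \<ge> 0"
    and disj: "\<And>i j. i \<in> {1..h} \<Longrightarrow> j \<in> {1..h} \<Longrightarrow> i \<noteq> j \<Longrightarrow> AE \<theta> in sphere_measure. u i \<theta> * u j \<theta> = 0"
    and gz: "\<And>i. i \<in> {1..h} \<Longrightarrow> AE \<theta> in sphere_measure. u i \<theta> = 0 \<longrightarrow> g i \<theta> = 0"
    and Q: "\<And>i. i \<in> {1..h} \<Longrightarrow> (LINT \<theta>|sphere_measure. (u i \<theta>)\<^sup>2) > 0"
  shows "optimal_beta TYPE('a) h \<le> 2 / real h * (\<Sum>i\<in>{1..h}.
    sqrt (r\<^sup>2 * (LINT \<theta>|sphere_measure. (norm (tangential \<theta> (g i \<theta>)))\<^sup>2) / (LINT \<theta>|sphere_measure. (u i \<theta>)\<^sup>2)))"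
proof -
  let ?I = "{1..h}"
  let ?\<sigma> = "sphere_measure :: 'a measure"
  \<comment> \<open>Signs for \<open>\<phi> i n\<close> minus the sum of the other functions.\<close>
  define c :: "nat \<Rightarrow> nat \<Rightarrow> real" where "c i j = (if j = i then 1 else -1)" for i j
  define F where "F i n x = (\<Sum>j\<in>?I. c i j * \<phi> j n x)" for i n x
  define U where "U i \<theta> = (\<Sum>j\<in>?I. c i j * u j \<theta>)" for i \<theta>
  define Hg where "Hg i \<theta> = (\<Sum>j\<in>?I. c i j *\<^sub>R g j \<theta>)" for i \<theta>
  have cabs: "\<bar>c i j\<bar> = 1" for i j by (simp add: c_def)
  have Fs: "smooth_on UNIV (F i n)" for i n
    unfolding F_def[abs_def] smooth_on_def
    by (intro allI Ck_on_sum Ck_on_mult Ck_on_const) (use smooth in \<open>auto simp: smooth_on_def\<close>)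
  have gF: "grad (F i n) x = (\<Sum>j\<in>?I. c i j *\<^sub>R grad (\<phi> j n) x)" for i n x
    unfolding F_def[abs_def] by (rule grad_sum) (use smooth in auto)
  have um: "u j \<in> borel_measurable ?\<sigma>" "g j \<in> borel_measurable ?\<sigma>" if "j \<in> ?I" for j
    using L2_limD(2)[OF lu[OF that]] L2_limD(2)[OF lg[OF that]] .
  have pm: "(\<lambda>\<theta>. \<phi> j n (r *\<^sub>R \<theta>)) \<in> borel_measurable ?\<sigma>" "(\<lambda>\<theta>. grad (\<phi> j n) (r *\<^sub>R \<theta>)) \<in> borel_measurable ?\<sigma>" if "j \<in> ?I" for j n
    using L2_limD(1)[OF lu[OF that]] L2_limD(1)[OF lg[OF that]] .
  have lF: "L2_lim ?\<sigma> (\<lambda>n \<theta>. F i n (r *\<^sub>R \<theta>)) (U i)" for i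
    unfolding F_def U_def[abs_def]
  proof (rule L2_lim_sum)
    fix j assume j: "j \<in> ?I"
    show "L2_lim ?\<sigma> (\<lambda>n \<theta>. c i j * \<phi> j n (r *\<^sub>R \<theta>)) (\<lambda>\<theta>. c i j * u j \<theta>)"
      by (rule L2_lim_lipschitz[OF lu[OF j]])
         (auto intro!: borel_measurable_times um pm j simp: right_diff_distrib[symmetric] abs_mult cabs)
  qed simp
  have lgF: "L2_lim ?\<sigma> (\<lambda>n \<theta>. grad (F i n) (r *\<^sub>R \<theta>)) (Hg i)" for i
    unfolding gF Hg_def[abs_def]
  proof (rule L2_lim_sum)
    fix j assume j: "j \<in> ?I"
    show "L2_lim ?\<sigma> (\<lambda>n \<theta>. c i j *\<^sub>R grad (\<phi> j n) (r *\<^sub>R \<theta>)) (\<lambda>\<theta>. c i j *\<^sub>R g j \<theta>)"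
      by (rule L2_lim_lipschitz[OF lg[OF j]])
         (auto intro!: borel_measurable_scaleR um pm j simp: scaleR_right_diff_distrib[symmetric] cabs)
  qed simp
  have tm: "(\<lambda>\<theta>. tangential \<theta> (p \<theta>)) \<in> borel_measurable ?\<sigma>" if "p \<in> borel_measurable ?\<sigma>" for p
  proof -
    note [measurable] = that
    have [measurable]: "(\<lambda>\<theta>. \<theta>) \<in> borel_measurable ?\<sigma>" using sphere_comp_measurable[of "\<lambda>x. x" 1] by simp
    show ?thesis unfolding tangential_def by measurable
  qed
  have lt: "L2_lim ?\<sigma> (\<lambda>n \<theta>. tangential \<theta> (grad (F i n) (r *\<^sub>R \<theta>))) (\<lambda>\<theta>. tangential \<theta> (Hg i \<theta>))" for i
    by (rule L2_lim_lipschitz[OF lgF])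
       (auto intro!: tm L2_limD(1,2)[OF lgF] norm_tangential_le simp: tangential_diff space_sphere_measure)
  have iH: "integrable ?\<sigma> (\<lambda>\<theta>. (norm (tangential \<theta> (Hg i \<theta>)))\<^sup>2)" for i
  proof (rule Bochner_Integration.integrable_bound)
    show "integrable ?\<sigma> (\<lambda>\<theta>. real h * (\<Sum>j\<in>?I. (norm (g j \<theta>))\<^sup>2))"
      by (intro integrable_mult_right Bochner_Integration.integrable_sum ig)
    show "(\<lambda>\<theta>. (norm (tangential \<theta> (Hg i \<theta>)))\<^sup>2) \<in> borel_measurable ?\<sigma>"
      using tm[OF L2_limD(2)[OF lgF]] by measurable
    show "AE \<theta> in ?\<sigma>. norm ((norm (tangential \<theta> (Hg i \<theta>)))\<^sup>2) \<le> norm (real h * (\<Sum>j\<in>?I. (norm (g j \<theta>))\<^sup>2))"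
    proof (rule AE_I2)
      fix \<theta> assume "\<theta> \<in> space ?\<sigma>"
      then have "norm (tangential \<theta> (Hg i \<theta>)) \<le> norm (Hg i \<theta>)" by (intro norm_tangential_le) (simp add: space_sphere_measure)
      also have "\<dots> \<le> (\<Sum>j\<in>?I. norm (g j \<theta>))" unfolding Hg_def
        by (rule order_trans[OF norm_sum]) (simp add: cabs)
      finally have "(norm (tangential \<theta> (Hg i \<theta>)))\<^sup>2 \<le> (\<Sum>j\<in>?I. norm (g j \<theta>))\<^sup>2" by (intro power_mono) auto
      also have "\<dots> \<le> real (card ?I) * (\<Sum>j\<in>?I. (norm (g j \<theta>))\<^sup>2)"
        using sum_squared_le_sum_of_squares[of "\<lambda>j. norm (g j \<theta>)" ?I] by (simp add: mult.commute)
      finally show "norm ((norm (tangential \<theta> (Hg i \<theta>)))\<^sup>2) \<le> norm (real h * (\<Sum>j\<in>?I. (norm (g j \<theta>))\<^sup>2))"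
        by (simp add: sum_nonneg)
    qed
  qed
  \<comment> \<open>A subsequence along which all \<open>F i n\<close> converge almost everywhere is needed, because the derivative of the smooth positive
part is a factor in the gradient and is handled pointwise.\<close>
  define D where "D n \<theta> = (\<Sum>i\<in>?I. (norm (F i n (r *\<^sub>R \<theta>) - U i \<theta>))\<^sup>2)" for n \<theta>
  have iD: "integrable ?\<sigma> (D n)" for n unfolding D_def[abs_def]
    by (intro Bochner_Integration.integrable_sum L2_limD(3)[OF lF])
  have "(\<lambda>n. \<Sum>i\<in>?I. LINT \<theta>|?\<sigma>. (norm (F i n (r *\<^sub>R \<theta>) - U i \<theta>))\<^sup>2) \<longlonglongrightarrow> (\<Sum>i\<in>?I. 0)"
    by (intro tendsto_sum L2_limD(4)[OF lF])
  moreover have "(LINT \<theta>|?\<sigma>. \<bar>D n \<theta>\<bar>) = (\<Sum>i\<in>?I. LINT \<theta>|?\<sigma>. (norm (F i n (r *\<^sub>R \<theta>) - U i \<theta>))\<^sup>2)" for n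
  proof -
    have "\<bar>D n \<theta>\<bar> = D n \<theta>" for \<theta> unfolding D_def by (intro abs_of_nonneg sum_nonneg) simp
    then show ?thesis unfolding D_def by (simp only: Bochner_Integration.integral_sum[OF L2_limD(3)[OF lF]])
  qed
  ultimately have "(\<lambda>n. LINT \<theta>|?\<sigma>. \<bar>D n \<theta>\<bar>) \<longlonglongrightarrow> 0" by (simp only: sum.neutral_const)
  from AE_subseq_of_L1[OF iD this] obtain \<rho> where \<rho>: "strict_mono (\<rho>::nat\<Rightarrow>nat)" "AE \<theta> in ?\<sigma>. (\<lambda>n. D (\<rho> n) \<theta>) \<longlonglongrightarrow> 0"
    by blast
  have aeF: "AE \<theta> in ?\<sigma>. (\<lambda>n. F i (\<rho> n) (r *\<^sub>R \<theta>)) \<longlonglongrightarrow> U i \<theta>" if i: "i \<in> ?I" for i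
    using \<rho>(2)
  proof eventually_elim
    fix \<theta> assume l: "(\<lambda>n. D (\<rho> n) \<theta>) \<longlonglongrightarrow> 0"
    have "(\<lambda>n. sqrt (D (\<rho> n) \<theta>)) \<longlonglongrightarrow> sqrt 0" by (intro tendsto_intros l)
    then have l': "(\<lambda>n. sqrt (D (\<rho> n) \<theta>)) \<longlonglongrightarrow> 0" by simp
    have "norm (F i (\<rho> n) (r *\<^sub>R \<theta>) - U i \<theta>) \<le> sqrt (D (\<rho> n) \<theta>)" for n
    proof (rule real_le_rsqrt)
      show "(norm (F i (\<rho> n) (r *\<^sub>R \<theta>) - U i \<theta>))\<^sup>2 \<le> D (\<rho> n) \<theta>"
        unfolding D_def by (rule member_le_sum[OF i]) auto
    qed
    then have "(\<lambda>n. F i (\<rho> n) (r *\<^sub>R \<theta>) - U i \<theta>) \<longlonglongrightarrow> 0"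
      by (intro Lim_null_comparison[OF always_eventually l']) blast
    then show "(\<lambda>n. F i (\<rho> n) (r *\<^sub>R \<theta>)) \<longlonglongrightarrow> U i \<theta>" by (simp add: LIM_zero_iff)
  qed
  \<comment> \<open>Where \<open>u i\<close> is positive the other \<open>u j\<close> vanish by disjointness, and with them their gradients \<open>g j\<close>.\<close>
  have struct: "AE \<theta> in ?\<sigma>. (u i \<theta> > 0 \<and> U i \<theta> = u i \<theta> \<and> Hg i \<theta> = g i \<theta>) \<or> (u i \<theta> = 0 \<and> U i \<theta> \<le> 0)" if i: "i \<in> ?I" for i
  proof -
    have "AE \<theta> in ?\<sigma>. \<forall>j\<in>?I. u j \<theta> \<ge> 0" using upos by (intro AE_finite_allI) auto
    moreover have "AE \<theta> in ?\<sigma>. \<forall>j\<in>?I. i \<noteq> j \<longrightarrow> u i \<theta> * u j \<theta> = 0"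
    proof (intro AE_finite_allI)
      fix j assume "j \<in> ?I" then show "AE \<theta> in ?\<sigma>. i \<noteq> j \<longrightarrow> u i \<theta> * u j \<theta> = 0"
        using disj[OF i, of j] by (cases "i = j") auto
    qed simp
    moreover have "AE \<theta> in ?\<sigma>. \<forall>j\<in>?I. u j \<theta> = 0 \<longrightarrow> g j \<theta> = 0" using gz by (intro AE_finite_allI) auto
    ultimately show ?thesis
    proof eventually_elim
      fix \<theta> assume a: "\<forall>j\<in>?I. u j \<theta> \<ge> 0" and b: "\<forall>j\<in>?I. i \<noteq> j \<longrightarrow> u i \<theta> * u j \<theta> = 0" and d: "\<forall>j\<in>?I. u j \<theta> = 0 \<longrightarrow> g j \<theta> = 0"
      have Us: "U i \<theta> = u i \<theta> - (\<Sum>j\<in>?I - {i}. u j \<theta>)" unfolding U_def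
        by (subst sum.remove[OF _ i]) (auto simp: c_def sum_negf[symmetric] intro!: sum.cong)
      have Hs: "Hg i \<theta> = g i \<theta> - (\<Sum>j\<in>?I - {i}. g j \<theta>)" unfolding Hg_def
        by (subst sum.remove[OF _ i]) (auto simp: c_def sum_negf[symmetric] intro!: sum.cong)
      show "(u i \<theta> > 0 \<and> U i \<theta> = u i \<theta> \<and> Hg i \<theta> = g i \<theta>) \<or> (u i \<theta> = 0 \<and> U i \<theta> \<le> 0)"
      proof (cases "u i \<theta> = 0")
        case True
        have "(\<Sum>j\<in>?I - {i}. u j \<theta>) \<ge> 0" using a by (intro sum_nonneg) auto
        then show ?thesis using True Us by simp
      next
        case False
        then have z: "u j \<theta> = 0" if "j \<in> ?I - {i}" for j using b that by auto
        have "(\<Sum>j\<in>?I - {i}. u j \<theta>) = 0" using z by (intro sum.neutral) blast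
        moreover have "(\<Sum>j\<in>?I - {i}. g j \<theta>) = 0" using z d by (intro sum.neutral) blast
        moreover have "u i \<theta> > 0" using False a i by (simp add: less_le)
        ultimately show ?thesis using Us Hs by simp
      qed
    qed
  qed
  define A where "A i = (LINT \<theta>|?\<sigma>. (norm (tangential \<theta> (g i \<theta>)))\<^sup>2)" for i
  define q where "q i = (LINT \<theta>|?\<sigma>. (u i \<theta>)\<^sup>2)" for i
  have q0: "q i > 0" if "i \<in> ?I" for i using Q[OF that] by (simp add: q_def)
  have itg: "integrable ?\<sigma> (\<lambda>\<theta>. (norm (tangential \<theta> (g i \<theta>)))\<^sup>2)" if i: "i \<in> ?I" for i
  proof (rule Bochner_Integration.integrable_bound[OF ig[OF i]])
    show "(\<lambda>\<theta>. (norm (tangential \<theta> (g i \<theta>)))\<^sup>2) \<in> borel_measurable ?\<sigma>" using tm[OF um(2)[OF i]] by measurable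
    show "AE \<theta> in ?\<sigma>. norm ((norm (tangential \<theta> (g i \<theta>)))\<^sup>2) \<le> norm ((norm (g i \<theta>))\<^sup>2)"
      by (rule AE_I2) (auto simp: space_sphere_measure intro!: power_mono norm_tangential_le)
  qed
  have key: "optimal_beta TYPE('a) h \<le> 2 / real h * (\<Sum>i\<in>?I. sqrt (r\<^sup>2 * A i / q i + \<delta>))" if \<delta>: "\<delta> > 0" for \<delta>
  proof -
    \<comment> \<open>The slack \<open>\<delta>\<close> leaves room for the two approximations: first the level \<open>\<epsilon>\<close> of the smooth positive part, then the index \<open>n\<close>.\<close>
    define \<kappa> where "\<kappa> i = r\<^sup>2 * A i / q i + \<delta>" for i
    have \<kappa>q: "r\<^sup>2 * A i < \<kappa> i * q i" if "i \<in> ?I" for i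
      using q0[OF that] \<delta> by (simp add: \<kappa>_def distrib_right)
    have lim_m: "(\<lambda>m. LINT \<theta>|?\<sigma>. (soft_pos (1 / real (Suc m)) (U i \<theta>))\<^sup>2) \<longlonglongrightarrow> q i" if i: "i \<in> ?I" for i
      unfolding q_def
    proof (rule integral_dominated_convergence[OF _ _ iu[OF i]])
      show "(\<lambda>\<theta>. (u i \<theta>)\<^sup>2) \<in> borel_measurable ?\<sigma>" using um(1)[OF i] by measurable
      show "(\<lambda>\<theta>. (soft_pos (1 / real (Suc m)) (U i \<theta>))\<^sup>2) \<in> borel_measurable ?\<sigma>" for m
        using measurable_compose[OF L2_limD(2)[OF lF] borel_measurable_continuous_onI[OF continuous_soft_pos]] by measurable
      show "AE \<theta> in ?\<sigma>. (\<lambda>m. (soft_pos (1 / real (Suc m)) (U i \<theta>))\<^sup>2) \<longlonglongrightarrow> (u i \<theta>)\<^sup>2"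
        using struct[OF i]
      proof eventually_elim
        case (elim \<theta>)
        then show ?case
        proof
          assume a: "u i \<theta> > 0 \<and> U i \<theta> = u i \<theta> \<and> Hg i \<theta> = g i \<theta>"
          then have "(\<lambda>m. (soft_pos (1 / real (Suc m)) (u i \<theta>))\<^sup>2) \<longlonglongrightarrow> (u i \<theta>)\<^sup>2"
            by (intro tendsto_power soft_pos_tendsto) simp
          then show ?thesis using a by simp
        next
          assume a: "u i \<theta> = 0 \<and> U i \<theta> \<le> 0"
          then have "soft_pos (1 / real (Suc m)) (U i \<theta>) = 0" for m
            by (intro soft_pos_eq_0(1)) (auto intro: order_trans)
          then show ?thesis using a by simp
        qed
      qed
      show "AE \<theta> in ?\<sigma>. norm ((soft_pos (1 / real (Suc m)) (U i \<theta>))\<^sup>2) \<le> (u i \<theta>)\<^sup>2" for m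
        using struct[OF i]
      proof eventually_elim
        case (elim \<theta>)
        then show ?case
        proof
          assume a: "u i \<theta> > 0 \<and> U i \<theta> = u i \<theta> \<and> Hg i \<theta> = g i \<theta>"
          then have "(soft_pos (1 / real (Suc m)) (U i \<theta>))\<^sup>2 \<le> (\<bar>u i \<theta>\<bar>)\<^sup>2"
            using soft_pos_bounds[of "1 / real (Suc m)" "u i \<theta>"] by (intro power_mono) auto
          then show ?thesis by simp
        next
          assume a: "u i \<theta> = 0 \<and> U i \<theta> \<le> 0"
          then have "soft_pos (1 / real (Suc m)) (U i \<theta>) = 0"
            by (intro soft_pos_eq_0(1)) (auto intro: order_trans)
          then show ?thesis by simp
        qed
      qed
    qed
    have "\<forall>\<^sub>F m in sequentially. \<forall>i\<in>?I. r\<^sup>2 * A i < \<kappa> i * (LINT \<theta>|?\<sigma>. (soft_pos (1 / real (Suc m)) (U i \<theta>))\<^sup>2)"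
    proof (rule eventually_ball_finite[OF finite_atLeastAtMost], rule ballI)
      fix i assume i: "i \<in> ?I"
      have "(\<lambda>m. \<kappa> i * (LINT \<theta>|?\<sigma>. (soft_pos (1 / real (Suc m)) (U i \<theta>))\<^sup>2)) \<longlonglongrightarrow> \<kappa> i * q i"
        by (intro tendsto_intros lim_m[OF i])
      then show "\<forall>\<^sub>F m in sequentially. r\<^sup>2 * A i < \<kappa> i * (LINT \<theta>|?\<sigma>. (soft_pos (1 / real (Suc m)) (U i \<theta>))\<^sup>2)"
        by (rule order_tendstoD(1)[OF _ \<kappa>q[OF i]])
    qed
    then obtain m where m: "\<And>i. i \<in> ?I \<Longrightarrow> r\<^sup>2 * A i < \<kappa> i * (LINT \<theta>|?\<sigma>. (soft_pos (1 / real (Suc m)) (U i \<theta>))\<^sup>2)"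
      using eventually_happens'[OF sequentially_bot] by blast
    define \<epsilon> where "\<epsilon> = 1 / real (Suc m)"
    have \<epsilon>: "\<epsilon> > 0" by (simp add: \<epsilon>_def)
    define p where "p i \<theta> = soft_pos' \<epsilon> (U i \<theta>) *\<^sub>R tangential \<theta> (Hg i \<theta>)" for i \<theta>
    have lp: "L2_lim ?\<sigma> (\<lambda>n \<theta>. soft_pos' \<epsilon> (F i (\<rho> n) (r *\<^sub>R \<theta>)) *\<^sub>R tangential \<theta> (grad (F i (\<rho> n)) (r *\<^sub>R \<theta>))) (p i)" if i: "i \<in> ?I" for i
      unfolding p_def[abs_def]
      by (rule L2_lim_scale[OF L2_lim_subseq[OF lt \<rho>(1)] iH L2_limD(1)[OF lF] L2_limD(2)[OF lF] aeF[OF i] continuous_soft_pos' soft_pos'_bounds[OF \<epsilon>]])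
    have ple: "AE \<theta> in ?\<sigma>. (norm (p i \<theta>))\<^sup>2 \<le> (norm (tangential \<theta> (g i \<theta>)))\<^sup>2" if i: "i \<in> ?I" for i
      using struct[OF i]
    proof eventually_elim
      case (elim \<theta>)
      then show ?case
      proof
        assume a: "u i \<theta> > 0 \<and> U i \<theta> = u i \<theta> \<and> Hg i \<theta> = g i \<theta>"
        have "\<bar>soft_pos' \<epsilon> (U i \<theta>)\<bar> * norm (tangential \<theta> (g i \<theta>)) \<le> 1 * norm (tangential \<theta> (g i \<theta>))"
          using soft_pos'_bounds[OF \<epsilon>, of "U i \<theta>"] by (intro mult_right_mono) auto
        then show ?thesis using a by (intro power_mono) (simp_all add: p_def)
      next
        assume "u i \<theta> = 0 \<and> U i \<theta> \<le> 0"
        then have "soft_pos' \<epsilon> (U i \<theta>) = 0" using \<epsilon> by (intro soft_pos_eq_0(2)) auto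
        then show ?thesis by (simp add: p_def)
      qed
    qed
    have ip: "integrable ?\<sigma> (\<lambda>\<theta>. (norm (p i \<theta>))\<^sup>2)" if i: "i \<in> ?I" for i
    proof (rule Bochner_Integration.integrable_bound[OF itg[OF i]])
      show "(\<lambda>\<theta>. (norm (p i \<theta>))\<^sup>2) \<in> borel_measurable ?\<sigma>" using L2_limD(2)[OF lp[OF i]] by measurable
      show "AE \<theta> in ?\<sigma>. norm ((norm (p i \<theta>))\<^sup>2) \<le> norm ((norm (tangential \<theta> (g i \<theta>)))\<^sup>2)"
        using ple[OF i] by eventually_elim simp
    qed
    have pA: "(LINT \<theta>|?\<sigma>. (norm (p i \<theta>))\<^sup>2) \<le> A i" if i: "i \<in> ?I" for i
      unfolding A_def by (rule integral_mono_AE[OF ip[OF i] itg[OF i] ple[OF i]])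
    have ls: "L2_lim ?\<sigma> (\<lambda>n \<theta>. soft_pos \<epsilon> (F i (\<rho> n) (r *\<^sub>R \<theta>))) (\<lambda>\<theta>. soft_pos \<epsilon> (U i \<theta>))" for i
    proof (rule L2_lim_lipschitz[OF L2_lim_subseq[OF lF[of i] \<rho>(1)]])
      note sm = borel_measurable_continuous_onI[OF continuous_soft_pos]
      show "(\<lambda>\<theta>. soft_pos \<epsilon> (F i (\<rho> n) (r *\<^sub>R \<theta>))) \<in> borel_measurable ?\<sigma>" for n
        by (rule measurable_compose[OF L2_limD(1)[OF lF] sm])
      show "(\<lambda>\<theta>. soft_pos \<epsilon> (U i \<theta>)) \<in> borel_measurable ?\<sigma>"
        by (rule measurable_compose[OF L2_limD(2)[OF lF] sm])
    qed (simp add: soft_pos_lipschitz[OF \<epsilon>])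
    have isq: "integrable ?\<sigma> (\<lambda>\<theta>. (norm (soft_pos \<epsilon> (U i \<theta>)))\<^sup>2)" if i: "i \<in> ?I" for i
    proof (rule Bochner_Integration.integrable_bound[OF iu[OF i]])
      show "(\<lambda>\<theta>. (norm (soft_pos \<epsilon> (U i \<theta>)))\<^sup>2) \<in> borel_measurable ?\<sigma>" using L2_limD(2)[OF ls] by measurable
      show "AE \<theta> in ?\<sigma>. norm ((norm (soft_pos \<epsilon> (U i \<theta>)))\<^sup>2) \<le> norm ((u i \<theta>)\<^sup>2)"
        using struct[OF i]
      proof eventually_elim
        case (elim \<theta>)
        then show ?case
        proof
          assume a: "u i \<theta> > 0 \<and> U i \<theta> = u i \<theta> \<and> Hg i \<theta> = g i \<theta>"
          then have "(soft_pos \<epsilon> (U i \<theta>))\<^sup>2 \<le> (\<bar>u i \<theta>\<bar>)\<^sup>2"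
            using soft_pos_bounds[OF \<epsilon>, of "u i \<theta>"] by (intro power_mono) auto
          then show ?thesis by simp
        next
          assume "u i \<theta> = 0 \<and> U i \<theta> \<le> 0"
          then have "soft_pos \<epsilon> (U i \<theta>) = 0" using \<epsilon> by (intro soft_pos_eq_0(1)) auto
          then show ?thesis by simp
        qed
      qed
    qed
    have "\<forall>\<^sub>F n in sequentially. \<forall>i\<in>?I.
        r\<^sup>2 * (LINT \<theta>|?\<sigma>. (norm (soft_pos' \<epsilon> (F i (\<rho> n) (r *\<^sub>R \<theta>)) *\<^sub>R tangential \<theta> (grad (F i (\<rho> n)) (r *\<^sub>R \<theta>))))\<^sup>2)
          < \<kappa> i * (LINT \<theta>|?\<sigma>. (norm (soft_pos \<epsilon> (F i (\<rho> n) (r *\<^sub>R \<theta>))))\<^sup>2)"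
    proof (rule eventually_ball_finite[OF finite_atLeastAtMost], rule ballI)
      fix i assume i: "i \<in> ?I"
      let ?b = "\<lambda>n. LINT \<theta>|?\<sigma>. (norm (soft_pos \<epsilon> (F i (\<rho> n) (r *\<^sub>R \<theta>))))\<^sup>2"
      let ?a = "\<lambda>n. LINT \<theta>|?\<sigma>. (norm (soft_pos' \<epsilon> (F i (\<rho> n) (r *\<^sub>R \<theta>)) *\<^sub>R tangential \<theta> (grad (F i (\<rho> n)) (r *\<^sub>R \<theta>))))\<^sup>2"
      have "(\<lambda>n. \<kappa> i * ?b n - r\<^sup>2 * ?a n) \<longlonglongrightarrow> \<kappa> i * (LINT \<theta>|?\<sigma>. (norm (soft_pos \<epsilon> (U i \<theta>)))\<^sup>2) - r\<^sup>2 * (LINT \<theta>|?\<sigma>. (norm (p i \<theta>))\<^sup>2)"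
        by (intro tendsto_diff tendsto_mult tendsto_const L2_lim_norm[OF ls isq[OF i]] L2_lim_norm[OF lp[OF i] ip[OF i]])
      moreover have "0 < \<kappa> i * (LINT \<theta>|?\<sigma>. (norm (soft_pos \<epsilon> (U i \<theta>)))\<^sup>2) - r\<^sup>2 * (LINT \<theta>|?\<sigma>. (norm (p i \<theta>))\<^sup>2)"
      proof -
        have "r\<^sup>2 * (LINT \<theta>|?\<sigma>. (norm (p i \<theta>))\<^sup>2) \<le> r\<^sup>2 * A i" by (intro mult_left_mono pA[OF i]) simp
        then show ?thesis using m[OF i] by (simp add: \<epsilon>_def)
      qed
      ultimately have "\<forall>\<^sub>F n in sequentially. 0 < \<kappa> i * ?b n - r\<^sup>2 * ?a n" by (rule order_tendstoD(1))
      then show "\<forall>\<^sub>F n in sequentially. r\<^sup>2 * ?a n < \<kappa> i * ?b n" by eventually_elim simp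
    qed
    then obtain n0 where n0: "\<And>i. i \<in> ?I \<Longrightarrow> r\<^sup>2 * (LINT \<theta>|?\<sigma>. (norm (soft_pos' \<epsilon> (F i (\<rho> n0) (r *\<^sub>R \<theta>)) *\<^sub>R tangential \<theta> (grad (F i (\<rho> n0)) (r *\<^sub>R \<theta>))))\<^sup>2)
          < \<kappa> i * (LINT \<theta>|?\<sigma>. (norm (soft_pos \<epsilon> (F i (\<rho> n0) (r *\<^sub>R \<theta>))))\<^sup>2)"
      using eventually_happens'[OF sequentially_bot] by blast
    define n where "n = \<rho> n0"
    \<comment> \<open>The support of the competitor lies in the compact set \<open>K i\<close>, since the smooth positive part vanishes up to \<open>\<epsilon>\<close>.\<close>
    define Om where "Om i = {\<theta> \<in> sphere (0::'a) 1. F i n (r *\<^sub>R \<theta>) > 0}" for i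
    define K where "K i = {\<theta> \<in> sphere (0::'a) 1. F i n (r *\<^sub>R \<theta>) \<ge> \<epsilon>}" for i
    have Fc: "continuous_on A (\<lambda>\<theta>. F i n (r *\<^sub>R \<theta>))" for A i
      by (intro continuous_on_compose2[OF smooth_on_continuous[OF Fs]] continuous_intros) auto
    have exC: "\<exists>C\<in>components (Om i). openin (top_of_set (sphere 0 1)) C \<and> first_eigenvalue C \<le> \<kappa> i" if i: "i \<in> ?I" for i
    proof (rule exists_component[where V="\<lambda>x. soft_pos \<epsilon> (F i n x)" and K="K i" and r=r])
      show "smooth_on UNIV (\<lambda>x. soft_pos \<epsilon> (F i n x))"
        by (rule smooth_on_compose_real[OF smooth_soft_pos Fs open_UNIV])
      have "open ((\<lambda>\<theta>. F i n (r *\<^sub>R \<theta>)) -` {0<..})" using Fc by (intro open_vimage) auto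
      moreover have "Om i = sphere 0 1 \<inter> ((\<lambda>\<theta>. F i n (r *\<^sub>R \<theta>)) -` {0<..})" by (auto simp: Om_def)
      ultimately show "openin (top_of_set (sphere 0 1)) (Om i)" unfolding openin_open by blast
      have "closed ((\<lambda>\<theta>. F i n (r *\<^sub>R \<theta>)) -` {\<epsilon>..})" using Fc by (intro closed_vimage) auto
      then have "compact (sphere 0 1 \<inter> ((\<lambda>\<theta>. F i n (r *\<^sub>R \<theta>)) -` {\<epsilon>..}))" by (intro compact_Int_closed) auto
      moreover have "K i = sphere 0 1 \<inter> ((\<lambda>\<theta>. F i n (r *\<^sub>R \<theta>)) -` {\<epsilon>..})" by (auto simp: K_def)
      ultimately show "compact (K i)" by simp
      show "K i \<subseteq> Om i" using \<epsilon> by (auto simp: K_def Om_def)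
      show "\<theta> \<in> K i" if "norm \<theta> = 1" "soft_pos \<epsilon> (F i n (r *\<^sub>R \<theta>)) \<noteq> 0" for \<theta>
        using that soft_pos_eq_0(1)[OF \<epsilon>, of "F i n (r *\<^sub>R \<theta>)"] by (force simp: K_def)
      have "norm (r *\<^sub>R tangential \<theta> (grad (\<lambda>x. soft_pos \<epsilon> (F i n x)) (r *\<^sub>R \<theta>))) = r * norm (soft_pos' \<epsilon> (F i n (r *\<^sub>R \<theta>)) *\<^sub>R tangential \<theta> (grad (F i n) (r *\<^sub>R \<theta>)))" for \<theta>
        using r by (simp add: grad_compose_real[OF Fs soft_pos_deriv[OF \<epsilon>]] tangential_scaleR abs_mult)
      then show "(LINT \<theta>|?\<sigma>. (norm (r *\<^sub>R tangential \<theta> (grad (\<lambda>x. soft_pos \<epsilon> (F i n x)) (r *\<^sub>R \<theta>))))\<^sup>2)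
          < \<kappa> i * (LINT \<theta>|?\<sigma>. (soft_pos \<epsilon> (F i n (r *\<^sub>R \<theta>)))\<^sup>2)"
        using n0[OF i] by (simp only: power_mult_distrib integral_mult_right_zero n_def real_norm_def power2_abs)
    qed
    then obtain C where C: "\<And>i. i \<in> ?I \<Longrightarrow> C i \<in> components (Om i)" "\<And>i. i \<in> ?I \<Longrightarrow> openin (top_of_set (sphere 0 1)) (C i)"
      "\<And>i. i \<in> ?I \<Longrightarrow> first_eigenvalue (C i) \<le> \<kappa> i" by metis
    have Omdisj: "Om i \<inter> Om j = {}" if ij: "i \<in> ?I" "j \<in> ?I" "i \<noteq> j" for i j
    proof -
      have Fle: "F i n x \<le> \<phi> i n x - \<phi> j n x" if "i \<in> ?I" "j \<in> ?I" "i \<noteq> j" for i j x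
      proof -
        have "F i n x = \<phi> i n x - (\<Sum>k\<in>?I - {i}. \<phi> k n x)" unfolding F_def
          by (subst sum.remove[OF _ that(1)]) (auto simp: c_def sum_negf[symmetric] intro!: sum.cong)
        moreover have "\<phi> j n x \<le> (\<Sum>k\<in>?I - {i}. \<phi> k n x)"
          by (rule member_le_sum) (use that pos in auto)
        ultimately show ?thesis by simp
      qed
      have "\<not> (F i n x > 0 \<and> F j n x > 0)" for x
        using Fle[OF ij, of x] Fle[OF ij(2,1) ij(3)[symmetric], of x] by linarith
      then show ?thesis unfolding Om_def by blast
    qed
    have "C \<in> sphere_partitions h"
      unfolding sphere_partitions_def mem_Collect_eq disjoint_family_on_def
    proof (intro conjI ballI impI)
      fix i j assume ij: "i \<in> ?I" "j \<in> ?I" "i \<noteq> j"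
      show "C i \<inter> C j = {}"
        using in_components_subset[OF C(1)[OF ij(1)]] in_components_subset[OF C(1)[OF ij(2)]] Omdisj[OF ij] by blast
    qed (use C in_components_connected in_components_nonempty in blast)+
    then have "optimal_beta TYPE('a) h \<le> 2 / real h * (\<Sum>i\<in>?I. sqrt (first_eigenvalue (C i)))"
      by (rule optimal_beta_le[OF _ h])
    also have "\<dots> \<le> 2 / real h * (\<Sum>i\<in>?I. sqrt (\<kappa> i))"
      by (intro mult_left_mono sum_mono real_sqrt_le_mono C(3)) auto
    finally show ?thesis by (simp add: \<kappa>_def)
  qed
  have "optimal_beta TYPE('a) h \<le> 2 / real h * (\<Sum>i\<in>?I. sqrt (r\<^sup>2 * A i / q i))"
  proof (rule tendsto_lowerbound[where F="at_right 0" and f="\<lambda>\<delta>. 2 / real h * (\<Sum>i\<in>?I. sqrt (r\<^sup>2 * A i / q i + \<delta>))"])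
    have "((\<lambda>\<delta>. 2 / real h * (\<Sum>i\<in>?I. sqrt (r\<^sup>2 * A i / q i + \<delta>))) \<longlongrightarrow> 2 / real h * (\<Sum>i\<in>?I. sqrt (r\<^sup>2 * A i / q i + 0))) (at_right 0)"
      by (intro tendsto_intros)
    then show "((\<lambda>\<delta>. 2 / real h * (\<Sum>i\<in>?I. sqrt (r\<^sup>2 * A i / q i + \<delta>))) \<longlongrightarrow> 2 / real h * (\<Sum>i\<in>?I. sqrt (r\<^sup>2 * A i / q i))) (at_right 0)" by simp
    show "\<forall>\<^sub>F \<delta> in at_right 0. optimal_beta TYPE('a) h \<le> 2 / real h * (\<Sum>i\<in>?I. sqrt (r\<^sup>2 * A i / q i + \<delta>))"
      unfolding eventually_at_right_field using key by (intro exI[of _ 1]) auto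
  qed simp
  then show ?thesis by (simp add: A_def q_def)
qed

section \<open>The differential inequality and its integration\<close>

lemma continuous_cumulative:
  fixes a :: "real \<Rightarrow> real"
  assumes a: "integrable lborel a"
  shows "isCont (\<lambda>t. LINT s|lborel. indicator {..<t} s * a s) x"
  unfolding continuous_at_sequentially
proof (intro allI impI)
  fix t :: "nat \<Rightarrow> real" assume t: "t \<longlonglongrightarrow> x"
  have [measurable]: "a \<in> borel_measurable borel" using a by simp
  show "((\<lambda>t. LINT s|lborel. indicator {..<t} s * a s) \<circ> t) \<longlonglongrightarrow> (LINT s|lborel. indicator {..<x} s * a s)"
    unfolding o_def
  proof (rule integral_dominated_convergence[where w="\<lambda>s. \<bar>a s\<bar>"])
    show "integrable lborel (\<lambda>s. \<bar>a s\<bar>)" using a by simp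
    have "AE s in lborel. s \<noteq> x" by (rule AE_lborel_singleton)
    then show "AE s in lborel. (\<lambda>n. indicator {..<t n} s * a s) \<longlonglongrightarrow> indicator {..<x} s * a s"
    proof eventually_elim
      fix s assume "s \<noteq> x"
      then have "\<forall>\<^sub>F n in sequentially. (indicator {..<t n} s :: real) = indicator {..<x} s"
      proof (cases "s < x")
        case True
        then have "\<forall>\<^sub>F n in sequentially. s < t n" by (rule order_tendstoD(1)[OF t])
        then show ?thesis by eventually_elim (use True in simp)
      next
        case False
        then have "x < s" using \<open>s \<noteq> x\<close> by simp
        then have "\<forall>\<^sub>F n in sequentially. t n < s" by (rule order_tendstoD(2)[OF t])
        then show ?thesis by eventually_elim (use False in simp)
      qed
      then have "(\<lambda>n. indicator {..<t n} s :: real) \<longlonglongrightarrow> indicator {..<x} s" by (rule tendsto_eventually)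
      then show "(\<lambda>n. indicator {..<t n} s * a s) \<longlonglongrightarrow> indicator {..<x} s * a s" by (rule tendsto_mult_right)
    qed
  qed (auto simp: indicator_def)
qed

text \<open>The functions \<open>D i\<close> are absolutely continuous with derivative \<open>a i\<close>, so the claim is the integral of \<open>ratio\<close>. To avoid
differentiating them, the inequality is first proved with a factor \<open>k < 1\<close> on short intervals, on which \<open>D i\<close> changes by
a factor of at most \<open>1 / k\<close>. There \<open>a i \<tau> / D i \<tau>\<close> can be compared with \<open>a i \<tau> / D i t\<close>, whose integral is bounded by the
increase of the logarithm. The intervals are joined by the Bolzano principle.\<close>

lemma log_growth:
  fixes a :: "'i \<Rightarrow> real \<Rightarrow> real"
  assumes I: "finite I" and ai: "\<And>i. i \<in> I \<Longrightarrow> integrable lborel (a i)" and a0: "\<And>i t. i \<in> I \<Longrightarrow> a i t \<ge> 0"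
    and D: "\<And>i t. i \<in> I \<Longrightarrow> D i t = (LINT s|lborel. indicator {..<t} s * a i s)"
    and pq: "0 < p" "p \<le> q" and Dp: "\<And>i. i \<in> I \<Longrightarrow> D i p > 0"
    and ratio: "AE t in lborel. p < t \<and> t < q \<longrightarrow> c / t \<le> (\<Sum>i\<in>I. a i t / D i t)"
  shows "c * (ln q - ln p) \<le> (\<Sum>i\<in>I. ln (D i q) - ln (D i p))"
proof -
  have ind: "integrable lborel (\<lambda>s. indicator A s * a i s)" if "i \<in> I" "A \<in> sets borel" for i A
    using integrable_mult_indicator[of A lborel "a i"] ai[OF that(1)] that(2) by simp
  have diff: "D i t - D i s = (LINT \<tau>|lborel. indicator {s..<t} \<tau> * a i \<tau>)" if "i \<in> I" "s \<le> t" for i s t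
  proof -
    have "D i t - D i s = (LINT \<tau>|lborel. indicator {..<t} \<tau> * a i \<tau> - indicator {..<s} \<tau> * a i \<tau>)"
      using ind[OF that(1)] by (simp add: D[OF that(1)])
    also have "\<dots> = (LINT \<tau>|lborel. indicator {s..<t} \<tau> * a i \<tau>)"
      by (intro Bochner_Integration.integral_cong refl) (use that(2) in \<open>auto simp: indicator_def\<close>)
    finally show ?thesis .
  qed
  have mono: "D i s \<le> D i t" if "i \<in> I" "s \<le> t" for i s t
  proof -
    have "0 \<le> (LINT \<tau>|lborel. indicator {s..<t} \<tau> * a i \<tau>)"
      by (intro integral_nonneg_AE AE_I2) (simp add: a0[OF that(1)])
    then show ?thesis using diff[OF that] by linarith
  qed
  have Dpos: "D i t > 0" if "i \<in> I" "p \<le> t" for i t using mono[OF that] Dp[OF that(1)] by linarith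
  have cont: "isCont (D i) x" if "i \<in> I" for i x
  proof -
    have "D i = (\<lambda>t. LINT s|lborel. indicator {..<t} s * a i s)" using D[OF that] by auto
    then show ?thesis using continuous_cumulative[OF ai[OF that]] by simp
  qed
  have main: "k * c * (ln q - ln p) \<le> (\<Sum>i\<in>I. ln (D i q) - ln (D i p))" if k: "0 < k" "k < 1" for k
  proof -
    define P where "P s t \<longleftrightarrow> (p \<le> s \<and> s \<le> t \<and> t \<le> q \<longrightarrow> k * c * (ln t - ln s) \<le> (\<Sum>i\<in>I. ln (D i t) - ln (D i s)))" for s t
    have "P p q"
      using pq(2)
    proof (induction rule: Bolzano)
      case (trans s t v)
      show ?case unfolding P_def
      proof
        assume b: "p \<le> s \<and> s \<le> v \<and> v \<le> q"
        have "k * c * (ln t - ln s) \<le> (\<Sum>i\<in>I. ln (D i t) - ln (D i s))" using trans b unfolding P_def by auto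
        moreover have "k * c * (ln v - ln t) \<le> (\<Sum>i\<in>I. ln (D i v) - ln (D i t))" using trans b unfolding P_def by auto
        ultimately have "k * c * (ln t - ln s) + k * c * (ln v - ln t) \<le> (\<Sum>i\<in>I. ln (D i t) - ln (D i s)) + (\<Sum>i\<in>I. ln (D i v) - ln (D i t))" by linarith
        then show "k * c * (ln v - ln s) \<le> (\<Sum>i\<in>I. ln (D i v) - ln (D i s))"
          by (simp add: sum.distrib[symmetric] algebra_simps)
      qed
    next
      case (local x)
      \<comment> \<open>Near \<open>x\<close> each \<open>D i\<close> stays within the factors \<open>sqrt k\<close> and \<open>1 / sqrt k\<close> of its value at \<open>x\<close>, so that the quotient of any
two nearby values is at least \<open>k\<close>.\<close>
      define sk where "sk = sqrt k"
      have sk: "0 < sk" "sk < 1" "sk * sk = k" using k by (auto simp: sk_def)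
      have "\<forall>i\<in>I. \<forall>\<^sub>F t in nhds x. sk * D i x < D i t \<and> D i t < D i x / sk"
      proof
        fix i assume i: "i \<in> I"
        have Dx: "D i x > 0" using Dpos[OF i] local by blast
        have t: "(D i \<longlongrightarrow> D i x) (nhds x)" using cont[OF i, of x] unfolding isCont_def tendsto_at_iff_tendsto_nhds .
        have "sk * D i x < D i x" "D i x < D i x / sk" using Dx sk by (simp_all add: field_simps)
        then show "\<forall>\<^sub>F t in nhds x. sk * D i x < D i t \<and> D i t < D i x / sk"
          by (intro eventually_conj order_tendstoD[OF t])
      qed
      then have "\<forall>\<^sub>F t in nhds x. \<forall>i\<in>I. sk * D i x < D i t \<and> D i t < D i x / sk"
        by (rule eventually_ball_finite[OF I])
      then obtain d where d: "d > 0" "\<And>t. dist t x < d \<Longrightarrow> \<forall>i\<in>I. sk * D i x < D i t \<and> D i t < D i x / sk"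
        unfolding eventually_nhds_metric by blast
      show ?case
      proof (intro exI conjI allI impI)
        show "d > 0" by (rule d(1))
        fix s t assume st: "s \<le> x \<and> x \<le> t \<and> t - s < d"
        show "P s t" unfolding P_def
        proof
          assume b: "p \<le> s \<and> s \<le> t \<and> t \<le> q"
          have s0: "s > 0" using b pq by linarith
          have kD: "k * D i t \<le> D i \<tau>" if "i \<in> I" "s \<le> \<tau>" "\<tau> \<le> t" for i \<tau>
          proof -
            have "dist t x < d" "dist \<tau> x < d" using st that by (auto simp: dist_real_def)
            then have "D i t < D i x / sk" "sk * D i x < D i \<tau>" using d(2) that(1) by blast+
            then have "k * D i t \<le> k * (D i x / sk)" using k by (intro mult_left_mono) auto
            also have "k * (D i x / sk) = sk * D i x" using sk by (simp add: sk(3)[symmetric])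
            finally show ?thesis using \<open>sk * D i x < D i \<tau>\<close> by linarith
          qed
          \<comment> \<open>From $\ln y \le y - 1$ with $y = D_i(s) / D_i(t)$.\<close>
          have lnle: "(D i t - D i s) / D i t \<le> ln (D i t) - ln (D i s)" if i: "i \<in> I" for i
          proof -
            have pos: "D i s > 0" "D i t > 0" using Dpos[OF i] b by auto
            have "ln (D i s / D i t) \<le> D i s / D i t - 1" by (rule ln_le_minus_one) (use pos in simp)
            then show ?thesis using pos by (simp add: ln_div diff_divide_distrib)
          qed
          have inv: "has_bochner_integral lborel (\<lambda>\<tau>. inverse \<tau> * indicator {s..t} \<tau>) (ln t - ln s)"
          proof (rule has_bochner_integral_FTC_Icc_nonneg)
            show "inverse \<in> borel_measurable (borel :: real measure)" by measurable
            fix \<tau> assume "\<tau> \<in> {s..t}"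
            then have "\<tau> > 0" using s0 by auto
            then show "DERIV ln \<tau> :> inverse \<tau>" "0 \<le> inverse \<tau>" by (auto intro: DERIV_ln)
          qed (use b in auto)
          have iS: "integrable lborel (\<lambda>\<tau>. \<Sum>i\<in>I. (indicator {s..<t} \<tau> * a i \<tau>) / D i t)"
            by (intro Bochner_Integration.integrable_sum integrable_divide ind) auto
          have "k * c * (ln t - ln s) = (LINT \<tau>|lborel. (k * c) * (inverse \<tau> * indicator {s..t} \<tau>))"
            by (rule has_bochner_integral_integral_eq[OF has_bochner_integral_mult_right[OF inv], symmetric])
          also have "\<dots> \<le> (LINT \<tau>|lborel. (\<Sum>i\<in>I. (indicator {s..<t} \<tau> * a i \<tau>) / D i t))"
          proof (rule integral_mono_AE[OF _ iS])
            show "integrable lborel (\<lambda>\<tau>. (k * c) * (inverse \<tau> * indicator {s..t} \<tau>))"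
              by (rule integrable_mult_right) (use inv in \<open>unfold has_bochner_integral_iff, blast\<close>)
            have "AE \<tau> in lborel. \<tau> \<noteq> s \<and> \<tau> \<noteq> t"
              using AE_lborel_singleton[of s] AE_lborel_singleton[of t] by eventually_elim simp
            with ratio show "AE \<tau> in lborel. (k * c) * (inverse \<tau> * indicator {s..t} \<tau>) \<le> (\<Sum>i\<in>I. (indicator {s..<t} \<tau> * a i \<tau>) / D i t)"
            proof eventually_elim
              fix \<tau> assume r: "p < \<tau> \<and> \<tau> < q \<longrightarrow> c / \<tau> \<le> (\<Sum>i\<in>I. a i \<tau> / D i \<tau>)" and ne: "\<tau> \<noteq> s \<and> \<tau> \<noteq> t"
              show "(k * c) * (inverse \<tau> * indicator {s..t} \<tau>) \<le> (\<Sum>i\<in>I. (indicator {s..<t} \<tau> * a i \<tau>) / D i t)"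
              proof (cases "s < \<tau> \<and> \<tau> < t")
                case True
                have "k * (c / \<tau>) \<le> k * (\<Sum>i\<in>I. a i \<tau> / D i \<tau>)"
                  using r True b k by (intro mult_left_mono) auto
                also have "\<dots> = (\<Sum>i\<in>I. k * (a i \<tau> / D i \<tau>))" by (rule sum_distrib_left)
                also have "\<dots> \<le> (\<Sum>i\<in>I. a i \<tau> / D i t)"
                proof (rule sum_mono)
                  fix i assume i: "i \<in> I"
                  have pos: "D i \<tau> > 0" "D i t > 0" using Dpos[OF i] b True by auto
                  have "a i \<tau> * (k * D i t) \<le> a i \<tau> * D i \<tau>"
                    using kD[OF i, of \<tau>] True by (intro mult_left_mono a0[OF i]) auto
                  then show "k * (a i \<tau> / D i \<tau>) \<le> a i \<tau> / D i t" using pos by (simp add: field_simps)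
                qed
                finally show ?thesis using True by (simp add: divide_inverse mult_ac)
              next
                case False
                then have "\<tau> \<notin> {s..t}" using ne by auto
                moreover then have "\<tau> \<notin> {s..<t}" by auto
                ultimately show ?thesis by simp
              qed
            qed
          qed
          also have "\<dots> = (\<Sum>i\<in>I. (LINT \<tau>|lborel. (indicator {s..<t} \<tau> * a i \<tau>) / D i t))"
            by (rule Bochner_Integration.integral_sum) (intro integrable_divide ind, auto)
          also have "\<dots> = (\<Sum>i\<in>I. (D i t - D i s) / D i t)"
            by (intro sum.cong refl) (use b in \<open>simp add: diff\<close>)
          also have "\<dots> \<le> (\<Sum>i\<in>I. ln (D i t) - ln (D i s))" by (rule sum_mono[OF lnle])
          finally show "k * c * (ln t - ln s) \<le> (\<Sum>i\<in>I. ln (D i t) - ln (D i s))" .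
        qed
      qed
    qed
    then show ?thesis using pq(2) unfolding P_def by simp
  qed
  show ?thesis
  proof (rule tendsto_upperbound[where F="at_left 1" and f="\<lambda>k. k * c * (ln q - ln p)"])
    have "((\<lambda>k. k * c * (ln q - ln p)) \<longlongrightarrow> 1 * c * (ln q - ln p)) (at_left 1)" by (intro tendsto_intros)
    then show "((\<lambda>k. k * c * (ln q - ln p)) \<longlongrightarrow> c * (ln q - ln p)) (at_left 1)" by simp
    show "\<forall>\<^sub>F k in at_left 1. k * c * (ln q - ln p) \<le> (\<Sum>i\<in>I. ln (D i q) - ln (D i p))"
      unfolding eventually_at_left_field using main by (intro exI[of _ 0]) auto
  qed simp
qed

lemma L2_lim_mult:
  fixes q q' :: "nat \<Rightarrow> 'a \<Rightarrow> real"
  assumes "L2_lim M q p" "L2_lim M q' p'" "integrable M (\<lambda>x. (p x)\<^sup>2)" "integrable M (\<lambda>x. (p' x)\<^sup>2)"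
  shows "(\<lambda>n. LINT x|M. q n x * q' n x) \<longlonglongrightarrow> (LINT x|M. p x * p' x)"
proof -
  note [measurable] = L2_limD(1,2)[OF assms(1)] L2_limD(1,2)[OF assms(2)]
  have m: "L2_lim M (\<lambda>n x. - q' n x) (\<lambda>x. - p' x)"
    by (rule L2_lim_lipschitz[OF assms(2)]) (auto simp: abs_minus_commute)
  note s = L2_lim_add[OF assms(1,2)] and d = L2_lim_add[OF assms(1) m]
  have bd: "(p x + p' x)\<^sup>2 \<le> 2 * (p x)\<^sup>2 + 2 * (p' x)\<^sup>2" "(p x - p' x)\<^sup>2 \<le> 2 * (p x)\<^sup>2 + 2 * (p' x)\<^sup>2" for x
    using zero_le_power2[of "p x - p' x"] zero_le_power2[of "p x + p' x"] by (simp_all add: power2_eq_square algebra_simps)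
  have iw: "integrable M (\<lambda>x. 2 * (p x)\<^sup>2 + 2 * (p' x)\<^sup>2)" using assms(3,4) by simp
  have isq: "integrable M (\<lambda>x. (norm (p x + p' x))\<^sup>2)"
    by (rule Bochner_Integration.integrable_bound[OF iw]) (use bd(1) in auto)
  have id: "integrable M (\<lambda>x. (norm (p x + - p' x))\<^sup>2)"
    by (rule Bochner_Integration.integrable_bound[OF iw]) (use bd(2) in auto)
  have pol: "a * b = ((norm (a + b))\<^sup>2 - (norm (a + - b))\<^sup>2) / 4" for a b :: real
    by (simp add: power2_eq_square algebra_simps)
  have e1: "(LINT x|M. q n x * q' n x) = ((LINT x|M. (norm (q n x + q' n x))\<^sup>2) - (LINT x|M. (norm (q n x + - q' n x))\<^sup>2)) / 4" for n
    unfolding pol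
    using L2_norm_tendsto(2)[OF L2_limD(1,2)[OF s] isq L2_limD(3,4)[OF s], of n] L2_norm_tendsto(2)[OF L2_limD(1,2)[OF d] id L2_limD(3,4)[OF d], of n]
    by simp
  have e2: "(LINT x|M. p x * p' x) = ((LINT x|M. (norm (p x + p' x))\<^sup>2) - (LINT x|M. (norm (p x + - p' x))\<^sup>2)) / 4"
    unfolding pol using isq id by simp
  show ?thesis unfolding e1 e2
    by (intro tendsto_divide tendsto_diff tendsto_const L2_lim_norm[OF s isq] L2_lim_norm[OF d id]) simp
qed

text \<open>The inequality \<open>energy_smooth\<close> for the mollified functions, which are nonnegative and, near the ball of radius \<open>t\<close>,
subharmonic, passes to the limit: both sides are continuous under the convergences that hold on the sphere and in the
ball.\<close>

lemma energy_slice: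
  fixes W :: "'a::euclidean_space \<Rightarrow> real"
  assumes SB: "sobolev_ball R W G" and W0: "AE x in lborel. W x \<ge> 0"
    and sub: "\<And>\<phi>. \<phi> \<in> test_functions (ball 0 R) \<Longrightarrow> (\<And>x. \<phi> x \<ge> 0) \<Longrightarrow> (LINT x|lborel. W x * laplacian \<phi> x) \<ge> 0"
    and t: "0 < t" "t < R" and \<rho>: "strict_mono (\<rho>::nat\<Rightarrow>nat)"
    and lw: "L2_lim sphere_measure (\<lambda>n \<theta>. mollified W (\<rho> n) (t *\<^sub>R \<theta>)) (\<lambda>\<theta>. W (t *\<^sub>R \<theta>))"
    and lg: "L2_lim sphere_measure (\<lambda>n \<theta>. grad (mollified W (\<rho> n)) (t *\<^sub>R \<theta>)) (\<lambda>\<theta>. G (t *\<^sub>R \<theta>))"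
    and iw: "integrable sphere_measure (\<lambda>\<theta>. (W (t *\<^sub>R \<theta>))\<^sup>2)" and ig: "integrable sphere_measure (\<lambda>\<theta>. (norm (G (t *\<^sub>R \<theta>)))\<^sup>2)"
  shows "(LINT x|lborel. indicator (ball 0 t) x * (norm (G x))\<^sup>2)
    \<le> t ^ (DIM('a) - 1) * (LINT \<theta>|sphere_measure. W (t *\<^sub>R \<theta>) * (G (t *\<^sub>R \<theta>) \<bullet> \<theta>))"
proof -
  have [measurable]: "ball (0::'a) t \<in> sets borel" by simp
  note [measurable] = sobolev_measurable[OF SB] mollified_measurable[OF SB]
  have l1: "L2_lim lborel (\<lambda>n x. indicator (ball 0 t) x *\<^sub>R grad (mollified W n) x) (\<lambda>x. indicator (ball 0 t) x *\<^sub>R G x)"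
  proof (rule L2_limI[OF _ _ grad_mollified_tendsto(2)[OF SB t(2)] _ grad_mollified_tendsto(1)[OF SB t(2)]])
    show "(norm (indicator (ball 0 t) x *\<^sub>R grad (mollified W n) x - indicator (ball 0 t) x *\<^sub>R G x))\<^sup>2 \<le> indicator (ball 0 t) x * (norm (grad (mollified W n) x - G x))\<^sup>2" for n x
      by (simp add: indicator_def)
  qed measurable
  have sq: "(norm (indicator (ball 0 t) x *\<^sub>R v))\<^sup>2 = indicator (ball 0 t) x * (norm v)\<^sup>2" for x v :: 'a by (simp add: indicator_def)
  have iG: "integrable lborel (\<lambda>x. (norm (indicator (ball 0 t) x *\<^sub>R G x))\<^sup>2)"
    unfolding sq using integrable_mult_indicator[of "ball (0::'a) t" lborel "\<lambda>x. (norm (G x))\<^sup>2"] sobolev_square_integrable(2)[OF SB] by simp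
  have L: "(\<lambda>n. LINT x|lborel. indicator (ball 0 t) x * (norm (grad (mollified W (\<rho> n)) x))\<^sup>2) \<longlonglongrightarrow> (LINT x|lborel. indicator (ball 0 t) x * (norm (G x))\<^sup>2)"
    using L2_lim_norm[OF L2_lim_subseq[OF l1 \<rho>] iG] unfolding sq .
  have lgn: "L2_lim sphere_measure (\<lambda>n \<theta>. grad (mollified W (\<rho> n)) (t *\<^sub>R \<theta>) \<bullet> \<theta>) (\<lambda>\<theta>. G (t *\<^sub>R \<theta>) \<bullet> \<theta>)"
  proof (rule L2_lim_lipschitz[OF lg])
    have [measurable]: "(\<lambda>\<theta>::'a. \<theta>) \<in> borel_measurable sphere_measure" using sphere_comp_measurable[of "\<lambda>x::'a. x" 1] by simp
    note [measurable] = L2_limD(1,2)[OF lg]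
    show "(\<lambda>\<theta>. grad (mollified W (\<rho> n)) (t *\<^sub>R \<theta>) \<bullet> \<theta>) \<in> borel_measurable sphere_measure" for n by measurable
    show "(\<lambda>\<theta>. G (t *\<^sub>R \<theta>) \<bullet> \<theta>) \<in> borel_measurable sphere_measure" by measurable
    fix n and \<theta> :: 'a assume "\<theta> \<in> space sphere_measure"
    then show "norm (grad (mollified W (\<rho> n)) (t *\<^sub>R \<theta>) \<bullet> \<theta> - G (t *\<^sub>R \<theta>) \<bullet> \<theta>) \<le> norm (grad (mollified W (\<rho> n)) (t *\<^sub>R \<theta>) - G (t *\<^sub>R \<theta>))"
      using Cauchy_Schwarz_ineq2[of "grad (mollified W (\<rho> n)) (t *\<^sub>R \<theta>) - G (t *\<^sub>R \<theta>)" \<theta>] by (simp add: inner_diff_left space_sphere_measure)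
  qed
  have ign: "integrable sphere_measure (\<lambda>\<theta>. (G (t *\<^sub>R \<theta>) \<bullet> \<theta>)\<^sup>2)"
  proof (rule Bochner_Integration.integrable_bound[OF ig])
    note [measurable] = L2_limD(1,2)[OF lgn]
    show "(\<lambda>\<theta>. (G (t *\<^sub>R \<theta>) \<bullet> \<theta>)\<^sup>2) \<in> borel_measurable sphere_measure" by measurable
    show "AE \<theta> in sphere_measure. norm ((G (t *\<^sub>R \<theta>) \<bullet> \<theta>)\<^sup>2) \<le> norm ((norm (G (t *\<^sub>R \<theta>)))\<^sup>2)"
    proof (rule AE_I2)
      fix \<theta> :: 'a assume "\<theta> \<in> space sphere_measure"
      then have "\<bar>G (t *\<^sub>R \<theta>) \<bullet> \<theta>\<bar> \<le> \<bar>norm (G (t *\<^sub>R \<theta>))\<bar>"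
        using Cauchy_Schwarz_ineq2[of "G (t *\<^sub>R \<theta>)" \<theta>] by (simp add: space_sphere_measure)
      then show "norm ((G (t *\<^sub>R \<theta>) \<bullet> \<theta>)\<^sup>2) \<le> norm ((norm (G (t *\<^sub>R \<theta>)))\<^sup>2)"
        by (simp add: abs_le_square_iff[symmetric])
    qed
  qed
  have "(\<lambda>n. t ^ (DIM('a) - 1) * (LINT \<theta>|sphere_measure. mollified W (\<rho> n) (t *\<^sub>R \<theta>) * (grad (mollified W (\<rho> n)) (t *\<^sub>R \<theta>) \<bullet> \<theta>)))
      \<longlonglongrightarrow> t ^ (DIM('a) - 1) * (LINT \<theta>|sphere_measure. W (t *\<^sub>R \<theta>) * (G (t *\<^sub>R \<theta>) \<bullet> \<theta>))"
    by (intro tendsto_mult tendsto_const L2_lim_mult[OF lw lgn iw ign])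
  moreover have "\<forall>\<^sub>F n in sequentially. (LINT x|lborel. indicator (ball 0 t) x * (norm (grad (mollified W (\<rho> n)) x))\<^sup>2)
      \<le> t ^ (DIM('a) - 1) * (LINT \<theta>|sphere_measure. mollified W (\<rho> n) (t *\<^sub>R \<theta>) * (grad (mollified W (\<rho> n)) (t *\<^sub>R \<theta>) \<bullet> \<theta>))"
  proof -
    have "\<forall>\<^sub>F n in sequentially. 1 / real (Suc n) < R - t"
      by (rule order_tendstoD(2)[OF LIMSEQ_Suc[OF lim_1_over_n]]) (use t in simp)
    then have "\<forall>\<^sub>F n in sequentially. 1 / real (Suc (\<rho> n)) < R - t"
      using eventually_subseq[OF \<rho>] by blast
    then show ?thesis
    proof eventually_elim
      fix n assume n: "1 / real (Suc (\<rho> n)) < R - t"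
      have d: "1 / real (Suc (\<rho> n)) > 0" by simp
      show "(LINT x|lborel. indicator (ball 0 t) x * (norm (grad (mollified W (\<rho> n)) x))\<^sup>2)
        \<le> t ^ (DIM('a) - 1) * (LINT \<theta>|sphere_measure. mollified W (\<rho> n) (t *\<^sub>R \<theta>) * (grad (mollified W (\<rho> n)) (t *\<^sub>R \<theta>) \<bullet> \<theta>))"
      proof (rule energy_smooth[OF mollified_smooth[OF SB] t(1)])
        show "mollified W (\<rho> n) x \<ge> 0" for x unfolding mollified_def[OF SB] by (rule conv_nonneg[OF SB W0 d])
        fix x :: 'a assume "norm x < t"
        then have "norm x + 1 / real (Suc (\<rho> n)) < R" using n by linarith
        then show "laplacian (mollified W (\<rho> n)) x \<ge> 0" unfolding mollified_def[OF SB]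
          by (intro laplacian_conv_nonneg[OF SB sub d]) auto
      qed
    qed
  qed
  ultimately show ?thesis using L by (intro tendsto_le[OF sequentially_bot])
qed

text \<open>Facts (1), (2) and (3) of the introduction combined for almost every radius. That the quotient \<open>\<kappa> i\<close> makes sense is part of
(1): if \<open>W i\<close> vanished on the sphere, the energy in the ball would be zero.\<close>

lemma slice_ratio:
  fixes W :: "nat \<Rightarrow> 'a::euclidean_space \<Rightarrow> real"
  assumes h: "h \<ge> 1" and SB: "\<And>i. i \<in> {1..h} \<Longrightarrow> sobolev_ball R (W i) (G i)"
    and W0: "\<And>i. i \<in> {1..h} \<Longrightarrow> AE x in lborel. W i x \<ge> 0"
    and disj: "\<And>i j. i \<in> {1..h} \<Longrightarrow> j \<in> {1..h} \<Longrightarrow> i \<noteq> j \<Longrightarrow> AE x in lborel. W i x * W j x = 0"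
    and sub: "\<And>i \<phi>. i \<in> {1..h} \<Longrightarrow> \<phi> \<in> test_functions (ball 0 R) \<Longrightarrow> (\<And>x. \<phi> x \<ge> 0) \<Longrightarrow> (LINT x|lborel. W i x * laplacian \<phi> x) \<ge> 0"
    and D: "\<And>i t. i \<in> {1..h} \<Longrightarrow> D i t = (LINT x|lborel. indicator (ball 0 t) x * (norm (G i x))\<^sup>2)"
    and s: "s < R"
  shows "AE t in lborel. 0 < t \<and> t < s \<and> (\<forall>i\<in>{1..h}. D i t > 0) \<longrightarrow>
    real h * optimal_beta TYPE('a) h / t \<le> (\<Sum>i\<in>{1..h}. (t ^ (DIM('a) - 1) * (LINT \<theta>|sphere_measure. (norm (G i (t *\<^sub>R \<theta>)))\<^sup>2)) / D i t)"
proof -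
  let ?I = "{1..h}"
  let ?\<sigma> = "sphere_measure :: 'a measure"
  obtain \<rho> where \<rho>: "strict_mono (\<rho>::nat\<Rightarrow>nat)" and sl: "AE t in lborel. 0 < t \<and> t < s \<longrightarrow> (\<forall>i\<in>?I.
     (\<forall>n. integrable ?\<sigma> (\<lambda>\<theta>. (mollified (W i) n (t *\<^sub>R \<theta>) - W i (t *\<^sub>R \<theta>))\<^sup>2)) \<and>
     (\<forall>n. integrable ?\<sigma> (\<lambda>\<theta>. (norm (grad (mollified (W i) n) (t *\<^sub>R \<theta>) - G i (t *\<^sub>R \<theta>)))\<^sup>2)) \<and>
     (\<lambda>n. LINT \<theta>|?\<sigma>. (mollified (W i) (\<rho> n) (t *\<^sub>R \<theta>) - W i (t *\<^sub>R \<theta>))\<^sup>2) \<longlonglongrightarrow> 0 \<and>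
     (\<lambda>n. LINT \<theta>|?\<sigma>. (norm (grad (mollified (W i) (\<rho> n)) (t *\<^sub>R \<theta>) - G i (t *\<^sub>R \<theta>)))\<^sup>2) \<longlonglongrightarrow> 0)"
    using sphere_slices[of ?I R W G s] SB s by auto
  have "AE t in lborel. \<forall>i\<in>?I. t > 0 \<longrightarrow> integrable ?\<sigma> (\<lambda>\<theta>. (W i (t *\<^sub>R \<theta>))\<^sup>2)"
    by (intro AE_finite_allI polar_integral(3)[OF sobolev_square_integrable(1)[OF SB]]) auto
  moreover have "AE t in lborel. \<forall>i\<in>?I. t > 0 \<longrightarrow> integrable ?\<sigma> (\<lambda>\<theta>. (norm (G i (t *\<^sub>R \<theta>)))\<^sup>2)"
    by (intro AE_finite_allI polar_integral(3)[OF sobolev_square_integrable(2)[OF SB]]) auto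
  moreover have "AE t in lborel. \<forall>i\<in>?I. t > 0 \<longrightarrow> (AE \<theta> in ?\<sigma>. W i (t *\<^sub>R \<theta>) \<ge> 0)"
    by (intro AE_finite_allI polar_AE W0) auto
  moreover have "AE t in lborel. \<forall>i\<in>?I. t > 0 \<longrightarrow> (AE \<theta> in ?\<sigma>. W i (t *\<^sub>R \<theta>) = 0 \<longrightarrow> G i (t *\<^sub>R \<theta>) = 0)"
    by (intro AE_finite_allI polar_AE[OF stampacchia[OF SB]]) auto
  moreover have "AE t in lborel. \<forall>i\<in>?I. \<forall>j\<in>?I. t > 0 \<longrightarrow> (AE \<theta> in ?\<sigma>. i \<noteq> j \<longrightarrow> W i (t *\<^sub>R \<theta>) * W j (t *\<^sub>R \<theta>) = 0)"
  proof (intro AE_finite_allI polar_AE)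
    fix i j assume "i \<in> ?I" "j \<in> ?I"
    then show "AE x in lborel. i \<noteq> j \<longrightarrow> W i x * W j x = 0" using disj[of i j] by (cases "i = j") auto
  qed auto
  ultimately show ?thesis using sl
  proof eventually_elim
    fix t
    assume iw: "\<forall>i\<in>?I. t > 0 \<longrightarrow> integrable ?\<sigma> (\<lambda>\<theta>. (W i (t *\<^sub>R \<theta>))\<^sup>2)"
      and ig: "\<forall>i\<in>?I. t > 0 \<longrightarrow> integrable ?\<sigma> (\<lambda>\<theta>. (norm (G i (t *\<^sub>R \<theta>)))\<^sup>2)"
      and w0: "\<forall>i\<in>?I. t > 0 \<longrightarrow> (AE \<theta> in ?\<sigma>. W i (t *\<^sub>R \<theta>) \<ge> 0)"
      and gz: "\<forall>i\<in>?I. t > 0 \<longrightarrow> (AE \<theta> in ?\<sigma>. W i (t *\<^sub>R \<theta>) = 0 \<longrightarrow> G i (t *\<^sub>R \<theta>) = 0)"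
      and dj: "\<forall>i\<in>?I. \<forall>j\<in>?I. t > 0 \<longrightarrow> (AE \<theta> in ?\<sigma>. i \<noteq> j \<longrightarrow> W i (t *\<^sub>R \<theta>) * W j (t *\<^sub>R \<theta>) = 0)"
      and sl: "0 < t \<and> t < s \<longrightarrow> (\<forall>i\<in>?I.
     (\<forall>n. integrable ?\<sigma> (\<lambda>\<theta>. (mollified (W i) n (t *\<^sub>R \<theta>) - W i (t *\<^sub>R \<theta>))\<^sup>2)) \<and>
     (\<forall>n. integrable ?\<sigma> (\<lambda>\<theta>. (norm (grad (mollified (W i) n) (t *\<^sub>R \<theta>) - G i (t *\<^sub>R \<theta>)))\<^sup>2)) \<and>
     (\<lambda>n. LINT \<theta>|?\<sigma>. (mollified (W i) (\<rho> n) (t *\<^sub>R \<theta>) - W i (t *\<^sub>R \<theta>))\<^sup>2) \<longlonglongrightarrow> 0 \<and>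
     (\<lambda>n. LINT \<theta>|?\<sigma>. (norm (grad (mollified (W i) (\<rho> n)) (t *\<^sub>R \<theta>) - G i (t *\<^sub>R \<theta>)))\<^sup>2) \<longlonglongrightarrow> 0)"
    show "0 < t \<and> t < s \<and> (\<forall>i\<in>?I. D i t > 0) \<longrightarrow>
      real h * optimal_beta TYPE('a) h / t \<le> (\<Sum>i\<in>?I. (t ^ (DIM('a) - 1) * (LINT \<theta>|?\<sigma>. (norm (G i (t *\<^sub>R \<theta>)))\<^sup>2)) / D i t)"
    proof
      assume as: "0 < t \<and> t < s \<and> (\<forall>i\<in>?I. D i t > 0)"
      then have t: "0 < t" "t < s" "t < R" and Dt: "\<And>i. i \<in> ?I \<Longrightarrow> D i t > 0" using s by auto
      have lw: "L2_lim ?\<sigma> (\<lambda>n \<theta>. mollified (W i) (\<rho> n) (t *\<^sub>R \<theta>)) (\<lambda>\<theta>. W i (t *\<^sub>R \<theta>))" if i: "i \<in> ?I" for i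
        unfolding L2_lim_def
        using sl t i mollified_measurable(1)[OF SB[OF i]] sobolev_measurable(1)[OF SB[OF i]] by (auto intro!: sphere_comp_measurable)
      have lg: "L2_lim ?\<sigma> (\<lambda>n \<theta>. grad (mollified (W i) (\<rho> n)) (t *\<^sub>R \<theta>)) (\<lambda>\<theta>. G i (t *\<^sub>R \<theta>))" if i: "i \<in> ?I" for i
        unfolding L2_lim_def
        using sl t i mollified_measurable(2)[OF SB[OF i]] sobolev_measurable(2)[OF SB[OF i]] by (auto intro!: sphere_comp_measurable)
      define q where "q i = (LINT \<theta>|?\<sigma>. (W i (t *\<^sub>R \<theta>))\<^sup>2)" for i
      define A where "A i = (LINT \<theta>|?\<sigma>. (norm (tangential \<theta> (G i (t *\<^sub>R \<theta>))))\<^sup>2)" for i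
      define N where "N i = (LINT \<theta>|?\<sigma>. (G i (t *\<^sub>R \<theta>) \<bullet> \<theta>)\<^sup>2)" for i
      define X where "X i = (LINT \<theta>|?\<sigma>. W i (t *\<^sub>R \<theta>) * (G i (t *\<^sub>R \<theta>) \<bullet> \<theta>))" for i
      have [measurable]: "(\<lambda>\<theta>. \<theta>) \<in> borel_measurable ?\<sigma>" using sphere_comp_measurable[of "\<lambda>x. x" 1] by simp
      have DX: "D i t \<le> t ^ (DIM('a) - 1) * X i" if i: "i \<in> ?I" for i
        unfolding X_def D[OF i]
        by (rule energy_slice[OF SB[OF i] W0[OF i] sub[OF i] t(1,3) \<rho> lw[OF i] lg[OF i]]) (use iw ig t i in auto)
      have iN: "integrable ?\<sigma> (\<lambda>\<theta>. (G i (t *\<^sub>R \<theta>) \<bullet> \<theta>)\<^sup>2)" and iA: "integrable ?\<sigma> (\<lambda>\<theta>. (norm (tangential \<theta> (G i (t *\<^sub>R \<theta>))))\<^sup>2)" if i: "i \<in> ?I" for i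
      proof -
        note [measurable] = L2_limD(2)[OF lg[OF i]]
        have g2: "integrable ?\<sigma> (\<lambda>\<theta>. (norm (G i (t *\<^sub>R \<theta>)))\<^sup>2)" using ig t i by blast
        show "integrable ?\<sigma> (\<lambda>\<theta>. (G i (t *\<^sub>R \<theta>) \<bullet> \<theta>)\<^sup>2)"
        proof (rule Bochner_Integration.integrable_bound[OF g2])
          show "(\<lambda>\<theta>. (G i (t *\<^sub>R \<theta>) \<bullet> \<theta>)\<^sup>2) \<in> borel_measurable ?\<sigma>" by measurable
          show "AE \<theta> in ?\<sigma>. norm ((G i (t *\<^sub>R \<theta>) \<bullet> \<theta>)\<^sup>2) \<le> norm ((norm (G i (t *\<^sub>R \<theta>)))\<^sup>2)"
          proof (rule AE_I2)
            fix \<theta> :: 'a assume "\<theta> \<in> space ?\<sigma>"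
            then have "(norm (tangential \<theta> (G i (t *\<^sub>R \<theta>))))\<^sup>2 = (norm (G i (t *\<^sub>R \<theta>)))\<^sup>2 - (G i (t *\<^sub>R \<theta>) \<bullet> \<theta>)\<^sup>2"
              by (intro norm_tangential_sq) (simp add: space_sphere_measure)
            then show "norm ((G i (t *\<^sub>R \<theta>) \<bullet> \<theta>)\<^sup>2) \<le> norm ((norm (G i (t *\<^sub>R \<theta>)))\<^sup>2)"
              using zero_le_power2[of "norm (tangential \<theta> (G i (t *\<^sub>R \<theta>)))"] by simp
          qed
        qed
        show "integrable ?\<sigma> (\<lambda>\<theta>. (norm (tangential \<theta> (G i (t *\<^sub>R \<theta>))))\<^sup>2)"
        proof (rule Bochner_Integration.integrable_bound[OF g2])
          show "(\<lambda>\<theta>. (norm (tangential \<theta> (G i (t *\<^sub>R \<theta>))))\<^sup>2) \<in> borel_measurable ?\<sigma>" unfolding tangential_def by measurable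
          show "AE \<theta> in ?\<sigma>. norm ((norm (tangential \<theta> (G i (t *\<^sub>R \<theta>))))\<^sup>2) \<le> norm ((norm (G i (t *\<^sub>R \<theta>)))\<^sup>2)"
            by (rule AE_I2) (auto simp: space_sphere_measure intro!: power_mono norm_tangential_le)
        qed
      qed
      have split: "(LINT \<theta>|?\<sigma>. (norm (G i (t *\<^sub>R \<theta>)))\<^sup>2) = N i + A i" if i: "i \<in> ?I" for i
      proof -
        have "(LINT \<theta>|?\<sigma>. (norm (G i (t *\<^sub>R \<theta>)))\<^sup>2) = (LINT \<theta>|?\<sigma>. (G i (t *\<^sub>R \<theta>) \<bullet> \<theta>)\<^sup>2 + (norm (tangential \<theta> (G i (t *\<^sub>R \<theta>))))\<^sup>2)"
          by (intro Bochner_Integration.integral_cong refl) (simp add: space_sphere_measure norm_tangential_sq)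
        then show ?thesis using iN[OF i] iA[OF i] by (simp add: N_def A_def)
      qed
      have A0: "A i \<ge> 0" and q0': "q i \<ge> 0" for i by (auto simp: A_def q_def)
      have q0: "q i > 0" if i: "i \<in> ?I" for i
      proof (rule ccontr)
        assume "\<not> q i > 0"
        then have "q i = 0" using q0'[of i] by simp
        moreover have "integrable ?\<sigma> (\<lambda>\<theta>. (W i (t *\<^sub>R \<theta>))\<^sup>2)" using iw t i by blast
        ultimately have "AE \<theta> in ?\<sigma>. (W i (t *\<^sub>R \<theta>))\<^sup>2 = 0"
          unfolding q_def by (subst (asm) integral_nonneg_eq_0_iff_AE) auto
        then have "AE \<theta> in ?\<sigma>. W i (t *\<^sub>R \<theta>) * (G i (t *\<^sub>R \<theta>) \<bullet> \<theta>) = 0" by eventually_elim simp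
        then have "X i = 0" unfolding X_def by (rule integral_eq_zero_AE)
        then show False using DX[OF i] Dt[OF i] by simp
      qed
      define \<kappa> where "\<kappa> i = sqrt (A i / q i)" for i
      have \<kappa>: "\<kappa> i \<ge> 0" for i using A0[of i] q0'[of i] by (simp add: \<kappa>_def)
      have \<kappa>2: "(\<kappa> i)\<^sup>2 * q i = A i" if i: "i \<in> ?I" for i using A0[of i] q0[OF i] by (simp add: \<kappa>_def)
      have ratio_i: "2 * \<kappa> i \<le> (t ^ (DIM('a) - 1) * (LINT \<theta>|?\<sigma>. (norm (G i (t *\<^sub>R \<theta>)))\<^sup>2)) / D i t" if i: "i \<in> ?I" for i
      proof -
        have iw': "integrable ?\<sigma> (\<lambda>\<theta>. (W i (t *\<^sub>R \<theta>))\<^sup>2)" using iw t i by blast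
        have "2 * \<kappa> i * X i = (LINT \<theta>|?\<sigma>. 2 * \<kappa> i * (W i (t *\<^sub>R \<theta>) * (G i (t *\<^sub>R \<theta>) \<bullet> \<theta>)))"
          unfolding X_def by (rule integral_mult_right_zero[symmetric])
        also have "\<dots> \<le> (LINT \<theta>|?\<sigma>. (G i (t *\<^sub>R \<theta>) \<bullet> \<theta>)\<^sup>2 + (\<kappa> i)\<^sup>2 * (W i (t *\<^sub>R \<theta>))\<^sup>2)"
        proof (rule integral_mono)
          note [measurable] = L2_limD(2)[OF lg[OF i]] L2_limD(2)[OF lw[OF i]]
          have bd: "\<bar>2 * \<kappa> i * (w * v)\<bar> \<le> v\<^sup>2 + (\<kappa> i)\<^sup>2 * w\<^sup>2" for w v
            using zero_le_power2[of "v - \<kappa> i * w"] zero_le_power2[of "v + \<kappa> i * w"]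
            by (simp add: power2_eq_square algebra_simps abs_le_iff)
          show i2: "integrable ?\<sigma> (\<lambda>\<theta>. (G i (t *\<^sub>R \<theta>) \<bullet> \<theta>)\<^sup>2 + (\<kappa> i)\<^sup>2 * (W i (t *\<^sub>R \<theta>))\<^sup>2)"
            using iN[OF i] iw' by simp
          show "integrable ?\<sigma> (\<lambda>\<theta>. 2 * \<kappa> i * (W i (t *\<^sub>R \<theta>) * (G i (t *\<^sub>R \<theta>) \<bullet> \<theta>)))"
          proof (rule Bochner_Integration.integrable_bound[OF i2])
            show "(\<lambda>\<theta>. 2 * \<kappa> i * (W i (t *\<^sub>R \<theta>) * (G i (t *\<^sub>R \<theta>) \<bullet> \<theta>))) \<in> borel_measurable ?\<sigma>" by measurable
            show "AE \<theta> in ?\<sigma>. norm (2 * \<kappa> i * (W i (t *\<^sub>R \<theta>) * (G i (t *\<^sub>R \<theta>) \<bullet> \<theta>))) \<le> norm ((G i (t *\<^sub>R \<theta>) \<bullet> \<theta>)\<^sup>2 + (\<kappa> i)\<^sup>2 * (W i (t *\<^sub>R \<theta>))\<^sup>2)"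
              by (rule AE_I2) (unfold real_norm_def, rule order_trans[OF bd abs_ge_self])
          qed
          show "2 * \<kappa> i * (W i (t *\<^sub>R \<theta>) * (G i (t *\<^sub>R \<theta>) \<bullet> \<theta>)) \<le> (G i (t *\<^sub>R \<theta>) \<bullet> \<theta>)\<^sup>2 + (\<kappa> i)\<^sup>2 * (W i (t *\<^sub>R \<theta>))\<^sup>2" for \<theta>
            using bd[of "W i (t *\<^sub>R \<theta>)" "G i (t *\<^sub>R \<theta>) \<bullet> \<theta>"] by linarith
        qed
        also have "\<dots> = N i + A i" using iN[OF i] iw' \<kappa>2[OF i] by (simp add: N_def q_def)
        finally have k: "2 * \<kappa> i * X i \<le> N i + A i" .
        have "2 * \<kappa> i * D i t \<le> 2 * \<kappa> i * (t ^ (DIM('a) - 1) * X i)" using DX[OF i] \<kappa>[of i] by (intro mult_left_mono) auto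
        also have "\<dots> = t ^ (DIM('a) - 1) * (2 * \<kappa> i * X i)" by (simp add: mult_ac)
        also have "\<dots> \<le> t ^ (DIM('a) - 1) * (N i + A i)" using k t by (intro mult_left_mono) auto
        finally show ?thesis using Dt[OF i] split[OF i] by (simp add: pos_le_divide_eq)
      qed
      have "optimal_beta TYPE('a) h \<le> 2 / real h * (\<Sum>i\<in>?I. sqrt (t\<^sup>2 * A i / q i))"
        unfolding A_def q_def
      proof (rule beta_le_quotients[OF h t(1), where \<phi>="\<lambda>i n. mollified (W i) (\<rho> n)"])
        show "smooth_on UNIV (mollified (W i) (\<rho> n))" if "i \<in> ?I" for i n by (rule mollified_smooth[OF SB[OF that]])
        show "mollified (W i) (\<rho> n) x \<ge> 0" if "i \<in> ?I" for i n x
          unfolding mollified_def[OF SB[OF that]] by (rule conv_nonneg[OF SB[OF that] W0[OF that]]) simp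
        show "AE \<theta> in ?\<sigma>. W i (t *\<^sub>R \<theta>) * W j (t *\<^sub>R \<theta>) = 0" if "i \<in> ?I" "j \<in> ?I" "i \<noteq> j" for i j
        proof -
          have "AE \<theta> in ?\<sigma>. i \<noteq> j \<longrightarrow> W i (t *\<^sub>R \<theta>) * W j (t *\<^sub>R \<theta>) = 0" using dj that t by blast
          then show ?thesis by eventually_elim (use that in simp)
        qed
        show "(LINT \<theta>|?\<sigma>. (W i (t *\<^sub>R \<theta>))\<^sup>2) > 0" if "i \<in> ?I" for i using q0[OF that] by (simp add: q_def)
      qed (use lw lg iw ig w0 gz t in blast)+
      also have "(\<Sum>i\<in>?I. sqrt (t\<^sup>2 * A i / q i)) = t * (\<Sum>i\<in>?I. \<kappa> i)"
        using t by (simp add: \<kappa>_def sum_distrib_left real_sqrt_mult real_sqrt_divide)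
      finally have b: "optimal_beta TYPE('a) h \<le> 2 / real h * (t * (\<Sum>i\<in>?I. \<kappa> i))" .
      have "real h * optimal_beta TYPE('a) h \<le> real h * (2 / real h * (t * (\<Sum>i\<in>?I. \<kappa> i)))" by (rule mult_left_mono[OF b]) simp
      also have "\<dots> = t * (\<Sum>i\<in>?I. 2 * \<kappa> i)" using h by (simp add: sum_distrib_left[symmetric])
      finally have "real h * optimal_beta TYPE('a) h / t \<le> (\<Sum>i\<in>?I. 2 * \<kappa> i)" using t by (simp add: field_simps)
      also have "\<dots> \<le> (\<Sum>i\<in>?I. (t ^ (DIM('a) - 1) * (LINT \<theta>|?\<sigma>. (norm (G i (t *\<^sub>R \<theta>)))\<^sup>2)) / D i t)"
        by (rule sum_mono[OF ratio_i])
      finally show "real h * optimal_beta TYPE('a) h / t \<le> (\<Sum>i\<in>?I. (t ^ (DIM('a) - 1) * (LINT \<theta>|?\<sigma>. (norm (G i (t *\<^sub>R \<theta>)))\<^sup>2)) / D i t)" .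
    qed
  qed
qed

text \<open>If some energy vanishes in the small ball, the left-hand side is zero. Otherwise all energies are positive from \<open>p\<close> on,
the logarithm of the product is defined, and \<open>log_growth\<close> applies.\<close>

theorem monotonicity_ball:
  fixes W :: "nat \<Rightarrow> 'a::euclidean_space \<Rightarrow> real"
  assumes h: "h \<ge> 1" and SB: "\<And>i. i \<in> {1..h} \<Longrightarrow> sobolev_ball R (W i) (G i)"
    and W0: "\<And>i. i \<in> {1..h} \<Longrightarrow> AE x in lborel. W i x \<ge> 0"
    and disj: "\<And>i j. i \<in> {1..h} \<Longrightarrow> j \<in> {1..h} \<Longrightarrow> i \<noteq> j \<Longrightarrow> AE x in lborel. W i x * W j x = 0"
    and sub: "\<And>i \<phi>. i \<in> {1..h} \<Longrightarrow> \<phi> \<in> test_functions (ball 0 R) \<Longrightarrow> (\<And>x. \<phi> x \<ge> 0) \<Longrightarrow> (LINT x|lborel. W i x * laplacian \<phi> x) \<ge> 0"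
    and pq: "0 < p" "p \<le> q" "q \<le> R"
  shows "(\<Prod>i\<in>{1..h}. 1 / p powr (optimal_beta TYPE('a) h) * (LINT x|lborel. indicator (ball 0 p) x * (norm (G i x))\<^sup>2))
    \<le> (\<Prod>i\<in>{1..h}. 1 / q powr (optimal_beta TYPE('a) h) * (LINT x|lborel. indicator (ball 0 q) x * (norm (G i x))\<^sup>2))"
proof -
  let ?I = "{1..h}"
  let ?b = "optimal_beta TYPE('a) h"
  define D where "D i t = (LINT x|lborel. indicator (ball 0 t) x * (norm (G i x))\<^sup>2)" for i t
  have D0: "D i t \<ge> 0" for i t unfolding D_def by (intro integral_nonneg_AE AE_I2) simp
  show ?thesis
  proof (cases "\<forall>i\<in>?I. D i p > 0")
    case False
    then obtain i where "i \<in> ?I" "D i p = 0" using D0 by (metis less_le)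
    then have "(\<Prod>i\<in>?I. 1 / p powr ?b * D i p) = 0" by (intro prod_zero) auto
    moreover have "0 \<le> (\<Prod>i\<in>?I. 1 / q powr ?b * D i q)" using D0 by (intro prod_nonneg) auto
    ultimately have "(\<Prod>i\<in>?I. 1 / p powr ?b * D i p) \<le> (\<Prod>i\<in>?I. 1 / q powr ?b * D i q)" by linarith
    then show ?thesis by (simp only: D_def)
  next
    case True
    \<comment> \<open>The derivative of \<open>D i\<close>.\<close>
    define a where "a i t = t ^ (DIM('a) - 1) * indicator {0<..} t * (LINT \<theta>|sphere_measure. (norm (G i (t *\<^sub>R \<theta>)))\<^sup>2)" for i and t :: real
    have ai: "integrable lborel (a i)" if "i \<in> ?I" for i
      unfolding a_def[abs_def] by (rule polar_integral(1)[OF sobolev_square_integrable(2)[OF SB[OF that]]])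
    have a0: "a i t \<ge> 0" for i t unfolding a_def by (cases "t > 0") auto
    have Da: "D i t = (LINT s|lborel. indicator {..<t} s * a i s)" if i: "i \<in> ?I" for i t
    proof -
      have "integrable lborel (\<lambda>x. indicator (ball 0 t) x * (norm (G i x))\<^sup>2)"
        using integrable_mult_indicator[of "ball (0::'a) t" lborel "\<lambda>x. (norm (G i x))\<^sup>2"] sobolev_square_integrable(2)[OF SB[OF i]] by simp
      from polar_integral(2)[OF this]
      have "D i t = (LINT s|lborel. s ^ (DIM('a) - 1) * indicator {0<..} s * (LINT \<theta>|sphere_measure. indicator (ball 0 t) (s *\<^sub>R \<theta>) * (norm (G i (s *\<^sub>R \<theta>)))\<^sup>2))"
        by (simp add: D_def)
      also have "\<dots> = (LINT s|lborel. indicator {..<t} s * a i s)"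
      proof (rule Bochner_Integration.integral_cong[OF refl])
        fix s :: real
        show "s ^ (DIM('a) - 1) * indicator {0<..} s * (LINT \<theta>|sphere_measure. indicator (ball 0 t) (s *\<^sub>R \<theta>) * (norm (G i (s *\<^sub>R \<theta>)))\<^sup>2) = indicator {..<t} s * a i s"
        proof (cases "s > 0")
          case True
          have "(LINT \<theta>|sphere_measure. indicator (ball 0 t) (s *\<^sub>R \<theta>) * (norm (G i (s *\<^sub>R \<theta>)))\<^sup>2) = (LINT \<theta>|sphere_measure. indicator {..<t} s * (norm (G i (s *\<^sub>R \<theta>)))\<^sup>2)"
            by (rule Bochner_Integration.integral_cong[OF refl]) (use True in \<open>auto simp: space_sphere_measure indicator_def\<close>)
          then show ?thesis unfolding integral_mult_right_zero by (simp add: a_def)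
        qed (simp add: a_def)
      qed
      finally show ?thesis .
    qed
    \<comment> \<open>\<open>slice_ratio\<close> is stated for radii below some \<open>s < R\<close>; countably many \<open>s\<close> exhaust the ball, including the case \<open>q = R\<close>.\<close>
    have "AE t in lborel. \<forall>m. 0 < t \<and> t < R - 1 / real (Suc m) \<and> (\<forall>i\<in>?I. D i t > 0) \<longrightarrow>
      real h * ?b / t \<le> (\<Sum>i\<in>?I. (t ^ (DIM('a) - 1) * (LINT \<theta>|sphere_measure. (norm (G i (t *\<^sub>R \<theta>)))\<^sup>2)) / D i t)"
      unfolding AE_all_countable
    proof
      fix m
      show "AE t in lborel. 0 < t \<and> t < R - 1 / real (Suc m) \<and> (\<forall>i\<in>?I. D i t > 0) \<longrightarrow>
        real h * ?b / t \<le> (\<Sum>i\<in>?I. (t ^ (DIM('a) - 1) * (LINT \<theta>|sphere_measure. (norm (G i (t *\<^sub>R \<theta>)))\<^sup>2)) / D i t)"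
        by (rule slice_ratio[OF h SB W0 disj sub D_def]) auto
    qed
    then have ratio: "AE t in lborel. p < t \<and> t < q \<longrightarrow> (real h * ?b) / t \<le> (\<Sum>i\<in>?I. a i t / D i t)"
    proof eventually_elim
      fix t assume A: "\<forall>m. 0 < t \<and> t < R - 1 / real (Suc m) \<and> (\<forall>i\<in>?I. D i t > 0) \<longrightarrow>
        real h * ?b / t \<le> (\<Sum>i\<in>?I. (t ^ (DIM('a) - 1) * (LINT \<theta>|sphere_measure. (norm (G i (t *\<^sub>R \<theta>)))\<^sup>2)) / D i t)"
      show "p < t \<and> t < q \<longrightarrow> (real h * ?b) / t \<le> (\<Sum>i\<in>?I. a i t / D i t)"
      proof
        assume t: "p < t \<and> t < q"
        then obtain m where "inverse (real (Suc m)) < R - t" using reals_Archimedean[of "R - t"] pq by auto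
        then have m: "t < R - 1 / real (Suc m)" by (simp add: inverse_eq_divide)
        have Dt: "D i t > 0" if i: "i \<in> ?I" for i
        proof -
          have "D i p \<le> D i t" unfolding Da[OF i]
          proof (rule integral_mono)
            have "integrable lborel (\<lambda>s. indicator {..<x} s * a i s)" for x
              using integrable_mult_indicator[of "{..<x}" lborel "a i"] ai[OF i] by simp
            then show "integrable lborel (\<lambda>s. indicator {..<p} s * a i s)" "integrable lborel (\<lambda>s. indicator {..<t} s * a i s)" by blast+
            show "indicator {..<p} s * a i s \<le> indicator {..<t} s * a i s" for s
              using t a0[of i s] by (auto simp: indicator_def)
          qed
          then show ?thesis using True i by force
        qed
        have "t > 0" using t pq by linarith
        then show "(real h * ?b) / t \<le> (\<Sum>i\<in>?I. a i t / D i t)"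
          using A[rule_format, of m] m Dt by (simp add: a_def)
      qed
    qed
    have growth: "(real h * ?b) * (ln q - ln p) \<le> (\<Sum>i\<in>?I. ln (D i q) - ln (D i p))"
      by (rule log_growth[OF _ ai a0 Da pq(1,2) _ ratio]) (use True in auto)
    have Dq: "D i q > 0" if i: "i \<in> ?I" for i
    proof -
      have "D i p \<le> D i q" unfolding Da[OF i]
      proof (rule integral_mono)
        have "integrable lborel (\<lambda>s. indicator {..<x} s * a i s)" for x
          using integrable_mult_indicator[of "{..<x}" lborel "a i"] ai[OF i] by simp
        then show "integrable lborel (\<lambda>s. indicator {..<p} s * a i s)" "integrable lborel (\<lambda>s. indicator {..<q} s * a i s)" by blast+
        show "indicator {..<p} s * a i s \<le> indicator {..<q} s * a i s" for s
          using pq a0[of i s] by (auto simp: indicator_def)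
      qed
      then show ?thesis using True i by force
    qed
    have ex: "(\<Prod>i\<in>?I. 1 / x powr ?b * D i x) = exp ((\<Sum>i\<in>?I. ln (D i x)) - real h * ?b * ln x)"
      if x: "x > 0" "\<And>i. i \<in> ?I \<Longrightarrow> D i x > 0" for x
    proof -
      have "(\<Prod>i\<in>?I. 1 / x powr ?b * D i x) = (\<Prod>i\<in>?I. exp (ln (D i x) - ?b * ln x))"
        by (intro prod.cong refl) (use x in \<open>simp add: exp_diff powr_def\<close>)
      also have "\<dots> = exp (\<Sum>i\<in>?I. ln (D i x) - ?b * ln x)" by (rule exp_sum[symmetric]) simp
      finally show ?thesis by (simp add: sum_subtractf)
    qed
    have "(\<Prod>i\<in>?I. 1 / p powr ?b * D i p) \<le> (\<Prod>i\<in>?I. 1 / q powr ?b * D i q)"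
      using growth pq True Dq by (subst (1 2) ex) (auto simp: sum_subtractf algebra_simps)
    then show ?thesis by (simp only: D_def)
  qed
qed

section \<open>From Lebesgue classes on a domain to Borel functions on a centred ball\<close>

lemma AE_lborel_translate:
  fixes c :: "'a::euclidean_space"
  assumes "AE x in lborel. P x" shows "AE x in lborel. P (c + x)"
proof (rule AE_distrD[where M'=borel and f="(+) c"])
  show "(+) c \<in> borel_measurable (lborel :: 'a measure)" by simp
  show "AE x in distr lborel borel ((+) c). P x" unfolding lborel_distr_plus by (rule assms)
qed

text \<open>\<open>F\<close> is a Borel function that represents the Lebesgue class of \<open>f\<close> on the ball about \<open>x0\<close>, moved to the origin and
extended by zero.\<close>

definition rep_at :: "'a::euclidean_space \<Rightarrow> real \<Rightarrow> ('a \<Rightarrow> 'b::euclidean_space) \<Rightarrow> ('a \<Rightarrow> 'b) \<Rightarrow> bool" where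
  "rep_at x0 R f F \<longleftrightarrow> F \<in> borel_measurable borel \<and> (\<forall>x. norm x \<ge> R \<longrightarrow> F x = 0)
     \<and> (AE x in lborel. norm x < R \<longrightarrow> F x = f (x0 + x))"

lemma rep_zero: "rep_at x0 R f F \<Longrightarrow> \<not> norm x < R \<Longrightarrow> F x = 0"
  unfolding rep_at_def by (simp add: not_less)

lemma ex_borel_rep:
  fixes f :: "'a::euclidean_space \<Rightarrow> 'b::euclidean_space"
  assumes f: "f \<in> borel_measurable lebesgue"
  shows "\<exists>F\<in>borel_measurable borel. AE x in lborel. f x = F x"
proof -
  have "\<exists>F\<in>borel_measurable lborel. AE x in lborel. f x \<bullet> b = F x" for b
    by (rule completion_ex_borel_measurable_real) (use f in measurable)
  then obtain F where F: "\<And>b. F b \<in> borel_measurable lborel" "\<And>b. AE x in lborel. f x \<bullet> b = F b x" by metis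
  have [measurable]: "F b \<in> borel_measurable borel" for b using F(1)[of b] by simp
  have "AE x in lborel. \<forall>b\<in>Basis. f x \<bullet> b = F b x" by (intro AE_finite_allI F(2)) auto
  then have ae: "AE x in lborel. f x = (\<Sum>b\<in>Basis. F b x *\<^sub>R b)"
  proof eventually_elim
    fix x assume x: "\<forall>b\<in>Basis. f x \<bullet> b = F b x"
    have "f x = (\<Sum>b\<in>Basis. (f x \<bullet> b) *\<^sub>R b)" by (rule euclidean_representation[symmetric])
    also have "\<dots> = (\<Sum>b\<in>Basis. F b x *\<^sub>R b)" by (rule sum.cong[OF refl]) (simp only: bspec[OF x])
    finally show "f x = (\<Sum>b\<in>Basis. F b x *\<^sub>R b)" .
  qed
  have "(\<lambda>x. \<Sum>b\<in>Basis. F b x *\<^sub>R b) \<in> borel_measurable borel" by measurable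
  then show ?thesis by (rule bexI[rotated]) (rule ae)
qed

lemma ex_rep_at:
  fixes f :: "'a::euclidean_space \<Rightarrow> 'b::euclidean_space"
  assumes f: "(\<lambda>y. indicator (ball x0 R) y *\<^sub>R f y) \<in> borel_measurable lebesgue"
  shows "\<exists>F. rep_at x0 R f F"
proof -
  obtain F where F: "F \<in> borel_measurable borel" "AE y in lborel. indicator (ball x0 R) y *\<^sub>R f y = F y"
    using ex_borel_rep[OF f] by blast
  note [measurable] = F(1)
  have [measurable]: "ball (0::'a) R \<in> sets borel" by simp
  have m: "(\<lambda>x. indicator (ball 0 R) x *\<^sub>R F (x0 + x)) \<in> borel_measurable borel" by measurable
  have "AE x in lborel. indicator (ball x0 R) (x0 + x) *\<^sub>R f (x0 + x) = F (x0 + x)"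
    by (rule AE_lborel_translate[OF F(2)])
  then have "AE x in lborel. norm x < R \<longrightarrow> indicator (ball 0 R) x *\<^sub>R F (x0 + x) = f (x0 + x)"
    by eventually_elim (auto simp: indicator_def dist_norm)
  then have "rep_at x0 R f (\<lambda>x. indicator (ball 0 R) x *\<^sub>R F (x0 + x))"
    unfolding rep_at_def using m by auto
  then show ?thesis by blast
qed

lemma rep_at_lebesgue:
  assumes "rep_at x0 R f F"
  shows "AE y in lebesgue. y \<in> ball x0 R \<longrightarrow> F (y - x0) = f y"
proof -
  have "AE x in lborel. norm x < R \<longrightarrow> F x = f (x0 + x)" using assms by (simp add: rep_at_def)
  from AE_lborel_translate[OF this, of "- x0"]
  have "AE y in lborel. y \<in> ball x0 R \<longrightarrow> F (y - x0) = f y"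
    by eventually_elim (auto simp: dist_norm norm_minus_commute)
  then show ?thesis by (rule AE_completion)
qed

lemma borel_imp_lebesgue: "F \<in> borel_measurable borel \<Longrightarrow> F \<in> borel_measurable lebesgue"
  by (simp add: measurable_completion)

lemma rep_integral:
  fixes f :: "'a::euclidean_space \<Rightarrow> real"
  assumes rep: "rep_at x0 R f F" and \<eta>: "\<eta> \<in> borel_measurable borel" "\<And>y. y \<notin> ball x0 R \<Longrightarrow> \<eta> y = 0"
  shows "(LINT y|lebesgue. f y * \<eta> y) = (LINT x|lborel. F x * \<eta> (x0 + x))"
proof -
  have [measurable]: "F \<in> borel_measurable borel" using rep by (simp add: rep_at_def)
  note [measurable] = \<eta>(1)
  have m: "(\<lambda>y. F (y - x0) * \<eta> y) \<in> borel_measurable borel" by measurable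
  have ae: "AE y in lebesgue. F (y - x0) * \<eta> y = f y * \<eta> y"
    using rep_at_lebesgue[OF rep] by eventually_elim (metis \<eta>(2) mult_zero_right)
  have "(LINT y|lebesgue. f y * \<eta> y) = (LINT y|lebesgue. F (y - x0) * \<eta> y)"
    by (rule integral_cong_AE)
       (use borel_measurable_AE[OF borel_imp_lebesgue[OF m] ae] borel_imp_lebesgue[OF m] ae in auto)
  also have "\<dots> = (LINT y|lborel. F (y - x0) * \<eta> y)"
    by (rule integral_completion) (use m in simp)
  also have "\<dots> = (LINT x|lborel. F x * \<eta> (x0 + x))"
    using integral_translate[OF m, of x0] by simp
  finally show ?thesis .
qed

lemma rep_integrable:
  fixes f :: "'a::euclidean_space \<Rightarrow> 'b::euclidean_space"
  assumes rep: "rep_at x0 R f F" and A: "A \<in> sets borel" "A \<subseteq> ball x0 R"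
    and i: "integrable lebesgue (\<lambda>y. indicator A y *\<^sub>R f y)"
  shows "integrable lborel (\<lambda>x. indicator A (x0 + x) *\<^sub>R F x)"
proof -
  have [measurable]: "F \<in> borel_measurable borel" using rep by (simp add: rep_at_def)
  note [measurable] = A(1)
  have m: "(\<lambda>y. indicator A y *\<^sub>R F (y - x0)) \<in> borel_measurable borel" by measurable
  have ae: "AE y in lebesgue. indicator A y *\<^sub>R f y = indicator A y *\<^sub>R F (y - x0)"
    using rep_at_lebesgue[OF rep] by eventually_elim (use A(2) in \<open>auto simp: indicator_def\<close>)
  have "integrable lebesgue (\<lambda>y. indicator A y *\<^sub>R F (y - x0))"
    by (rule integrable_cong_AE_imp[OF i borel_imp_lebesgue[OF m]]) (use ae in \<open>eventually_elim, simp\<close>)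
  then have "integrable lborel (\<lambda>y. indicator A y *\<^sub>R F (y - x0))"
    by (subst (asm) integrable_completion) (use m in simp)
  from integrable_translate[OF this, of x0] show ?thesis by simp
qed

lemma rep_compose:
  assumes "rep_at x0 R f F" "k \<in> borel_measurable borel" "k 0 = 0"
  shows "rep_at x0 R (\<lambda>y. k (f y)) (\<lambda>x. k (F x))"
  using assms unfolding rep_at_def by (auto intro: measurable_compose elim!: eventually_mono)

text \<open>Local integrability gives measurability on each smaller closed ball; the ball is their countable union.\<close>

lemma local_measurable:
  fixes f :: "'a::euclidean_space \<Rightarrow> 'b::euclidean_space"
  assumes f: "locally_integrable_on U f" and U: "ball x0 R \<subseteq> U"
  shows "(\<lambda>y. indicator (ball x0 R) y *\<^sub>R f y) \<in> borel_measurable lebesgue"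
proof (rule borel_measurable_LIMSEQ_metric)
  let ?B = "\<lambda>n. cball x0 (R - 1 / real (Suc n))"
  show "(\<lambda>y. indicator (?B n) y *\<^sub>R f y) \<in> borel_measurable lebesgue" for n
  proof -
    have "?B n \<subseteq> ball x0 R"
    proof
      fix y assume "y \<in> ?B n"
      then have "dist x0 y \<le> R - 1 / real (Suc n)" by (simp only: mem_cball)
      moreover have "1 / real (Suc n) > 0" by simp
      ultimately show "y \<in> ball x0 R" unfolding mem_ball by linarith
    qed
    then have "f absolutely_integrable_on ?B n"
      using f U unfolding locally_integrable_on_def by (meson compact_cball order_trans)
    then show ?thesis unfolding set_integrable_def by (rule borel_measurable_integrable)
  qed
  fix y
  show "(\<lambda>n. indicator (?B n) y *\<^sub>R f y) \<longlonglongrightarrow> indicator (ball x0 R) y *\<^sub>R f y"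
  proof (cases "y \<in> ball x0 R")
    case True
    have "\<forall>\<^sub>F n in sequentially. 1 / real (Suc n) < R - dist x0 y"
      by (rule order_tendstoD(2)[OF LIMSEQ_Suc[OF lim_1_over_n]]) (use True in simp)
    then have "\<forall>\<^sub>F n in sequentially. indicator (?B n) y *\<^sub>R f y = indicator (ball x0 R) y *\<^sub>R f y"
      by eventually_elim (use True in simp)
    then show ?thesis by (rule tendsto_eventually)
  next
    case False
    have "indicator (?B n) y *\<^sub>R f y = indicator (ball x0 R) y *\<^sub>R f y" for n
    proof -
      have "1 / real (Suc n) > 0" by simp
      then have "y \<notin> ?B n" using False unfolding mem_cball mem_ball by linarith
      then show ?thesis using False by simp
    qed
    then show ?thesis by (simp only: tendsto_const)
  qed
qed

lemma translate_test:
  fixes \<phi> :: "'a::euclidean_space \<Rightarrow> real"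
  assumes \<phi>: "\<phi> \<in> test_functions (ball 0 R)"
  shows "(\<lambda>y. \<phi> (y - x0)) \<in> test_functions (ball x0 R)"
    "b \<in> Basis \<Longrightarrow> partial_deriv b (\<lambda>y. \<phi> (y - x0)) y = partial_deriv b \<phi> (y - x0)"
    "laplacian (\<lambda>y. \<phi> (y - x0)) y = laplacian \<phi> (y - x0)"
proof -
  have "(\<lambda>y. \<phi> (- x0 + 1 *\<^sub>R y)) \<in> test_functions (ball x0 R)"
    by (rule test_affine_map[OF \<phi>]) (auto simp: dist_norm)
  then show "(\<lambda>y. \<phi> (y - x0)) \<in> test_functions (ball x0 R)" by simp
  have pd: "partial_deriv b (\<lambda>y. f (y - x0)) = (\<lambda>y. partial_deriv b f (y - x0))" if "smooth_on UNIV f" "b \<in> Basis" for f :: "'a \<Rightarrow> real" and b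
    using partial_deriv_affine_map[OF that, of "- x0" 1] by simp
  show "b \<in> Basis \<Longrightarrow> partial_deriv b (\<lambda>y. \<phi> (y - x0)) y = partial_deriv b \<phi> (y - x0)"
    using pd[OF test_functionsD(1)[OF \<phi>]] by simp
  show "laplacian (\<lambda>y. \<phi> (y - x0)) y = laplacian \<phi> (y - x0)"
    unfolding laplacian_def
    by (intro sum.cong refl) (simp add: pd test_functionsD(1)[OF \<phi>] smooth_on_partial_deriv)
qed

lemma test_zero_outside:
  assumes "\<psi> \<in> test_functions U" "y \<notin> U"
  shows "\<psi> y = 0" "partial_deriv b \<psi> y = 0"
  using assms test_functionsD(3)[OF assms(1)] closure_subset[of "{x. \<psi> x \<noteq> 0}"] partial_deriv_support[of b \<psi>] by blast+

lemma set_integral_test: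
  fixes f :: "'a::euclidean_space \<Rightarrow> real"
  assumes "\<And>y. y \<notin> S \<Longrightarrow> \<eta> y = 0"
  shows "(LINT y:S|lebesgue. f y * \<eta> y) = (LINT y|lebesgue. f y * \<eta> y)"
  unfolding set_lebesgue_integral_def
  by (rule Bochner_Integration.integral_cong[OF refl]) (use assms in \<open>auto simp: indicator_def\<close>)

lemma weak_grad_rep:
  fixes w :: "'a::euclidean_space \<Rightarrow> real"
  assumes wg: "has_weak_grad U w g" and U: "ball x0 R \<subseteq> U" and W: "rep_at x0 R w W" and G: "rep_at x0 R g G"
    and \<phi>: "\<phi> \<in> test_functions (ball 0 R)" and b: "b \<in> Basis"
  shows "(LINT x|lborel. W x * partial_deriv b \<phi> x) = - (LINT x|lborel. (G x \<bullet> b) * \<phi> x)"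
proof -
  let ?\<psi> = "\<lambda>y. \<phi> (y - x0)"
  note \<psi> = translate_test(1)[OF \<phi>, of x0]
  have Gb: "rep_at x0 R (\<lambda>y. g y \<bullet> b) (\<lambda>x. G x \<bullet> b)" by (rule rep_compose[OF G]) auto
  have "(LINT x:U|lebesgue. w x * partial_deriv b ?\<psi> x) = - (LINT x:U|lebesgue. (g x \<bullet> b) * ?\<psi> x)"
    using wg test_functions_mono[OF U \<psi>] b by (auto simp: has_weak_grad_def)
  moreover have "(LINT x:U|lebesgue. w x * partial_deriv b ?\<psi> x) = (LINT x|lborel. W x * partial_deriv b \<phi> x)"
  proof -
    have "(LINT x:U|lebesgue. w x * partial_deriv b ?\<psi> x) = (LINT x|lebesgue. w x * partial_deriv b ?\<psi> x)"
      by (rule set_integral_test) (rule test_zero_outside(2)[OF test_functions_mono[OF U \<psi>]])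
    also have "\<dots> = (LINT x|lborel. W x * partial_deriv b ?\<psi> (x0 + x))"
      by (rule rep_integral[OF W test_functions_measurable[OF test_functions_partial[OF \<psi> b]] test_zero_outside(2)[OF \<psi>]])
    finally show ?thesis by (simp add: translate_test(2)[OF \<phi> b])
  qed
  moreover have "(LINT x:U|lebesgue. (g x \<bullet> b) * ?\<psi> x) = (LINT x|lborel. (G x \<bullet> b) * \<phi> x)"
  proof -
    have "(LINT x:U|lebesgue. (g x \<bullet> b) * ?\<psi> x) = (LINT x|lebesgue. (g x \<bullet> b) * ?\<psi> x)"
      by (rule set_integral_test) (rule test_zero_outside(1)[OF test_functions_mono[OF U \<psi>]])
    also have "\<dots> = (LINT x|lborel. (G x \<bullet> b) * ?\<psi> (x0 + x))"
      by (rule rep_integral[OF Gb test_functions_measurable[OF \<psi>] test_zero_outside(1)[OF \<psi>]])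
    finally show ?thesis by simp
  qed
  ultimately show ?thesis by simp
qed

lemma rep_local_integrable:
  fixes g :: "'a::euclidean_space \<Rightarrow> 'b::euclidean_space"
  assumes g: "locally_integrable_on U g" and U: "ball x0 R \<subseteq> U" and G: "rep_at x0 R g G" and s: "s < R"
  shows "integrable lborel (\<lambda>x. indicator (cball 0 s) x *\<^sub>R G x)"
proof -
  have sub: "cball x0 s \<subseteq> ball x0 R" using s by auto
  then have "g absolutely_integrable_on cball x0 s"
    using g U unfolding locally_integrable_on_def by (meson compact_cball order_trans)
  then have "integrable lborel (\<lambda>x. indicator (cball x0 s) (x0 + x) *\<^sub>R G x)"
    unfolding set_integrable_def by (intro rep_integrable[OF G _ sub]) auto
  moreover have "indicator (cball x0 s) (x0 + x) = (indicator (cball 0 s) x :: real)" for x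
    by (simp add: indicator_def dist_norm)
  ultimately show ?thesis by simp
qed

text \<open>The difference of two weak gradients is orthogonal to all test functions of the ball. This is what makes the Dirichlet
integral independent of the representative selected in \<open>weak_grad\<close>, which need not be the square integrable one a priori.\<close>

lemma weak_grad_unique:
  fixes w :: "'a::euclidean_space \<Rightarrow> real"
  assumes g1: "has_weak_grad U w g1" and g2: "has_weak_grad U w g2" and U: "ball x0 R \<subseteq> U"
    and W: "rep_at x0 R w W" and G1: "rep_at x0 R g1 G1" and G2: "rep_at x0 R g2 G2"
  shows "AE x in lborel. G1 x = G2 x"
proof -
  have [measurable]: "G1 \<in> borel_measurable borel" "G2 \<in> borel_measurable borel" using G1 G2 by (auto simp: rep_at_def)
  have loc: "integrable lborel (\<lambda>x. indicator (cball 0 s) x *\<^sub>R G1 x)" "integrable lborel (\<lambda>x. indicator (cball 0 s) x *\<^sub>R G2 x)" if "s < R" for s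
    using g1 g2 rep_local_integrable[OF _ U G1 that] rep_local_integrable[OF _ U G2 that] by (auto simp: has_weak_grad_def)
  have ae: "AE x in lborel. x \<in> ball 0 R \<longrightarrow> G1 x \<bullet> b - G2 x \<bullet> b = 0" if b: "b \<in> Basis" for b
  proof (rule fundamental_lemma_ball)
    show "(\<lambda>x. G1 x \<bullet> b - G2 x \<bullet> b) \<in> borel_measurable borel" by measurable
    show "integrable lborel (\<lambda>x. indicator (cball 0 s) x * (G1 x \<bullet> b - G2 x \<bullet> b))" if "s < R" for s
    proof -
      have "integrable lborel (\<lambda>x. (indicator (cball 0 s) x *\<^sub>R G1 x) \<bullet> b - (indicator (cball 0 s) x *\<^sub>R G2 x) \<bullet> b)"
        by (intro Bochner_Integration.integrable_diff integrable_inner_left loc that)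
      then show ?thesis by (simp add: right_diff_distrib)
    qed
    fix \<phi> assume \<phi>: "\<phi> \<in> test_functions (ball (0::'a) R)"
    obtain s where s: "s < R" "closure {x. \<phi> x \<noteq> 0} \<subseteq> ball 0 s"
      using compact_in_ball_shrink[OF test_functionsD(2,3)[OF \<phi>]] by blast
    obtain B where B: "\<And>x. \<bar>\<phi> x\<bar> \<le> B" using test_functions_bounded[OF \<phi>] by blast
    have [measurable]: "\<phi> \<in> borel_measurable borel" by (rule test_functions_measurable[OF \<phi>])
    have \<phi>0: "\<phi> x = 0" if "x \<notin> cball 0 s" for x
      using s(2) closure_subset[of "{x. \<phi> x \<noteq> 0}"] that by force
    have int: "integrable lborel (\<lambda>x. (G x \<bullet> b) * \<phi> x)"
      if m: "G \<in> borel_measurable borel" and i: "integrable lborel (\<lambda>x. indicator (cball 0 s) x *\<^sub>R G x)" for G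
    proof (rule Bochner_Integration.integrable_bound)
      note [measurable] = m
      show "integrable lborel (\<lambda>x. B * \<bar>(indicator (cball 0 s) x *\<^sub>R G x) \<bullet> b\<bar>)"
        using integrable_inner_left[of b lborel "\<lambda>x. indicator (cball 0 s) x *\<^sub>R G x"] i by (intro integrable_mult_right integrable_abs) simp
      show "(\<lambda>x. (G x \<bullet> b) * \<phi> x) \<in> borel_measurable lborel" by measurable
      show "AE x in lborel. norm ((G x \<bullet> b) * \<phi> x) \<le> norm (B * \<bar>(indicator (cball 0 s) x *\<^sub>R G x) \<bullet> b\<bar>)"
      proof (rule AE_I2)
        fix x
        show "norm ((G x \<bullet> b) * \<phi> x) \<le> norm (B * \<bar>(indicator (cball 0 s) x *\<^sub>R G x) \<bullet> b\<bar>)"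
        proof (cases "x \<in> cball 0 s")
          case True
          have "\<bar>\<phi> x\<bar> * \<bar>G x \<bullet> b\<bar> \<le> \<bar>B\<bar> * \<bar>G x \<bullet> b\<bar>" using B[of x] by (intro mult_right_mono) auto
          then show ?thesis using True by (simp add: abs_mult mult.commute)
        qed (simp add: \<phi>0)
      qed
    qed
    have "(LINT x|lborel. (G1 x \<bullet> b - G2 x \<bullet> b) * \<phi> x) = (LINT x|lborel. (G1 x \<bullet> b) * \<phi> x) - (LINT x|lborel. (G2 x \<bullet> b) * \<phi> x)"
      unfolding left_diff_distrib by (rule Bochner_Integration.integral_diff) (intro int loc[OF s(1)]; measurable)+
    also have "\<dots> = 0" using weak_grad_rep[OF g1 U W G1 \<phi> b] weak_grad_rep[OF g2 U W G2 \<phi> b] by simp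
    finally show "(LINT x|lborel. (G1 x \<bullet> b - G2 x \<bullet> b) * \<phi> x) = 0" .
  qed
  have "AE x in lborel. \<forall>b\<in>Basis. x \<in> ball 0 R \<longrightarrow> G1 x \<bullet> b - G2 x \<bullet> b = 0"
    by (rule AE_finite_allI[OF finite_Basis ae])
  then show ?thesis
  proof eventually_elim
    fix x assume x: "\<forall>b\<in>Basis. x \<in> ball 0 R \<longrightarrow> G1 x \<bullet> b - G2 x \<bullet> b = 0"
    show "G1 x = G2 x"
    proof (cases "norm x < R")
      case True
      show ?thesis
      proof (rule euclidean_eqI)
        fix b :: 'a assume b: "b \<in> Basis"
        have "x \<in> ball 0 R" using True by simp
        with bspec[OF x b] have "G1 x \<bullet> b - G2 x \<bullet> b = 0" by (rule mp)
        then show "G1 x \<bullet> b = G2 x \<bullet> b" by simp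
      qed
    next
      case False
      then have "G1 x = 0" "G2 x = 0" using rep_zero[OF G1] rep_zero[OF G2] by simp_all
      then show ?thesis by simp
    qed
  qed
qed

lemma square_integrable_rep:
  fixes f :: "'a::euclidean_space \<Rightarrow> 'b::euclidean_space"
  assumes U: "open U" "ball x0 R \<subseteq> U" and f: "square_integrable (lebesgue_on U) f" and F: "rep_at x0 R f F"
  shows "integrable lborel (\<lambda>x. (norm (F x))\<^sup>2)"
proof -
  have Um: "U \<in> sets lebesgue" using U(1) by simp
  have "integrable lebesgue (\<lambda>x. indicator U x *\<^sub>R (norm (f x))\<^sup>2)"
    using f Um unfolding square_integrable_def by (subst (asm) integrable_restrict_space) auto
  then have "integrable lebesgue (\<lambda>x. indicator (ball x0 R) x *\<^sub>R (indicator U x *\<^sub>R (norm (f x))\<^sup>2))"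
    by (rule integrable_mult_indicator[rotated]) simp
  moreover have "(\<lambda>x. indicator (ball x0 R) x *\<^sub>R (indicator U x *\<^sub>R (norm (f x))\<^sup>2)) = (\<lambda>x. indicator (ball x0 R) x *\<^sub>R (norm (f x))\<^sup>2)"
    using U(2) by (auto simp: indicator_def fun_eq_iff)
  ultimately have i: "integrable lebesgue (\<lambda>x. indicator (ball x0 R) x *\<^sub>R (norm (f x))\<^sup>2)" by simp
  have "rep_at x0 R (\<lambda>y. (norm (f y))\<^sup>2) (\<lambda>x. (norm (F x))\<^sup>2)" by (rule rep_compose[OF F]) auto
  from rep_integrable[OF this _ order_refl i]
  have i2: "integrable lborel (\<lambda>x. indicator (ball x0 R) (x0 + x) *\<^sub>R (norm (F x))\<^sup>2)" by simp
  have eq: "indicator (ball x0 R) (x0 + x) *\<^sub>R (norm (F x))\<^sup>2 = (norm (F x))\<^sup>2" for x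
    using rep_zero[OF F, of x] by (cases "norm x < R") (simp_all add: indicator_def dist_norm)
  show ?thesis using i2 unfolding eq .
qed

lemma H1_transfer:
  fixes w :: "'a::euclidean_space \<Rightarrow> real"
  assumes U: "open U" "ball x0 R \<subseteq> U" and w: "w \<in> H1 U"
  shows "\<exists>W G. sobolev_ball R W G \<and> rep_at x0 R w W \<and>
    (\<forall>r\<le>R. (LINT x:ball x0 r|lebesgue. (norm (weak_grad U w x))\<^sup>2) = (LINT x|lborel. indicator (ball 0 r) x * (norm (G x))\<^sup>2))"
proof -
  obtain g where g: "has_weak_grad U w g" "square_integrable (lebesgue_on U) g" and w2: "square_integrable (lebesgue_on U) w"
    using w by (auto simp: H1_def)
  define g1 where "g1 = weak_grad U w"
  have g1: "has_weak_grad U w g1" unfolding g1_def weak_grad_def by (rule someI[where P="has_weak_grad U w", OF g(1)])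
  obtain W where W: "rep_at x0 R w W"
    using ex_rep_at[OF local_measurable[OF _ U(2)]] g(1) unfolding has_weak_grad_def by blast
  obtain G where G: "rep_at x0 R g G"
    using ex_rep_at[OF local_measurable[OF _ U(2)]] g(1) unfolding has_weak_grad_def by blast
  obtain G1 where G1: "rep_at x0 R g1 G1"
    using ex_rep_at[OF local_measurable[OF _ U(2)]] g1 unfolding has_weak_grad_def by blast
  have [measurable]: "G \<in> borel_measurable borel" "G1 \<in> borel_measurable borel" "W \<in> borel_measurable borel"
    using G G1 W by (auto simp: rep_at_def)
  have SB: "sobolev_ball R W G"
    unfolding sobolev_ball_def
    using W G weak_grad_rep[OF g(1) U(2) W G] square_integrable_rep[OF U w2 W] square_integrable_rep[OF U g(2) G]
    by (auto simp: rep_at_def)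
  have eq: "(LINT x:ball x0 r|lebesgue. (norm (g1 x))\<^sup>2) = (LINT x|lborel. indicator (ball 0 r) x * (norm (G x))\<^sup>2)" if r: "r \<le> R" for r
  proof -
    have [measurable]: "ball x0 r \<in> sets borel" "ball (0::'a) r \<in> sets borel" by simp_all
    have "rep_at x0 R (\<lambda>y. (norm (g1 y))\<^sup>2) (\<lambda>x. (norm (G1 x))\<^sup>2)" by (rule rep_compose[OF G1]) auto
    from rep_integral[OF this, of "indicator (ball x0 r)"]
    have "(LINT y|lebesgue. (norm (g1 y))\<^sup>2 * indicator (ball x0 r) y) = (LINT x|lborel. (norm (G1 x))\<^sup>2 * indicator (ball x0 r) (x0 + x))"
      using r by (auto simp: indicator_def)
    moreover have "(LINT x:ball x0 r|lebesgue. (norm (g1 x))\<^sup>2) = (LINT y|lebesgue. (norm (g1 y))\<^sup>2 * indicator (ball x0 r) y)"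
      unfolding set_lebesgue_integral_def by (simp add: mult.commute)
    moreover have "(LINT x|lborel. (norm (G1 x))\<^sup>2 * indicator (ball x0 r) (x0 + x)) = (LINT x|lborel. indicator (ball 0 r) x * (norm (G x))\<^sup>2)"
    proof (rule integral_cong_AE)
      show "AE x in lborel. (norm (G1 x))\<^sup>2 * indicator (ball x0 r) (x0 + x) = indicator (ball 0 r) x * (norm (G x))\<^sup>2"
        using weak_grad_unique[OF g1 g(1) U(2) W G1 G] by eventually_elim (simp add: indicator_def dist_norm)
    qed measurable
    ultimately show ?thesis by simp
  qed
  show ?thesis using SB W eq unfolding g1_def by blast
qed

lemma subharmonic_transfer:
  fixes w :: "'a::euclidean_space \<Rightarrow> real"
  assumes w: "weakly_subharmonic_on (ball x0 R) w" and W: "rep_at x0 R w W"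
    and \<phi>: "\<phi> \<in> test_functions (ball 0 R)" "\<And>x. \<phi> x \<ge> 0"
  shows "(LINT x|lborel. W x * laplacian \<phi> x) \<ge> 0"
proof -
  let ?\<psi> = "\<lambda>y. \<phi> (y - x0)"
  note \<psi> = translate_test(1)[OF \<phi>(1), of x0]
  have p2: "partial_deriv b (partial_deriv b ?\<psi>) \<in> test_functions (ball x0 R)" if "b \<in> Basis" for b
    by (intro test_functions_partial \<psi> that)
  have z: "laplacian ?\<psi> y = 0" if "y \<notin> ball x0 R" for y
    unfolding laplacian_def by (intro sum.neutral ballI test_zero_outside(1)[OF p2 that])
  have m: "laplacian ?\<psi> \<in> borel_measurable borel"
    unfolding laplacian_def[abs_def] by (intro borel_measurable_sum test_functions_measurable[OF p2])
  have "- (LINT x:ball x0 R|lebesgue. w x * laplacian ?\<psi> x) \<le> 0"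
  proof -
    from w have "\<forall>\<phi>\<in>test_functions (ball x0 R). (\<forall>x. 0 \<le> \<phi> x) \<longrightarrow> - (LINT x:ball x0 R|lebesgue. w x * laplacian \<phi> x) \<le> 0"
      unfolding weakly_subharmonic_on_def by (rule conjunct2)
    from bspec[OF this \<psi>] show ?thesis by (rule mp) (intro allI \<phi>(2))
  qed
  moreover have "(LINT x:ball x0 R|lebesgue. w x * laplacian ?\<psi> x) = (LINT x|lborel. W x * laplacian \<phi> x)"
  proof -
    have "(LINT x:ball x0 R|lebesgue. w x * laplacian ?\<psi> x) = (LINT x|lebesgue. w x * laplacian ?\<psi> x)"
      by (rule set_integral_test[OF z])
    also have "\<dots> = (LINT x|lborel. W x * laplacian ?\<psi> (x0 + x))" by (rule rep_integral[OF W m z])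
    finally show ?thesis by (simp add: translate_test(3)[OF \<phi>(1)])
  qed
  ultimately show ?thesis by simp
qed

theorem lemma1p2:
  fixes \<Omega> :: "'a::euclidean_space set" and x0 :: 'a and rbar :: real
    and h :: nat and w :: "nat \<Rightarrow> 'a \<Rightarrow> real"
  assumes "DIM('a) \<ge> 2"
    and "open \<Omega>" "connected \<Omega>" "bounded \<Omega>" "regular_boundary \<Omega>"
    and "h \<ge> 1"
    and "rbar > 0" "ball x0 rbar \<subseteq> \<Omega>"
    and "\<And>i. i \<in> {1..h} \<Longrightarrow> w i \<in> H1 \<Omega>"
    and "\<And>i. i \<in> {1..h} \<Longrightarrow> AE x in lebesgue. x \<in> ball x0 rbar \<longrightarrow> 0 \<le> w i x"
    and "\<And>i. i \<in> {1..h} \<Longrightarrow> weakly_subharmonic_on (ball x0 rbar) (w i)"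
    and "\<And>i j. i \<in> {1..h} \<Longrightarrow> j \<in> {1..h} \<Longrightarrow> i \<noteq> j \<Longrightarrow>
           AE x in lebesgue. x \<in> \<Omega> \<longrightarrow> w i x * w j x = 0"
    and "\<And>j. j \<in> {1..h} \<Longrightarrow> x0 \<in> frontier (ess_supp \<Omega> (w j)) \<inter> \<Omega>"
  shows "mono_on {0<..rbar}
           (\<lambda>r. \<Prod>i\<in>{1..h}. 1 / r powr (optimal_beta TYPE('a) h)
                  * (LINT x:ball x0 r|lebesgue. (norm (weak_grad \<Omega> (w i) x))\<^sup>2))"
proof (rule mono_onI)
  fix p q assume "p \<in> {0<..rbar}" "q \<in> {0<..rbar}" "p \<le> q"
  then have pq: "0 < p" "p \<le> q" "q \<le> rbar" by auto
  let ?I = "{1..h}"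
  have "\<forall>i\<in>?I. \<exists>W G. sobolev_ball rbar W G \<and> rep_at x0 rbar (w i) W \<and>
    (\<forall>r\<le>rbar. (LINT x:ball x0 r|lebesgue. (norm (weak_grad \<Omega> (w i) x))\<^sup>2) = (LINT x|lborel. indicator (ball 0 r) x * (norm (G x))\<^sup>2))"
    by (intro ballI H1_transfer[OF assms(2,8)] assms(9))
  then have "\<exists>W G. \<forall>i\<in>?I. sobolev_ball rbar (W i) (G i) \<and> rep_at x0 rbar (w i) (W i) \<and>
    (\<forall>r\<le>rbar. (LINT x:ball x0 r|lebesgue. (norm (weak_grad \<Omega> (w i) x))\<^sup>2) = (LINT x|lborel. indicator (ball 0 r) x * (norm (G i x))\<^sup>2))"
    unfolding bchoice_iff .
  then obtain W G where WG: "\<forall>i\<in>?I. sobolev_ball rbar (W i) (G i) \<and> rep_at x0 rbar (w i) (W i) \<and>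
    (\<forall>r\<le>rbar. (LINT x:ball x0 r|lebesgue. (norm (weak_grad \<Omega> (w i) x))\<^sup>2) = (LINT x|lborel. indicator (ball 0 r) x * (norm (G i x))\<^sup>2))"
    by (elim exE) (rule that)
  have SB: "sobolev_ball rbar (W i) (G i)" if "i \<in> ?I" for i
    using bspec[OF WG that] by (rule conjunct1)
  have rep: "rep_at x0 rbar (w i) (W i)" if "i \<in> ?I" for i
    using conjunct2[OF bspec[OF WG that]] by (rule conjunct1)
  have D: "(LINT x:ball x0 r|lebesgue. (norm (weak_grad \<Omega> (w i) x))\<^sup>2) = (LINT x|lborel. indicator (ball 0 r) x * (norm (G i x))\<^sup>2)"
    if "i \<in> ?I" "r \<le> rbar" for i r
    using spec[OF conjunct2[OF conjunct2[OF bspec[OF WG that(1)]]], of r] that(2) by (rule mp)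
  have ae: "AE x in lborel. norm x < rbar \<longrightarrow> W i x = w i (x0 + x)" if "i \<in> ?I" for i
    using conjunct2[OF iffD1[OF rep_at_def rep[OF that]]] by (rule conjunct2)
  have zero: "\<not> norm x < rbar \<Longrightarrow> W i x = 0" if "i \<in> ?I" for i x
    by (rule rep_zero[OF rep[OF that]])
  have W0: "AE x in lborel. W i x \<ge> 0" if i: "i \<in> ?I" for i
  proof -
    have "AE x in lborel. x \<in> ball x0 rbar \<longrightarrow> 0 \<le> w i x" using assms(10)[OF i] by (simp add: AE_completion_iff)
    from AE_lborel_translate[OF this, of x0] ae[OF i] show ?thesis
    proof eventually_elim
      fix x assume "x0 + x \<in> ball x0 rbar \<longrightarrow> 0 \<le> w i (x0 + x)" "norm x < rbar \<longrightarrow> W i x = w i (x0 + x)"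
      then show "W i x \<ge> 0" using zero[OF i, of x] by (cases "norm x < rbar") (auto simp: dist_norm)
    qed
  qed
  have disj: "AE x in lborel. W i x * W j x = 0" if ij: "i \<in> ?I" "j \<in> ?I" "i \<noteq> j" for i j
  proof -
    have "AE x in lborel. x \<in> \<Omega> \<longrightarrow> w i x * w j x = 0" using assms(12)[OF ij] by (simp add: AE_completion_iff)
    from AE_lborel_translate[OF this, of x0] ae[OF ij(1)] ae[OF ij(2)] show ?thesis
    proof eventually_elim
      fix x assume a: "x0 + x \<in> \<Omega> \<longrightarrow> w i (x0 + x) * w j (x0 + x) = 0"
        "norm x < rbar \<longrightarrow> W i x = w i (x0 + x)" "norm x < rbar \<longrightarrow> W j x = w j (x0 + x)"
      show "W i x * W j x = 0"
      proof (cases "norm x < rbar")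
        case True
        then have "x0 + x \<in> \<Omega>" using assms(8) by (auto simp: subset_iff dist_norm)
        then show ?thesis using a True by simp
      next
        case False
        then show ?thesis using zero[OF ij(1), of x] by simp
      qed
    qed
  qed
  have sub: "(LINT x|lborel. W i x * laplacian \<phi> x) \<ge> 0"
    if "i \<in> ?I" "\<phi> \<in> test_functions (ball 0 rbar)" "\<And>x. \<phi> x \<ge> 0" for i \<phi>
    by (rule subharmonic_transfer[OF assms(11) rep]) (rule that)+
  have "(\<Prod>i\<in>?I. 1 / p powr (optimal_beta TYPE('a) h) * (LINT x|lborel. indicator (ball 0 p) x * (norm (G i x))\<^sup>2))
    \<le> (\<Prod>i\<in>?I. 1 / q powr (optimal_beta TYPE('a) h) * (LINT x|lborel. indicator (ball 0 q) x * (norm (G i x))\<^sup>2))"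
    by (rule monotonicity_ball[OF assms(6) SB W0 disj sub pq])
  moreover have "(\<Prod>i\<in>?I. 1 / r powr (optimal_beta TYPE('a) h) * (LINT x:ball x0 r|lebesgue. (norm (weak_grad \<Omega> (w i) x))\<^sup>2))
    = (\<Prod>i\<in>?I. 1 / r powr (optimal_beta TYPE('a) h) * (LINT x|lborel. indicator (ball 0 r) x * (norm (G i x))\<^sup>2))" if "r \<le> rbar" for r
    by (intro prod.cong refl) (simp only: D that)
  ultimately show "(\<Prod>i\<in>?I. 1 / p powr (optimal_beta TYPE('a) h) * (LINT x:ball x0 p|lebesgue. (norm (weak_grad \<Omega> (w i) x))\<^sup>2))
    \<le> (\<Prod>i\<in>?I. 1 / q powr (optimal_beta TYPE('a) h) * (LINT x:ball x0 q|lebesgue. (norm (weak_grad \<Omega> (w i) x))\<^sup>2))"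
    using pq by simp
qed

end
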